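(* There are absolute constants $C\ge 1$ and $c>0$ such that the following holds. Let $N$ be a positive integer, $\delta>0$, and let $f_0, f_1, f_2 : \mathbb{Z}^2 \to \mathbb{C}$ be functions with $|f_i|\le 1$ pointwise and with support contained in $[N]\times [N^2]$. Suppose that $$\Big|\sum_{x,y,d\in\mathbb{Z}} f_0(x,y)f_1(x+d,y) f_2(x,y+d^2)\Big| \geq \delta N^4.$$ Then either $N \leq C\delta^{-C}$, or there exist $\alpha, \beta \in \mathbb{T}$ and a positive integer $q \leq C\delta^{-C}$ with $\|q\alpha\|_{\mathbb{T}} \leq C\delta^{-C}/N$ and $\|q\beta\|_{\mathbb{T}} \leq C\delta^{-C}/N^2$ such that $$\sum_{y\in\mathbb{Z}} \Big|\sum_{x\in\mathbb{Z}} f_1(x, y)\, e(\alpha x)\Big| \geq c\,\delta^{C} N^3 \quad \text{and} \quad\sum_{x\in\mathbb{Z}} \Big|\sum_{y\in\mathbb{Z}} f_2(x, y)\, e(\beta y)\Big| \geq c\,\delta^{C} N^3 .$$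
   Context: $[X]=\{1,2,\dots,\lfloor X\rfloor\}$. $\mathbb{T}=\mathbb{R}/\mathbb{Z}$, $\|\alpha\|_{\mathbb{T}}$ is the distance from $\alpha$ to the nearest integer, and $e(t)=e^{2\pi i t}$. *)

theory Defs
  imports "HOL-Analysis.Analysis"
begin

text \<open>
  Elements of the torus \<open>\<real>/\<int>\<close> are represented by arbitrary real representatives.  This is
  legitimate because both functions below are invariant under integer translations
  (lemmas \<open>torus_norm_add_int\<close> and \<open>unit_char_add_int\<close>), and because \<open>q\<alpha>\<close>, for an integer \<open>q\<close>,
  changes by an integer when \<open>\<alpha>\<close> does.
\<close>

definition torus_norm :: "real \<Rightarrow> real"  (\<open>\<parallel>_\<parallel>\<^sub>T\<close>) where
  "\<parallel>\<alpha>\<parallel>\<^sub>T = \<bar>\<alpha> - of_int (round \<alpha>)\<bar>"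

definition unit_char :: "real \<Rightarrow> complex" where
  "unit_char t = exp (2 * of_real pi * \<i> * of_real t)"

lemma torus_norm_le: "\<parallel>\<alpha>\<parallel>\<^sub>T \<le> \<bar>\<alpha> - of_int m\<bar>"
  unfolding torus_norm_def by (metis abs_minus_commute round_diff_minimal)

lemma torus_norm_add_int: "\<parallel>\<alpha> + of_int m\<parallel>\<^sub>T = \<parallel>\<alpha>\<parallel>\<^sub>T"
proof -
  have "\<lfloor>\<alpha> + of_int m + 1 / 2\<rfloor> = \<lfloor>\<alpha> + 1 / 2\<rfloor> + m"
    using floor_add_int[of "\<alpha> + 1 / 2" m] by (simp add: algebra_simps)
  then show ?thesis
    by (simp add: torus_norm_def round_def)
qed

lemma unit_char_add_int: "unit_char (t + of_int m) = unit_char t"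
proof -
  have "exp (2 * of_real pi * \<i> * of_int m) = (1 :: complex)"
    unfolding exp_eq_1 by auto
  then show ?thesis
    by (simp add: unit_char_def ring_distribs exp_add)
qed

end

theory Submission imports Defs begin

text \<open>
  Put \<open>z = x + d\<close> and \<open>M = 2N\<^sup>2\<close>, and regard the second coordinate as a residue modulo \<open>M\<close>. Then the sum
  is an average of \<open>f\<^sub>0(x,y) f\<^sub>1(z,y) g(x, y + (z-x)\<^sup>2)\<close> with \<open>g = f\<^sub>2\<close>.

  Cauchy--Schwarz removes \<open>f\<^sub>0\<close> and \<open>f\<^sub>1\<close>, and further applications remove all but one of the remaining
  factors. The differencing directions that arise cover the residues nearly uniformly, so
  for many \<open>x\<close> the multiplicative derivatives of order \<open>4\<close> of \<open>g(x,\<cdot>)\<close> correlate with characters.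
  By another Cauchy--Schwarz step \<open>g\<close> may be taken to be the conjugate of the dual function
  \<open>F\<^sub>x(y) = avg\<^sub>z f\<^sub>0(x, y-(z-x)\<^sup>2) f\<^sub>1(z, y-(z-x)\<^sup>2)\<close>. This is itself an average of products, and
  exchanging that average with the derivatives reduces the question which frequencies occur to
  quadratic Weyl sums: up to major arcs, alternating sums of the frequencies over cubes vanish.
  A weighted Gowers--Cauchy--Schwarz inequality then lowers the order of the derivatives one by
  one, until \<open>F\<^sub>x\<close> itself correlates with a character whose frequency lies on a major arc.

  Along short progressions whose step is the denominator, the quadratic phase in this
  correlation is nearly constant, and Parseval's identity gives the linear phase for \<open>f\<^sub>1\<close>.
  Applied with the function that is dual to \<open>f\<^sub>1\<close> in place of \<open>f\<^sub>1\<close>, the same result followed by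
  Weyl's inequality and Parseval's identity gives the linear phase for \<open>f\<^sub>2\<close>.
\<close>

subsection \<open>Averages\<close>

text \<open>Order 4 arises because five directions survive the Cauchy--Schwarz steps. Three of them
  are two-dimensional and nearly equidistributed for generic parameters. The other two are products
  \<open>2ks\<close> and \<open>2hs\<close>, whose values are not; one more Cauchy--Schwarz step
  turns such a product into a difference of two products, which is. The fifth derivative is spent on
  passing to a Fourier coefficient. The obstacle is that an arbitrary \<open>g\<close> allows any
  frequencies at all. Only the form of the dual function, an average of \<open>f0\<close> and
  \<open>f1\<close> along a parabola, restricts them. Even then a single frequency of a derivative
  is out of reach; an alternating sum over a cube is not, and it suffices, because every vertex
  except one misses some differencing parameter and yields a phase that Cauchy--Schwarz removes. All
  losses are polynomial in \<delta>. In most statements one function \<epsilon> of the class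
  \<open>polylow\<close> is at once the threshold for \<open>N\<close>, the inverse bound for
  denominators and the size of the resulting correlation, so that the steps can be composed
  freely.\<close>

definition avg :: "'a set \<Rightarrow> ('a \<Rightarrow> 'b::real_normed_field) \<Rightarrow> 'b" where
  "avg S f = (\<Sum>s\<in>S. f s) / of_nat (card S)"

lemma avg_cong: "S = T \<Longrightarrow> (\<And>s. s \<in> T \<Longrightarrow> f s = g s) \<Longrightarrow> avg S f = avg T g"
  by (simp add: avg_def cong: sum.cong)

lemma avg_cmult: "avg S (\<lambda>s. c * f s) = c * avg S f"
  by (simp add: avg_def sum_distrib_left)

lemma avg_multc: "avg S (\<lambda>s. f s * c) = avg S f * c"
  by (simp add: avg_def sum_distrib_right)

lemma avg_add: "avg S (\<lambda>s. f s + g s) = avg S f + avg S g"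
  by (simp add: avg_def sum.distrib add_divide_distrib)

lemma avg_diff: "avg S (\<lambda>s. f s - g s) = avg S f - avg S g"
  by (simp add: avg_def sum_subtractf diff_divide_distrib)

lemma cnj_avg: "cnj (avg S f) = avg S (\<lambda>s. cnj (f s))"
  by (simp add: avg_def)

lemma of_real_avg: "complex_of_real (avg S f) = avg S (\<lambda>s. of_real (f s))"
  by (simp add: avg_def)

lemma avg_swap: "avg S (\<lambda>s. avg T (\<lambda>t. f s t)) = avg T (\<lambda>t. avg S (\<lambda>s. f s t))"
  unfolding avg_def by (simp add: sum_divide_distrib sum.swap[of _ S T] mult.commute)

lemma avg_times: "avg (S \<times> T) f = avg S (\<lambda>s. avg T (\<lambda>t. f (s, t)))"
  unfolding avg_def by (simp add: sum.cartesian_product sum_divide_distrib card_cartesian_product mult.commute)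

lemma avg_product: "avg S f * avg T g = avg S (\<lambda>s. avg T (\<lambda>t. f s * g t))"
  by (simp add: avg_cmult avg_multc)

text \<open>Over an empty or infinite set \<open>avg\<close> is 0, by the conventions for
  \<open>sum\<close> and division. Upper bounds such as \<open>avg_le\<close> therefore ask only for
  a nonnegative bound, whereas a constant is reproduced only by a genuine average.\<close>

lemma avg_const [simp]: "finite S \<Longrightarrow> S \<noteq> {} \<Longrightarrow> avg S (\<lambda>_. c) = c"
  by (simp add: avg_def card_eq_0_iff)

lemma norm_avg: "norm (avg S f) \<le> avg S (\<lambda>s. norm (f s))"
  unfolding avg_def by (simp add: norm_divide divide_right_mono norm_sum)

lemma avg_mono: "(\<And>s. s \<in> S \<Longrightarrow> f s \<le> g s) \<Longrightarrow> avg S f \<le> avg S (g :: 'a \<Rightarrow> real)"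
  unfolding avg_def by (simp add: divide_right_mono sum_mono)

lemma avg_nonneg: "(\<And>s. s \<in> S \<Longrightarrow> 0 \<le> f s) \<Longrightarrow> 0 \<le> avg S (f :: 'a \<Rightarrow> real)"
  unfolding avg_def by (simp add: sum_nonneg)

lemma avg_le: "(\<And>s. s \<in> S \<Longrightarrow> f s \<le> c) \<Longrightarrow> 0 \<le> c \<Longrightarrow> avg S f \<le> (c::real)"
proof (cases "finite S \<and> S \<noteq> {}")
  case True
  assume "\<And>s. s \<in> S \<Longrightarrow> f s \<le> c"
  then have "avg S f \<le> avg S (\<lambda>_. c)" by (rule avg_mono)
  with True show ?thesis by simp
qed (auto simp: avg_def)

lemma norm_avg_le: "(\<And>s. s \<in> S \<Longrightarrow> norm (f s) \<le> c) \<Longrightarrow> 0 \<le> c \<Longrightarrow> norm (avg S f) \<le> c"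
  by (rule order_trans[OF norm_avg], rule avg_le) auto

lemma norm_avg_complex: "norm (avg S (f :: 'a \<Rightarrow> complex)) = norm (\<Sum>s\<in>S. f s) / card S"
  by (simp add: avg_def norm_divide)

lemma avg_square_le: "(avg S f)\<^sup>2 \<le> avg S (\<lambda>s. (f s)\<^sup>2)" for f :: "'a \<Rightarrow> real"
proof (cases "finite S \<and> S \<noteq> {}")
  case True
  let ?a = "avg S f"
  have "0 \<le> avg S (\<lambda>s. (f s - ?a)\<^sup>2)" by (intro avg_nonneg) simp
  also have "(\<lambda>s. (f s - ?a)\<^sup>2) = (\<lambda>s. ((f s)\<^sup>2 - 2 * ?a * f s) + ?a\<^sup>2)"
    by (auto simp: power2_eq_square algebra_simps)
  also have "avg S \<dots> = avg S (\<lambda>s. (f s)\<^sup>2) - 2 * ?a * ?a + ?a\<^sup>2"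
    using True by (simp only: avg_add avg_diff avg_cmult) simp
  finally show ?thesis by (simp add: power2_eq_square)
qed (auto simp: avg_def)

text \<open>Cauchy--Schwarz \<open>n\<close> times. The exponents are powers of two because the
  later losses come from repeated squaring.\<close>

lemma avg_power_le:
  fixes f :: "'a \<Rightarrow> real"
  assumes "\<And>s. s \<in> S \<Longrightarrow> 0 \<le> f s"
  shows "(avg S f) ^ (2 ^ n) \<le> avg S (\<lambda>s. f s ^ (2 ^ n))"
proof (induction n)
  case (Suc n)
  have "(avg S f) ^ (2 ^ Suc n) = ((avg S f) ^ (2 ^ n))\<^sup>2"
    by (simp add: power_mult [symmetric] mult.commute)
  also have "\<dots> \<le> (avg S (\<lambda>s. f s ^ (2 ^ n)))\<^sup>2"
    using Suc.IH assms by (intro power_mono) (auto intro!: avg_nonneg zero_le_power)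
  also have "\<dots> \<le> avg S (\<lambda>s. (f s ^ (2 ^ n))\<^sup>2)" by (rule avg_square_le)
  also have "\<dots> = avg S (\<lambda>s. f s ^ (2 ^ Suc n))"
    by (simp add: power_mult [symmetric] mult.commute)
  finally show ?case .
qed simp

lemma norm_avg_square_le: "(norm (avg S f))\<^sup>2 \<le> avg S (\<lambda>s. (norm (f s))\<^sup>2)"
  by (rule order_trans[OF power_mono[OF norm_avg norm_ge_zero] avg_square_le])

lemma norm_square_avg:
  "complex_of_real ((norm (avg S f))\<^sup>2) = avg S (\<lambda>s. avg S (\<lambda>s'. f s * cnj (f s')))"
  by (simp add: complex_norm_square cnj_avg avg_product del: of_real_power)

lemma avg_norm_square:
  "complex_of_real (avg Y (\<lambda>y. (norm (avg S (\<lambda>s. f s y)))\<^sup>2)) =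
     avg S (\<lambda>s. avg S (\<lambda>s'. avg Y (\<lambda>y. f s y * cnj (f s' y))))"
proof -
  have "complex_of_real (avg Y (\<lambda>y. (norm (avg S (\<lambda>s. f s y)))\<^sup>2)) =
     avg Y (\<lambda>y. avg S (\<lambda>s. avg S (\<lambda>s'. f s y * cnj (f s' y))))"
    by (simp only: of_real_avg norm_square_avg)
  also have "\<dots> = avg S (\<lambda>s. avg Y (\<lambda>y. avg S (\<lambda>s'. f s y * cnj (f s' y))))"
    by (rule avg_swap)
  also have "\<dots> = avg S (\<lambda>s. avg S (\<lambda>s'. avg Y (\<lambda>y. f s y * cnj (f s' y))))"
    by (rule avg_cong[OF refl], rule avg_swap)
  finally show ?thesis .
qed

lemma avg_norm_square':
  "avg Y (\<lambda>y. (norm (avg S (\<lambda>s. f s y)))\<^sup>2) =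
     norm (avg S (\<lambda>s. avg S (\<lambda>s'. avg Y (\<lambda>y. f s y * cnj (f s' y)))))"
  unfolding avg_norm_square [symmetric] norm_of_real
  by (simp add: avg_nonneg)

text \<open>The basic removal step: the weight \<open>b\<close> depends on \<open>y\<close> alone,
  so after Cauchy--Schwarz in \<open>y\<close> it is bounded by 1 and disappears, at the price of
  doubling \<open>s\<close>.\<close>

lemma avg_vdc:
  assumes "\<And>y. y \<in> Y \<Longrightarrow> norm (b y) \<le> 1"
  shows "(norm (avg Y (\<lambda>y. b y * avg S (\<lambda>s. f s y))))\<^sup>2 \<le>
     norm (avg S (\<lambda>s. avg S (\<lambda>s'. avg Y (\<lambda>y. f s y * cnj (f s' y)))))"
proof -
  have "(norm (avg Y (\<lambda>y. b y * avg S (\<lambda>s. f s y))))\<^sup>2 \<le> avg Y (\<lambda>y. (norm (b y * avg S (\<lambda>s. f s y)))\<^sup>2)"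
    by (rule norm_avg_square_le)
  also have "\<dots> \<le> avg Y (\<lambda>y. (norm (avg S (\<lambda>s. f s y)))\<^sup>2)"
    using assms by (intro avg_mono power_mono) (auto simp: norm_mult mult_left_le_one_le)
  finally show ?thesis by (simp only: avg_norm_square')
qed

lemma norm_avg2: "norm (avg S (\<lambda>s. avg T (\<lambda>t. f s t))) \<le> avg S (\<lambda>s. avg T (\<lambda>t. norm (f s t)))"
  by (rule order_trans[OF norm_avg], rule avg_mono, rule norm_avg)

lemma avg_vdc_norm:
  assumes "\<And>y. y \<in> Y \<Longrightarrow> norm (b y) \<le> 1"
  shows "(norm (avg Y (\<lambda>y. b y * avg S (\<lambda>s. f s y))))\<^sup>2 \<le>
     avg S (\<lambda>s. avg S (\<lambda>s'. norm (avg Y (\<lambda>y. f s y * cnj (f s' y)))))"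
  by (rule order_trans[OF avg_vdc[OF assms] norm_avg2])

text \<open>Two removal steps. Doubling \<open>z\<close> removes \<open>f0\<close>, which does not
  involve \<open>z\<close>; the product of the two values of \<open>f1\<close> then does not involve
  \<open>x\<close> and is removed by doubling \<open>x\<close>. The averages over \<open>z\<close>
  and \<open>z'\<close> recombine into a square.\<close>

lemma avg_corner_square:
  assumes "\<And>x y. norm (f0 x y) \<le> (1::real)" "\<And>z y. norm (f1 z y) \<le> (1::real)"
  shows "(norm (avg Y (\<lambda>y. avg X (\<lambda>x. avg Z (\<lambda>z. f0 x y * f1 z y * g x z y)))))^4 \<le>
    avg X (\<lambda>x. avg X (\<lambda>x'. avg Y (\<lambda>y. (norm (avg Z (\<lambda>z. g x z y * cnj (g x' z y))))\<^sup>2)))"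
    (is "(norm ?L)^4 \<le> ?R")
proof -
  have "?L = avg (Y \<times> X) (\<lambda>p. f0 (snd p) (fst p) * avg Z (\<lambda>z. f1 z (fst p) * g (snd p) z (fst p)))"
    by (simp add: avg_times avg_cmult[symmetric] mult.assoc)
  then have "(norm ?L)\<^sup>2 \<le> norm (avg Z (\<lambda>z. avg Z (\<lambda>z'. avg (Y \<times> X) (\<lambda>p. (f1 z (fst p) * g (snd p) z (fst p)) * cnj (f1 z' (fst p) * g (snd p) z' (fst p))))))"
    by (simp only:) (rule avg_vdc, simp add: assms)
  also have "avg Z (\<lambda>z. avg Z (\<lambda>z'. avg (Y \<times> X) (\<lambda>p. (f1 z (fst p) * g (snd p) z (fst p)) * cnj (f1 z' (fst p) * g (snd p) z' (fst p))))) =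
     avg (Z \<times> Z \<times> Y) (\<lambda>(z,z',y). (f1 z y * cnj (f1 z' y)) * avg X (\<lambda>x. g x z y * cnj (g x z' y)))" (is "_ = ?L2")
    by (simp add: avg_times avg_cmult[symmetric] mult_ac)
  finally have 1: "(norm ?L)\<^sup>2 \<le> norm ?L2" .
  have "(norm ?L2)\<^sup>2 \<le> norm (avg X (\<lambda>x. avg X (\<lambda>x'. avg (Z \<times> Z \<times> Y) (\<lambda>p. (\<lambda>(z,z',y). g x z y * cnj (g x z' y)) p * cnj ((\<lambda>(z,z',y). g x' z y * cnj (g x' z' y)) p)))))"
    unfolding split_beta
    by (rule avg_vdc) (simp add: norm_mult assms mult_le_one)
  also have "\<dots> \<le> avg X (\<lambda>x. avg X (\<lambda>x'. norm (avg (Z \<times> Z \<times> Y) (\<lambda>p. (\<lambda>(z,z',y). g x z y * cnj (g x z' y)) p * cnj ((\<lambda>(z,z',y). g x' z y * cnj (g x' z' y)) p)))))"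
    by (rule norm_avg2)
  also have "\<dots> = ?R"
  proof (intro avg_cong refl)
    fix x x'
    have "avg (Z \<times> Z \<times> Y) (\<lambda>p. (\<lambda>(z,z',y). g x z y * cnj (g x z' y)) p * cnj ((\<lambda>(z,z',y). g x' z y * cnj (g x' z' y)) p)) =
       avg Z (\<lambda>z. avg Z (\<lambda>z'. avg Y (\<lambda>y. (g x z y * cnj (g x' z y)) * cnj (g x z' y * cnj (g x' z' y)))))"
      by (simp add: avg_times mult_ac)
    then show "norm (avg (Z \<times> Z \<times> Y) (\<lambda>p. (\<lambda>(z,z',y). g x z y * cnj (g x z' y)) p * cnj ((\<lambda>(z,z',y). g x' z y * cnj (g x' z' y)) p))) =
      avg Y (\<lambda>y. (norm (avg Z (\<lambda>z. g x z y * cnj (g x' z y))))\<^sup>2)"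
      by (simp only: avg_norm_square')
  qed
  finally have 2: "(norm ?L2)\<^sup>2 \<le> ?R" .
  have "(norm ?L)^4 = ((norm ?L)\<^sup>2)\<^sup>2" by simp
  also have "\<dots> \<le> (norm ?L2)\<^sup>2" using 1 by (intro power_mono) auto
  finally show ?thesis using 2 by linarith
qed

subsection \<open>Periodic functions and differencing\<close>

definition per :: "int \<Rightarrow> (int \<Rightarrow> 'b) \<Rightarrow> bool" where
  "per M F \<longleftrightarrow> (\<forall>y. F (y + M) = F y)"

lemma perD: "per M F \<Longrightarrow> F (y + M) = F y"
  by (simp add: per_def)

lemma per_shift: "per M F \<Longrightarrow> per M (\<lambda>y. F (y + c))"
  unfolding per_def by (metis add.assoc add.commute)

lemma per_op1: "per M F \<Longrightarrow> per M (\<lambda>y. f (F y))"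
  by (simp add: per_def)

lemma per_op2: "per M F \<Longrightarrow> per M G \<Longrightarrow> per M (\<lambda>y. f (F y) (G y))"
  by (simp add: per_def)

lemma per_mult: "per M F \<Longrightarrow> per M G \<Longrightarrow> per M (\<lambda>y. F y * G y)"
  by (rule per_op2)

lemma per_cnj: "per M F \<Longrightarrow> per M (\<lambda>y. cnj (F y))"
  by (rule per_op1)

lemma per_const: "per M (\<lambda>y. c)"
  by (simp add: per_def)

lemma per_avg: "(\<And>s. s \<in> S \<Longrightarrow> per M (F s)) \<Longrightarrow> per M (\<lambda>y. avg S (\<lambda>s. F s y))"
  by (simp add: per_def cong: avg_cong)

lemma per_mod: "per M F \<Longrightarrow> F (y mod M) = F y"
proof -
  assume p: "per M F"
  have *: "F (z + int n * M) = F z" for z n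
  proof (induction n)
    case (Suc n)
    have "F (z + int (Suc n) * M) = F ((z + int n * M) + M)" by (simp add: algebra_simps)
    with Suc show ?case using perD[OF p] by simp
  qed simp
  show ?thesis
  proof (cases "y div M \<ge> 0")
    case True
    then have "y = y mod M + int (nat (y div M)) * M" by simp
    then show ?thesis using * by metis
  next
    case False
    then have "y mod M = y + int (nat (- (y div M))) * M"
      by (simp add: minus_div_mult_eq_mod [symmetric])
    then show ?thesis using * by metis
  qed
qed

lemma avg_shift:
  assumes "per M F" "0 < M"
  shows "avg {0..<M} (\<lambda>y. F (y + h)) = avg {0..<M} F"
proof -
  have "(\<Sum>y\<in>{0..<M}. F (y + h)) = (\<Sum>y\<in>{0..<M}. F ((y + h) mod M))"
    using per_mod[OF assms(1)] by simp
  also have "\<dots> = (\<Sum>y\<in>{0..<M}. F y)"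
  proof (rule sum.reindex_bij_witness[where i = "\<lambda>y. (y - h) mod M" and j = "\<lambda>y. (y + h) mod M"])
    fix a assume "a \<in> {0..<M}"
    then show "((a + h) mod M - h) mod M = a" "((a - h) mod M + h) mod M = a"
      by (simp_all add: mod_simps)
  qed (use assms(2) in auto)
  finally show ?thesis by (simp add: avg_def)
qed

abbreviation zavg :: "int \<Rightarrow> (int \<Rightarrow> 'b::real_normed_field) \<Rightarrow> 'b" where
  "zavg M \<equiv> avg {0..<M}"

text \<open>Iterated multiplicative derivatives. The steps form a list, so that the order is a
  length and inductions on the order can vary the function.\<close>

primrec mder :: "int list \<Rightarrow> (int \<Rightarrow> complex) \<Rightarrow> int \<Rightarrow> complex" where
  "mder [] F = F"
| "mder (t # v) F = mder v (\<lambda>y. F (y + t) * cnj (F y))"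

lemma mder_mult: "mder v (\<lambda>y. F y * G y) = (\<lambda>y. mder v F y * mder v G y)"
proof (induction v arbitrary: F G)
  case (Cons t v)
  have "mder (t # v) (\<lambda>y. F y * G y) = mder v (\<lambda>y. (F (y + t) * cnj (F y)) * (G (y + t) * cnj (G y)))"
    by (simp add: mult_ac)
  then show ?case using Cons by simp
qed simp

lemma mder_cnj: "mder v (\<lambda>y. cnj (F y)) = (\<lambda>y. cnj (mder v F y))"
proof (induction v arbitrary: F)
  case (Cons t v)
  have "mder (t # v) (\<lambda>y. cnj (F y)) = mder v (\<lambda>y. cnj (F (y + t) * cnj (F y)))"
    by simp
  also have "\<dots> = (\<lambda>y. cnj (mder (t # v) F y))"
    unfolding mder.simps by (rule Cons.IH)
  finally show ?case .
qed simp

lemma mder_shift: "mder v (\<lambda>y. F (y + c)) = (\<lambda>y. mder v F (y + c))"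
proof (induction v arbitrary: F)
  case (Cons t v)
  have "mder (t # v) (\<lambda>y. F (y + c)) = mder v (\<lambda>y. (\<lambda>u. F (u + t) * cnj (F u)) (y + c))"
    by (simp add: add_ac)
  also have "\<dots> = (\<lambda>y. mder (t # v) F (y + c))"
    unfolding mder.simps by (rule Cons.IH)
  finally show ?case .
qed simp

text \<open>The defining recursion differences along \<open>t\<close> first. Since derivatives are
  multiplicative and commute with shifts and conjugation, \<open>t\<close> may just as well come
  last, which is the form needed when the other steps are held fixed.\<close>

lemma mder_Cons: "mder (t # v) F y = mder v F (y + t) * cnj (mder v F y)"
  by (simp add: mder_mult mder_cnj mder_shift)

lemma mder_commute: "mder u (mder v F) = mder v (mder u F)"
proof (induction v arbitrary: F)
  case (Cons t v)
  have "mder u (mder (t # v) F) = mder u (\<lambda>y. mder v F (y + t) * cnj (mder v F y))"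
    by (simp only: mder_Cons[abs_def])
  also have "\<dots> = (\<lambda>y. mder u (mder v F) (y + t) * cnj (mder u (mder v F) y))"
    by (simp only: mder_mult mder_cnj mder_shift)
  also have "\<dots> = mder (t # v) (mder u F)"
    by (simp only: mder_Cons[abs_def] Cons.IH)
  finally show ?case .
qed simp

lemma mder_norm: "(\<And>y. norm (F y) \<le> 1) \<Longrightarrow> norm (mder v F y) \<le> 1"
proof (induction v arbitrary: F)
  case (Cons t v)
  show ?case unfolding mder.simps
    by (rule Cons.IH) (simp add: norm_mult Cons.prems mult_le_one)
qed simp

lemma mder_per: "per M F \<Longrightarrow> per M (mder v F)"
  by (induction v arbitrary: F) (auto intro!: per_mult per_cnj per_shift)

text \<open>Iterated rather than over a set of lists, so that its recursion runs parallel to that of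
  \<open>mder\<close>; \<open>vavg_avg\<close> supplies the other form.\<close>

primrec vavg :: "int \<Rightarrow> nat \<Rightarrow> (int list \<Rightarrow> 'b::real_normed_field) \<Rightarrow> 'b" where
  "vavg M 0 f = f []"
| "vavg M (Suc m) f = avg {0..<M} (\<lambda>t. vavg M m (\<lambda>v. f (t # v)))"

lemma vavg_mono: "(\<And>v. length v = m \<Longrightarrow> f v \<le> g v) \<Longrightarrow> vavg M m f \<le> vavg M m (g :: _ \<Rightarrow> real)"
  by (induction m arbitrary: f g) (auto intro!: avg_mono)

lemma vavg_cong: "(\<And>v. length v = m \<Longrightarrow> f v = g v) \<Longrightarrow> vavg M m f = vavg M m g"
proof (induction m arbitrary: f g)
  case (Suc m)
  show ?case unfolding vavg.simps
    by (rule avg_cong[OF refl], rule Suc.IH) (simp add: Suc.prems)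
qed simp

lemma vavg_nonneg: "(\<And>v. length v = m \<Longrightarrow> 0 \<le> f v) \<Longrightarrow> 0 \<le> vavg M m (f :: _ \<Rightarrow> real)"
  by (induction m arbitrary: f) (auto intro!: avg_nonneg)

lemma vavg_le: "(\<And>v. length v = m \<Longrightarrow> f v \<le> c) \<Longrightarrow> 0 \<le> c \<Longrightarrow> vavg M m f \<le> (c::real)"
  by (induction m arbitrary: f) (auto intro!: avg_le)

lemma vavg_norm: "norm (vavg M m f) \<le> vavg M m (\<lambda>v. norm (f v))"
proof (induction m arbitrary: f)
  case (Suc m)
  show ?case unfolding vavg.simps
    by (rule order_trans[OF norm_avg], rule avg_mono, rule Suc.IH)
qed simp

lemma vavg_add: "vavg M m (\<lambda>v. f v + g v) = vavg M m f + vavg M m g"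
  by (induction m arbitrary: f g) (simp_all add: avg_add)

lemma vavg_cmult: "vavg M m (\<lambda>v. c * f v) = c * vavg M m f"
  by (induction m arbitrary: f) (simp_all add: avg_cmult)

lemma vavg_const [simp]: "0 < M \<Longrightarrow> vavg M m (\<lambda>_. c) = c"
  by (induction m) auto

lemma avg_vavg_swap: "avg S (\<lambda>s. vavg M m (\<lambda>v. f s v)) = vavg M m (\<lambda>v. avg S (\<lambda>s. f s v))"
proof (induction m arbitrary: f)
  case (Suc m)
  have "avg S (\<lambda>s. vavg M (Suc m) (\<lambda>v. f s v)) = zavg M (\<lambda>t. avg S (\<lambda>s. vavg M m (\<lambda>v. f s (t # v))))"
    by (simp add: avg_swap[of S])
  with Suc show ?case by simp
qed simp

lemma vavg_swap: "vavg M m (\<lambda>v. vavg M n (\<lambda>w. f v w)) = vavg M n (\<lambda>w. vavg M m (\<lambda>v. f v w))"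
  by (induction m arbitrary: f) (simp_all add: avg_vavg_swap)

lemma vavg_square_le: "(vavg M m f)\<^sup>2 \<le> vavg M m (\<lambda>v. (f v)\<^sup>2)" for f :: "_ \<Rightarrow> real"
proof (induction m arbitrary: f)
  case (Suc m)
  show ?case unfolding vavg.simps
    by (rule order_trans[OF avg_square_le], rule avg_mono, rule Suc.IH)
qed simp

lemma avg_ge_ex:
  fixes f :: "'a \<Rightarrow> real"
  assumes "avg S f \<ge> c" "finite S" "S \<noteq> {}"
  obtains s where "s \<in> S" "f s \<ge> c"
proof (cases "\<exists>s\<in>S. f s \<ge> c")
  case False
  then have "\<And>s. s \<in> S \<Longrightarrow> f s < c" by force
  then have "(\<Sum>s\<in>S. f s) < (\<Sum>s\<in>S. c)" using assms by (intro sum_strict_mono) auto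
  then have "avg S f < c" using assms by (simp add: avg_def divide_less_eq card_gt_0_iff mult.commute)
  with assms(1) show ?thesis by simp
qed (use that in blast)

lemma vavg_ge_ex:
  fixes f :: "int list \<Rightarrow> real"
  assumes "vavg M m f \<ge> c" "0 < M"
  obtains v where "length v = m" "f v \<ge> c"
  using assms
proof (induction m arbitrary: f thesis)
  case (Suc m)
  obtain t where "vavg M m (\<lambda>v. f (t # v)) \<ge> c"
    using Suc.prems(2,3) avg_ge_ex[of c "{0..<M}" "\<lambda>t. vavg M m (\<lambda>v. f (t # v))"] by auto
  then obtain v where "length v = m" "f (t # v) \<ge> c" using Suc.IH[of "\<lambda>v. f (t # v)"] Suc.prems(3) by blast
  then show ?case using Suc.prems(1)[of "t # v"] by simp
qed auto

subsection \<open>The distance to the nearest integer\<close>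

lemma unit_char_cis: "unit_char t = cis (2 * pi * t)"
  by (simp add: unit_char_def cis_conv_exp mult_ac)

lemma norm_unit_char [simp]: "norm (unit_char t) = 1"
  by (simp add: unit_char_cis)

lemma unit_char_add: "unit_char (s + t) = unit_char s * unit_char t"
  by (simp add: unit_char_cis cis_mult ring_distribs)

lemma unit_char_0 [simp]: "unit_char 0 = 1"
  by (simp add: unit_char_cis)

lemma unit_char_minus: "unit_char (- t) = cnj (unit_char t)"
  by (simp add: unit_char_cis cis_cnj)

lemma unit_char_diff: "unit_char (s - t) = unit_char s * cnj (unit_char t)"
  using unit_char_add[of s "- t"] by (simp add: unit_char_minus)

lemma unit_char_int [simp]: "unit_char (of_int m) = 1"
  using unit_char_add_int[of 0 m] by simp

lemma unit_char_mod1: "s - t = of_int m \<Longrightarrow> unit_char s = unit_char t"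
  using unit_char_add_int[of t m] by (simp add: algebra_simps)

lemma torus_norm_nonneg [simp]: "0 \<le> torus_norm a"
  by (simp add: torus_norm_def)

lemma torus_norm_le_abs: "torus_norm a \<le> \<bar>a\<bar>"
  using torus_norm_le[of a 0] by simp

lemma torus_norm_le_half: "torus_norm a \<le> 1 / 2"
  using of_int_round_abs_le[of a] by (simp add: torus_norm_def abs_minus_commute)

lemma torus_norm_add: "torus_norm (a + b) \<le> torus_norm a + torus_norm b"
  using torus_norm_le[of "a + b" "round a + round b"] by (simp add: torus_norm_def)

lemma torus_norm_minus [simp]: "torus_norm (- a) = torus_norm a"
proof -
  have "torus_norm (- a) \<le> torus_norm a" for a
    using torus_norm_le[of "- a" "- round a"] by (simp add: torus_norm_def)
  from this[of a] this[of "- a"] show ?thesis by simp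
qed

lemma torus_norm_diff: "torus_norm (a - b) \<le> torus_norm a + torus_norm b"
  using torus_norm_add[of a "- b"] by simp

lemma torus_norm_int_mult: "torus_norm (of_int n * a) \<le> of_int \<bar>n\<bar> * torus_norm a"
proof -
  have "torus_norm (of_int n * a) \<le> \<bar>of_int n * a - of_int (n * round a)\<bar>"
    by (rule torus_norm_le)
  also have "\<dots> = of_int \<bar>n\<bar> * torus_norm a"
    by (simp add: torus_norm_def abs_mult[symmetric] algebra_simps)
  finally show ?thesis .
qed

lemma torus_norm_nat_mult: "torus_norm (of_nat n * a) \<le> of_nat n * torus_norm a"
  using torus_norm_int_mult[of "int n" a] by simp

lemma torus_norm_cong: "s - t = of_int m \<Longrightarrow> torus_norm s = torus_norm t"
  using torus_norm_add_int[of t m] by (simp add: algebra_simps)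

lemma torus_norm_small: "\<bar>a\<bar> \<le> 1 / 2 \<Longrightarrow> torus_norm a = \<bar>a\<bar>"
proof (rule antisym[OF torus_norm_le_abs])
  assume a: "\<bar>a\<bar> \<le> 1 / 2"
  show "\<bar>a\<bar> \<le> torus_norm a"
  proof (cases "round a = 0")
    case False
    then have "1 \<le> \<bar>real_of_int (round a)\<bar>" by linarith
    then show ?thesis unfolding torus_norm_def using a by linarith
  qed (simp add: torus_norm_def)
qed

lemma norm_unit_char_minus_1:
  "norm (unit_char a - 1) = 2 * \<bar>sin (pi * (a - of_int (round a)))\<bar>"
proof -
  let ?b = "a - of_int (round a)"
  have "norm (unit_char a - 1) = norm (cis (2 * pi * ?b) - cis 0)"
    using unit_char_mod1[of a ?b "round a"] by (simp add: unit_char_cis)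
  also have "\<dots> = 2 * \<bar>sin (pi * ?b)\<bar>"
  proof -
    have "(norm (cis (2 * t) - cis 0))\<^sup>2 = (2 * \<bar>sin t\<bar>)\<^sup>2" for t :: real
    proof -
      have "(norm (cis (2 * t) - cis 0))\<^sup>2 = (cos (2*t) - 1)\<^sup>2 + (sin (2*t))\<^sup>2"
        by (simp add: cmod_power2)
      also have "\<dots> = 4 * (sin t)\<^sup>2"
        using sin_cos_squared_add[of t]
        by (simp add: cos_double sin_double power2_eq_square) algebra
      finally show ?thesis by (simp add: power_mult_distrib)
    qed
    then have "norm (cis (2 * t) - cis 0) = 2 * \<bar>sin t\<bar>" for t :: real
      by (rule power2_eq_imp_eq) auto
    from this[of "pi * ?b"] show ?thesis by (simp add: mult_ac)
  qed
  finally show ?thesis .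
qed

lemma unit_char_near_1: "norm (unit_char a - 1) \<le> 2 * pi * torus_norm a"
proof -
  let ?b = "a - of_int (round a)"
  have "norm (unit_char a - 1) = 2 * \<bar>sin (pi * ?b)\<bar>"
    by (rule norm_unit_char_minus_1)
  also have "\<dots> \<le> 2 * \<bar>pi * ?b\<bar>" by (simp add: abs_sin_x_le_abs_x)
  finally show ?thesis by (simp add: torus_norm_def abs_mult)
qed

text \<open>Sine is concave on the interval from 0 to pi, hence lies above its chord from 0 to pi /
  2.\<close>

lemma sin_ge_linear: "0 \<le> t \<Longrightarrow> t \<le> 1 / 2 \<Longrightarrow> 2 * t \<le> sin (pi * t)"
proof -
  assume t: "0 \<le> t" "t \<le> 1 / 2"
  have cv: "concave_on {0..pi} sin"
  proof (rule f''_le0_imp_concave)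
    show "convex {0..pi::real}" by simp
    fix x :: real assume "x \<in> {0..pi}"
    show "(sin has_real_derivative cos x) (at x)" "(cos has_real_derivative - sin x) (at x)"
      by (auto intro!: derivative_eq_intros)
    show "- sin x \<le> 0" using \<open>x \<in> {0..pi}\<close> by (auto intro!: sin_ge_zero)
  qed
  have "(1 - 2 * t) * sin 0 + (2 * t) * sin (pi / 2) \<le> sin ((1 - 2 * t) *\<^sub>R 0 + (2 * t) *\<^sub>R (pi / 2))"
    using cv t by (intro concave_onD) auto
  then show ?thesis by (simp add: mult_ac)
qed

lemma unit_char_far_1: "4 * torus_norm a \<le> norm (unit_char a - 1)"
proof -
  let ?b = "a - of_int (round a)"
  have "norm (unit_char a - 1) = 2 * \<bar>sin (pi * ?b)\<bar>"
    by (rule norm_unit_char_minus_1)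
  also have "\<bar>sin (pi * ?b)\<bar> = \<bar>sin (pi * \<bar>?b\<bar>)\<bar>"
  proof -
    have "\<bar>sin (pi * t)\<bar> = \<bar>sin (pi * \<bar>t\<bar>)\<bar>" for t
      by (cases "t \<ge> 0") (auto simp: abs_if)
    then show ?thesis .
  qed
  also have "2 * \<bar>?b\<bar> \<le> sin (pi * \<bar>?b\<bar>)"
    using torus_norm_le_half[of a] by (intro sin_ge_linear) (auto simp: torus_norm_def)
  then have "2 * (2 * \<bar>?b\<bar>) \<le> 2 * \<bar>sin (pi * \<bar>?b\<bar>)\<bar>" by linarith
  finally show ?thesis by (simp add: torus_norm_def)
qed

lemma geometric_sum_telescope:
  fixes a b :: int
  assumes "a \<le> b + 1"
  shows "(unit_char \<theta> - 1) * (\<Sum>z\<in>{a..b}. unit_char (\<theta> * of_int z)) =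
    unit_char (\<theta> * of_int (b + 1)) - unit_char (\<theta> * of_int a)"
proof -
  have "a - 1 \<le> b" using assms by simp
  then show ?thesis
  proof (induction b rule: int_ge_induct)
    case (step i)
    have "{a..i + 1} = insert (i + 1) {a..i}" using step(1) by auto
    then have "(\<Sum>z\<in>{a..i + 1}. unit_char (\<theta> * of_int z)) =
      unit_char (\<theta> * of_int (i + 1)) + (\<Sum>z\<in>{a..i}. unit_char (\<theta> * of_int z))"
      by simp
    moreover have "unit_char (\<theta> * of_int (i + 1 + 1)) = unit_char \<theta> * unit_char (\<theta> * of_int (i + 1))"
      by (simp add: unit_char_add[symmetric] algebra_simps)
    ultimately show ?case using step(2) by (simp only: distrib_left) (simp add: algebra_simps)
  qed simp
qed

text \<open>The telescoped sum has modulus at most 2, while \<open>unit_char \<theta> - 1\<close>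
  has modulus at least four times the torus norm. The product form covers integral \<theta> as
  well.\<close>

lemma geometric_sum_bound:
  fixes a b :: int
  shows "norm (\<Sum>z\<in>{a..b}. unit_char (\<theta> * of_int z)) * torus_norm \<theta> \<le> 1 / 2"
proof (cases "a \<le> b + 1")
  case True
  let ?S = "\<Sum>z\<in>{a..b}. unit_char (\<theta> * of_int z)"
  have "norm ?S * (4 * torus_norm \<theta>) \<le> norm ?S * norm (unit_char \<theta> - 1)"
    by (intro mult_left_mono unit_char_far_1) auto
  also have "\<dots> = norm (unit_char (\<theta> * of_int (b + 1)) - unit_char (\<theta> * of_int a))"
    using geometric_sum_telescope[OF True, of \<theta>] by (simp add: norm_mult[symmetric] mult.commute)
  also have "\<dots> \<le> 2"
    using norm_triangle_ineq4[of "unit_char (\<theta> * of_int (b + 1))" "unit_char (\<theta> * of_int a)"] by simp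
  finally show ?thesis by (simp add: mult_ac)
qed auto

section \<open>Diophantine approximation from many small multiples\<close>

lemma pigeonhole_fibre:
  assumes "finite T" "f ` J \<subseteq> T" "finite J" "J \<noteq> {}"
  obtains t where "t \<in> T" "card J \<le> card {j \<in> J. f j = t} * card T"
proof (rule ccontr)
  assume "\<not> thesis"
  with that have *: "\<And>t. t \<in> T \<Longrightarrow> card {j \<in> J. f j = t} * card T < card J" by force
  have "T \<noteq> {}" using assms by auto
  have "card J = (\<Sum>t\<in>T. card {j \<in> J. f j = t})"
    using assms sum.group[of J T f "\<lambda>_. 1 :: nat"] by (simp add: image_subset_iff)
  then have "card J * card T = (\<Sum>t\<in>T. card {j \<in> J. f j = t} * card T)" by (simp add: sum_distrib_right)
  also have "\<dots> < (\<Sum>t\<in>T. card J)" using * assms(1) \<open>T \<noteq> {}\<close> by (intro sum_strict_mono) auto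
  finally show False by (simp add: mult.commute)
qed

lemma int_set_spread:
  fixes S :: "int set"
  assumes "finite S" "S \<noteq> {}"
  obtains i j where "i \<in> S" "j \<in> S" "int (card S) - 1 \<le> j - i"
proof -
  have "S \<subseteq> {Min S..Max S}" using assms by auto
  then have "card S \<le> card {Min S..Max S}" by (intro card_mono) auto
  then have "int (card S) - 1 \<le> Max S - Min S" 
    using Max_ge[OF assms(1) Min_in[OF assms]] by (simp only: card_atLeastAtMost_int)
  then show thesis using that[of "Min S" "Max S"] assms by auto
qed

text \<open>Two elements of \<open>K\<close> at bounded distance give the denominator \<open>q\<close>; many elements in one class
  modulo \<open>q\<close> and in one short window then force \<open>q\<theta>\<close> to be as close to an integer as claimed.\<close>
lemma many_small_multiples:
  fixes K :: "int set" and a :: int and n :: nat and \<eta> \<epsilon> \<theta> :: real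
  assumes K: "K \<subseteq> {a..<a + int n}" "card K \<ge> \<eta> * n"
    and small: "\<And>k. k \<in> K \<Longrightarrow> torus_norm (of_int k * \<theta>) \<le> \<epsilon>"
    and \<eta>: "0 < \<eta>" "\<eta> \<le> 1" and \<epsilon>: "0 \<le> \<epsilon>" "\<epsilon> < \<eta> / 128" and n: "\<eta>\<^sup>2 * n \<ge> 12"
  obtains q :: nat where "0 < q" "q \<le> 3 / \<eta>" "torus_norm (of_nat q * \<theta>) \<le> 24 * \<epsilon> / (\<eta>\<^sup>2 * n)"
proof -
  have finK: "finite K" using K(1) finite_subset by blast
  have n0: "0 < real n" using n \<eta> by (cases "n = 0") auto
  have \<eta>n: "\<eta> * n \<ge> 12"
  proof -
    have "\<eta> * (\<eta> * n) \<le> 1 * (\<eta> * n)" using \<eta> n0 by (intro mult_right_mono) auto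
    then show ?thesis using n by (simp add: power2_eq_square mult.assoc)
  qed
  have cK: "12 \<le> card K" using \<eta>n K(2) by linarith
  then have neK: "K \<noteq> {}" by auto
  \<comment> \<open>Blocks of length at least 2 / \<eta> number at most \<eta>n / 2 + 1, fewer than
    the elements of \<open>K\<close>. Two elements therefore share a block, and their difference is
    the denominator \<open>q\<close>.\<close>
  define b where "b = \<lceil>2 / \<eta>\<rceil>"
  have b: "2 / \<eta> \<le> b" "b \<le> 3 / \<eta>"
  proof -
    show "2 / \<eta> \<le> b" unfolding b_def by linarith
    have "b \<le> 2 / \<eta> + 1" unfolding b_def by linarith
    also have "\<dots> \<le> 3 / \<eta>" using \<eta> by (simp add: field_simps)
    finally show "b \<le> 3 / \<eta>" .
  qed
  have b1: "1 \<le> b" using b(1) \<eta> by (smt (verit) divide_pos_pos of_int_0_less_iff)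
  obtain q :: nat where q: "0 < q" "int q \<le> b" "torus_norm (of_nat q * \<theta>) \<le> 2 * \<epsilon>"
  proof -
    let ?T = "{0..(int n - 1) div b}"
    have "(\<lambda>k. (k - a) div b) ` K \<subseteq> ?T"
    proof -
      have "0 \<le> (k - a) div b \<and> (k - a) div b \<le> (int n - 1) div b" if "k \<in> K" for k
      proof -
        have "a \<le> k" "k - a \<le> int n - 1" using that K(1) by force+
        then show ?thesis using b1 by (auto intro!: zdiv_mono1 simp: pos_imp_zdiv_nonneg_iff)
      qed
      then show ?thesis by auto
    qed
    then obtain t where t: "card K \<le> card {k \<in> K. (k - a) div b = t} * card ?T"
      by (rule pigeonhole_fibre[OF finite_atLeastAtMost_int _ finK neK])
    let ?F = "{k \<in> K. (k - a) div b = t}"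
    have "real (card ?T) \<le> n / b + 1"
    proof -
      have "real (card ?T) \<le> real_of_int ((int n - 1) div b) + 1"
        using n0 b1 by (simp add: pos_imp_zdiv_nonneg_iff)
      also have "real_of_int ((int n - 1) div b) \<le> real_of_int (int n - 1) / b"
        by (rule real_of_int_div4)
      also have "\<dots> \<le> n / b" using b1 by (simp add: divide_right_mono)
      finally show ?thesis by simp
    qed
    also have "n / b \<le> \<eta> * n / 2"
    proof -
      have "n / b \<le> n / (2 / \<eta>)" using b(1) \<eta> n0 b1 by (intro divide_left_mono) auto
      then show ?thesis by (simp add: mult_ac)
    qed
    finally have cT: "real (card ?T) < \<eta> * n" using \<eta>n by simp
    have "\<not> card ?F \<le> 1"
    proof
      assume "card ?F \<le> 1"
      then have "card ?F * card ?T \<le> 1 * card ?T" by (rule mult_le_mono1)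
      with t have "card K \<le> card ?T" by linarith
      with cT K(2) show False by linarith
    qed
    then obtain x y where xy: "x \<in> ?F" "y \<in> ?F" "x < y"
    proof -
      have "finite ?F" using finK by simp
      then obtain x y where "x \<in> ?F" "y \<in> ?F" "x \<noteq> y"
        using \<open>\<not> card ?F \<le> 1\<close> unfolding One_nat_def card_le_Suc0_iff_eq[OF \<open>finite ?F\<close>] by blast
      then show thesis using that[of x y] that[of y x] by (cases "x < y") auto
    qed
    show thesis
    proof (rule that[of "nat (y - x)"])
      show "0 < nat (y - x)" using xy by simp
      have "y - a = t * b + (y - a) mod b" "x - a = t * b + (x - a) mod b"
        using xy by (metis (mono_tags, lifting) div_mult_mod_eq mem_Collect_eq)+
      moreover have "(y - a) mod b < b" "0 \<le> (x - a) mod b" using b1 by auto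
      ultimately have "y - x \<le> b" by linarith
      then show "int (nat (y - x)) \<le> b" using b1 by simp
      have "real (nat (y - x)) * \<theta> = of_int y * \<theta> - of_int x * \<theta>" using xy by (simp add: algebra_simps)
      then have "torus_norm (real (nat (y - x)) * \<theta>) \<le> torus_norm (of_int y * \<theta>) + torus_norm (of_int x * \<theta>)"
        using torus_norm_diff by simp
      then show "torus_norm (real (nat (y - x)) * \<theta>) \<le> 2 * \<epsilon>" using small[of x] small[of y] xy by simp
    qed
  qed
  have q3: "q \<le> 3 / \<eta>" using q(2) b(2) by (smt (verit) of_int_le_iff of_int_of_nat_eq)
  have q4: "4 * q \<le> \<eta> * n"
  proof -
    have "4 * q \<le> 12 / \<eta>" using q3 by (simp add: field_simps)
    also have "12 / \<eta> \<le> \<eta> * n" using n \<eta> by (simp add: field_simps power2_eq_square)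
    finally show ?thesis .
  qed
  define \<rho> where "\<rho> = q * \<theta> - of_int (round (q * \<theta>))"
  have \<rho>: "torus_norm (q * \<theta>) = \<bar>\<rho>\<bar>" "\<bar>\<rho>\<bar> \<le> 2 * \<epsilon>" using q(3) by (simp_all add: \<rho>_def torus_norm_def)
  have "\<bar>\<rho>\<bar> \<le> 24 * \<epsilon> / (\<eta>\<^sup>2 * n)"
  proof (cases "\<rho> = 0")
    case False
    \<comment> \<open>A window of \<open>P\<close> consecutive quotients is so short that multiples
      of \<rho> within it stay below 1/4. Their torus norm is then their absolute value, and
      smallness can be read off without wrap-around.\<close>
    define P where "P = \<lfloor>1 / (4 * \<bar>\<rho>\<bar>)\<rfloor>"
    have \<rho>small: "\<bar>\<rho>\<bar> \<le> 1 / 64" using \<rho>(2) \<epsilon>(2) \<eta>(2) by linarith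
    have "1 / (4 * \<bar>\<rho>\<bar>) \<ge> 16" using \<rho>small False by (simp add: field_simps)
    then have P: "P \<ge> 16" "P \<le> 1 / (4 * \<bar>\<rho>\<bar>)" "P \<ge> 1 / (8 * \<bar>\<rho>\<bar>)"
    proof -
      have "1 / (4 * \<bar>\<rho>\<bar>) = 2 * (1 / (8 * \<bar>\<rho>\<bar>))" by simp
      then show "P \<ge> 16" "P \<le> 1 / (4 * \<bar>\<rho>\<bar>)" "P \<ge> 1 / (8 * \<bar>\<rho>\<bar>)"
        using \<open>1 / (4 * \<bar>\<rho>\<bar>) \<ge> 16\<close> unfolding P_def by linarith+
    qed
    have P\<rho>: "P * \<bar>\<rho>\<bar> \<le> 1 / 4" "1 / P \<le> 8 * \<bar>\<rho>\<bar>" using P False by (simp_all add: field_simps)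
    define c0 where "c0 = a div int q"
    let ?l = "int n div int q + 1"
    \<comment> \<open>Classes: the residue modulo \<open>q\<close> together with the window
      containing the quotient. Within a class differences are \<open>q\<close> times an integer
      below \<open>P\<close> in absolute value.\<close>
    let ?T = "{0..<int q} \<times> {0..?l div P}"
    let ?f = "\<lambda>k. (k mod int q, (k div int q - c0) div P)"
    have "?f ` K \<subseteq> ?T"
    proof -
      have "0 \<le> k div int q - c0 \<and> k div int q - c0 \<le> ?l" if "k \<in> K" for k
      proof -
        have k: "a \<le> k" "k \<le> a + int n" using that K(1) by force+
        have "k div int q \<ge> c0" unfolding c0_def using k q by (intro zdiv_mono1) auto
        moreover have "k div int q \<le> (a + int n) div int q" using k q by (intro zdiv_mono1) auto
        moreover have "(a + int n) div int q \<le> a div int q + int n div int q + 1"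
        proof -
          have "(a mod int q + int n mod int q) div int q \<le> 1"
          proof -
            have "a mod int q < int q" "int n mod int q < int q" using q(1) by simp_all
            then have "a mod int q + int n mod int q < 2 * int q" by linarith
            then have "(a mod int q + int n mod int q) div int q < 2"
            proof -
              have "x div int q < 2" if "x < 2 * int q" for x
                using that q(1) mult_right_mono[of 2 "x div int q" "int q"] div_mult_mod_eq[of x "int q"]
                  pos_mod_sign[of "int q" x] by linarith
              from this[OF \<open>a mod int q + int n mod int q < 2 * int q\<close>] show ?thesis .
            qed
            then show ?thesis by linarith
          qed
          then show ?thesis using div_add1_eq[of a "int n" "int q"] by linarith
        qed
        ultimately show ?thesis unfolding c0_def by linarith
      qed
      then show ?thesis using P(1) q(1) by (auto intro!: zdiv_mono1 simp: pos_imp_zdiv_nonneg_iff)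
    qed
    then obtain t where t: "card K \<le> card {k \<in> K. ?f k = t} * card ?T"
      by (rule pigeonhole_fibre[OF finite_cartesian_product[OF finite_atLeastLessThan_int finite_atLeastAtMost_int] _ finK neK])
    let ?F = "{k \<in> K. ?f k = t}"
    let ?m = "real (card ?F)"
    have cT: "real (card ?T) \<le> 16 * n * \<bar>\<rho>\<bar> + q"
    proof -
      have "real (card ?T) = q * real (nat (?l div P + 1))"
        by (simp add: card_cartesian_product)
      also have "real (nat (?l div P + 1)) = real_of_int (?l div P) + 1"
        using P(1) q(1) by (simp add: pos_imp_zdiv_nonneg_iff)
      finally have e: "real (card ?T) = q * (real_of_int (?l div P) + 1)" .
      have "real_of_int (?l div P) \<le> real_of_int ?l / P" by (rule real_of_int_div4)
      also have "real_of_int ?l / P \<le> (n / q + 1) * (8 * \<bar>\<rho>\<bar>)"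
      proof -
        have "real_of_int ?l \<le> n / q + 1" using real_of_int_div4[of "int n" "int q"] by simp
        then have "real_of_int ?l * (1 / P) \<le> (n / q + 1) * (8 * \<bar>\<rho>\<bar>)"
          using P(1) P\<rho>(2) by (intro mult_mono) auto
        then show ?thesis by simp
      qed
      finally have "real (card ?T) \<le> q * ((n / q + 1) * (8 * \<bar>\<rho>\<bar>) + 1)"
        unfolding e by (intro mult_left_mono add_right_mono) auto
      also have "\<dots> = 8 * n * \<bar>\<rho>\<bar> + 8 * q * \<bar>\<rho>\<bar> + q" using q(1) by (simp add: field_simps)
      also have "\<dots> \<le> 16 * n * \<bar>\<rho>\<bar> + q"
      proof -
        have "real q \<le> n"
        proof -
          have "\<eta> * n \<le> n" using \<eta> n0 by (simp add: mult_left_le_one_le)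
          then show ?thesis using q4 by linarith
        qed
        then have "q * \<bar>\<rho>\<bar> \<le> n * \<bar>\<rho>\<bar>" by (intro mult_right_mono) auto
        then show ?thesis by (simp add: mult.commute)
      qed
      finally show ?thesis .
    qed
    have m: "\<eta> * n \<le> ?m * (16 * n * \<bar>\<rho>\<bar> + q)"
    proof -
      have "\<eta> * n \<le> ?m * real (card ?T)" 
      proof -
        have "real (card K) \<le> real (card ?F * card ?T)" using t by (simp only: of_nat_le_iff)
        then show ?thesis using K(2) by (simp only: of_nat_mult)
      qed
      also have "\<dots> \<le> ?m * (16 * n * \<bar>\<rho>\<bar> + q)" using cT by (intro mult_left_mono) auto
      finally show ?thesis .
    qed
    have m1: "(?m - 1) * \<bar>\<rho>\<bar> \<le> 2 * \<epsilon>"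
    proof -
      have ne: "?F \<noteq> {}" 
      proof
        assume e: "?F = {}"
        show False using m \<eta>n unfolding e by simp
      qed
      let ?J = "(\<lambda>k. k div int q) ` ?F"
      have inj: "inj_on (\<lambda>k. k div int q) ?F"
      proof (rule inj_onI)
        fix x y assume "x \<in> ?F" "y \<in> ?F" and d: "x div int q = y div int q"
        then have "x mod int q = y mod int q" by auto
        with d have "x div int q * int q + x mod int q = y div int q * int q + y mod int q" by (simp only:)
        then show "x = y" by (simp only: div_mult_mod_eq)
      qed
      obtain i j where ij: "i \<in> ?J" "j \<in> ?J" "int (card ?J) - 1 \<le> j - i"
      proof (rule int_set_spread)
        show "finite ?J" using finK by (intro finite_imageI) simp
        show "?J \<noteq> {}" using ne by (simp only: image_is_empty not_False_eq_True)
      qed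
      then obtain x y where xy: "x \<in> ?F" "y \<in> ?F" "i = x div int q" "j = y div int q" by auto
      have "(j - c0) div P = (i - c0) div P" using xy by auto
      then have ji: "\<bar>j - i\<bar> < P"
      proof -
        have "(j - c0) mod P < P" "(i - c0) mod P < P" "0 \<le> (j - c0) mod P" "0 \<le> (i - c0) mod P"
          using P(1) by auto
        moreover have "j - c0 = (i - c0) div P * P + (j - c0) mod P"
          using div_mult_mod_eq[of "j - c0" P] \<open>(j - c0) div P = (i - c0) div P\<close> by simp
        moreover have "i - c0 = (i - c0) div P * P + (i - c0) mod P" by simp
        ultimately show ?thesis by linarith
      qed
      have "x mod int q = y mod int q" using xy by auto
      then have yx: "y - x = int q * (j - i)"
      proof -
        have "x = (x div int q) * int q + x mod int q" "y = (y div int q) * int q + y mod int q" by simp_all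
        with \<open>x mod int q = y mod int q\<close> have "y - x = (y div int q) * int q - (x div int q) * int q" by linarith
        then show ?thesis using xy(3,4) by (simp only: right_diff_distrib mult.commute)
      qed
      have "torus_norm (of_int (j - i) * \<rho>) = torus_norm (of_int y * \<theta> - of_int x * \<theta>)"
      proof (rule torus_norm_cong)
        have "of_int y * \<theta> - of_int x * \<theta> = of_int (y - x) * \<theta>" by (simp add: algebra_simps)
        then show "of_int (j - i) * \<rho> - (of_int y * \<theta> - of_int x * \<theta>) = of_int (- (j - i) * round (q * \<theta>))"
          unfolding yx \<rho>_def by (simp add: algebra_simps)
      qed
      also have "\<dots> \<le> 2 * \<epsilon>"
        using torus_norm_diff[of "of_int y * \<theta>" "of_int x * \<theta>"] small[of x] small[of y] xy by auto
      finally have *: "torus_norm (of_int (j - i) * \<rho>) \<le> 2 * \<epsilon>" .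
      have "\<bar>of_int (j - i) * \<rho>\<bar> \<le> P * \<bar>\<rho>\<bar>" using ji by (simp add: abs_mult mult_right_mono)
      then have "torus_norm (of_int (j - i) * \<rho>) = \<bar>of_int (j - i) * \<rho>\<bar>"
        using P\<rho>(1) by (intro torus_norm_small) linarith
      then have "\<bar>of_int (j - i)\<bar> * \<bar>\<rho>\<bar> \<le> 2 * \<epsilon>" using * by (simp add: abs_mult)
      moreover have "?m - 1 \<le> \<bar>of_int (j - i)\<bar>"
        using ij(3) card_image[OF inj] by simp
      then have "(?m - 1) * \<bar>\<rho>\<bar> \<le> \<bar>of_int (j - i)\<bar> * \<bar>\<rho>\<bar>" by (intro mult_right_mono) auto
      ultimately show ?thesis by linarith
    qed
    show ?thesis
    \<comment> \<open>The bound for the number of classes has two terms. If the first dominates, the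
      class is so populous relative to \<rho> that \<eta> \<le> 128 \<epsilon>, contrary to the
      hypothesis on \<epsilon>. Otherwise there are at most 2q classes, and the spread of the
      largest one bounds \<rho> as claimed.\<close>
    proof (cases "16 * n * \<bar>\<rho>\<bar> \<ge> q")
      case True
      have "\<eta> * n \<le> ?m * (32 * n * \<bar>\<rho>\<bar>)"
        by (rule order_trans[OF m], intro mult_left_mono) (use True in linarith, simp)
      then have "\<eta> * n \<le> (32 * (?m * \<bar>\<rho>\<bar>)) * n" by (simp add: mult_ac)
      then have "\<eta> \<le> 32 * (?m * \<bar>\<rho>\<bar>)" using n0 by (simp only: mult_le_cancel_right)
      moreover have "?m * \<bar>\<rho>\<bar> \<le> 4 * \<epsilon>" using m1 \<rho>(2) by (simp add: algebra_simps)
      ultimately show ?thesis using \<epsilon>(2) by linarith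
    next
      case False
      have "\<eta> * n \<le> ?m * (2 * q)"
        by (rule order_trans[OF m], intro mult_left_mono) (use False in linarith, simp)
      then have mm: "?m \<ge> \<eta> * n / (2 * q)" using q(1) by (simp add: field_simps)
      moreover have "\<eta> * n / (2 * q) \<ge> 2" using q4 q(1) by (simp add: field_simps)
      ultimately have "?m - 1 \<ge> \<eta> * n / (4 * q)" by (simp add: field_simps) 
      then have "\<eta> * n / (4 * q) * \<bar>\<rho>\<bar> \<le> 2 * \<epsilon>" using m1 mult_right_mono[of "\<eta> * n / (4 * q)" "?m - 1" "\<bar>\<rho>\<bar>"] by simp
      then have "\<bar>\<rho>\<bar> * (\<eta> * n) \<le> 8 * \<epsilon> * q" using q(1) by (simp add: field_simps)
      also have "\<dots> \<le> 8 * \<epsilon> * (3 / \<eta>)" using q3 \<epsilon>(1) by (intro mult_left_mono) auto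
      finally show ?thesis using \<eta>(1) n0 by (simp add: field_simps power2_eq_square)
    qed
  qed (use \<epsilon>(1) in simp)
  then show thesis using that[of q] q(1) q3 \<rho>(1) by simp
qed

subsection \<open>Quadratic Weyl sums\<close>

text \<open>Pairs are sorted by their difference \<open>m\<close>. For each \<open>m\<close> the
  remaining variable runs over an interval, so that for quadratic phases the inner sums are
  geometric.\<close>

lemma sum_square_differences:
  fixes f :: "int \<Rightarrow> complex" and n :: int
  shows "(\<Sum>z\<in>{1..n}. f z) * cnj (\<Sum>z\<in>{1..n}. f z) =
    (\<Sum>m\<in>{-n<..<n}. \<Sum>z\<in>{max 1 (1 - m)..min n (n - m)}. f (z + m) * cnj (f z))"
proof -
  have "(\<Sum>z\<in>{1..n}. f z) * cnj (\<Sum>z\<in>{1..n}. f z) = (\<Sum>p\<in>{1..n}\<times>{1..n}. f (fst p) * cnj (f (snd p)))"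
    by (simp add: sum_product sum.cartesian_product split_def)
  also have "\<dots> = (\<Sum>p\<in>Sigma {-n<..<n} (\<lambda>m. {max 1 (1 - m)..min n (n - m)}). f (snd p + fst p) * cnj (f (snd p)))"
    by (rule sum.reindex_bij_witness[where i = "\<lambda>p. (snd p + fst p, snd p)" and j = "\<lambda>p. (fst p - snd p, snd p)"])
      auto
  also have "\<dots> = (\<Sum>m\<in>{-n<..<n}. \<Sum>z\<in>{max 1 (1 - m)..min n (n - m)}. f (z + m) * cnj (f z))"
    by (simp add: sum.Sigma split_def)
  finally show ?thesis .
qed

text \<open>Terms below \<open>s\<close> cost at most \<open>s\<close> each, the others at most
  \<open>B\<close>.\<close>

lemma many_large_values:
  fixes c :: "'a \<Rightarrow> real" and B s :: real
  assumes "finite A" "\<And>a. a \<in> A \<Longrightarrow> c a \<le> B" "s \<ge> 0" "B > 0"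
  shows "(\<Sum>a\<in>A. c a) \<le> card {a \<in> A. c a \<ge> s} * B + card A * s"
proof -
  have "(\<Sum>a\<in>A. c a) \<le> (\<Sum>a\<in>A. (if c a \<ge> s then B else 0) + s)"
    using assms by (intro sum_mono) (auto intro: add_increasing2)
  also have "\<dots> = card {a \<in> A. c a \<ge> s} * B + card A * s"
    using assms by (simp add: sum.distrib sum.If_cases Int_def)
  finally show ?thesis .
qed

text \<open>Weyl differencing: the square of the sum consists of geometric sums with frequencies
  \<open>2 * \<alpha> * m\<close>. Many of them must be large, so \<open>2 * \<alpha> * m\<close> is
  close to an integer for many \<open>m\<close>, and \<open>many_small_multiples\<close>
  applies.\<close>

lemma weyl_leading:
  fixes N :: nat and \<alpha> \<beta> \<eta> :: real
  assumes \<eta>: "0 < \<eta>" "\<eta> \<le> 1" and N: "N * \<eta>^7 \<ge> 100000"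
    and large: "norm (\<Sum>z\<in>{1..int N}. unit_char (\<alpha> * of_int (z^2) + \<beta> * of_int z)) \<ge> \<eta> * N"
  obtains q :: nat where "0 < q" "q \<le> 24 / \<eta>^2" "torus_norm (q * \<alpha>) \<le> 384 / (\<eta>^6 * N^2)"
proof -
  have N0: "0 < N" using N by (cases "N = 0") auto
  have pw: "\<eta> ^ i \<le> 1" for i using \<eta> by (simp add: power_le_one)
  have pw': "\<eta>^7 \<le> \<eta>^i" if "i \<le> 7" for i using \<eta> that by (intro power_decreasing) auto
  have Nbig: "N * \<eta>^i \<ge> 100000" if "i \<le> 7" for i
    by (rule order_trans[OF N], intro mult_left_mono pw' that) simp
  define n where "n = int N"
  define f where "f z = unit_char (\<alpha> * of_int (z^2) + \<beta> * of_int z)" for z :: int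
  define I where "I m = {max 1 (1 - m)..min n (n - m)}" for m
  define c where "c m = norm (\<Sum>z\<in>I m. unit_char ((2 * \<alpha> * of_int m) * of_int z))" for m
  have f_eq: "f (z + m) * cnj (f z) = unit_char (\<alpha> * of_int (m^2) + \<beta> * of_int m) * unit_char ((2 * \<alpha> * of_int m) * of_int z)" for z m
    unfolding f_def unit_char_diff[symmetric] unit_char_add[symmetric]
    by (rule arg_cong[of _ _ unit_char]) (simp add: power2_eq_square algebra_simps)
  have "\<eta>^2 * N^2 \<le> (norm (\<Sum>z\<in>{1..n}. f z))\<^sup>2"
    using large \<eta> power_mono[of "\<eta> * N" "norm (\<Sum>z\<in>{1..n}. f z)" 2] unfolding f_def n_def by (simp add: power_mult_distrib)
  also have "\<dots> = norm ((\<Sum>z\<in>{1..n}. f z) * cnj (\<Sum>z\<in>{1..n}. f z))"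
    by (simp only: norm_mult complex_mod_cnj power2_eq_square)
  also have "\<dots> = norm (\<Sum>m\<in>{-n<..<n}. \<Sum>z\<in>I m. f (z + m) * cnj (f z))"
    unfolding I_def sum_square_differences by simp
  also have "\<dots> \<le> (\<Sum>m\<in>{-n<..<n}. c m)"
    unfolding f_eq c_def
    by (rule order_trans[OF norm_sum]) (simp add: sum_distrib_left[symmetric] norm_mult)
  also have "\<dots> \<le> card {m \<in> {-n<..<n}. c m \<ge> \<eta>^2 * N / 4} * real N + card {-n<..<n} * (\<eta>^2 * N / 4)"
  proof (rule many_large_values)
    fix m
    have "c m \<le> (\<Sum>z\<in>I m. 1)" unfolding c_def by (rule order_trans[OF norm_sum]) simp
    also have "\<dots> = real (card (I m))" by simp
    also have "card (I m) \<le> card {1..n}" by (intro card_mono) (auto simp: I_def)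
    finally show "c m \<le> N" by (simp add: n_def)
  qed (use N0 in auto)
  finally have *: "\<eta>^2 * N^2 \<le> card {m \<in> {-n<..<n}. c m \<ge> \<eta>^2 * N / 4} * real N + card {-n<..<n} * (\<eta>^2 * N / 4)" .
  define K where "K = {m \<in> {-n<..<n}. c m \<ge> \<eta>^2 * N / 4}"
  have "real (card {-n<..<n}) * (\<eta>^2 * N / 4) \<le> (2 * N) * (\<eta>^2 * N / 4)"
    by (intro mult_right_mono) (auto simp: n_def)
  with * have "\<eta>^2 * N^2 \<le> card K * real N + (2 * N) * (\<eta>^2 * N / 4)"
    unfolding K_def by linarith
  then have "(\<eta>^2 * N / 2) * N \<le> card K * real N" by (simp add: power2_eq_square field_simps)
  then have cK: "\<eta>^2 * N / 2 \<le> card K" using N0 by (simp only: mult_le_cancel_right of_nat_0_less_iff simp_thms)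
  have K1: "K \<subseteq> {-n..<-n + int (2 * N)}" unfolding K_def n_def by auto
  have K2: "torus_norm (of_int m * (2 * \<alpha>)) \<le> 2 / (\<eta>^2 * N)" if "m \<in> K" for m
  proof -
    have "(\<eta>^2 * N / 4) * torus_norm (2 * \<alpha> * of_int m) \<le> c m * torus_norm (2 * \<alpha> * of_int m)"
      using that by (intro mult_right_mono) (auto simp: K_def)
    also have "\<dots> \<le> 1 / 2" unfolding c_def I_def by (rule geometric_sum_bound)
    finally show ?thesis using \<eta> N0 by (simp add: field_simps)
  qed
  obtain q :: nat where q: "0 < q" "q \<le> 3 / (\<eta>^2 / 4)"
    "torus_norm (q * (2 * \<alpha>)) \<le> 24 * (2 / (\<eta>^2 * N)) / ((\<eta>^2 / 4)\<^sup>2 * real (2 * N))"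
  proof (rule many_small_multiples[OF K1 _ K2])
    show "\<eta>^2 / 4 * real (2 * N) \<le> card K" using cK by (simp add: mult.commute)
    show "0 < \<eta>^2 / 4" "\<eta>^2 / 4 \<le> 1" "0 \<le> 2 / (\<eta>^2 * N)" using \<eta> pw[of 2] by simp_all
    have "256 < N * \<eta>^4 / 4" using Nbig[of 4] by simp
    then have "1024 < N * (\<eta>^2 * \<eta>^2)" by (simp add: power_add[symmetric])
    then show "2 / (\<eta>^2 * N) < \<eta>^2 / 4 / 128" using \<eta> N0 by (simp add: field_simps)
    have "(\<eta>^2 / 4)^2 * real (2 * N) = N * \<eta>^4 / 8" by (simp add: power_divide)
    moreover have "12 \<le> N * \<eta>^4 / 8" using Nbig[of 4] by simp
    ultimately show "12 \<le> (\<eta>^2 / 4)^2 * real (2 * N)" by linarith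
  qed
  show thesis
  \<comment> \<open>The factor 2 of the differenced frequency is moved into the denominator.\<close>
  proof (rule that[of "2 * q"])
    show "0 < 2 * q" using q by simp
    show "real (2 * q) \<le> 24 / \<eta>^2" using q(2) by simp
    have "24 * (2 / (\<eta>^2 * N)) / ((\<eta>^2 / 4)\<^sup>2 * real (2 * N)) = 384 / (\<eta>^6 * N^2)"
      using \<eta> N0 by (simp add: field_simps power2_eq_square eval_nat_numeral)
    then show "torus_norm (real (2 * q) * \<alpha>) \<le> 384 / (\<eta>^6 * N^2)" using q(3) by (simp add: mult_ac)
  qed
qed

lemma convex_int_set:
  fixes I :: "int set"
  assumes "finite I" "\<And>a b x. a \<in> I \<Longrightarrow> b \<in> I \<Longrightarrow> a \<le> x \<Longrightarrow> x \<le> b \<Longrightarrow> x \<in> I"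
  obtains u v where "I = {u..v}"
proof (cases "I = {}")
  case True
  then show thesis using that[of 1 0] by simp
next
  case False
  have "I = {Min I..Max I}"
  proof
    show "I \<subseteq> {Min I..Max I}" using assms(1) by auto
    show "{Min I..Max I} \<subseteq> I" using assms False by (metis Max_in Min_in atLeastAtMost_iff subsetI)
  qed
  then show thesis using that by blast
qed

lemma sum_shift_support:
  fixes F :: "int \<Rightarrow> 'b::comm_monoid_add"
  assumes F: "\<And>z. F z \<noteq> 0 \<Longrightarrow> z \<in> {1..n}" and s: "0 \<le> s" "s \<le> n"
  shows "(\<Sum>\<zeta>\<in>{-n..n}. F (\<zeta> + s)) = (\<Sum>z\<in>{1..n}. F z)"
proof -
  have "(\<Sum>\<zeta>\<in>{-n..n}. F (\<zeta> + s)) = (\<Sum>\<zeta>\<in>{1 - s..n - s}. F (\<zeta> + s))"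
    using s F by (intro sum.mono_neutral_right) force+
  also have "\<dots> = (\<Sum>z\<in>{1..n}. F z)"
    by (rule sum.reindex_bij_witness[where i = "\<lambda>z. z - s" and j = "\<lambda>z. z + s"]) auto
  finally show ?thesis .
qed

text \<open>With \<open>q\<alpha>\<close> almost an integer, the quadratic phase is nearly linear along short progressions of
  step \<open>q\<close>; one of them carries a large sum.\<close>
lemma weyl_quadratic:
  fixes N :: nat and \<alpha> \<beta> \<eta> :: real
  assumes \<eta>: "0 < \<eta>" "\<eta> \<le> 1" and N: "N * \<eta>^7 \<ge> 100000"
    and large: "norm (\<Sum>z\<in>{1..int N}. unit_char (\<alpha> * of_int (z^2) + \<beta> * of_int z)) \<ge> \<eta> * N"
  obtains q :: nat where "0 < q" "q \<le> 24 / \<eta>^2" "torus_norm (q * \<alpha>) \<le> 384 / (\<eta>^6 * N^2)"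
    "torus_norm (q * \<beta>) \<le> 400000 / (\<eta>^8 * N)"
proof -
  obtain q :: nat where q: "0 < q" "q \<le> 24 / \<eta>^2" "torus_norm (q * \<alpha>) \<le> 384 / (\<eta>^6 * N^2)"
    using weyl_leading[OF assms] .
  have N0: "0 < N" using N by (cases "N = 0") auto
  define n where "n = int N"
  \<comment> \<open>The length of the progressions. The quadratic phase varies along them by at most
    3NL times the bound for \<rho>, which for L \<le> x is \<eta> / 80; multiplied by 2 pi < 20 / 3
    this gives the error \<eta> / 12.\<close>
  define x where "x = \<eta>^7 * N / 92160"
  have x1: "x \<ge> 1" using N by (simp add: x_def mult.commute)
  define L where "L = nat \<lfloor>x\<rfloor>"
  have L: "L \<le> x" "x / 2 \<le> L" "1 \<le> L"
  proof -
    have "real L = of_int \<lfloor>x\<rfloor>" "1 \<le> \<lfloor>x\<rfloor>" using x1 by (simp_all add: L_def)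
    then show "L \<le> x" "x / 2 \<le> L" "1 \<le> L" using x1 by linarith+
  qed
  have qL: "q * L \<le> N"
  proof -
    have "real q * L \<le> 24 / \<eta>^2 * x" using q(2) L(1) x1 \<eta> by (intro mult_mono) auto
    also have "\<dots> = \<eta>^5 * N * (24 / 92160)" using \<eta> by (simp add: x_def field_simps eval_nat_numeral)
    also have "\<dots> \<le> 1 * real N * 1" using \<eta> by (intro mult_mono power_le_one) auto
    finally show ?thesis by (simp add: of_nat_mult[symmetric] del: of_nat_mult)
  qed
  define \<rho> where "\<rho> = q * \<alpha> - of_int (round (q * \<alpha>))"
  have \<rho>: "\<bar>\<rho>\<bar> \<le> 384 / (\<eta>^6 * N^2)" using q(3) by (simp add: \<rho>_def torus_norm_def)
  define f where "f z = unit_char (\<alpha> * of_int (z^2) + \<beta> * of_int z)" for z :: int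
  define F where "F z = (if z \<in> {1..n} then f z else 0)" for z
  define T where "T \<zeta> = (\<Sum>w\<in>{0..<int L}. F (\<zeta> + int q * w))" for \<zeta>
  have "(\<Sum>\<zeta>\<in>{-n..n}. T \<zeta>) = (\<Sum>w\<in>{0..<int L}. \<Sum>\<zeta>\<in>{-n..n}. F (\<zeta> + int q * w))"
    unfolding T_def by (rule sum.swap)
  also have "\<dots> = (\<Sum>w\<in>{0..<int L}. \<Sum>z\<in>{1..n}. F z)"
  proof (rule sum.cong[OF refl], rule sum_shift_support)
    fix w assume w: "w \<in> {0..<int L}"
    then show "0 \<le> int q * w" by simp
    have "int q * w \<le> int q * int L" using w by (intro mult_left_mono) auto
    then show "int q * w \<le> n" using qL unfolding n_def by (simp add: of_nat_mult[symmetric] del: of_nat_mult)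
  qed (auto simp: F_def split: if_splits)
  also have "\<dots> = L * (\<Sum>z\<in>{1..n}. f z)" by (simp add: F_def)
  finally have "L * norm (\<Sum>z\<in>{1..n}. f z) = norm (\<Sum>\<zeta>\<in>{-n..n}. T \<zeta>)" by (simp add: norm_mult)
  also have "\<dots> \<le> (\<Sum>\<zeta>\<in>{-n..n}. norm (T \<zeta>))" by (rule norm_sum)
  finally have T1: "L * (\<eta> * N) \<le> (\<Sum>\<zeta>\<in>{-n..n}. norm (T \<zeta>))"
    using large mult_left_mono[OF large, of "real L"] unfolding f_def n_def by simp
  have "\<exists>\<zeta>\<in>{-n..n}. norm (T \<zeta>) \<ge> \<eta> * L / 3"
  proof (rule ccontr)
    assume "\<not> ?thesis"
    then have "(\<Sum>\<zeta>\<in>{-n..n}. norm (T \<zeta>)) < (\<Sum>\<zeta>\<in>{-n..n}. \<eta> * L / 3)"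
      by (intro sum_strict_mono) (auto simp: n_def not_le)
    also have "\<dots> = (2 * N + 1) * (\<eta> * L / 3)" by (simp add: n_def)
    also have "\<dots> \<le> (3 * N) * (\<eta> * L / 3)" using N0 \<eta> by (intro mult_right_mono) auto
    finally show False using T1 by (simp add: mult_ac)
  qed
  then obtain \<zeta> where \<zeta>: "\<zeta> \<in> {-n..n}" "norm (T \<zeta>) \<ge> \<eta> * L / 3" by blast
  \<comment> \<open>Cutting off at \<open>1\<close> and \<open>n\<close> leaves an interval of
    values \<open>w\<close>, so the geometric sum bound still applies to the truncated
    progression.\<close>
  define I where "I = {w \<in> {0..<int L}. \<zeta> + int q * w \<in> {1..n}}"
  have "finite I" by (rule finite_subset[of _ "{0..<int L}"]) (auto simp: I_def)
  have cardI: "card I \<le> L"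
    using card_mono[of "{0..<int L}" I] by (simp add: I_def subset_iff)
  obtain u v where uv: "I = {u..v}"
  proof (rule convex_int_set[OF \<open>finite I\<close>])
    fix a b x assume *: "a \<in> I" "b \<in> I" "a \<le> x" "x \<le> b"
    have "int q * a \<le> int q * x" "int q * x \<le> int q * b" using * by (auto intro!: mult_left_mono)
    with * show "x \<in> I" by (auto simp: I_def)
  qed
  define \<omega> where "\<omega> = unit_char (\<alpha> * of_int (\<zeta>^2) + \<beta> * of_int \<zeta>)"
  have approx: "norm (f (\<zeta> + int q * w) - \<omega> * unit_char ((q * \<beta>) * of_int w)) \<le> \<eta> / 12" if w: "w \<in> I" for w
  proof -
    \<comment> \<open>In the expansion of the square at \<open>\<zeta> + q w\<close>, everything
      beyond the square of \<zeta> is an integer multiple of \<open>q\<close>. There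
      \<open>q * \<alpha>\<close> may be replaced by its distance \<rho> from the nearest
      integer.\<close>
    let ?t = "(2 * of_int \<zeta> * of_int w + q * (of_int w)^2) * \<rho>"
    have eq: "f (\<zeta> + int q * w) = \<omega> * unit_char ((q * \<beta>) * of_int w) * unit_char ?t"
      unfolding f_def \<omega>_def unit_char_add[symmetric]
      by (rule unit_char_mod1[where m = "(2 * \<zeta> * w + int q * w^2) * round (q * \<alpha>)"])
        (simp add: \<rho>_def power2_eq_square algebra_simps)
    have "norm (f (\<zeta> + int q * w) - \<omega> * unit_char ((q * \<beta>) * of_int w)) =
      norm (\<omega> * unit_char ((q * \<beta>) * of_int w) * (unit_char ?t - 1))"
      unfolding eq by (simp add: algebra_simps)
    also have "\<dots> = norm (unit_char ?t - 1)" by (simp add: norm_mult \<omega>_def)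
    also have "\<dots> \<le> 2 * pi * torus_norm ?t" by (rule unit_char_near_1)
    also have "\<dots> \<le> 2 * pi * \<bar>?t\<bar>" by (intro mult_left_mono torus_norm_le_abs) auto
    also have "\<bar>?t\<bar> \<le> (3 * N * L) * (384 / (\<eta>^6 * N^2))"
    proof -
      define W Z Q where "W = real_of_int w" and "Z = real_of_int \<zeta>" and "Q = real q"
      have w0: "0 \<le> W" "W \<le> L" using w by (auto simp: I_def W_def)
      have \<zeta>0: "\<bar>Z\<bar> \<le> N" using \<zeta>(1) by (auto simp: n_def Z_def)
      have Q: "0 \<le> Q" "Q * L \<le> N" using qL unfolding Q_def of_nat_mult[symmetric] of_nat_le_iff by simp_all
      have "\<bar>2 * Z * W\<bar> \<le> 2 * N * L" using w0 \<zeta>0 by (simp add: abs_mult mult_mono)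
      moreover have "\<bar>Q * W^2\<bar> \<le> N * L"
      proof -
        have "Q * W * W \<le> (Q * L) * W" using w0 Q by (intro mult_right_mono mult_left_mono) auto
        also have "\<dots> \<le> real N * real L" using w0 Q by (intro mult_mono) auto
        finally show ?thesis using w0 Q by (simp add: power2_eq_square mult.assoc)
      qed
      ultimately have "\<bar>2 * Z * W + Q * W^2\<bar> \<le> 3 * N * L" by linarith
      then have "\<bar>2 * Z * W + Q * W^2\<bar> * \<bar>\<rho>\<bar> \<le> (3 * N * L) * (384 / (\<eta>^6 * N^2))"
        using \<rho> by (intro mult_mono) auto
      then show ?thesis unfolding abs_mult W_def Z_def Q_def by simp
    qed
    also have "(3 * N * L) * (384 / (\<eta>^6 * N^2)) \<le> (3 * N * x) * (384 / (\<eta>^6 * N^2))"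
      using mult_left_mono[OF L(1), of "real N"] \<eta> by (intro mult_right_mono) auto
    also have "\<dots> = \<eta> / 80" using N0 \<eta> by (simp add: x_def field_simps power2_eq_square eval_nat_numeral)
    finally have "norm (f (\<zeta> + int q * w) - \<omega> * unit_char ((q * \<beta>) * of_int w)) \<le> 2 * pi * (\<eta> / 80)" by simp
    also have "\<dots> \<le> 2 * (10/3) * (\<eta> / 80)" using pi_less_4 pi_approx \<eta> by (intro mult_right_mono mult_left_mono) auto
    finally show ?thesis using \<eta> by simp
  qed
  have "T \<zeta> = (\<Sum>w\<in>I. f (\<zeta> + int q * w))"
    unfolding T_def I_def F_def by (rule sum.inter_filter[symmetric]) simp
  also have "\<dots> = \<omega> * (\<Sum>w\<in>I. unit_char ((q * \<beta>) * of_int w)) + (\<Sum>w\<in>I. f (\<zeta> + int q * w) - \<omega> * unit_char ((q * \<beta>) * of_int w))"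
    by (simp add: sum_distrib_left sum_subtractf)
  finally have "norm (T \<zeta>) \<le> norm (\<Sum>w\<in>I. unit_char ((q * \<beta>) * of_int w)) + norm (\<Sum>w\<in>I. f (\<zeta> + int q * w) - \<omega> * unit_char ((q * \<beta>) * of_int w))"
    using norm_triangle_ineq[of "\<omega> * (\<Sum>w\<in>I. unit_char ((q * \<beta>) * of_int w))"
      "\<Sum>w\<in>I. f (\<zeta> + int q * w) - \<omega> * unit_char ((q * \<beta>) * of_int w)"]
    by (simp only: norm_mult) (simp add: \<omega>_def)
  moreover have "norm (\<Sum>w\<in>I. f (\<zeta> + int q * w) - \<omega> * unit_char ((q * \<beta>) * of_int w)) \<le> card I * (\<eta> / 12)"
    using approx by (intro order_trans[OF norm_sum] sum_bounded_above) auto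
  moreover have "card I * (\<eta> / 12) \<le> L * (\<eta> / 12)" using cardI \<eta> by (intro mult_right_mono) auto
  moreover have "L * (\<eta> / 12) = \<eta> * L / 12" by simp
  ultimately have big: "\<eta> * L / 4 \<le> norm (\<Sum>w\<in>{u..v}. unit_char ((q * \<beta>) * of_int w))"
    using \<zeta>(2) unfolding uv by linarith
  have "(\<eta> * L / 4) * torus_norm (q * \<beta>) \<le> 1 / 2"
    by (rule order_trans[OF mult_right_mono[OF big] geometric_sum_bound]) simp
  moreover have "(\<eta> * (x / 2) / 4) * torus_norm (q * \<beta>) \<le> (\<eta> * L / 4) * torus_norm (q * \<beta>)"
    using L(2) \<eta> by (intro mult_right_mono divide_right_mono mult_left_mono) auto
  ultimately have "(\<eta> * (x / 2) / 4) * torus_norm (q * \<beta>) \<le> 1 / 2" by linarith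
  then have "torus_norm (q * \<beta>) * (\<eta>^8 * N) \<le> 400000"
    by (simp add: x_def eval_nat_numeral mult_ac)
  then have "torus_norm (q * \<beta>) \<le> 400000 / (\<eta>^8 * N)" using N0 \<eta> by (simp add: field_simps)
  then show thesis using that[OF q] by simp
qed

subsection \<open>Major arcs and dual functions\<close>

text \<open>A lower bound by a fixed power of \<delta>. One number serves both as exponent and as
  constant, which makes closure under products, powers and composition a matter of enlarging
  it.\<close>

definition polylow :: "(real \<Rightarrow> real) \<Rightarrow> bool" where
  "polylow F \<longleftrightarrow> (\<exists>C::nat. C \<ge> 1 \<and> (\<forall>\<delta>. 0 < \<delta> \<longrightarrow> \<delta> \<le> 1 \<longrightarrow> \<delta> ^ C / C \<le> F \<delta>))"

lemma polylowI: "1 \<le> C \<Longrightarrow> (\<And>\<delta>. 0 < \<delta> \<Longrightarrow> \<delta> \<le> 1 \<Longrightarrow> \<delta> ^ C / real C \<le> F \<delta>) \<Longrightarrow> polylow F"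
  unfolding polylow_def by blast

lemma polylowE:
  assumes "polylow F"
  obtains C :: nat where "1 \<le> C" "\<And>\<delta>. 0 < \<delta> \<Longrightarrow> \<delta> \<le> 1 \<Longrightarrow> \<delta> ^ C / C \<le> F \<delta>"
  using assms unfolding polylow_def by blast

lemma polylow_pos: "polylow F \<Longrightarrow> 0 < \<delta> \<Longrightarrow> \<delta> \<le> 1 \<Longrightarrow> 0 < F \<delta>"
  by (erule polylowE) (smt (verit) divide_pos_pos of_nat_0_less_iff zero_less_power less_le_trans zero_less_one)

lemma polylow_power: "0 < c \<Longrightarrow> polylow (\<lambda>\<delta>. c * \<delta> ^ n)"
proof (rule polylowI[where C = "max (max 1 n) (nat \<lceil>1 / c\<rceil>)"])
  fix \<delta> :: real assume "0 < c" and \<delta>: "0 < \<delta>" "\<delta> \<le> 1"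
  let ?C = "max (max 1 n) (nat \<lceil>1 / c\<rceil>)"
  have "1 / c \<le> ?C" by (simp add: le_max_iff_disj) linarith
  then have "1 \<le> c * ?C" using \<open>0 < c\<close> by (simp only: pos_divide_le_eq mult.commute)
  moreover have "\<delta> ^ ?C \<le> \<delta> ^ n" using \<delta> by (intro power_decreasing) auto
  ultimately have "\<delta> ^ ?C * 1 \<le> \<delta> ^ n * (c * ?C)" using \<delta> by (intro mult_mono) auto
  moreover have "0 < real ?C" by simp
  ultimately show "\<delta> ^ ?C / ?C \<le> c * \<delta> ^ n" by (simp only: pos_divide_le_eq mult_ac mult_1_right)
qed simp

lemma polylow_id: "polylow (\<lambda>\<delta>. \<delta>)"
  using polylow_power[of 1 1] by simp

lemma polylow_mono: "polylow F \<Longrightarrow> (\<And>\<delta>. 0 < \<delta> \<Longrightarrow> \<delta> \<le> 1 \<Longrightarrow> F \<delta> \<le> G \<delta>) \<Longrightarrow> polylow G"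
  unfolding polylow_def by (meson order_trans)

text \<open>The comparison passes through the power that lies below \<open>G\<close>, because that
  power is monotone while \<open>G\<close> may not be.\<close>

lemma polylow_comp:
  assumes G: "polylow G" and F: "polylow F" and le: "\<And>\<delta>. 0 < \<delta> \<Longrightarrow> \<delta> \<le> 1 \<Longrightarrow> F \<delta> \<le> 1"
  shows "polylow (\<lambda>\<delta>. G (F \<delta>))"
proof -
  obtain A where A: "1 \<le> A" "\<And>\<delta>. 0 < \<delta> \<Longrightarrow> \<delta> \<le> 1 \<Longrightarrow> \<delta> ^ A / real A \<le> F \<delta>" using polylowE[OF F] by blast
  obtain B where B: "1 \<le> B" "\<And>\<delta>. 0 < \<delta> \<Longrightarrow> \<delta> \<le> 1 \<Longrightarrow> \<delta> ^ B / real B \<le> G \<delta>" using polylowE[OF G] by blast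
  have "polylow (\<lambda>\<delta>. (1 / (real A ^ B * B)) * \<delta> ^ (A * B))" using A(1) B(1) by (intro polylow_power) auto
  then show ?thesis
  proof (rule polylow_mono)
    fix \<delta> :: real assume \<delta>: "0 < \<delta>" "\<delta> \<le> 1"
    have "1 / (real A ^ B * B) * \<delta> ^ (A * B) = (\<delta> ^ A / A) ^ B / B" by (simp add: power_divide power_mult)
    also have "\<dots> \<le> F \<delta> ^ B / B" using A \<delta> by (intro divide_right_mono power_mono) auto
    also have "\<dots> \<le> G (F \<delta>)" using polylow_pos[OF F \<delta>] le[OF \<delta>] by (intro B) auto
    finally show "1 / (real A ^ B * B) * \<delta> ^ (A * B) \<le> G (F \<delta>)" .
  qed
qed

lemma polylow_mult:
  assumes "polylow F" "polylow G"
  shows "polylow (\<lambda>\<delta>. F \<delta> * G \<delta>)"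
proof -
  obtain A where A: "1 \<le> A" "\<And>\<delta>. 0 < \<delta> \<Longrightarrow> \<delta> \<le> 1 \<Longrightarrow> \<delta> ^ A / real A \<le> F \<delta>" using polylowE[OF assms(1)] by blast
  obtain B where B: "1 \<le> B" "\<And>\<delta>. 0 < \<delta> \<Longrightarrow> \<delta> \<le> 1 \<Longrightarrow> \<delta> ^ B / real B \<le> G \<delta>" using polylowE[OF assms(2)] by blast
  have "polylow (\<lambda>\<delta>. (1 / (real A * B)) * \<delta> ^ (A + B))" using A(1) B(1) by (intro polylow_power) auto
  then show ?thesis
  proof (rule polylow_mono)
    fix \<delta> :: real assume \<delta>: "0 < \<delta>" "\<delta> \<le> 1"
    have "1 / (real A * B) * \<delta> ^ (A + B) = (\<delta> ^ A / A) * (\<delta> ^ B / B)" by (simp add: power_add)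
    also have "\<dots> \<le> F \<delta> * G \<delta>" using A(2)[OF \<delta>] B(2)[OF \<delta>] \<delta> polylow_pos[OF assms(1) \<delta>] by (intro mult_mono) auto
    finally show "1 / (real A * B) * \<delta> ^ (A + B) \<le> F \<delta> * G \<delta>" .
  qed
qed

lemma polylow_cmult: "0 < c \<Longrightarrow> polylow F \<Longrightarrow> polylow (\<lambda>\<delta>. c * F \<delta>)"
  using polylow_mult[OF polylow_power[of c 0]] by simp

lemma polylow_pow: "polylow F \<Longrightarrow> polylow (\<lambda>\<delta>. F \<delta> ^ n)"
proof (induction n)
  case 0
  then show ?case using polylow_power[of 1 0] by simp
next
  case (Suc n)
  then show ?case using polylow_mult[of F "\<lambda>\<delta>. F \<delta> ^ n"] by simp
qed

text \<open>The width is on the scale \<open>N^2\<close> of the second coordinate. A single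
  \<epsilon> governs denominator and width, so shrinking it only enlarges the arcs.\<close>

definition major :: "nat \<Rightarrow> real \<Rightarrow> real \<Rightarrow> bool" where
  "major N \<epsilon> \<theta> \<longleftrightarrow> (\<exists>q::nat. 0 < q \<and> real q \<le> 1 / \<epsilon> \<and> torus_norm (real q * \<theta>) \<le> 1 / (\<epsilon> * real N^2))"

lemma major_mono:
  assumes "major N \<epsilon> \<theta>" "0 < \<epsilon>'" "\<epsilon>' \<le> \<epsilon>"
  shows "major N \<epsilon>' \<theta>"
proof -
  have "1 / \<epsilon> \<le> 1 / \<epsilon>'" using assms by (intro divide_left_mono) auto
  moreover have "1 / (\<epsilon> * real N^2) \<le> 1 / (\<epsilon>' * real N^2)"
  proof (cases "N = 0")
    case False
    then show ?thesis using assms by (intro divide_left_mono mult_right_mono) auto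
  qed simp
  ultimately show ?thesis using assms(1) unfolding major_def by fastforce
qed

text \<open>Frequencies are arbitrary integers, so that their sums and differences need no
  reduction; \<open>chi_mod\<close> reduces them when they have to be counted.\<close>

definition chi :: "int \<Rightarrow> int \<Rightarrow> int \<Rightarrow> complex" where
  "chi M j y = unit_char (of_int (j * y) / of_int M)"

lemma norm_chi [simp]: "norm (chi M j y) = 1"
  by (simp add: chi_def)

lemma chi_add: "chi M (i + j) y = chi M i y * chi M j y"
  by (simp add: chi_def unit_char_add[symmetric] add_divide_distrib ring_distribs)

lemma chi_minus: "chi M (- j) y = cnj (chi M j y)"
  by (simp add: chi_def unit_char_minus[symmetric])

lemma chi_diff: "chi M (i - j) y = chi M i y * cnj (chi M j y)"
  using chi_add[of M i "- j" y] by (simp add: chi_minus)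

lemma chi_add_right: "chi M j (x + y) = chi M j x * chi M j y"
  by (simp add: chi_def unit_char_add[symmetric] add_divide_distrib ring_distribs)

lemma per_chi: "0 < M \<Longrightarrow> per M (chi M j)"
  unfolding per_def chi_def
  by (intro allI unit_char_mod1[where m = j]) (simp add: field_simps)

lemma chi_mod: "0 < M \<Longrightarrow> chi M (j mod M) y = chi M j y"
  unfolding chi_def
  by (rule unit_char_mod1[where m = "- (j div M) * y"])
     (simp add: field_simps of_int_mult[symmetric] of_int_add[symmetric] minus_div_mult_eq_mod[symmetric] del: of_int_mult of_int_add)

definition dual :: "nat \<Rightarrow> (int \<Rightarrow> int \<Rightarrow> complex) \<Rightarrow> (int \<Rightarrow> int \<Rightarrow> complex) \<Rightarrow> int \<Rightarrow> int \<Rightarrow> complex" where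
  "dual N f0 f1 x y = avg {1..int N} (\<lambda>z. f0 x (y - (z - x)^2) * f1 z (y - (z - x)^2))"

text \<open>With this period no wrap-around occurs in \<open>y + (z - x)\<^sup>2\<close> for \<open>y \<in> {1..N\<^sup>2}\<close> and \<open>x, z \<in> {1..N}\<close>.\<close>
definition modulus :: "nat \<Rightarrow> int" where
  "modulus N = 2 * (int N)^2"

lemma modulus_pos: "0 < N \<Longrightarrow> 0 < modulus N"
  by (simp add: modulus_def)

definition bddper :: "int \<Rightarrow> (int \<Rightarrow> int \<Rightarrow> complex) \<Rightarrow> bool" where
  "bddper M f \<longleftrightarrow> (\<forall>x y. norm (f x y) \<le> 1) \<and> (\<forall>x. per M (f x))"

lemma bddperD: "bddper M f \<Longrightarrow> norm (f x y) \<le> 1" "bddper M f \<Longrightarrow> per M (f x)"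
  by (auto simp: bddper_def)

lemma dual_bddper: "bddper M f0 \<Longrightarrow> bddper M f1 \<Longrightarrow> bddper M (dual N f0 f1)"
  unfolding bddper_def dual_def
  by (auto intro!: norm_avg_le per_avg per_mult per_shift[where c = "- c" for c, simplified] simp: norm_mult mult_le_one)

text \<open>Values below \<open>t / 2\<close> contribute at most half of the average, and the
  remaining ones are at most 1.\<close>

lemma avg_large:
  fixes f :: "'a \<Rightarrow> real"
  assumes S: "finite S" "S \<noteq> {}" and f: "\<And>s. s \<in> S \<Longrightarrow> f s \<le> 1" and t: "t \<le> avg S f" "0 \<le> t"
  shows "t / 2 \<le> avg S (\<lambda>s. of_bool (t / 2 \<le> f s))"
proof -
  have "avg S f \<le> avg S (\<lambda>s. of_bool (t / 2 \<le> f s) + t / 2)"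
    using f t by (intro avg_mono) (auto simp: not_le intro: add_increasing2)
  also have "\<dots> = avg S (\<lambda>s. of_bool (t / 2 \<le> f s)) + t / 2" using S by (simp add: avg_add)
  finally show ?thesis using t by simp
qed

lemma avg_of_bool: "finite S \<Longrightarrow> avg S (\<lambda>s. of_bool (P s)) = (card {s \<in> S. P s} / card S :: real)"
  by (simp add: avg_def of_bool_def sum.If_cases Int_def)

text \<open>For each \<open>z\<close> separately, translating \<open>y\<close> by the square moves
  it from the arguments of \<open>f0\<close> and \<open>f1\<close> to that of \<open>g\<close>. In
  this sense \<open>dual\<close> is the adjoint of the averaging that \<open>g\<close>
  undergoes.\<close>

lemma dual_correlation_point:
  assumes M: "0 < M" and f: "bddper M f0" "bddper M f1" and g: "per M g"
  shows "zavg M (\<lambda>y. dual N f0 f1 x y * g y) = zavg M (\<lambda>y. avg {1..int N} (\<lambda>z. f0 x y * f1 z y * g (y + (z - x)^2)))"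
proof -
  have "zavg M (\<lambda>y. dual N f0 f1 x y * g y) =
    avg {1..int N} (\<lambda>z. zavg M (\<lambda>y. f0 x (y - (z - x)^2) * f1 z (y - (z - x)^2) * g y))"
    unfolding dual_def avg_multc[symmetric] by (rule avg_swap)
  also have "\<dots> = avg {1..int N} (\<lambda>z. zavg M (\<lambda>y. f0 x y * f1 z y * g (y + (z - x)^2)))"
  proof (rule avg_cong[OF refl])
    fix z
    have "per M (\<lambda>y. f0 x y * f1 z y * g (y + (z - x)^2))"
      using f by (intro per_mult per_shift g bddperD(2))
    from avg_shift[OF this M, of "- ((z - x)^2)"]
    show "zavg M (\<lambda>y. f0 x (y - (z - x)^2) * f1 z (y - (z - x)^2) * g y) = zavg M (\<lambda>y. f0 x y * f1 z y * g (y + (z - x)^2))"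
      by simp
  qed
  finally show ?thesis by (simp only: avg_swap[of "{1..int N}" "{0..<M}"])
qed

lemma dual_correlation:
  assumes M: "0 < M" and f: "bddper M f0" "bddper M f1" and g: "\<And>x. per M (g x)"
  shows "avg {1..int N} (\<lambda>x. zavg M (\<lambda>y. dual N f0 f1 x y * g x y)) =
    zavg M (\<lambda>y. avg {1..int N} (\<lambda>x. avg {1..int N} (\<lambda>z. f0 x y * f1 z y * g x (y + (z - x)^2))))"
  unfolding dual_correlation_point[OF M f g] by (rule avg_swap)

text \<open>All dependence on \<open>y\<close> sits in the constant phase \<open>u\<close>; the
  modulus is that of a quadratic Weyl sum in \<open>z\<close>, the same for every
  \<open>y\<close>.\<close>

lemma chi_phase_difference:
  assumes "0 < M"
  shows "norm (avg {1..int N} (\<lambda>z. chi M i (y + (z - x)^2) * cnj (chi M j (y + (z - x')^2)))) =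
    norm (\<Sum>z\<in>{1..int N}. unit_char ((of_int i / of_int M - of_int j / of_int M) * of_int (z^2) +
      (- 2 * (of_int x * (of_int i / of_int M) - of_int x' * (of_int j / of_int M))) * of_int z)) / N"
proof -
  define u where "u = unit_char (of_int i / of_int M * of_int (y + x^2) - of_int j / of_int M * of_int (y + x'^2))"
  have "chi M i (y + (z - x)^2) * cnj (chi M j (y + (z - x')^2)) = u * unit_char ((of_int i / of_int M - of_int j / of_int M) * of_int (z^2) +
      (- 2 * (of_int x * (of_int i / of_int M) - of_int x' * (of_int j / of_int M))) * of_int z)" for z
    unfolding chi_def u_def unit_char_diff[symmetric] unit_char_add[symmetric]
    by (rule arg_cong[of _ _ unit_char]) (simp add: divide_inverse power2_eq_square algebra_simps)
  then show ?thesis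
    by (simp only: avg_cmult norm_mult) (simp add: u_def norm_avg_complex)
qed

text \<open>For most pairs \<open>(x, x')\<close> the quadratic Weyl sum with coefficients
  \<open>\<phi> x - \<phi> x'\<close> and \<open>-2(x \<phi> x - x' \<phi> x')\<close> is large, which makes
  \<open>2 q (x - x') \<phi> x\<close> nearly an integer for many \<open>x'\<close>.\<close>
lemma major_from_pairs:
  fixes \<phi> :: "int \<Rightarrow> real" and \<kappa> :: real and X' :: "int set"
  assumes \<kappa>: "0 < \<kappa>" "\<kappa> \<le> 1" and N: "N * (\<kappa>^16 / 12000000000) \<ge> 1"
    and X': "X' \<subseteq> {1..int N}" "card X' \<ge> \<kappa>^2 * N"
    and large: "\<And>x'. x' \<in> X' \<Longrightarrow> norm (\<Sum>z\<in>{1..int N}. unit_char ((\<phi> x - \<phi> x') * of_int (z^2) +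
      (- 2 * (of_int x * \<phi> x - of_int x' * \<phi> x')) * of_int z)) \<ge> \<kappa> * N"
    and x: "x \<in> {1..int N}"
  shows "major N (\<kappa>^16 / 12000000000) (\<phi> x)"
proof -
  have N0: "0 < N" using N by (cases "N = 0") auto
  have Nbig: "N * \<kappa>^i \<ge> 12000000000" if "i \<le> 16" for i
  proof -
    have "N * \<kappa>^16 \<le> N * \<kappa>^i" using \<kappa> that by (intro mult_left_mono power_decreasing) auto
    then show ?thesis using N by simp
  qed
  have finX: "finite X'" using X'(1) finite_subset by blast
  have neX: "X' \<noteq> {}" using X'(2) \<kappa> N0 by (metis card.empty mult_pos_pos not_le of_nat_0 of_nat_0_less_iff zero_less_power)
  define Q where "Q = nat \<lfloor>24 / \<kappa>^2\<rfloor>"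
  have Q: "real Q \<le> 24 / \<kappa>^2" using \<kappa> by (simp add: Q_def)
  have "\<exists>q::nat. 0 < q \<and> real q \<le> 24 / \<kappa>^2 \<and> torus_norm (real q * (\<phi> x - \<phi> x')) \<le> 384 / (\<kappa>^6 * N^2) \<and>
     torus_norm (real q * (- 2 * (of_int x * \<phi> x - of_int x' * \<phi> x'))) \<le> 400000 / (\<kappa>^8 * N)" if "x' \<in> X'" for x'
  proof -
    have "100000 \<le> N * \<kappa>^7" using Nbig[of 7] by simp
    from weyl_quadratic[OF \<kappa> this large[OF that]] show ?thesis by metis
  qed
  then obtain q :: "int \<Rightarrow> nat" where q: "\<And>x'. x' \<in> X' \<Longrightarrow> 0 < q x' \<and> real (q x') \<le> 24 / \<kappa>^2 \<and> torus_norm (real (q x') * (\<phi> x - \<phi> x')) \<le> 384 / (\<kappa>^6 * N^2) \<and>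
     torus_norm (real (q x') * (- 2 * (of_int x * \<phi> x - of_int x' * \<phi> x'))) \<le> 400000 / (\<kappa>^8 * N)" by metis
  have "q ` X' \<subseteq> {1..Q}" using q by (force simp: Q_def le_nat_floor)
  \<comment> \<open>The denominators supplied by Weyl's inequality vary with \<open>x'\<close>, but
    there are at most \<open>Q\<close> of them; one value \<open>t\<close> serves a proportion at
    least 1 / Q of \<open>X'\<close>.\<close>
  then obtain t where t: "t \<in> {1..Q}" "card X' \<le> card {x' \<in> X'. q x' = t} * card {1..Q}"
    by (rule pigeonhole_fibre[OF finite_atLeastAtMost _ finX neX])
  define Y where "Y = {x' \<in> X'. q x' = t}"
  have t24: "real t \<le> 24 / \<kappa>^2" using t(1) Q by (meson atLeastAtMost_iff of_nat_le_iff order_trans)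
  have cY: "card Y \<ge> \<kappa>^4 / 48 * real (2 * N)"
  proof -
    have "\<kappa>^2 * N \<le> real (card Y * Q)" using X'(2) t(2) unfolding Y_def by (simp del: of_nat_mult)
    also have "\<dots> \<le> card Y * (24 / \<kappa>^2)" unfolding of_nat_mult using Q by (intro mult_left_mono) auto
    finally have "\<kappa>^2 * N * \<kappa>^2 \<le> card Y * 24" using \<kappa> by (simp add: field_simps)
    then show ?thesis by (simp add: power_add[symmetric] mult_ac)
  qed
  define K where "K = (\<lambda>x'. x - x') ` Y"
  have cK: "card K = card Y" unfolding K_def by (intro card_image inj_onI) simp
  have K1: "K \<subseteq> {- int N..<- int N + int (2 * N)}" using X'(1) x unfolding K_def Y_def by auto
  have K2: "torus_norm (of_int k * (2 * t * \<phi> x)) \<le> 401000 / (\<kappa>^8 * N)" if k: "k \<in> K" for k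
  proof -
    obtain x' where x': "x' \<in> Y" "k = x - x'" using k by (auto simp: K_def)
    then have x'X: "x' \<in> X'" "q x' = t" by (auto simp: Y_def)
    let ?\<beta> = "t * (- 2 * (of_int x * \<phi> x - of_int x' * \<phi> x'))" and ?\<alpha> = "t * (\<phi> x - \<phi> x')"
    \<comment> \<open>Adding \<open>2 * x'\<close> times the quadratic coefficient to the linear one
      eliminates \<open>\<phi> x'\<close>, so that a condition on \<open>\<phi> x\<close> alone is
      left.\<close>
    have "of_int k * (2 * t * \<phi> x) = - (?\<beta> + of_int (2 * x') * ?\<alpha>)" unfolding x'(2) by (simp add: algebra_simps)
    then have "torus_norm (of_int k * (2 * t * \<phi> x)) \<le> torus_norm ?\<beta> + torus_norm (of_int (2 * x') * ?\<alpha>)"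
      using torus_norm_add[of ?\<beta> "of_int (2 * x') * ?\<alpha>"] by (simp only: torus_norm_minus)
    also have "torus_norm (of_int (2 * x') * ?\<alpha>) \<le> of_int \<bar>2 * x'\<bar> * torus_norm ?\<alpha>" by (rule torus_norm_int_mult)
    also have "\<dots> \<le> (2 * N) * (384 / (\<kappa>^6 * N^2))"
    proof (rule mult_mono)
      have "\<bar>2 * x'\<bar> \<le> int (2 * N)" using X'(1) x'X by force
      then show "real_of_int \<bar>2 * x'\<bar> \<le> real (2 * N)" by linarith
      show "torus_norm ?\<alpha> \<le> 384 / (\<kappa>^6 * N^2)" using q[OF x'X(1)] x'X(2) by simp
    qed auto
    also have "\<dots> = 768 / (\<kappa>^6 * N)" using N0 \<kappa> by (simp add: field_simps power2_eq_square)
    also have "\<dots> \<le> 768 / (\<kappa>^8 * N)" using N0 \<kappa> by (intro divide_left_mono mult_right_mono power_decreasing) auto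
    also have "torus_norm ?\<beta> \<le> 400000 / (\<kappa>^8 * N)" using q[OF x'X(1)] x'X(2) by simp
    finally have "torus_norm (of_int k * (2 * t * \<phi> x)) \<le> 400000 / (\<kappa>^8 * N) + 768 / (\<kappa>^8 * N)" by simp
    also have "\<dots> = 400768 / (\<kappa>^8 * N)" by (simp add: add_divide_distrib[symmetric])
    also have "\<dots> \<le> 401000 / (\<kappa>^8 * N)" using N0 \<kappa> by (intro divide_right_mono) auto
    finally show ?thesis .
  qed
  obtain p :: nat where p: "0 < p" "p \<le> 3 / (\<kappa>^4 / 48)"
    "torus_norm (p * (2 * t * \<phi> x)) \<le> 24 * (401000 / (\<kappa>^8 * N)) / ((\<kappa>^4 / 48)\<^sup>2 * real (2 * N))"
  proof (rule many_small_multiples[OF K1 _ K2])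
    show "\<kappa>^4 / 48 * real (2 * N) \<le> card K" using cY cK by simp
    have "\<kappa>^4 \<le> 1" using \<kappa> by (simp add: power_le_one)
    then show "0 < \<kappa>^4 / 48" "\<kappa>^4 / 48 \<le> 1" "0 \<le> 401000 / (\<kappa>^8 * N)" using \<kappa> by simp_all
    have "401000 * 6144 < N * \<kappa>^12" using Nbig[of 12] by simp
    then have "401000 * 6144 < N * (\<kappa>^8 * \<kappa>^4)" by (simp add: power_add[symmetric])
    then show "401000 / (\<kappa>^8 * N) < \<kappa>^4 / 48 / 128" using \<kappa> N0 by (simp add: field_simps)
    have "(\<kappa>^4 / 48)^2 * real (2 * N) = N * \<kappa>^8 / 1152" by (simp add: power_divide)
    moreover have "12 \<le> N * \<kappa>^8 / 1152" using Nbig[of 8] by simp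
    ultimately show "12 \<le> (\<kappa>^4 / 48)^2 * real (2 * N)" by linarith
  qed
  show ?thesis unfolding major_def
  proof (intro exI[of _ "p * (2 * t)"] conjI)
    show "0 < p * (2 * t)" using p t by simp
    have "real p * (2 * real t) \<le> (144 / \<kappa>^4) * (2 * (24 / \<kappa>^2))" using p(2) t24 \<kappa> by (intro mult_mono) auto
    also have "\<dots> = 6912 / \<kappa>^6" by (simp add: power_add[symmetric])
    also have "\<dots> \<le> 12000000000 / \<kappa>^16" using \<kappa> by (intro frac_le power_decreasing) auto
    finally show "real (p * (2 * t)) \<le> 1 / (\<kappa>^16 / 12000000000)" by simp
    have "24 * (401000 / (\<kappa>^8 * N)) / ((\<kappa>^4 / 48)\<^sup>2 * real (2 * N)) = (24 * 401000 * 1152) / (\<kappa>^16 * N^2)"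
      using \<kappa> N0 by (simp add: field_simps power2_eq_square eval_nat_numeral)
    also have "\<dots> \<le> 12000000000 / (\<kappa>^16 * N^2)" using \<kappa> by (intro divide_right_mono) auto
    finally show "torus_norm (real (p * (2 * t)) * \<phi> x) \<le> 1 / (\<kappa>^16 / 12000000000 * real N^2)"
      using p(3) by (simp add: mult_ac)
  qed
qed

text \<open>After \<open>f0\<close> and \<open>f1\<close> have been removed, the average over pairs
  \<open>x\<close>, \<open>x'\<close> is one of squared Weyl sums. Two popularity arguments, for
  \<open>x\<close> and then for \<open>x'\<close>, lead to \<open>major_from_pairs\<close>. The
  weight \<open>c\<close> is carried along so that the values of \<open>x\<close> found can be
  confined to its support.\<close>

lemma dual_correlates_character:
  assumes \<eta>: "0 < \<eta>" "\<eta> \<le> 1" and N: "N * ((\<eta>^2 / 2)^16 / 12000000000) \<ge> 1"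
    and f: "bddper (modulus N) f0" "bddper (modulus N) f1" and c: "\<And>x. norm (c x) \<le> (1::real)"
    and large: "norm (avg {1..int N} (\<lambda>x. c x * zavg (modulus N) (\<lambda>y. dual N f0 f1 x y * chi (modulus N) (J x) y))) \<ge> \<eta>"
  shows "avg {1..int N} (\<lambda>x. of_bool (c x \<noteq> 0 \<and> major N ((\<eta>^2 / 2)^16 / 12000000000) (of_int (J x) / of_int (modulus N)))) \<ge> \<eta>^4 / 2"
proof -
  have N0: "0 < N" using N by (cases "N = 0") auto
  define M where "M = modulus N"
  have M: "0 < M" using N0 modulus_pos by (simp add: M_def)
  let ?X = "{1..int N}"
  have X: "finite ?X" "?X \<noteq> {}" using N0 by auto
  define g where "g x z y = c x * chi M (J x) (y + (z - x)^2)" for x z y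
  \<comment> \<open>The choice \<open>y = 0\<close> is a normalisation: by
    \<open>chi_phase_difference\<close> the modulus is independent of \<open>y\<close>.\<close>
  define W where "W x x' = (norm (avg ?X (\<lambda>z. chi M (J x) (0 + (z - x)^2) * cnj (chi M (J x') (0 + (z - x')^2)))))\<^sup>2" for x x'
  define b where "b x = (of_bool (c x \<noteq> 0) :: real)" for x
  have W: "0 \<le> W x x'" "W x x' \<le> 1" for x x'
    unfolding W_def by (auto intro!: power_le_one norm_avg_le simp: norm_mult)
  have "avg ?X (\<lambda>x. c x * zavg M (\<lambda>y. dual N f0 f1 x y * chi M (J x) y)) =
     avg ?X (\<lambda>x. zavg M (\<lambda>y. dual N f0 f1 x y * (c x * chi M (J x) y)))"
    by (simp add: avg_cmult[symmetric] mult_ac)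
  also have "\<dots> = zavg M (\<lambda>y. avg ?X (\<lambda>x. avg ?X (\<lambda>z. f0 x y * f1 z y * g x z y)))"
    unfolding g_def
    by (rule dual_correlation) (use M f in \<open>auto simp: M_def intro!: per_mult per_const per_chi\<close>)
  finally have "\<eta>^4 \<le> norm (zavg M (\<lambda>y. avg ?X (\<lambda>x. avg ?X (\<lambda>z. f0 x y * f1 z y * g x z y))))^4"
    using large \<eta> unfolding M_def by (intro power_mono) auto
  also have "\<dots> \<le> avg ?X (\<lambda>x. avg ?X (\<lambda>x'. zavg M (\<lambda>y. (norm (avg ?X (\<lambda>z. g x z y * cnj (g x' z y))))\<^sup>2)))"
    by (rule avg_corner_square) (use f in \<open>auto dest: bddperD\<close>)
  also have "\<dots> \<le> avg ?X (\<lambda>x. avg ?X (\<lambda>x'. b x * W x x'))"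
  proof (intro avg_mono avg_le)
    fix x x' y
    have "avg ?X (\<lambda>z. g x z y * cnj (g x' z y)) = c x * cnj (c x') * avg ?X (\<lambda>z. chi M (J x) (y + (z - x)^2) * cnj (chi M (J x') (y + (z - x')^2)))"
      unfolding g_def avg_cmult[symmetric] by (simp add: mult_ac)
    moreover have "norm (avg ?X (\<lambda>z. chi M (J x) (y + (z - x)^2) * cnj (chi M (J x') (y + (z - x')^2)))) = sqrt (W x x')"
      unfolding W_def chi_phase_difference[OF M] by simp
    ultimately have "(norm (avg ?X (\<lambda>z. g x z y * cnj (g x' z y))))\<^sup>2 = (norm (c x))\<^sup>2 * (norm (c x'))\<^sup>2 * W x x'"
      using W by (simp add: norm_mult power_mult_distrib)
    also have "\<dots> \<le> b x * 1 * W x x'" using c W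
      by (intro mult_mono) (auto simp: b_def intro!: power_le_one)
    finally show "(norm (avg ?X (\<lambda>z. g x z y * cnj (g x' z y))))\<^sup>2 \<le> b x * W x x'" by simp
  qed (use W in \<open>auto simp: b_def\<close>)
  finally have "\<eta>^4 \<le> avg ?X (\<lambda>x. avg ?X (\<lambda>x'. b x * W x x'))" .
  then have "\<eta>^4 / 2 \<le> avg ?X (\<lambda>x. of_bool (\<eta>^4 / 2 \<le> avg ?X (\<lambda>x'. b x * W x x')))"
    using X \<eta> W by (intro avg_large avg_le) (auto simp: b_def)
  also have "\<dots> \<le> avg ?X (\<lambda>x. of_bool (c x \<noteq> 0 \<and> major N ((\<eta>^2 / 2)^16 / 12000000000) (of_int (J x) / of_int M)))"
  proof (rule avg_mono)
    fix x assume x: "x \<in> ?X"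
    let ?\<kappa> = "\<eta>^2 / 2"
    have "c x \<noteq> 0 \<and> major N (?\<kappa>^16 / 12000000000) (of_int (J x) / of_int M)" if *: "\<eta>^4 / 2 \<le> avg ?X (\<lambda>x'. b x * W x x')"
    proof -
      have c0: "c x \<noteq> 0" using * \<eta> X by (auto simp: b_def)
      then have "\<eta>^4 / 2 \<le> avg ?X (\<lambda>x'. W x x')" using * by (simp add: b_def)
      then have "\<eta>^4 / 2 / 2 \<le> avg ?X (\<lambda>x'. of_bool (\<eta>^4 / 2 / 2 \<le> W x x'))"
        using X \<eta> W by (intro avg_large) auto
      then have cd: "\<eta>^4 / 4 * N \<le> card {x' \<in> ?X. \<eta>^4 / 4 \<le> W x x'}"
        using N0 by (simp add: avg_of_bool field_simps)
      have "major N (?\<kappa>^16 / 12000000000) (of_int (J x) / of_int M)"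
      proof (rule major_from_pairs[where x = x and \<phi> = "\<lambda>x. of_int (J x) / of_int M" and X' = "{x' \<in> ?X. \<eta>^4 / 4 \<le> W x x'}"])
        show "?\<kappa>^2 * real N \<le> real (card {x' \<in> ?X. \<eta>^4 / 4 \<le> W x x'})" using cd by (simp add: power_divide)
        fix x' assume "x' \<in> {x' \<in> ?X. \<eta>^4 / 4 \<le> W x x'}"
        then have "(?\<kappa>)\<^sup>2 \<le> W x x'" by (simp add: power_divide)
        then have "?\<kappa> \<le> norm (avg ?X (\<lambda>z. chi M (J x) (0 + (z - x)^2) * cnj (chi M (J x') (0 + (z - x')^2))))"
          unfolding W_def by (rule power2_le_imp_le) simp
        then show "?\<kappa> * N \<le> norm (\<Sum>z\<in>?X. unit_char ((of_int (J x) / of_int M - of_int (J x') / of_int M) * of_int (z^2) +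
          (- 2 * (of_int x * (of_int (J x) / of_int M) - of_int x' * (of_int (J x') / of_int M))) * of_int z))"
          using N0 unfolding chi_phase_difference[OF M] by (simp add: field_simps)
      next
        have "\<eta>\<^sup>2 \<le> 1" using \<eta> by (simp add: power_le_one)
        then show "?\<kappa> \<le> 1" by simp
      qed (use \<eta> N x in auto)
      then show ?thesis using c0 by simp
    qed
    then show "of_bool (\<eta>^4 / 2 \<le> avg ?X (\<lambda>x'. b x * W x x')) \<le> (of_bool (c x \<noteq> 0 \<and> major N (?\<kappa>^16 / 12000000000) (of_int (J x) / of_int M)) :: real)"
      by auto
  qed
  finally show ?thesis unfolding M_def .
qed

subsection \<open>Frequencies of differenced dual functions\<close>

lemma of_real_vavg: "complex_of_real (vavg M m f) = vavg M m (\<lambda>v. of_real (f v))"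
  by (induction m arbitrary: f) (simp_all add: of_real_avg)

lemma avg_reindex: "inj_on h S \<Longrightarrow> avg (h ` S) f = avg S (\<lambda>s. f (h s))"
  by (simp add: avg_def sum.reindex card_image)

text \<open>If \<open>F\<close> is an average of functions \<open>\<alpha> i\<close>, Cauchy--Schwarz leads to the positive kernel \<open>K\<close>. Both
  survive multiplicative differencing: the averages for \<open>F(y + s)\<close> and \<open>cnj (F y)\<close> multiply.\<close>
definition represents :: "(int \<Rightarrow> complex) \<Rightarrow> (int \<Rightarrow> int \<Rightarrow> int \<Rightarrow> complex) \<Rightarrow> bool" where
  "represents F K \<longleftrightarrow> (\<exists>(\<Omega>::nat set) \<alpha>. (\<forall>y. F y = avg \<Omega> (\<lambda>i. \<alpha> i y)) \<and>
     (\<forall>t t' y. K t t' y = avg \<Omega> (\<lambda>i. \<alpha> i (y + t) * cnj (\<alpha> i (y + t')))))"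

text \<open>Products of two averages are averages over pairs of indices. The pairs are coded as
  naturals by \<open>prod_encode\<close>, because \<open>represents\<close> fixes the index type
  while each derivative squares the index set.\<close>

lemma represents_diff:
  assumes "represents F K"
  shows "represents (\<lambda>y. F (y + s) * cnj (F y)) (\<lambda>t t' y. K t t' (y + s) * cnj (K t t' y))"
proof -
  obtain \<Omega> :: "nat set" and \<alpha> where F: "\<And>y. F y = avg \<Omega> (\<lambda>i. \<alpha> i y)"
    and K: "\<And>t t' y. K t t' y = avg \<Omega> (\<lambda>i. \<alpha> i (y + t) * cnj (\<alpha> i (y + t')))"
    using assms unfolding represents_def by blast
  let ?\<Omega> = "prod_encode ` (\<Omega> \<times> \<Omega>)"
  let ?\<alpha> = "\<lambda>k y. \<alpha> (fst (prod_decode k)) (y + s) * cnj (\<alpha> (snd (prod_decode k)) y)"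
  have avg\<Omega>: "avg ?\<Omega> (\<lambda>k. g (prod_decode k)) = avg \<Omega> (\<lambda>i. avg \<Omega> (\<lambda>j. g (i, j)))" for g :: "_ \<Rightarrow> complex"
    by (subst avg_reindex) (simp_all add: inj_prod_encode avg_times)
  show ?thesis unfolding represents_def
  proof (intro exI[of _ ?\<Omega>] exI[of _ ?\<alpha>] conjI allI)
    fix y
    show "F (y + s) * cnj (F y) = avg ?\<Omega> (\<lambda>k. ?\<alpha> k y)"
      unfolding avg\<Omega>[of "\<lambda>p. \<alpha> (fst p) (y + s) * cnj (\<alpha> (snd p) y)"] F cnj_avg avg_product by simp
    fix t t'
    have "avg ?\<Omega> (\<lambda>k. ?\<alpha> k (y + t) * cnj (?\<alpha> k (y + t'))) = avg \<Omega> (\<lambda>i. avg \<Omega> (\<lambda>j.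
       (\<alpha> i (y + t + s) * cnj (\<alpha> j (y + t))) * cnj (\<alpha> i (y + t' + s) * cnj (\<alpha> j (y + t')))))"
      using avg\<Omega>[of "\<lambda>p. (\<alpha> (fst p) (y + t + s) * cnj (\<alpha> (snd p) (y + t))) * cnj (\<alpha> (fst p) (y + t' + s) * cnj (\<alpha> (snd p) (y + t')))"]
      by simp
    then show "K t t' (y + s) * cnj (K t t' y) = avg ?\<Omega> (\<lambda>k. ?\<alpha> k (y + t) * cnj (?\<alpha> k (y + t')))"
      unfolding K cnj_avg avg_product by (simp add: mult_ac add_ac)
  qed
qed

lemma represents_D: "represents F K \<Longrightarrow> represents (mder v F) (\<lambda>t t'. mder v (K t t'))"
proof (induction v arbitrary: F K)
  case (Cons s v)
  from Cons.IH[OF represents_diff[OF Cons.prems, of s]] show ?case by simp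
qed simp

text \<open>The kernel of a dual function is again a dual function, namely of \<open>f0\<close> and
  \<open>f1\<close> differenced between the shifts \<open>t\<close> and \<open>t'\<close>. This is
  what lets the induction on the order close.\<close>

lemma represents_dual:
  "represents (dual N f0 f1 x) (\<lambda>t t'. dual N (\<lambda>x y. f0 x (y + t) * cnj (f0 x (y + t'))) (\<lambda>z y. f1 z (y + t) * cnj (f1 z (y + t'))) x)"
proof -
  have e: "avg {1..int N} g = avg (nat ` {1..int N}) (\<lambda>i. g (int i))" for g :: "int \<Rightarrow> complex"
  proof -
    have "inj_on nat {1..int N}" by (rule inj_onI) auto
    then have "avg (nat ` {1..int N}) (\<lambda>i. g (int i)) = avg {1..int N} (\<lambda>z. g (int (nat z)))" by (rule avg_reindex)
    also have "\<dots> = avg {1..int N} g" by (rule avg_cong) auto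
    finally show ?thesis by simp
  qed
  show ?thesis unfolding represents_def dual_def
    unfolding e
    by (intro exI[of _ "nat ` {1..int N}"] exI[of _ "\<lambda>i y. f0 x (y - (int i - x)^2) * f1 (int i) (y - (int i - x)^2)"])
       (simp add: algebra_simps)
qed

text \<open>With \<open>F\<close> written as an average over \<open>i\<close>, the weight
  \<open>B\<close> is free of \<open>t\<close>. Cauchy--Schwarz over the pairs of \<open>y\<close>
  and \<open>i\<close> removes it and doubles \<open>t\<close>, and the average over
  \<open>i\<close> then produces the kernel. Thus the outer derivative of \<open>F\<close> is
  exchanged for one inside the average.\<close>

lemma dual_interchange:
  assumes "represents F K" and B: "\<And>y. norm (B y) \<le> 1"
  shows "(norm (avg T (\<lambda>t. zavg M (\<lambda>y. B y * F (y + t) * W t y))))\<^sup>2 \<le>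
    avg T (\<lambda>t. avg T (\<lambda>t'. norm (zavg M (\<lambda>y. K t t' y * (W t y * cnj (W t' y))))))"
proof -
  obtain \<Omega> :: "nat set" and \<alpha> where F: "\<And>y. F y = avg \<Omega> (\<lambda>i. \<alpha> i y)"
    and K: "\<And>t t' y. K t t' y = avg \<Omega> (\<lambda>i. \<alpha> i (y + t) * cnj (\<alpha> i (y + t')))"
    using assms unfolding represents_def by blast
  have "avg T (\<lambda>t. zavg M (\<lambda>y. B y * F (y + t) * W t y)) =
    zavg M (\<lambda>y. avg T (\<lambda>t. avg \<Omega> (\<lambda>i. B y * (\<alpha> i (y + t) * W t y))))"
    by (subst avg_swap) (simp add: F avg_cmult avg_multc mult_ac)
  also have "\<dots> = avg ({0..<M} \<times> \<Omega>) (\<lambda>p. B (fst p) * avg T (\<lambda>t. \<alpha> (snd p) (fst p + t) * W t (fst p)))"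
    by (simp add: avg_times avg_swap[of T] avg_cmult)
  also have "(norm \<dots>)\<^sup>2 \<le> avg T (\<lambda>t. avg T (\<lambda>t'. norm (avg ({0..<M} \<times> \<Omega>) (\<lambda>p. (\<alpha> (snd p) (fst p + t) * W t (fst p)) * cnj (\<alpha> (snd p) (fst p + t') * W t' (fst p))))))"
    by (rule avg_vdc_norm) (rule B)
  also have "\<dots> = avg T (\<lambda>t. avg T (\<lambda>t'. norm (zavg M (\<lambda>y. K t t' y * (W t y * cnj (W t' y))))))"
  proof -
    have "avg \<Omega> (\<lambda>i. (\<alpha> i (y + t) * W t y) * cnj (\<alpha> i (y + t') * W t' y)) = K t t' y * (W t y * cnj (W t' y))" for t t' y
      unfolding K avg_multc[symmetric] by (rule avg_cong) (simp_all add: mult_ac)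
    then show ?thesis by (simp only: avg_times fst_conv snd_conv)
  qed
  finally show ?thesis .
qed

text \<open>The alternating sum of \<open>J\<close> over the vertices of a cube, each coordinate
  being taken from \<open>v\<close> with sign plus or from \<open>w\<close> with sign minus.\<close>

fun alt :: "(int list \<Rightarrow> int) \<Rightarrow> int list \<Rightarrow> int list \<Rightarrow> int" where
  "alt J [] w = J []"
| "alt J (t # v) w = alt (\<lambda>u. J (t # u) - J (hd w # u)) v (tl w)"

text \<open>The quantifiers over \<open>f0\<close>, \<open>f1\<close>, \<open>c\<close> and
  \<open>J\<close> stand inside, since the induction on \<open>m\<close> replaces all four. The
  condition \<open>c x v \<noteq> 0\<close> in the conclusion makes it possible to restrict to those
  \<open>v\<close> for which the correlation is known to be large.\<close>

definition alt_bound :: "nat \<Rightarrow> (real \<Rightarrow> real) \<Rightarrow> bool" where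
  "alt_bound m \<epsilon> \<longleftrightarrow> (\<forall>\<eta> N f0 f1 c J. 0 < \<eta> \<longrightarrow> \<eta> \<le> 1 \<longrightarrow> 1 \<le> real N * \<epsilon> \<eta> \<longrightarrow>
     bddper (modulus N) f0 \<longrightarrow> bddper (modulus N) f1 \<longrightarrow> (\<forall>x v. norm (c x v) \<le> 1) \<longrightarrow>
     \<eta> \<le> norm (avg {1..int N} (\<lambda>x. vavg (modulus N) m (\<lambda>v. c x v *
        zavg (modulus N) (\<lambda>y. mder v (dual N f0 f1 x) y * chi (modulus N) (J x v) y)))) \<longrightarrow>
     \<epsilon> \<eta> \<le> avg {1..int N} (\<lambda>x. vavg (modulus N) m (\<lambda>v. vavg (modulus N) m (\<lambda>w.
        of_bool (c x v \<noteq> 0 \<and> major N (\<epsilon> \<eta>) (of_int (alt (J x) v w) / of_int (modulus N)))))))"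

lemma bddper_diff: "bddper M f \<Longrightarrow> bddper M (\<lambda>x y. f x (y + t) * cnj (f x (y + t')))"
  unfolding bddper_def by (auto intro!: per_mult per_cnj per_shift simp: norm_mult mult_le_one)

lemma alt_bound_0: "alt_bound 0 (\<lambda>\<eta>. (\<eta>^2 / 2)^16 / 12000000000)"
  unfolding alt_bound_def
proof (intro allI impI)
  fix \<eta> :: real and N f0 f1 and c :: "int \<Rightarrow> int list \<Rightarrow> complex" and J :: "int \<Rightarrow> int list \<Rightarrow> int"
  assume \<eta>: "0 < \<eta>" "\<eta> \<le> 1" and *: "1 \<le> real N * ((\<eta>\<^sup>2 / 2) ^ 16 / 12000000000)"
    "bddper (modulus N) f0" "bddper (modulus N) f1" "\<forall>x v. norm (c x v) \<le> 1"
    "\<eta> \<le> norm (avg {1..int N} (\<lambda>x. vavg (modulus N) 0 (\<lambda>v. c x v * zavg (modulus N) (\<lambda>y. mder v (dual N f0 f1 x) y * chi (modulus N) (J x v) y))))"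
  have "(\<eta>\<^sup>2 / 2) ^ 16 / 12000000000 \<le> \<eta>^4 / 2"
  proof -
    have "(\<eta>\<^sup>2 / 2) ^ 16 \<le> \<eta> ^ 32" using \<eta> by (simp add: power_divide power_mult[symmetric] divide_le_eq)
    also have "\<dots> \<le> \<eta> ^ 4" using \<eta> by (intro power_decreasing) auto
    finally have "(\<eta>\<^sup>2 / 2) ^ 16 \<le> \<eta> ^ 4" .
    moreover have "0 \<le> \<eta> ^ 4" using \<eta> by simp
    ultimately show ?thesis by linarith
  qed
  also have "\<dots> \<le> avg {1..int N} (\<lambda>x. of_bool (c x [] \<noteq> 0 \<and> major N ((\<eta>\<^sup>2 / 2) ^ 16 / 12000000000) (of_int (J x []) / of_int (modulus N))))"
    using * by (intro dual_correlates_character[OF \<eta>]) auto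
  finally show "(\<eta>\<^sup>2 / 2) ^ 16 / 12000000000 \<le> avg {1..int N} (\<lambda>x. vavg (modulus N) 0 (\<lambda>v. vavg (modulus N) 0 (\<lambda>w.
        of_bool (c x v \<noteq> 0 \<and> major N ((\<eta>\<^sup>2 / 2) ^ 16 / 12000000000) (of_int (alt (J x) v w) / of_int (modulus N))))))"
    by simp
qed

lemma cnj_sgn_mult: "cnj (sgn z) * z = complex_of_real (norm z)"
proof (cases "z = 0")
  case False
  have "cnj (sgn z) * z = (z * cnj z) / of_real (norm z)" by (simp add: sgn_div_norm divide_inverse scaleR_conv_of_real mult_ac)
  also have "\<dots> = of_real (norm z)" using False by (simp add: complex_norm_square[symmetric] power2_eq_square)
  finally show ?thesis .
qed simp

text \<open>For fixed remaining steps \<open>v\<close>, \<open>dual_interchange\<close> doubles the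
  first step into \<open>t\<close> and \<open>t'\<close>. What is left is the same problem of order
  \<open>m\<close> for the differenced \<open>f0\<close> and \<open>f1\<close>, with the frequency
  \<open>J x (t # v) - J x (t' # v)\<close>, whose alternating sum is that of \<open>J\<close> one
  order higher. The induction hypothesis is applied to each of the many pairs \<open>t\<close>,
  \<open>t'\<close> with a large contribution.\<close>

lemma alt_bound_Suc:
  assumes IH: "alt_bound m \<epsilon>" and \<epsilon>: "\<And>\<delta>. 0 < \<delta> \<Longrightarrow> \<delta> \<le> 1 \<Longrightarrow> 0 < \<epsilon> \<delta>"
  shows "alt_bound (Suc m) (\<lambda>\<eta>. (\<eta>^2 / 2) * \<epsilon> (\<eta>^2 / 2))"
  unfolding alt_bound_def
proof (intro allI impI)
  fix \<eta> :: real and N f0 f1 and c :: "int \<Rightarrow> int list \<Rightarrow> complex" and J :: "int \<Rightarrow> int list \<Rightarrow> int"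
  define M where "M = modulus N"
  define t0 where "t0 = \<eta>^2 / 2"
  let ?X = "{1..int N}"
  let ?F = "dual N f0 f1"
  assume \<eta>: "0 < \<eta>" "\<eta> \<le> 1" and N: "1 \<le> real N * ((\<eta>\<^sup>2 / 2) * \<epsilon> (\<eta>\<^sup>2 / 2))"
    and f: "bddper (modulus N) f0" "bddper (modulus N) f1" and c: "\<forall>x v. norm (c x v) \<le> 1"
    and large: "\<eta> \<le> norm (avg {1..int N} (\<lambda>x. vavg (modulus N) (Suc m) (\<lambda>v. c x v * zavg (modulus N) (\<lambda>y. mder v (dual N f0 f1 x) y * chi (modulus N) (J x v) y))))"
  have N0: "0 < N" using N by (cases "N = 0") auto
  have M: "0 < M" "{0..<M} \<noteq> {}" using N0 modulus_pos by (auto simp: M_def)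
  have X: "finite ?X" "?X \<noteq> {}" using N0 by auto
  have t0: "0 < t0" "t0 \<le> 1" using \<eta> by (simp_all add: t0_def power_le_one order_trans[OF power_le_one])
  have Nt0: "1 \<le> real N * \<epsilon> t0"
  proof -
    have "real N * (t0 * \<epsilon> t0) \<le> real N * (1 * \<epsilon> t0)" using t0 \<epsilon>[OF t0] by (intro mult_left_mono mult_right_mono) auto
    then show ?thesis using N by (simp add: t0_def)
  qed
  define f0' where "f0' t t' x y = f0 x (y + t) * cnj (f0 x (y + t'))" for t t' x y
  define f1' where "f1' t t' z y = f1 z (y + t) * cnj (f1 z (y + t'))" for t t' z y
  define J' where "J' t t' x v = J x (t # v) - J x (t' # v)" for t t' x v
  define Z where "Z t t' x v = zavg M (\<lambda>y. mder v (dual N (f0' t t') (f1' t t') x) y * chi M (J' t t' x v) y)" for t t' x v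
  define n where "n t t' x v = norm (c x (t # v)) * norm (c x (t' # v))" for t t' x v
  \<comment> \<open>The sign turns the terms into their absolute values; the factor \<open>n\<close>
    makes \<open>c'\<close> vanish wherever \<open>c x (t # v)\<close> does, which carries the
    support condition back to \<open>c\<close>.\<close>
  define c' where "c' t t' x v = of_real (n t t' x v) * cnj (sgn (Z t t' x v))" for t t' x v
  have n: "0 \<le> n t t' x v" "n t t' x v \<le> 1" for t t' x v using c by (auto simp: n_def mult_le_one)
  have c': "norm (c' t t' x v) \<le> 1" for t t' x v
    unfolding c'_def norm_mult using n by (auto simp: norm_sgn)
  have c'Z: "c' t t' x v * Z t t' x v = of_real (n t t' x v * norm (Z t t' x v))" for t t' x v
  proof -
    show ?thesis unfolding c'_def mult.assoc cnj_sgn_mult by simp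
  qed
  define I where "I x v = zavg M (\<lambda>t. c x (t # v) * zavg M (\<lambda>y. mder (t # v) (?F x) y * chi M (J x (t # v)) y))" for x v
  define E where "E t t' = avg ?X (\<lambda>x. vavg M m (\<lambda>v. n t t' x v * norm (Z t t' x v)))" for t t'
  have I: "(norm (I x v))\<^sup>2 \<le> zavg M (\<lambda>t. zavg M (\<lambda>t'. n t t' x v * norm (Z t t' x v)))" for x v
  proof -
    let ?W = "\<lambda>t y. c x (t # v) * chi M (J x (t # v)) y"
    have "I x v = zavg M (\<lambda>t. zavg M (\<lambda>y. cnj (mder v (?F x) y) * mder v (?F x) (y + t) * ?W t y))"
      unfolding I_def mder_Cons avg_cmult[symmetric] by (simp add: mult_ac)
    then have "(norm (I x v))\<^sup>2 \<le> zavg M (\<lambda>t. zavg M (\<lambda>t'. norm (zavg M (\<lambda>y. mder v (dual N (f0' t t') (f1' t t') x) y * (?W t y * cnj (?W t' y))))))"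
      unfolding f0'_def f1'_def
      by (simp only:) (rule dual_interchange[OF represents_D[OF represents_dual]],
        simp, rule mder_norm, use dual_bddper[OF f] in \<open>auto simp: bddper_def\<close>)
    also have "\<dots> = zavg M (\<lambda>t. zavg M (\<lambda>t'. n t t' x v * norm (Z t t' x v)))"
    proof (intro avg_cong refl)
      fix t t'
      have "zavg M (\<lambda>y. mder v (dual N (f0' t t') (f1' t t') x) y * (?W t y * cnj (?W t' y))) = (c x (t # v) * cnj (c x (t' # v))) * Z t t' x v"
        unfolding Z_def J'_def chi_diff avg_cmult[symmetric] by (simp add: mult_ac)
      then show "norm (zavg M (\<lambda>y. mder v (dual N (f0' t t') (f1' t t') x) y * (?W t y * cnj (?W t' y)))) = n t t' x v * norm (Z t t' x v)"
        by (simp add: norm_mult n_def)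
    qed
    finally show ?thesis .
  qed
  have "avg ?X (\<lambda>x. vavg M (Suc m) (\<lambda>v. c x v * zavg M (\<lambda>y. mder v (?F x) y * chi M (J x v) y))) = avg ?X (\<lambda>x. vavg M m (\<lambda>v. I x v))"
    unfolding I_def by (simp add: avg_vavg_swap del: mder.simps)
  then have "\<eta> \<le> avg ?X (\<lambda>x. vavg M m (\<lambda>v. norm (I x v)))"
    using large order_trans[OF norm_avg[of ?X "\<lambda>x. vavg M m (\<lambda>v. I x v)"] avg_mono[OF vavg_norm]] unfolding M_def by (simp del: vavg.simps)
  then have "\<eta>\<^sup>2 \<le> (avg ?X (\<lambda>x. vavg M m (\<lambda>v. norm (I x v))))\<^sup>2" using \<eta> by (intro power_mono) auto
  also have "\<dots> \<le> avg ?X (\<lambda>x. vavg M m (\<lambda>v. (norm (I x v))\<^sup>2))"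
    by (rule order_trans[OF avg_square_le avg_mono[OF vavg_square_le]])
  also have "\<dots> \<le> avg ?X (\<lambda>x. vavg M m (\<lambda>v. zavg M (\<lambda>t. zavg M (\<lambda>t'. n t t' x v * norm (Z t t' x v)))))"
    by (intro avg_mono vavg_mono I)
  also have "\<dots> = zavg M (\<lambda>t. zavg M (\<lambda>t'. E t t'))"
    unfolding E_def by (simp add: avg_vavg_swap[symmetric] avg_swap[of ?X])
  also have "\<dots> = avg ({0..<M} \<times> {0..<M}) (\<lambda>p. E (fst p) (snd p))" by (simp add: avg_times)
  finally have 1: "2 * t0 \<le> avg ({0..<M} \<times> {0..<M}) (\<lambda>p. E (fst p) (snd p))" by (simp add: t0_def)
  have Z1: "norm (Z t t' x v) \<le> 1" for t t' x v
  proof -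
    have "bddper M (f0' t t')" "bddper M (f1' t t')" using f bddper_diff unfolding f0'_def f1'_def M_def by blast+
    from dual_bddper[OF this] have "norm (mder v (dual N (f0' t t') (f1' t t') x) y) \<le> 1" for y
      by (intro mder_norm) (auto simp: bddper_def)
    then show ?thesis unfolding Z_def by (intro norm_avg_le) (auto simp: norm_mult)
  qed
  have E1: "E t t' \<le> 1" for t t'
    unfolding E_def using n Z1 by (intro avg_le vavg_le mult_le_one) auto
  have 2: "t0 \<le> avg ({0..<M} \<times> {0..<M}) (\<lambda>p. of_bool (t0 \<le> E (fst p) (snd p)))"
    using avg_large[of "{0..<M} \<times> {0..<M}" "\<lambda>p. E (fst p) (snd p)", OF _ _ E1 1] M t0 by simp
  define R where "R t t' = avg ?X (\<lambda>x. vavg M m (\<lambda>v. vavg M m (\<lambda>w.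
        of_bool (c x (t # v) \<noteq> 0 \<and> major N (t0 * \<epsilon> t0) (of_int (alt (J x) (t # v) (t' # w)) / of_int M)) :: real)))" for t t'
  have R: "of_bool (t0 \<le> E t t') * \<epsilon> t0 \<le> R t t'" for t t'
  proof (cases "t0 \<le> E t t'")
    case True
    have "avg ?X (\<lambda>x. vavg M m (\<lambda>v. c' t t' x v * Z t t' x v)) = of_real (E t t')"
      unfolding c'Z E_def of_real_avg of_real_vavg ..
    then have "t0 \<le> norm (avg ?X (\<lambda>x. vavg M m (\<lambda>v. c' t t' x v * Z t t' x v)))" using True t0 by simp
    then have "\<epsilon> t0 \<le> avg ?X (\<lambda>x. vavg M m (\<lambda>v. vavg M m (\<lambda>w.
        of_bool (c' t t' x v \<noteq> 0 \<and> major N (\<epsilon> t0) (of_int (alt (J' t t' x) v w) / of_int M)))))"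
      using IH[unfolded alt_bound_def, rule_format, OF t0 Nt0, of "f0' t t'" "f1' t t'" "c' t t'" "J' t t'"]
        bddper_diff[OF f(1), of t t'] bddper_diff[OF f(2), of t t'] c'
      unfolding Z_def M_def f0'_def f1'_def by blast
    also have "\<dots> \<le> R t t'"
      unfolding R_def
    proof (intro avg_mono vavg_mono)
      fix x v w
      have "major N (t0 * \<epsilon> t0) \<theta>" if "major N (\<epsilon> t0) \<theta>" for \<theta>
        using that t0 \<epsilon>[OF t0] by (elim major_mono) auto
      then show "of_bool (c' t t' x v \<noteq> 0 \<and> major N (\<epsilon> t0) (of_int (alt (J' t t' x) v w) / of_int M)) \<le>
        (of_bool (c x (t # v) \<noteq> 0 \<and> major N (t0 * \<epsilon> t0) (of_int (alt (J x) (t # v) (t' # w)) / of_int M)) :: real)"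
        by (auto simp: J'_def[abs_def] c'_def n_def)
    qed
    finally show ?thesis using True by simp
  next
    case False
    then show ?thesis unfolding R_def by (auto intro!: avg_nonneg vavg_nonneg)
  qed
  have "t0 * \<epsilon> t0 \<le> avg ({0..<M} \<times> {0..<M}) (\<lambda>p. of_bool (t0 \<le> E (fst p) (snd p))) * \<epsilon> t0"
    using 2 \<epsilon>[OF t0] by (intro mult_right_mono) auto
  also have "\<dots> \<le> avg ({0..<M} \<times> {0..<M}) (\<lambda>p. R (fst p) (snd p))"
    unfolding avg_multc[symmetric] by (intro avg_mono R)
  also have "\<dots> = avg ?X (\<lambda>x. vavg M (Suc m) (\<lambda>v. vavg M (Suc m) (\<lambda>w.
      of_bool (c x v \<noteq> 0 \<and> major N (t0 * \<epsilon> t0) (of_int (alt (J x) v w) / of_int M)))))"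
    unfolding R_def by (simp add: avg_times avg_vavg_swap avg_swap[of "{0..<M}" ?X] del: alt.simps)
  finally show "\<eta>\<^sup>2 / 2 * \<epsilon> (\<eta>\<^sup>2 / 2) \<le> avg {1..int N} (\<lambda>x. vavg (modulus N) (Suc m) (\<lambda>v. vavg (modulus N) (Suc m) (\<lambda>w.
        of_bool (c x v \<noteq> 0 \<and> major N (\<eta>\<^sup>2 / 2 * \<epsilon> (\<eta>\<^sup>2 / 2)) (of_int (alt (J x) v w) / of_int (modulus N))))))"
    unfolding t0_def M_def .
qed

lemma alt_bound_ex: "\<exists>\<epsilon>. polylow \<epsilon> \<and> (\<forall>\<delta>. 0 < \<delta> \<longrightarrow> \<delta> \<le> 1 \<longrightarrow> \<epsilon> \<delta> \<le> 1) \<and> alt_bound m \<epsilon>"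
proof (induction m)
  case 0
  have "polylow (\<lambda>\<eta>. (1 / (2^16 * 12000000000)) * \<eta> ^ 32)" by (rule polylow_power) simp
  then have "polylow (\<lambda>\<eta>. (\<eta>^2 / 2)^16 / 12000000000)" by (simp add: power_divide power_mult[symmetric])
  moreover have "(\<delta>^2 / 2)^16 / 12000000000 \<le> 1" if "0 < \<delta>" "\<delta> \<le> 1" for \<delta> :: real
  proof -
    have "\<delta>^2 / 2 \<le> 1" using that by (simp add: order_trans[OF power_le_one])
    then have "(\<delta>^2 / 2)^16 \<le> 1" using that by (intro power_le_one) auto
    then show ?thesis by simp
  qed
  ultimately show ?case using alt_bound_0 by blast
next
  case (Suc m)
  then obtain \<epsilon> where \<epsilon>: "polylow \<epsilon>" "\<And>\<delta>. 0 < \<delta> \<Longrightarrow> \<delta> \<le> 1 \<Longrightarrow> \<epsilon> \<delta> \<le> 1" "alt_bound m \<epsilon>" by blast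
  have sq: "0 < \<delta>^2 / 2" "\<delta>^2 / 2 \<le> 1" if "0 < \<delta>" "\<delta> \<le> 1" for \<delta> :: real
    using that by (simp_all add: order_trans[OF power_le_one])
  have p: "polylow (\<lambda>\<delta>. \<delta>^2 / 2)" using polylow_power[of "1/2" 2] by simp
  have "polylow (\<lambda>\<eta>. (\<eta>^2 / 2) * \<epsilon> (\<eta>^2 / 2))"
    using sq by (intro polylow_mult p polylow_comp[OF \<epsilon>(1)])
  moreover have "(\<delta>^2 / 2) * \<epsilon> (\<delta>^2 / 2) \<le> 1" if "0 < \<delta>" "\<delta> \<le> 1" for \<delta>
    using sq[OF that] \<epsilon>(2) polylow_pos[OF \<epsilon>(1)] by (intro mult_le_one) (auto intro: less_imp_le)
  ultimately show ?case using alt_bound_Suc[OF \<epsilon>(3)] polylow_pos[OF \<epsilon>(1)] by blast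
qed

subsection \<open>Fourier analysis modulo an integer\<close>

lemma mder_prod_shift: "mder v (\<lambda>y. F (y + s) * cnj (F (y + t))) y = mder v F (y + s) * cnj (mder v F (y + t))"
proof -
  have "mder v (\<lambda>y. F (y + s) * cnj (F (y + t))) = (\<lambda>y. mder v (\<lambda>y. F (y + s)) y * mder v (\<lambda>y. cnj (F (y + t))) y)"
    by (rule mder_mult)
  also have "mder v (\<lambda>y. cnj (F (y + t))) = (\<lambda>y. cnj (mder v (\<lambda>y. F (y + t)) y))" by (rule mder_cnj)
  also have "mder v (\<lambda>y. F (y + s)) = (\<lambda>y. mder v F (y + s))" by (rule mder_shift)
  also have "mder v (\<lambda>y. F (y + t)) = (\<lambda>y. mder v F (y + t))" by (rule mder_shift)
  finally show ?thesis by (rule fun_cong)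
qed

lemma mder_prod_diff: "mder v (\<lambda>y. F (y + s) * cnj (F y)) y = mder v F (y + s) * cnj (mder v F y)"
  using mder_Cons[of s v F y] by simp

primrec vecs :: "int \<Rightarrow> nat \<Rightarrow> int list set" where
  "vecs M 0 = {[]}"
| "vecs M (Suc m) = (\<lambda>(t, v). t # v) ` ({0..<M} \<times> vecs M m)"

lemma vavg_avg: "vavg M m f = avg (vecs M m) f"
proof (induction m arbitrary: f)
  case 0
  then show ?case by (simp add: avg_def)
next
  case (Suc m)
  have "avg (vecs M (Suc m)) f = avg ({0..<M} \<times> vecs M m) (\<lambda>p. f (fst p # snd p))"
    unfolding vecs.simps by (subst avg_reindex) (auto simp: inj_on_def split_def)
  then show ?case using Suc by (simp add: avg_times)
qed

lemma chi_diff_right: "chi M j x * cnj (chi M j y) = chi M j (x - y)"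
  by (simp add: chi_def unit_char_diff[symmetric] diff_divide_distrib right_diff_distrib)

lemma sum_chi:
  assumes M: "0 < M"
  shows "(\<Sum>j\<in>{0..<M}. chi M j u) = (if M dvd u then of_int M else 0)"
proof (cases "M dvd u")
  case True
  then obtain k where u: "u = M * k" by blast
  have "chi M j u = 1" for j
    unfolding chi_def u using M unit_char_int[of "j * k"] by (simp add: field_simps)
  then show ?thesis using True M by simp
next
  case False
  define \<theta> where "\<theta> = real_of_int u / of_int M"
  have eq: "chi M j u = unit_char (\<theta> * of_int j)" for j by (simp add: chi_def \<theta>_def mult.commute)
  have iv: "{0..<M} = {0..M - 1}" by auto
  have "(unit_char \<theta> - 1) * (\<Sum>j\<in>{0..<M}. chi M j u) = unit_char (\<theta> * of_int M) - 1"
    unfolding eq iv using geometric_sum_telescope[of 0 "M - 1" \<theta>] M by simp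
  also have "\<theta> * of_int M = of_int u" using M by (simp add: \<theta>_def)
  finally have z: "(unit_char \<theta> - 1) * (\<Sum>j\<in>{0..<M}. chi M j u) = 0" by simp
  have "unit_char \<theta> \<noteq> 1"
  proof
    assume "unit_char \<theta> = 1"
    then have "torus_norm \<theta> \<le> 0" using unit_char_far_1[of \<theta>] by simp
    then have "\<theta> = of_int (round \<theta>)" by (simp add: torus_norm_def)
    then have "real_of_int u = of_int (round \<theta> * M)" using M by (simp add: \<theta>_def field_simps)
    then have "u = round \<theta> * M" by (simp only: of_int_eq_iff)
    then show False using False by simp
  qed
  then show ?thesis using z False by simp
qed

lemma parseval:
  assumes M: "0 < M"
  shows "(\<Sum>j\<in>{0..<M}. (norm (zavg M (\<lambda>y. F y * chi M j y)))\<^sup>2) = zavg M (\<lambda>y. (norm (F y))\<^sup>2)"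
proof -
  have "complex_of_real (\<Sum>j\<in>{0..<M}. (norm (zavg M (\<lambda>y. F y * chi M j y)))\<^sup>2) =
    (\<Sum>j\<in>{0..<M}. zavg M (\<lambda>y. zavg M (\<lambda>y'. (F y * cnj (F y')) * chi M j (y - y'))))"
    unfolding of_real_sum norm_square_avg chi_diff_right[symmetric] by (simp add: mult_ac)
  also have "\<dots> = zavg M (\<lambda>y. zavg M (\<lambda>y'. (F y * cnj (F y')) * (\<Sum>j\<in>{0..<M}. chi M j (y - y'))))"
    unfolding avg_def sum_distrib_left sum_divide_distrib
    by (subst sum.swap, rule sum.cong[OF refl], subst sum.swap) simp
  also have "\<dots> = zavg M (\<lambda>y. zavg M (\<lambda>y'. (F y * cnj (F y')) * (if y' = y then of_int M else 0)))"
  proof (intro avg_cong refl arg_cong2[of _ _ _ _ "(*)"])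
    fix y y' assume "y \<in> {0..<M}" "y' \<in> {0..<M}"
    then have "M dvd (y - y') \<longleftrightarrow> y' = y"
      by (auto simp: mod_eq_dvd_iff[symmetric])
    then show "(\<Sum>j\<in>{0..<M}. chi M j (y - y')) = (if y' = y then of_int M else 0)"
      unfolding sum_chi[OF M] by simp
  qed
  also have "\<dots> = zavg M (\<lambda>y. F y * cnj (F y))"
  proof (rule avg_cong[OF refl])
    fix y assume "y \<in> {0..<M}"
    then show "zavg M (\<lambda>y'. (F y * cnj (F y')) * (if y' = y then of_int M else 0)) = F y * cnj (F y)"
      using M by (simp add: avg_def if_distrib cong: if_cong)
  qed
  also have "\<dots> = complex_of_real (zavg M (\<lambda>y. (norm (F y))\<^sup>2))"
    by (simp add: of_real_avg complex_norm_square del: of_real_power)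
  finally show ?thesis by (simp only: of_real_eq_iff)
qed

lemma norm_zavg_square:
  assumes "per M h" "0 < M"
  shows "complex_of_real ((norm (zavg M h))\<^sup>2) = zavg M (\<lambda>u. zavg M (\<lambda>y. h (y + u) * cnj (h y)))"
proof -
  have "zavg M (\<lambda>u. zavg M (\<lambda>y. h (y + u) * cnj (h y))) = zavg M (\<lambda>y. zavg M (\<lambda>u. h (u + y)) * cnj (h y))"
    by (subst avg_swap) (simp add: avg_multc add.commute)
  also have "\<dots> = zavg M h * cnj (zavg M h)" by (simp add: avg_shift[OF assms] avg_cmult cnj_avg)
  finally show ?thesis by (simp add: complex_norm_square del: of_real_power)
qed

lemma fourier_autocorrelation:
  assumes G: "per M G" and M: "0 < M"
  shows "zavg M (\<lambda>t. zavg M (\<lambda>y. G (y + t) * cnj (G y)) * chi M j t) = of_real ((norm (zavg M (\<lambda>y. G y * chi M j y)))\<^sup>2)"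
proof -
  have "per M (\<lambda>y. G y * chi M j y)" using G per_chi[OF M] by (intro per_mult) auto
  from norm_zavg_square[OF this M]
  have "complex_of_real ((norm (zavg M (\<lambda>y. G y * chi M j y)))\<^sup>2) =
     zavg M (\<lambda>t. zavg M (\<lambda>y. (G (y + t) * cnj (G y)) * (chi M j (y + t) * cnj (chi M j y))))"
    by (simp add: mult_ac)
  also have "\<dots> = zavg M (\<lambda>t. zavg M (\<lambda>y. G (y + t) * cnj (G y)) * chi M j t)"
    unfolding chi_diff_right by (simp add: avg_multc)
  finally show ?thesis by simp
qed

text \<open>The Fourier coefficients of the autocorrelation are the squared moduli of those of
  \<open>G\<close>. By Parseval the left side is the sum of their fourth powers, at most the largest
  square times the sum of squares, and the latter is at most 1.\<close>

lemma autocorrelation_le_fourier: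
  assumes G: "per M G" "\<And>y. norm (G y) \<le> 1" and M: "0 < M"
  obtains j where "zavg M (\<lambda>t. (norm (zavg M (\<lambda>y. G (y + t) * cnj (G y))))\<^sup>2) \<le> (norm (zavg M (\<lambda>y. G y * chi M j y)))\<^sup>2"
proof -
  define a where "a j = (norm (zavg M (\<lambda>y. G y * chi M j y)))\<^sup>2" for j
  have fin: "finite (a ` {0..<M})" "a ` {0..<M} \<noteq> {}" using M by auto
  then obtain j0 where j0: "j0 \<in> {0..<M}" "a j0 = Max (a ` {0..<M})" by (metis Max_in imageE)
  have le: "a j \<le> a j0" if "j \<in> {0..<M}" for j using fin that j0 by simp
  have a0: "0 \<le> a j" for j by (simp add: a_def)
  have "zavg M (\<lambda>t. (norm (zavg M (\<lambda>y. G (y + t) * cnj (G y))))\<^sup>2) = (\<Sum>j\<in>{0..<M}. (norm (complex_of_real (a j)))\<^sup>2)"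
    unfolding parseval[OF M, symmetric] fourier_autocorrelation[OF G(1) M] a_def ..
  also have "\<dots> = (\<Sum>j\<in>{0..<M}. a j * a j)" by (simp add: power2_eq_square)
  also have "\<dots> \<le> (\<Sum>j\<in>{0..<M}. a j0 * a j)" using le a0 by (intro sum_mono mult_right_mono) auto
  also have "\<dots> = a j0 * zavg M (\<lambda>y. (norm (G y))\<^sup>2)" unfolding a_def parseval[OF M, symmetric] by (simp add: sum_distrib_left)
  also have "\<dots> \<le> a j0 * 1" using G(2) a0 by (intro mult_left_mono avg_le power_le_one) auto
  finally show thesis using that[of j0] by (simp add: a_def)
qed

text \<open>Products of bounded weights, and sums of phases, of which the \<open>i\<close>-th does not depend on the
  \<open>i\<close>-th differencing parameter; such weights are what Gowers--Cauchy--Schwarz can remove.\<close>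
primrec lower_weight :: "nat \<Rightarrow> (int list \<Rightarrow> complex) \<Rightarrow> bool" where
  "lower_weight 0 w \<longleftrightarrow> w [] = 1"
| "lower_weight (Suc m) w \<longleftrightarrow> (\<exists>c b. (\<forall>v. norm (c v :: complex) \<le> 1) \<and> (\<forall>t. lower_weight m (b t)) \<and> (\<forall>t v. w (t # v) = c v * b t v))"

primrec lower_phase :: "nat \<Rightarrow> (int list \<Rightarrow> int) \<Rightarrow> bool" where
  "lower_phase 0 p \<longleftrightarrow> p [] = 0"
| "lower_phase (Suc m) p \<longleftrightarrow> (\<exists>\<psi> b. (\<forall>t. lower_phase m (b t)) \<and> (\<forall>t v. p (t # v) = \<psi> v + b t v))"

lemma lower_weight_mult_cnj: "lower_weight m w \<Longrightarrow> lower_weight m w' \<Longrightarrow> lower_weight m (\<lambda>v. w v * cnj (w' v))"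
proof (induction m arbitrary: w w')
  case (Suc m)
  obtain c b where 1: "\<And>v. norm (c v :: complex) \<le> 1" "\<And>t. lower_weight m (b t)" "\<And>t v. w (t # v) = c v * b t v"
    using Suc.prems(1) unfolding lower_weight.simps by blast
  obtain c' b' where 2: "\<And>v. norm (c' v :: complex) \<le> 1" "\<And>t. lower_weight m (b' t)" "\<And>t v. w' (t # v) = c' v * b' t v"
    using Suc.prems(2) unfolding lower_weight.simps by blast
  show ?case unfolding lower_weight.simps
    using 1 2 Suc.IH
    by (intro exI[of _ "\<lambda>v. c v * cnj (c' v)"] exI[of _ "\<lambda>t v. b t v * cnj (b' t v)"])
       (auto simp: norm_mult mult_le_one mult_ac)
qed simp

lemma lower_phase_chi: "lower_phase m p \<Longrightarrow> lower_weight m (\<lambda>v. chi M (p v) u)"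
proof (induction m arbitrary: p)
  case 0
  then show ?case by (simp add: chi_def)
next
  case (Suc m)
  obtain \<psi> b where "\<And>t. lower_phase m (b t)" "\<And>t v. p (t # v) = \<psi> v + b t v" using Suc.prems unfolding lower_phase.simps by blast
  then show ?case unfolding lower_weight.simps using Suc.IH
    by (intro exI[of _ "\<lambda>v. chi M (\<psi> v) u"] exI[of _ "\<lambda>t v. chi M (b t v) u"]) (simp add: chi_add)
qed

text \<open>With \<open>w\<close> fixed, every vertex of the cube except \<open>v\<close> itself
  takes some coordinate from \<open>w\<close> and so does not depend on the corresponding coordinate
  of \<open>v\<close>.\<close>

lemma alt_lower_phase: "lower_phase m (\<lambda>v. J v - alt J (take m v) w)"
proof (induction m arbitrary: J w)
  case (Suc m)
  show ?case unfolding lower_phase.simps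
    using Suc.IH[of "\<lambda>u. J (t # u) - J (hd w # u)" "tl w" for t]
    by (intro exI[of _ "\<lambda>v. J (hd w # v)"] exI[of _ "\<lambda>t v. J (t # v) - J (hd w # v) - alt (\<lambda>u. J (t # u) - J (hd w # u)) (take m v) (tl w)"]) auto
qed simp

text \<open>The factor \<open>c v\<close> of the weight does not involve the first step
  \<open>t\<close>, so Cauchy--Schwarz removes it and doubles \<open>t\<close>. The rest is a
  problem of one order less for the product of two translates of \<open>G\<close>, with weights of
  the same kind. In the base case the weight is a constant.\<close>

lemma weighted_differences_bound:
  assumes "lower_weight (Suc m) w" "per M G" "\<And>y. norm (G y) \<le> 1" "0 < M"
  shows "norm (vavg M (Suc m) (\<lambda>v. w v * zavg M (mder v G))) ^ (2 ^ m) \<le> vavg M m (\<lambda>v. (norm (zavg M (mder v G)))\<^sup>2)"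
  using assms(1-3)
proof (induction m arbitrary: w G)
  case 0
  then obtain c where c: "norm (c :: complex) \<le> 1" "\<And>t. w [t] = c" by fastforce
  have "vavg M (Suc 0) (\<lambda>v. w v * zavg M (mder v G)) = c * complex_of_real ((norm (zavg M G))\<^sup>2)"
    unfolding norm_zavg_square[OF 0(2) assms(4)] by (simp add: c avg_cmult)
  then have "norm (vavg M (Suc 0) (\<lambda>v. w v * zavg M (mder v G))) = norm c * (norm (zavg M G))\<^sup>2"
    by (simp only: norm_mult norm_of_real) simp
  also have "\<dots> \<le> (norm (zavg M G))\<^sup>2" using c(1) by (intro mult_left_le_one_le) auto
  finally show ?case by simp
next
  case (Suc m)
  obtain c b where w: "\<And>v. norm (c v :: complex) \<le> 1" "\<And>t. lower_weight (Suc m) (b t)" "\<And>t v. w (t # v) = c v * b t v"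
    using Suc.prems(1) unfolding lower_weight.simps by blast
  let ?V = "vecs M (Suc m)"
  define G' where "G' t t' y = G (y + t) * cnj (G (y + t'))" for t t' y
  define S where "S t t' = vavg M (Suc m) (\<lambda>v. (b t v * cnj (b t' v)) * zavg M (mder v (G' t t')))" for t t'
  define \<psi> where "\<psi> u = vavg M m (\<lambda>v. (norm (zavg M (mder v (G' u 0))))\<^sup>2)" for u
  have perG': "per M (G' t t')" and G'1: "norm (G' t t' y) \<le> 1" for t t' y
    unfolding G'_def using Suc.prems(2,3) by (auto intro!: per_mult per_shift per_cnj simp: norm_mult mult_le_one)
  have e1: "vavg M (Suc (Suc m)) (\<lambda>v. w v * zavg M (mder v G)) =
      zavg M (\<lambda>t. avg ?V (\<lambda>v. zavg M (\<lambda>y. (c v * cnj (mder v G y)) * (b t v * mder v G (y + t)))))"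
    unfolding vavg.simps(2)[of M "Suc m"] w(3) mder_Cons
    by (simp only: vavg_avg avg_cmult[symmetric] mult_ac)
  have e2: "zavg M (\<lambda>t. avg ?V (\<lambda>v. zavg M (\<lambda>y. (c v * cnj (mder v G y)) * (b t v * mder v G (y + t))))) = avg (?V \<times> {0..<M}) (\<lambda>p. (c (fst p) * cnj (mder (fst p) G (snd p))) * zavg M (\<lambda>t. b t (fst p) * mder (fst p) G (snd p + t)))"
  proof -
    have "zavg M (\<lambda>t. avg ?V (\<lambda>v. zavg M (\<lambda>y. X t v y))) = avg ?V (\<lambda>v. zavg M (\<lambda>y. zavg M (\<lambda>t. X t v y)))" for X :: "_ \<Rightarrow> _ \<Rightarrow> _ \<Rightarrow> complex"
      by (subst avg_swap, rule avg_cong[OF refl], rule avg_swap)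
    then show ?thesis by (simp only: avg_times fst_conv snd_conv avg_cmult)
  qed
  have "(norm (vavg M (Suc (Suc m)) (\<lambda>v. w v * zavg M (mder v G))))\<^sup>2 \<le> zavg M (\<lambda>t. zavg M (\<lambda>t'. norm (avg (?V \<times> {0..<M}) (\<lambda>p. (b t (fst p) * mder (fst p) G (snd p + t)) * cnj (b t' (fst p) * mder (fst p) G (snd p + t'))))))"
    unfolding e1 e2
    by (rule avg_vdc_norm, unfold norm_mult complex_mod_cnj) (intro mult_le_one w(1) mder_norm[OF Suc.prems(3)] norm_ge_zero)
  also have "\<dots> = zavg M (\<lambda>t. zavg M (\<lambda>t'. norm (S t t')))"
  proof -
    have "avg (?V \<times> {0..<M}) (\<lambda>p. (b t (fst p) * mder (fst p) G (snd p + t)) * cnj (b t' (fst p) * mder (fst p) G (snd p + t'))) = S t t'" for t t'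
    proof -
      have "avg (?V \<times> {0..<M}) (\<lambda>p. (b t (fst p) * mder (fst p) G (snd p + t)) * cnj (b t' (fst p) * mder (fst p) G (snd p + t'))) =
        avg ?V (\<lambda>v. zavg M (\<lambda>y. (b t v * mder v G (y + t)) * cnj (b t' v * mder v G (y + t'))))"
        by (simp only: avg_times fst_conv snd_conv)
      also have "\<dots> = S t t'"
        unfolding S_def vavg_avg avg_cmult[symmetric]
        by (intro avg_cong refl) (simp only: G'_def[abs_def] mder_prod_shift complex_cnj_mult mult_ac)
      finally show ?thesis .
    qed
    then show ?thesis by (simp only:)
  qed
  finally have 1: "(norm (vavg M (Suc (Suc m)) (\<lambda>v. w v * zavg M (mder v G))))\<^sup>2 \<le> zavg M (\<lambda>t. zavg M (\<lambda>t'. norm (S t t')))" .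
  have 2: "norm (S t t') ^ 2 ^ m \<le> \<psi> (t - t')" for t t'
  proof -
    have "norm (S t t') ^ 2 ^ m \<le> vavg M m (\<lambda>v. (norm (zavg M (mder v (G' t t'))))\<^sup>2)"
      unfolding S_def using w(2) perG' G'1 by (intro Suc.IH lower_weight_mult_cnj) auto
    also have "\<dots> = \<psi> (t - t')"
      unfolding \<psi>_def
    proof (rule vavg_cong)
      fix v
      \<comment> \<open>Up to a translation of \<open>y\<close> the product depends only on
        \<open>t - t'\<close>; the double average over \<open>t\<close> and \<open>t'\<close> thus
        collapses to a single differencing step.\<close>
      have e: "G' t t' = (\<lambda>y. G' (t - t') 0 (y + t'))" by (auto simp: G'_def algebra_simps)
      have "zavg M (mder v (G' t t')) = zavg M (\<lambda>y. mder v (G' (t - t') 0) (y + t'))"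
        unfolding e by (rule arg_cong[OF mder_shift])
      also have "\<dots> = zavg M (mder v (G' (t - t') 0))" using perG' assms(4) by (intro avg_shift mder_per)
      finally show "(norm (zavg M (mder v (G' t t'))))\<^sup>2 = (norm (zavg M (mder v (G' (t - t') 0))))\<^sup>2" by simp
    qed
    finally show ?thesis .
  qed
  have per\<psi>: "per M \<psi>"
    unfolding per_def
  proof
    fix u
    have "G' (u + M) 0 = G' u 0" using Suc.prems(2) by (auto simp: G'_def add.assoc[symmetric] perD)
    then show "\<psi> (u + M) = \<psi> u" by (simp add: \<psi>_def)
  qed
  have "norm (vavg M (Suc (Suc m)) (\<lambda>v. w v * zavg M (mder v G))) ^ 2 ^ Suc m = ((norm (vavg M (Suc (Suc m)) (\<lambda>v. w v * zavg M (mder v G))))\<^sup>2) ^ 2 ^ m"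
    by (simp add: power_mult[symmetric])
  also have "\<dots> \<le> (zavg M (\<lambda>t. zavg M (\<lambda>t'. norm (S t t')))) ^ 2 ^ m"
    using 1 by (intro power_mono) auto
  also have "\<dots> \<le> zavg M (\<lambda>t. (zavg M (\<lambda>t'. norm (S t t'))) ^ 2 ^ m)" by (intro avg_power_le avg_nonneg) auto
  also have "\<dots> \<le> zavg M (\<lambda>t. zavg M (\<lambda>t'. norm (S t t') ^ 2 ^ m))" by (intro avg_mono avg_power_le) auto
  also have "\<dots> \<le> zavg M (\<lambda>t. zavg M (\<lambda>t'. \<psi> (t - t')))" by (intro avg_mono 2)
  also have "\<dots> = zavg M (\<lambda>t'. zavg M (\<lambda>t. \<psi> (t + (- t'))))" by (subst avg_swap) simp
  also have "\<dots> = zavg M \<psi>" using assms(4) unfolding avg_shift[OF per\<psi> assms(4)] by simp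
  also have "\<dots> = vavg M (Suc m) (\<lambda>v. (norm (zavg M (mder v G)))\<^sup>2)"
    by (simp add: \<psi>_def[abs_def] G'_def[abs_def])
  finally show ?case .
qed

text \<open>Expanding the square over shifts \<open>u\<close> turns the twist into a factor
  \<open>chi M (p v) u\<close>, constant in \<open>y\<close> and a removable weight in
  \<open>v\<close>. The fixed frequency \<gamma> contributes only a unimodular factor depending on
  \<open>u\<close>, hence nothing after absolute values.\<close>

lemma twisted_differences_bound:
  assumes p: "lower_phase (Suc m) p" and F: "per M F" "\<And>y. norm (F y) \<le> 1" and M: "0 < M"
  shows "(vavg M (Suc m) (\<lambda>v. (norm (zavg M (\<lambda>y. mder v F y * chi M (p v + \<gamma>) y)))\<^sup>2)) ^ (2 ^ m) \<le>
    vavg M (Suc m) (\<lambda>v. (norm (zavg M (mder v F)))\<^sup>2)" (is "?L ^ _ \<le> ?R")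
proof -
  define B where "B u = vavg M (Suc m) (\<lambda>v. chi M (p v) u * zavg M (mder v (\<lambda>y. F (y + u) * cnj (F y))))" for u
  have "complex_of_real ?L = vavg M (Suc m) (\<lambda>v. zavg M (\<lambda>u. chi M \<gamma> u * (chi M (p v) u * zavg M (mder v (\<lambda>y. F (y + u) * cnj (F y))))))"
    unfolding of_real_vavg
  proof (rule vavg_cong)
    fix v
    have "per M (\<lambda>y. mder v F y * chi M (p v + \<gamma>) y)" using F per_chi[OF M] by (intro per_mult mder_per) auto
    from norm_zavg_square[OF this M]
    have "complex_of_real ((norm (zavg M (\<lambda>y. mder v F y * chi M (p v + \<gamma>) y)))\<^sup>2) =
      zavg M (\<lambda>u. zavg M (\<lambda>y. (mder v F (y + u) * cnj (mder v F y)) * (chi M (p v + \<gamma>) (y + u) * cnj (chi M (p v + \<gamma>) y))))"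
      by (simp add: mult_ac)
    also have "\<dots> = zavg M (\<lambda>u. chi M \<gamma> u * (chi M (p v) u * zavg M (mder v (\<lambda>y. F (y + u) * cnj (F y)))))"
      unfolding chi_diff_right avg_cmult[symmetric] mder_prod_diff by (simp add: chi_add mult_ac)
    finally show "complex_of_real ((norm (zavg M (\<lambda>y. mder v F y * chi M (p v + \<gamma>) y)))\<^sup>2) =
      zavg M (\<lambda>u. chi M \<gamma> u * (chi M (p v) u * zavg M (mder v (\<lambda>y. F (y + u) * cnj (F y)))))" .
  qed
  also have "\<dots> = zavg M (\<lambda>u. chi M \<gamma> u * B u)"
    unfolding B_def by (simp only: avg_vavg_swap[symmetric] vavg_cmult)
  finally have "norm (complex_of_real ?L) = norm (zavg M (\<lambda>u. chi M \<gamma> u * B u))" by (rule arg_cong)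
  moreover have "0 \<le> ?L" by (rule vavg_nonneg) simp
  ultimately have "?L = norm (zavg M (\<lambda>u. chi M \<gamma> u * B u))" by (simp only: norm_of_real abs_of_nonneg)
  also have "\<dots> \<le> zavg M (\<lambda>u. norm (B u))" by (rule order_trans[OF norm_avg]) (simp add: norm_mult)
  finally have "?L ^ 2 ^ m \<le> (zavg M (\<lambda>u. norm (B u))) ^ 2 ^ m"
    by (intro power_mono vavg_nonneg) auto
  also have "\<dots> \<le> zavg M (\<lambda>u. norm (B u) ^ 2 ^ m)" by (rule avg_power_le) simp
  also have "\<dots> \<le> zavg M (\<lambda>u. vavg M m (\<lambda>v. (norm (zavg M (mder v (\<lambda>y. F (y + u) * cnj (F y)))))\<^sup>2))"
    unfolding B_def using F M lower_phase_chi[OF p]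
    by (intro avg_mono weighted_differences_bound) (auto intro!: per_mult per_shift per_cnj simp: norm_mult mult_le_one)
  also have "\<dots> = ?R" by simp
  finally show ?thesis .
qed

section \<open>Counting frequencies on major arcs\<close>

lemma card_small_multiples:
  assumes M: "0 < M" and q: "0 < q" and \<tau>: "0 \<le> \<tau>"
  shows "real (card {j \<in> {0..<M}. torus_norm (real q * (of_int j / of_int M)) \<le> \<tau>}) \<le> (real q + 1) * (2 * \<tau> * of_int M / q + 1)"
proof -
  let ?S = "{j \<in> {0..<M}. torus_norm (real q * (of_int j / of_int M)) \<le> \<tau>}"
  let ?I = "\<lambda>k. {\<lceil>(of_int k - \<tau>) * of_int M / q\<rceil>..\<lfloor>(of_int k + \<tau>) * of_int M / q\<rfloor>}"
  have cI: "real (card (?I k)) \<le> 2 * \<tau> * of_int M / q + 1" for k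
  proof -
    have e: "(of_int k + \<tau>) * of_int M / q - (of_int k - \<tau>) * of_int M / q = 2 * \<tau> * of_int M / q"
      by (simp add: diff_divide_distrib[symmetric] algebra_simps)
    have "0 \<le> 2 * \<tau> * of_int M / q" using M \<tau> by simp
    then show ?thesis using e by (simp add: of_nat_nat) linarith
  qed
  have "?S \<subseteq> (\<Union>k\<in>{0..int q}. ?I k)"
  proof
    fix j assume j: "j \<in> ?S"
    define x where "x = real q * (of_int j / of_int M)"
    have x: "0 \<le> x" "x \<le> q" using j M q by (auto simp: x_def field_simps intro!: mult_left_mono)
    have jx: "of_int j = x * of_int M / q" using M q by (simp add: x_def)
    have d: "\<bar>x - of_int (round x)\<bar> \<le> \<tau>" using j by (simp add: x_def torus_norm_def)
    have "0 \<le> round x" "round x \<le> int q" using x round_mono[of 0 x] round_mono[of x "real q"] by simp_all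
    moreover have "(of_int (round x) - \<tau>) * of_int M / q \<le> of_int j" "of_int j \<le> (of_int (round x) + \<tau>) * of_int M / q"
      unfolding jx using d M q by (auto intro!: divide_right_mono mult_right_mono)
    ultimately show "j \<in> (\<Union>k\<in>{0..int q}. ?I k)" by (auto simp: ceiling_le_iff le_floor_iff intro!: bexI[of _ "round x"])
  qed
  then have "card ?S \<le> card (\<Union>k\<in>{0..int q}. ?I k)" by (intro card_mono) auto
  also have "\<dots> \<le> (\<Sum>k\<in>{0..int q}. card (?I k))" by (intro card_UN_le) auto
  finally have "real (card ?S) \<le> (\<Sum>k\<in>{0..int q}. real (card (?I k)))" by (simp only: of_nat_sum[symmetric] of_nat_le_iff)
  also have "\<dots> \<le> real (card {0..int q}) * (2 * \<tau> * of_int M / q + 1)" using cI by (intro sum_bounded_above) auto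
  finally show ?thesis by simp
qed

text \<open>The modulus is proportional to \<open>N^2\<close>, the reciprocal of the width of the
  arcs, so each denominator contributes a number of frequencies that is bounded independently of
  \<open>N\<close>.\<close>

lemma card_major:
  assumes N: "0 < N" and \<epsilon>: "0 < \<epsilon>" "\<epsilon> \<le> 1"
  shows "real (card {j \<in> {0..<modulus N}. major N \<epsilon> (of_int j / of_int (modulus N))}) \<le> 10 / \<epsilon>^2"
proof -
  let ?M = "modulus N"
  let ?S = "\<lambda>q::nat. {j \<in> {0..<?M}. torus_norm (real q * (of_int j / of_int ?M)) \<le> 1 / (\<epsilon> * real N^2)}"
  let ?Q = "nat \<lfloor>1 / \<epsilon>\<rfloor>"
  have M: "0 < ?M" using N by (rule modulus_pos)
  have cS: "real (card (?S q)) \<le> 10 / \<epsilon>" if "q \<in> {1..?Q}" for q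
  proof -
    have q: "1 \<le> real q" "real q \<le> 1 / \<epsilon>" using that \<epsilon> by (auto simp: le_nat_iff le_floor_iff)
    have "real (card (?S q)) \<le> (real q + 1) * (2 * (1 / (\<epsilon> * real N^2)) * of_int ?M / q + 1)"
      using that \<epsilon> by (intro card_small_multiples M) auto
    also have "2 * (1 / (\<epsilon> * real N^2)) * of_int ?M = 4 / \<epsilon>" using N \<epsilon> by (simp add: modulus_def)
    also have "(real q + 1) * (4 / \<epsilon> / q + 1) \<le> (2 * real q) * (4 / \<epsilon> / q + 1)" using q \<epsilon> by (intro mult_right_mono) auto
    also have "\<dots> = 8 / \<epsilon> + 2 * q" using q \<epsilon> by (simp add: field_simps)
    also have "\<dots> \<le> 10 / \<epsilon>" using q \<epsilon> by (simp add: field_simps)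
    finally show ?thesis .
  qed
  have "{j \<in> {0..<?M}. major N \<epsilon> (of_int j / of_int ?M)} \<subseteq> (\<Union>q\<in>{1..?Q}. ?S q)"
  proof
    fix j assume "j \<in> {j \<in> {0..<?M}. major N \<epsilon> (of_int j / of_int ?M)}"
    then obtain q :: nat where q: "0 < q" "real q \<le> 1 / \<epsilon>" "j \<in> ?S q" unfolding major_def by auto
    have "q \<in> {1..?Q}" using q by (auto simp: le_nat_floor)
    then show "j \<in> (\<Union>q\<in>{1..?Q}. ?S q)" using q(3) by blast
  qed
  then have "card {j \<in> {0..<?M}. major N \<epsilon> (of_int j / of_int ?M)} \<le> card (\<Union>q\<in>{1..?Q}. ?S q)"
    by (intro card_mono finite_UN_I finite_atLeastAtMost) (auto intro: finite_subset[of _ "{0..<?M}"])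
  also have "\<dots> \<le> (\<Sum>q\<in>{1..?Q}. card (?S q))" by (intro card_UN_le) auto
  finally have "real (card {j \<in> {0..<?M}. major N \<epsilon> (of_int j / of_int ?M)}) \<le> (\<Sum>q\<in>{1..?Q}. real (card (?S q)))"
    by (simp only: of_nat_sum[symmetric] of_nat_le_iff)
  also have "\<dots> \<le> real (card {1..?Q}) * (10 / \<epsilon>)" using cS by (intro sum_bounded_above) auto
  also have "\<dots> \<le> (1 / \<epsilon>) * (10 / \<epsilon>)" using \<epsilon> by (intro mult_right_mono) auto
  finally show ?thesis by (simp add: power2_eq_square)
qed

lemma major_mod:
  assumes "0 < M"
  shows "major N \<epsilon> (of_int (j mod M) / of_int M) = major N \<epsilon> (of_int j / of_int M)"
proof -
  have "torus_norm (real q * (of_int (j mod M) / of_int M)) = torus_norm (real q * (of_int j / of_int M))" for q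
  proof (rule torus_norm_cong[where m = "- int q * (j div M)"])
    have "real_of_int j = of_int (j div M) * of_int M + of_int (j mod M)"
      by (simp only: of_int_mult[symmetric] of_int_add[symmetric] div_mult_mod_eq)
    then show "real q * (of_int (j mod M) / of_int M) - real q * (of_int j / of_int M) = of_int (- int q * (j div M))"
      using assms by (simp add: field_simps)
  qed
  then show ?thesis by (simp add: major_def)
qed

subsection \<open>Degree lowering\<close>

definition correlation :: "nat \<Rightarrow> nat \<Rightarrow> (int \<Rightarrow> int \<Rightarrow> complex) \<Rightarrow> (int \<Rightarrow> int list \<Rightarrow> int) \<Rightarrow> real" where
  "correlation N m F J = avg {1..int N} (\<lambda>x. vavg (modulus N) m (\<lambda>v.
     norm (zavg (modulus N) (\<lambda>y. mder v (F x) y * chi (modulus N) (J x v) y))))"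

text \<open>The first of the \<open>m + 1\<close> steps is singled out; for the others fixed, the
  average over it is that of a squared autocorrelation, and a single Fourier coefficient bounds
  it.\<close>

lemma differences_le_correlation:
  assumes F: "per M F" "\<And>y. norm (F y) \<le> 1" and M: "0 < M"
  obtains J where "vavg M (Suc m) (\<lambda>v. (norm (zavg M (mder v F)))\<^sup>2) \<le>
    vavg M m (\<lambda>v. norm (zavg M (\<lambda>y. mder v F y * chi M (J v) y)))"
proof -
  have "\<exists>j. zavg M (\<lambda>t. (norm (zavg M (\<lambda>y. mder v F (y + t) * cnj (mder v F y))))\<^sup>2) \<le> norm (zavg M (\<lambda>y. mder v F y * chi M j y))" for v
  proof -
    obtain j where j: "zavg M (\<lambda>t. (norm (zavg M (\<lambda>y. mder v F (y + t) * cnj (mder v F y))))\<^sup>2) \<le> (norm (zavg M (\<lambda>y. mder v F y * chi M j y)))\<^sup>2"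
      using autocorrelation_le_fourier[OF mder_per[OF F(1)] mder_norm[OF F(2)] M] .
    have "norm (zavg M (\<lambda>y. mder v F y * chi M j y)) \<le> 1"
      using mder_norm[OF F(2)] by (intro norm_avg_le) (simp_all add: norm_mult)
    then have "(norm (zavg M (\<lambda>y. mder v F y * chi M j y)))\<^sup>2 \<le> norm (zavg M (\<lambda>y. mder v F y * chi M j y))"
      by (simp add: power2_eq_square mult_left_le)
    with j show ?thesis by (intro exI[of _ j]) linarith
  qed
  then have "\<forall>v. \<exists>j. zavg M (\<lambda>t. (norm (zavg M (\<lambda>y. mder v F (y + t) * cnj (mder v F y))))\<^sup>2) \<le> norm (zavg M (\<lambda>y. mder v F y * chi M j y))" ..
  from choice[OF this] obtain J where "\<forall>v. zavg M (\<lambda>t. (norm (zavg M (\<lambda>y. mder v F (y + t) * cnj (mder v F y))))\<^sup>2) \<le> norm (zavg M (\<lambda>y. mder v F y * chi M (J v) y))" ..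
  note J = this[rule_format]
  have "vavg M (Suc m) (\<lambda>v. (norm (zavg M (mder v F)))\<^sup>2) = vavg M m (\<lambda>v. zavg M (\<lambda>t. (norm (zavg M (mder (t # v) F)))\<^sup>2))"
    unfolding vavg.simps by (rule avg_vavg_swap)
  also have "\<dots> = vavg M m (\<lambda>v. zavg M (\<lambda>t. (norm (zavg M (\<lambda>y. mder v F (y + t) * cnj (mder v F y))))\<^sup>2))"
    unfolding mder_Cons[abs_def] ..
  also have "\<dots> \<le> vavg M m (\<lambda>v. norm (zavg M (\<lambda>y. mder v F y * chi M (J v) y)))"
    by (intro vavg_mono J)
  finally show thesis using that by blast
qed

text \<open>For a suitable \<open>w\<close> the frequency \<open>J x v\<close> is a \<open>lower_phase\<close> plus \<open>alt (J x) v w\<close>, which often is one of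
  boundedly many major frequencies.\<close>
lemma degree_lowering_step:
  assumes alt: "alt_bound (Suc m) \<epsilon>0" and \<epsilon>0: "polylow \<epsilon>0" "\<And>\<delta>. 0 < \<delta> \<Longrightarrow> \<delta> \<le> 1 \<Longrightarrow> \<epsilon>0 \<delta> \<le> 1"
    and \<eta>: "0 < \<eta>" "\<eta> \<le> 1" and N: "1 \<le> real N * ((\<eta>^2 / 4) * \<epsilon>0 (\<eta> / 2) * (\<epsilon>0 (\<eta> / 2))^2 / 10) ^ (2 ^ m)"
    and f: "bddper (modulus N) f0" "bddper (modulus N) f1"
    and large: "\<eta> \<le> correlation N (Suc m) (dual N f0 f1) J"
  obtains J' where "((\<eta>^2 / 4) * \<epsilon>0 (\<eta> / 2) * (\<epsilon>0 (\<eta> / 2))^2 / 10) ^ (2 ^ m) \<le> correlation N m (dual N f0 f1) J'"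
proof -
  define M where "M = modulus N"
  define F where "F = dual N f0 f1"
  define \<epsilon> where "\<epsilon> = \<epsilon>0 (\<eta> / 2)"
  let ?X = "{1..int N}"
  have \<epsilon>: "0 < \<epsilon>" "\<epsilon> \<le> 1" using \<epsilon>0 \<eta> polylow_pos[OF \<epsilon>0(1), of "\<eta> / 2"] by (auto simp: \<epsilon>_def)
  have N0: "0 < N" using N by (cases "N = 0") auto
  have M: "0 < M" using N0 modulus_pos by (simp add: M_def)
  have X: "finite ?X" "?X \<noteq> {}" using N0 by auto
  have F: "\<And>x. per M (F x)" "\<And>x y. norm (F x y) \<le> 1"
    using dual_bddper[OF f] by (auto simp: F_def M_def bddper_def)
  \<comment> \<open>The losses: \<eta>^2 / 4 from correlations of size \<eta> / 2, one factor
    \<epsilon> for the proportion of good parameters, and \<epsilon>^2 / 10 for choosing one of the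
    major frequencies. The later power \<open>2 ^ m\<close> is that of
    \<open>twisted_differences_bound\<close>.\<close>
  define b where "b = (\<eta>^2 / 4) * \<epsilon> * \<epsilon>^2 / 10"
  have \<eta>4: "0 \<le> \<eta>^2 / 4" "\<eta>^2 / 4 \<le> 1" using \<eta> power_le_one[of \<eta> 2] by auto
  have b: "0 \<le> b" "b \<le> \<epsilon>"
  proof -
    show "0 \<le> b" using \<epsilon> by (simp add: b_def)
    have "(\<eta>^2 / 4) * \<epsilon> * (\<epsilon>^2 / 10) \<le> 1 * \<epsilon> * 1"
      using \<eta>4 \<epsilon> power_le_one[of \<epsilon> 2] by (intro mult_mono) auto
    then show "b \<le> \<epsilon>" by (simp add: b_def)
  qed
  have N\<epsilon>: "1 \<le> real N * \<epsilon>0 (\<eta> / 2)"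
  proof -
    have "b ^ 2 ^ m \<le> b ^ 1" using b \<epsilon> by (intro power_decreasing) auto
    then have "real N * b ^ 2 ^ m \<le> real N * \<epsilon>" using b by (intro mult_left_mono) auto
    then show ?thesis using N by (simp add: b_def \<epsilon>_def)
  qed
  define Z where "Z x v = zavg M (\<lambda>y. mder v (F x) y * chi M (J x v) y)" for x v
  define g where "g x v = (of_bool (\<eta> / 2 \<le> norm (Z x v)) :: real)" for x v
  define c where "c x v = of_real (g x v) * cnj (sgn (Z x v))" for x v
  have c1: "norm (c x v) \<le> 1" for x v unfolding c_def norm_mult by (simp add: g_def norm_sgn)
  have "correlation N (Suc m) F J = avg ?X (\<lambda>x. vavg M (Suc m) (\<lambda>v. norm (Z x v)))"
    unfolding correlation_def Z_def M_def ..
  also have "\<dots> \<le> avg ?X (\<lambda>x. vavg M (Suc m) (\<lambda>v. g x v * norm (Z x v) + \<eta> / 2))"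
  proof (intro avg_mono vavg_mono)
    show "norm (Z x v) \<le> g x v * norm (Z x v) + \<eta> / 2" for x v using \<eta> by (simp add: g_def)
  qed
  finally have "\<eta> \<le> avg ?X (\<lambda>x. vavg M (Suc m) (\<lambda>v. g x v * norm (Z x v) + \<eta> / 2))"
    using large unfolding F_def by linarith
  also have "\<dots> = avg ?X (\<lambda>x. vavg M (Suc m) (\<lambda>v. g x v * norm (Z x v))) + \<eta> / 2"
    unfolding vavg_add avg_add vavg_const[OF M] avg_const[OF X] ..
  also have "avg ?X (\<lambda>x. vavg M (Suc m) (\<lambda>v. g x v * norm (Z x v))) \<le> norm (avg ?X (\<lambda>x. vavg M (Suc m) (\<lambda>v. c x v * Z x v)))"
  proof -
    have "c x v * Z x v = of_real (g x v * norm (Z x v))" for x v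
      unfolding c_def mult.assoc cnj_sgn_mult by simp
    then have "avg ?X (\<lambda>x. vavg M (Suc m) (\<lambda>v. c x v * Z x v)) = of_real (avg ?X (\<lambda>x. vavg M (Suc m) (\<lambda>v. g x v * norm (Z x v))))"
      unfolding of_real_avg of_real_vavg by (simp only:)
    then show ?thesis by (simp only: norm_of_real abs_ge_self)
  qed
  finally have cZ: "\<eta> / 2 \<le> norm (avg ?X (\<lambda>x. vavg M (Suc m) (\<lambda>v. c x v * Z x v)))" by simp
  define r where "r x v w = (of_bool (c x v \<noteq> 0 \<and> major N \<epsilon> (of_int (alt (J x) v w) / of_int M)) :: real)" for x v w
  have r: "\<epsilon> \<le> avg ?X (\<lambda>x. vavg M (Suc m) (\<lambda>v. vavg M (Suc m) (r x v)))"
    using alt[unfolded alt_bound_def, rule_format, of "\<eta> / 2" N f0 f1 c J] \<eta> N\<epsilon> f c1 cZ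
    unfolding r_def \<epsilon>_def[symmetric] M_def Z_def F_def by simp
  define A where "A x = vavg M (Suc m) (\<lambda>w. vavg M (Suc m) (\<lambda>v. r x v w))" for x
  have A: "\<epsilon> \<le> avg ?X A" "\<And>x. 0 \<le> A x"
  proof -
    have "avg ?X A = avg ?X (\<lambda>x. vavg M (Suc m) (\<lambda>v. vavg M (Suc m) (r x v)))"
      unfolding A_def by (rule avg_cong[OF refl], rule vavg_swap)
    then show "\<epsilon> \<le> avg ?X A" using r by simp
    show "0 \<le> A x" for x unfolding A_def by (intro vavg_nonneg) (simp add: r_def)
  qed
  define U where "U x = vavg M (Suc m) (\<lambda>v. (norm (zavg M (mder v (F x))))\<^sup>2)" for x
  define \<Gamma> where "\<Gamma> = {j \<in> {0..<M}. major N \<epsilon> (of_int j / of_int M)}"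
  have fin\<Gamma>: "finite \<Gamma>" by (rule finite_subset[of _ "{0..<M}"]) (auto simp: \<Gamma>_def)
  have card\<Gamma>: "real (card \<Gamma>) \<le> 10 / \<epsilon>^2" unfolding \<Gamma>_def M_def by (rule card_major[OF N0 \<epsilon>])
  have main: "(\<eta>^2 / 4 * A x * \<epsilon>^2 / 10) ^ (2 ^ m) \<le> U x" for x
  proof -
    \<comment> \<open>For each \<open>x\<close> one corner \<open>w\<close> is fixed at which the
      average over \<open>v\<close> is at least the average over both.\<close>
    obtain w where w: "length w = Suc m" "A x \<le> vavg M (Suc m) (\<lambda>v. r x v w)"
      using vavg_ge_ex[of "A x" M "Suc m" "\<lambda>w. vavg M (Suc m) (\<lambda>v. r x v w)"] M unfolding A_def by blast
    define p where "p v = J x v - alt (J x) (take (Suc m) v) w" for v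
    have p: "lower_phase (Suc m) p" unfolding p_def by (rule alt_lower_phase)
    define s where "s \<gamma> = vavg M (Suc m) (\<lambda>v. (norm (zavg M (\<lambda>y. mder v (F x) y * chi M (p v + \<gamma>) y)))\<^sup>2)" for \<gamma>
    have s0: "0 \<le> s \<gamma>" for \<gamma> unfolding s_def by (rule vavg_nonneg) simp
    have s: "s \<gamma> ^ (2 ^ m) \<le> U x" for \<gamma>
      unfolding s_def U_def by (rule twisted_differences_bound[OF p F M])
    have "\<eta>^2 / 4 * A x \<le> vavg M (Suc m) (\<lambda>v. \<eta>^2 / 4 * r x v w)"
      unfolding vavg_cmult using w(2) by (intro mult_left_mono) auto
    also have "\<dots> \<le> vavg M (Suc m) (\<lambda>v. \<Sum>\<gamma>\<in>\<Gamma>. (norm (zavg M (\<lambda>y. mder v (F x) y * chi M (p v + \<gamma>) y)))\<^sup>2)"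
    proof (rule vavg_mono)
      fix v :: "int list" assume v: "length v = Suc m"
      show "\<eta>^2 / 4 * r x v w \<le> (\<Sum>\<gamma>\<in>\<Gamma>. (norm (zavg M (\<lambda>y. mder v (F x) y * chi M (p v + \<gamma>) y)))\<^sup>2)"
      proof (cases "c x v \<noteq> 0 \<and> major N \<epsilon> (of_int (alt (J x) v w) / of_int M)")
        case True
        define \<gamma> where "\<gamma> = alt (J x) v w mod M"
        have "\<gamma> \<in> \<Gamma>" using True M by (simp add: \<Gamma>_def \<gamma>_def major_mod)
        \<comment> \<open>The original frequency is the lower phase plus the alternating sum;
          replacing the latter by its residue does not change the character.\<close>
        have "chi M (p v + \<gamma>) y = chi M (J x v) y" for y
          unfolding chi_add \<gamma>_def chi_mod[OF M] p_def chi_diff using v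
          by (simp add: mult.assoc complex_norm_square[symmetric] mult.commute[of "cnj _"] del: of_real_power)
        then have "norm (zavg M (\<lambda>y. mder v (F x) y * chi M (p v + \<gamma>) y)) = norm (Z x v)" by (simp add: Z_def)
        moreover have "\<eta> / 2 \<le> norm (Z x v)" using True by (auto simp: c_def g_def)
        then have "(\<eta> / 2)\<^sup>2 \<le> (norm (Z x v))\<^sup>2" using \<eta> by (intro power_mono) auto
        ultimately have "\<eta>^2 / 4 \<le> (norm (zavg M (\<lambda>y. mder v (F x) y * chi M (p v + \<gamma>) y)))\<^sup>2" by (simp add: power_divide)
        also have "\<dots> \<le> (\<Sum>\<gamma>\<in>\<Gamma>. (norm (zavg M (\<lambda>y. mder v (F x) y * chi M (p v + \<gamma>) y)))\<^sup>2)"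
          using \<open>\<gamma> \<in> \<Gamma>\<close> fin\<Gamma> by (intro member_le_sum) auto
        finally show ?thesis using True by (simp add: r_def sum_nonneg)
      next
        case False
        then have "r x v w = 0" by (auto simp: r_def)
        then show ?thesis by (simp add: sum_nonneg)
      qed
    qed
    also have "\<dots> = (\<Sum>\<gamma>\<in>\<Gamma>. s \<gamma>)"
      unfolding s_def using fin\<Gamma> by (induction \<Gamma> rule: finite_induct) (simp_all add: vavg_add vavg_const[OF M] del: vavg.simps)
    finally have sum: "\<eta>^2 / 4 * A x \<le> (\<Sum>\<gamma>\<in>\<Gamma>. s \<gamma>)" .
    have "\<exists>y\<ge>\<eta>^2 / 4 * A x * \<epsilon>^2 / 10. y ^ (2 ^ m) \<le> U x"
    proof (cases "\<Gamma> = {}")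
      case True
      then have "\<eta>^2 / 4 * A x = 0" using sum A(2)[of x] by (intro antisym) auto
      moreover have "0 \<le> U x" unfolding U_def by (rule vavg_nonneg) simp
      ultimately show ?thesis by (intro exI[of _ 0]) (auto simp: power_0_left)
    next
      case False
      have "\<exists>\<gamma>\<in>\<Gamma>. s \<gamma> \<ge> \<eta>^2 / 4 * A x * \<epsilon>^2 / 10"
      proof (rule ccontr)
        assume "\<not> ?thesis"
        then have "(\<Sum>\<gamma>\<in>\<Gamma>. s \<gamma>) < (\<Sum>\<gamma>\<in>\<Gamma>. \<eta>^2 / 4 * A x * \<epsilon>^2 / 10)"
          using False fin\<Gamma> by (intro sum_strict_mono) (auto simp: not_le)
        also have "\<dots> = card \<Gamma> * (\<eta>^2 / 4 * A x * \<epsilon>^2 / 10)" by simp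
        also have "\<dots> \<le> (10 / \<epsilon>^2) * (\<eta>^2 / 4 * A x * \<epsilon>^2 / 10)"
          using card\<Gamma> A(2)[of x] by (intro mult_right_mono) auto
        also have "\<dots> = \<eta>^2 / 4 * A x" using \<epsilon> by simp
        finally show False using sum by simp
      qed
      then show ?thesis using s by blast
    qed
    then obtain y where y: "\<eta>^2 / 4 * A x * \<epsilon>^2 / 10 \<le> y" "y ^ (2 ^ m) \<le> U x" by blast
    have "(\<eta>^2 / 4 * A x * \<epsilon>^2 / 10) ^ (2 ^ m) \<le> y ^ (2 ^ m)" using y(1) A(2)[of x] by (intro power_mono) auto
    then show ?thesis using y(2) by linarith
  qed
  have "b \<le> avg ?X (\<lambda>x. \<eta>^2 / 4 * A x * \<epsilon>^2 / 10)"
  proof -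
    have "b = (\<eta>^2 / 4 * \<epsilon>^2 / 10) * \<epsilon>" by (simp add: b_def)
    also have "\<dots> \<le> (\<eta>^2 / 4 * \<epsilon>^2 / 10) * avg ?X A" using A(1) by (intro mult_left_mono) auto
    also have "\<dots> = avg ?X (\<lambda>x. \<eta>^2 / 4 * A x * \<epsilon>^2 / 10)" unfolding avg_cmult[symmetric] by (simp add: mult_ac)
    finally show ?thesis .
  qed
  then have "b ^ (2 ^ m) \<le> (avg ?X (\<lambda>x. \<eta>^2 / 4 * A x * \<epsilon>^2 / 10)) ^ (2 ^ m)" using b by (intro power_mono) auto
  also have "\<dots> \<le> avg ?X (\<lambda>x. (\<eta>^2 / 4 * A x * \<epsilon>^2 / 10) ^ (2 ^ m))" using A(2) by (intro avg_power_le) auto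
  also have "\<dots> \<le> avg ?X U" by (intro avg_mono main)
  finally have bU: "b ^ (2 ^ m) \<le> avg ?X U" .
  have "\<exists>J. U x \<le> vavg M m (\<lambda>v. norm (zavg M (\<lambda>y. mder v (F x) y * chi M (J v) y)))" for x
    unfolding U_def by (rule differences_le_correlation[OF F M]) blast
  then have "\<forall>x. \<exists>J. U x \<le> vavg M m (\<lambda>v. norm (zavg M (\<lambda>y. mder v (F x) y * chi M (J v) y)))" ..
  from choice[OF this] obtain J' where "\<forall>x. U x \<le> vavg M m (\<lambda>v. norm (zavg M (\<lambda>y. mder v (F x) y * chi M (J' x v) y)))" ..
  note J' = this[rule_format]
  have "b ^ (2 ^ m) \<le> correlation N m F J'"
    unfolding correlation_def M_def[symmetric] by (rule order_trans[OF bU]) (intro avg_mono J')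
  then show thesis using that unfolding b_def \<epsilon>_def F_def by blast
qed

text \<open>The steps are iterated by composing their loss functions. The bound
  \<open>\<epsilon> \<delta> \<le> \<delta>\<close> guarantees that a threshold for \<open>N\<close>
  stated for the final loss also covers the intermediate ones.\<close>

lemma degree_lowering:
  "\<exists>\<epsilon>. polylow \<epsilon> \<and> (\<forall>\<delta>. 0 < \<delta> \<longrightarrow> \<delta> \<le> 1 \<longrightarrow> \<epsilon> \<delta> \<le> \<delta>) \<and>
    (\<forall>\<eta> N f0 f1 J. 0 < \<eta> \<longrightarrow> \<eta> \<le> 1 \<longrightarrow> 1 \<le> real N * \<epsilon> \<eta> \<longrightarrow> bddper (modulus N) f0 \<longrightarrow> bddper (modulus N) f1 \<longrightarrow>
      \<eta> \<le> correlation N m (dual N f0 f1) J \<longrightarrow> (\<exists>J'. \<epsilon> \<eta> \<le> correlation N 0 (dual N f0 f1) J'))"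
proof (induction m)
  case 0
  show ?case by (intro exI[of _ "\<lambda>\<delta>. \<delta>"]) (auto simp: polylow_id)
next
  case (Suc m)
  then obtain \<epsilon> where \<epsilon>: "polylow \<epsilon>" "\<And>\<delta>. 0 < \<delta> \<Longrightarrow> \<delta> \<le> 1 \<Longrightarrow> \<epsilon> \<delta> \<le> \<delta>"
    "\<And>\<eta> N f0 f1 J. 0 < \<eta> \<Longrightarrow> \<eta> \<le> 1 \<Longrightarrow> 1 \<le> real N * \<epsilon> \<eta> \<Longrightarrow> bddper (modulus N) f0 \<Longrightarrow> bddper (modulus N) f1 \<Longrightarrow>
      \<eta> \<le> correlation N m (dual N f0 f1) J \<Longrightarrow> \<exists>J'. \<epsilon> \<eta> \<le> correlation N 0 (dual N f0 f1) J'" by blast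
  obtain \<epsilon>0 where \<epsilon>0: "polylow \<epsilon>0" "\<And>\<delta>. 0 < \<delta> \<Longrightarrow> \<delta> \<le> 1 \<Longrightarrow> \<epsilon>0 \<delta> \<le> 1" "alt_bound (Suc m) \<epsilon>0"
    using alt_bound_ex[of "Suc m"] by blast
  define h where "h \<eta> = ((\<eta>^2 / 4) * \<epsilon>0 (\<eta> / 2) * (\<epsilon>0 (\<eta> / 2))^2 / 10) ^ (2 ^ m)" for \<eta>
  have half: "polylow (\<lambda>\<delta>. \<epsilon>0 (\<delta> / 2))"
    using polylow_comp[OF \<epsilon>0(1), of "\<lambda>\<delta>. \<delta> / 2"] polylow_power[of "1/2" 1] by simp
  have "polylow (\<lambda>\<eta>. ((1/40) * \<eta>^2) * (\<epsilon>0 (\<eta> / 2) * (\<epsilon>0 (\<eta> / 2))^2))"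
    by (intro polylow_mult polylow_power polylow_pow half) simp
  then have "polylow (\<lambda>\<eta>. (\<eta>^2 / 4) * \<epsilon>0 (\<eta> / 2) * (\<epsilon>0 (\<eta> / 2))^2 / 10)" by (simp add: mult_ac)
  then have h: "polylow h" unfolding h_def[abs_def] by (rule polylow_pow)
  have h1: "0 < h \<delta>" "h \<delta> \<le> \<delta>" if \<delta>: "0 < \<delta>" "\<delta> \<le> 1" for \<delta>
  proof -
    show "0 < h \<delta>" using polylow_pos[OF h \<delta>] .
    let ?e = "\<epsilon>0 (\<delta> / 2)"
    have e: "0 < ?e" "?e \<le> 1" using \<epsilon>0 polylow_pos[OF \<epsilon>0(1), of "\<delta> / 2"] \<delta> by auto
    have d2: "\<delta>^2 \<le> \<delta>" using \<delta> by (simp add: power2_eq_square mult_left_le)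
    then have "(\<delta>^2 / 4) * ?e * (?e^2 / 10) \<le> \<delta> * 1 * 1" using e \<delta> power_le_one[of ?e 2] by (intro mult_mono) auto
    then have *: "(\<delta>^2 / 4) * ?e * ?e^2 / 10 \<le> \<delta>" by simp
    moreover have "0 \<le> (\<delta>^2 / 4) * ?e * ?e^2 / 10" using e by simp
    ultimately have "h \<delta> \<le> ((\<delta>^2 / 4) * ?e * ?e^2 / 10) ^ 1" unfolding h_def using \<delta> by (intro power_decreasing) auto
    then show "h \<delta> \<le> \<delta>" using * by simp
  qed
  have "polylow (\<lambda>\<eta>. \<epsilon> (h \<eta>))" using h1 by (intro polylow_comp[OF \<epsilon>(1) h]) (auto intro: order_trans)
  moreover have "\<epsilon> (h \<delta>) \<le> \<delta>" if "0 < \<delta>" "\<delta> \<le> 1" for \<delta> using \<epsilon>(2)[of "h \<delta>"] h1[OF that] that by linarith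
  moreover have "\<exists>J'. \<epsilon> (h \<eta>) \<le> correlation N 0 (dual N f0 f1) J'"
    if *: "0 < \<eta>" "\<eta> \<le> 1" "1 \<le> real N * \<epsilon> (h \<eta>)" "bddper (modulus N) f0" "bddper (modulus N) f1"
      "\<eta> \<le> correlation N (Suc m) (dual N f0 f1) J" for \<eta> N f0 f1 J
  proof -
    have hh: "0 < h \<eta>" "h \<eta> \<le> 1" using h1[OF *(1,2)] *(2) by auto
    have "real N * \<epsilon> (h \<eta>) \<le> real N * h \<eta>" using \<epsilon>(2)[OF hh] by (intro mult_left_mono) auto
    then have "1 \<le> real N * h \<eta>" using *(3) by linarith
    then obtain J' where "h \<eta> \<le> correlation N m (dual N f0 f1) J'"
      using degree_lowering_step[OF \<epsilon>0(3,1,2) *(1,2) _ *(4,5,6)] unfolding h_def by blast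
    then show ?thesis using \<epsilon>(3)[OF hh *(3-5)] by blast
  qed
  ultimately show ?case by blast
qed

subsection \<open>Removing factors by Cauchy--Schwarz\<close>

abbreviation gaps :: "nat \<Rightarrow> int set" where
  "gaps N \<equiv> {- int N<..<int N}"

text \<open>A function together with the slopes of its argument in two summation variables. After
  the squares have cancelled, every factor has this shape.\<close>

type_synonym linear_factor = "(int \<Rightarrow> complex) \<times> int \<times> int"

definition eval_factor :: "int \<times> int \<Rightarrow> int \<Rightarrow> linear_factor \<Rightarrow> complex" where
  "eval_factor p y = (\<lambda>(F, a, b). F (y + (a * fst p + b * snd p)))"

text \<open>The domain \<open>P\<close> is arbitrary and the sum over it is not normalised: each
  differencing replaces \<open>P\<close> by its intersection with a translate.\<close>

definition lin_form :: "int \<Rightarrow> (int \<times> int) set \<Rightarrow> linear_factor list \<Rightarrow> real" where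
  "lin_form M P L = norm (\<Sum>p\<in>P. zavg M (\<lambda>y. prod_list (map (eval_factor p y) L)))"

definition bdd_factor :: "int \<Rightarrow> linear_factor \<Rightarrow> bool" where
  "bdd_factor M = (\<lambda>(F, a, b). per M F \<and> (\<forall>y. norm (F y) \<le> 1))"

text \<open>Once the argument of the removed factor with slopes \<open>a1\<close>, \<open>b1\<close>
  has been made independent of \<open>p\<close>, replacing \<open>p\<close> by \<open>p + q\<close>
  moves the other factors along \<open>q\<close> by the differences of slopes.\<close>

definition diff_factor :: "int \<Rightarrow> int \<Rightarrow> int \<times> int \<Rightarrow> linear_factor \<Rightarrow> linear_factor" where
  "diff_factor a1 b1 q = (\<lambda>(F, a, b). (\<lambda>y. F (y + ((a - a1) * fst q + (b - b1) * snd q)) * cnj (F y), a, b))"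

lemma bdd_factor_diff: "bdd_factor M l \<Longrightarrow> bdd_factor M (diff_factor a1 b1 q l)"
  by (cases l) (auto simp: bdd_factor_def diff_factor_def norm_mult intro!: per_mult per_shift per_cnj mult_le_one)

lemma per_prod_factor: "\<forall>l\<in>set L. bdd_factor M l \<Longrightarrow> per M (\<lambda>y. prod_list (map (eval_factor p y) L))"
proof (induction L)
  case Nil
  then show ?case by (simp add: per_const)
next
  case (Cons l L)
  obtain F a b where l: "l = (F, a, b)" by (cases l)
  have "per M (\<lambda>y. F (y + (a * fst p + b * snd p)))" using Cons.prems l by (intro per_shift) (auto simp: bdd_factor_def)
  then show ?case using Cons l by (auto simp: eval_factor_def intro!: per_mult)
qed

lemma prod_factor_diff:
  "prod_list (map (eval_factor (fst p + fst q, snd p + snd q) (y - (a1 * fst q + b1 * snd q))) L) * cnj (prod_list (map (eval_factor p y) L)) =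
   prod_list (map (eval_factor p y) (map (diff_factor a1 b1 q) L))"
proof (induction L)
  case (Cons l L)
  obtain F a b where l: "l = (F, a, b)" by (cases l)
  have "y - (a1 * fst q + b1 * snd q) + (a * (fst p + fst q) + b * (snd p + snd q)) =
    y + (a * fst p + b * snd p) + ((a - a1) * fst q + (b - b1) * snd q)" by (simp add: algebra_simps)
  then have "eval_factor (fst p + fst q, snd p + snd q) (y - (a1 * fst q + b1 * snd q)) l * cnj (eval_factor p y l) = eval_factor p y (diff_factor a1 b1 q l)"
    by (simp only: l eval_factor_def diff_factor_def prod.case fst_conv snd_conv complex_cnj_mult)
  then have "(eval_factor (fst p + fst q, snd p + snd q) (y - (a1 * fst q + b1 * snd q)) l * cnj (eval_factor p y l)) *
    (prod_list (map (eval_factor (fst p + fst q, snd p + snd q) (y - (a1 * fst q + b1 * snd q))) L) * cnj (prod_list (map (eval_factor p y) L))) =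
    eval_factor p y (diff_factor a1 b1 q l) * prod_list (map (eval_factor p y) (map (diff_factor a1 b1 q) L))"
    by (simp only: Cons)
  then show ?case by (simp add: mult_ac)
qed simp

text \<open>Translating \<open>y\<close> for each \<open>p\<close> makes \<open>F1\<close>
  independent of \<open>p\<close>. Cauchy--Schwarz in \<open>y\<close> removes it, and the resulting
  pairs of points of \<open>P\<close> are parametrised by \<open>p\<close> and their difference
  \<open>q\<close>.\<close>

lemma kill_step:
  assumes M: "0 < M" and F1: "per M F1" "\<And>y. norm (F1 y) \<le> 1" and L: "\<forall>l\<in>set L. bdd_factor M l"
    and P: "P \<subseteq> {1..int N} \<times> {1..int N}"
  shows "(lin_form M P ((F1, a1, b1) # L))\<^sup>2 \<le>
    (\<Sum>q\<in>gaps N \<times> gaps N. lin_form M {p \<in> P. (fst p + fst q, snd p + snd q) \<in> P} (map (diff_factor a1 b1 q) L))"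
proof -
  define l1 where "l1 p = a1 * fst p + b1 * snd p" for p :: "int \<times> int"
  define S where "S p y = prod_list (map (eval_factor p y) L)" for p y
  have perS: "per M (S p)" for p unfolding S_def by (rule per_prod_factor[OF L])
  have finP: "finite P" using P finite_subset by blast
  let ?Pq = "\<lambda>q. {p \<in> P. (fst p + fst q, snd p + snd q) \<in> P}"
  have "(\<Sum>p\<in>P. zavg M (\<lambda>y. prod_list (map (eval_factor p y) ((F1, a1, b1) # L)))) = (\<Sum>p\<in>P. zavg M (\<lambda>y. F1 y * S p (y - l1 p)))"
  proof (rule sum.cong[OF refl])
    fix p
    have "per M (\<lambda>y. F1 y * S p (y + - l1 p))" using F1 perS by (intro per_mult per_shift)
    from avg_shift[OF this M, of "l1 p"]
    have "zavg M (\<lambda>y. F1 (y + l1 p) * S p y) = zavg M (\<lambda>y. F1 y * S p (y - l1 p))" by simp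
    then show "zavg M (\<lambda>y. prod_list (map (eval_factor p y) ((F1, a1, b1) # L))) = zavg M (\<lambda>y. F1 y * S p (y - l1 p))"
      by (simp only: list.map prod_list.Cons S_def l1_def) (simp only: eval_factor_def prod.case)
  qed
  also have "\<dots> = zavg M (\<lambda>y. F1 y * (\<Sum>p\<in>P. S p (y - l1 p)))"
    unfolding avg_def sum_distrib_left sum_divide_distrib[symmetric] by (simp add: sum.swap[of _ P])
  finally have "lin_form M P ((F1, a1, b1) # L) = norm (zavg M (\<lambda>y. F1 y * (\<Sum>p\<in>P. S p (y - l1 p))))" by (simp add: lin_form_def)
  then have "(lin_form M P ((F1, a1, b1) # L))\<^sup>2 \<le> zavg M (\<lambda>y. (norm (F1 y * (\<Sum>p\<in>P. S p (y - l1 p))))\<^sup>2)"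
    using norm_avg_square_le by simp
  also have "\<dots> \<le> zavg M (\<lambda>y. (norm (\<Sum>p\<in>P. S p (y - l1 p)))\<^sup>2)"
    using F1(2) by (intro avg_mono power_mono) (auto simp: norm_mult mult_left_le_one_le)
  finally have 1: "(lin_form M P ((F1, a1, b1) # L))\<^sup>2 \<le> zavg M (\<lambda>y. (norm (\<Sum>p\<in>P. S p (y - l1 p)))\<^sup>2)" .
  have "complex_of_real (zavg M (\<lambda>y. (norm (\<Sum>p\<in>P. S p (y - l1 p)))\<^sup>2)) =
    zavg M (\<lambda>y. \<Sum>w\<in>P \<times> P. S (fst w) (y - l1 (fst w)) * cnj (S (snd w) (y - l1 (snd w))))"
    by (simp add: of_real_avg complex_norm_square sum_product sum.cartesian_product split_def del: of_real_power)
  also have "\<dots> = (\<Sum>w\<in>P \<times> P. zavg M (\<lambda>y. S (fst w) (y - l1 (fst w)) * cnj (S (snd w) (y - l1 (snd w)))))"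
    unfolding avg_def sum_divide_distrib[symmetric] by (subst sum.swap) simp
  also have "\<dots> = (\<Sum>w\<in>Sigma (gaps N \<times> gaps N) ?Pq. zavg M (\<lambda>y. S (fst (snd w) + fst (fst w), snd (snd w) + snd (fst w))
       (y - l1 (fst (snd w) + fst (fst w), snd (snd w) + snd (fst w))) * cnj (S (snd w) (y - l1 (snd w)))))"
  proof -
    have Pb: "1 \<le> u \<and> u \<le> int N \<and> 1 \<le> v \<and> v \<le> int N" if "(u, v) \<in> P" for u v using P that by auto
    show ?thesis
      by (rule sum.reindex_bij_witness[where i = "\<lambda>((q1, q2), (p1, p2)). ((p1 + q1, p2 + q2), (p1, p2))"
        and j = "\<lambda>((w1, w2), (p1, p2)). ((w1 - p1, w2 - p2), (p1, p2))"])
        (auto, (drule Pb, drule Pb, linarith)+)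
  qed
  also have "\<dots> = (\<Sum>q\<in>gaps N \<times> gaps N. \<Sum>p\<in>?Pq q. zavg M (\<lambda>y. S (fst p + fst q, snd p + snd q)
       (y - l1 (fst p + fst q, snd p + snd q)) * cnj (S p (y - l1 p))))"
    using finP by (subst sum.Sigma) (auto simp: split_def)
  also have "\<dots> = (\<Sum>q\<in>gaps N \<times> gaps N. \<Sum>p\<in>?Pq q. zavg M (\<lambda>y. prod_list (map (eval_factor p y) (map (diff_factor a1 b1 q) L))))"
  proof (intro sum.cong refl)
    fix p q
    have "per M (\<lambda>y. S (fst p + fst q, snd p + snd q) (y + - l1 (fst p + fst q, snd p + snd q)) * cnj (S p (y + - l1 p)))"
      by (intro per_mult per_cnj per_shift perS)
    from avg_shift[OF this M, of "l1 p"]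
    have "zavg M (\<lambda>y. S (fst p + fst q, snd p + snd q) (y - l1 (fst p + fst q, snd p + snd q)) * cnj (S p (y - l1 p))) =
      zavg M (\<lambda>y. S (fst p + fst q, snd p + snd q) (y + l1 p - l1 (fst p + fst q, snd p + snd q)) * cnj (S p y))" by simp
    also have "\<dots> = zavg M (\<lambda>y. prod_list (map (eval_factor p y) (map (diff_factor a1 b1 q) L)))"
    proof (rule avg_cong[OF refl])
      fix y
      have "y + l1 p - l1 (fst p + fst q, snd p + snd q) = y - (a1 * fst q + b1 * snd q)" by (simp add: l1_def algebra_simps)
      then show "S (fst p + fst q, snd p + snd q) (y + l1 p - l1 (fst p + fst q, snd p + snd q)) * cnj (S p y) =
        prod_list (map (eval_factor p y) (map (diff_factor a1 b1 q) L))"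
        unfolding S_def prod_factor_diff[symmetric] by (simp only:)
    qed
    finally show "zavg M (\<lambda>y. S (fst p + fst q, snd p + snd q) (y - l1 (fst p + fst q, snd p + snd q)) * cnj (S p (y - l1 p))) =
      zavg M (\<lambda>y. prod_list (map (eval_factor p y) (map (diff_factor a1 b1 q) L)))" .
  qed
  finally have 2: "complex_of_real (zavg M (\<lambda>y. (norm (\<Sum>p\<in>P. S p (y - l1 p)))\<^sup>2)) =
    (\<Sum>q\<in>gaps N \<times> gaps N. \<Sum>p\<in>?Pq q. zavg M (\<lambda>y. prod_list (map (eval_factor p y) (map (diff_factor a1 b1 q) L))))" .
  have "zavg M (\<lambda>y. (norm (\<Sum>p\<in>P. S p (y - l1 p)))\<^sup>2) \<le> norm (complex_of_real (zavg M (\<lambda>y. (norm (\<Sum>p\<in>P. S p (y - l1 p)))\<^sup>2)))"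
    by (simp only: norm_of_real abs_ge_self)
  also have "\<dots> \<le> (\<Sum>q\<in>gaps N \<times> gaps N. lin_form M (?Pq q) (map (diff_factor a1 b1 q) L))"
    unfolding 2 lin_form_def by (rule norm_sum)
  finally show ?thesis using 1 by linarith
qed

text \<open>A box-norm expression in which every step is the value of a linear form at its own
  independent pair \<open>q\<close>.\<close>

primrec boxavg :: "int \<Rightarrow> nat \<Rightarrow> (int \<times> int) list \<Rightarrow> (int \<Rightarrow> complex) \<Rightarrow> real" where
  "boxavg M N [] T = norm (zavg M T)"
| "boxavg M N (c # cs) T = avg (gaps N \<times> gaps N) (\<lambda>q. boxavg M N cs (\<lambda>y. T (y + (fst c * fst q + snd c * snd q)) * cnj (T y)))"

lemma boxavg_nonneg: "0 \<le> boxavg M N cs T"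
  by (induction cs arbitrary: T) (auto intro!: avg_nonneg)

lemma boxavg_shift: "per M T \<Longrightarrow> 0 < M \<Longrightarrow> boxavg M N cs (\<lambda>y. T (y + c)) = boxavg M N cs T"
proof (induction cs arbitrary: T)
  case Nil
  then show ?case by (simp add: avg_shift)
next
  case (Cons d cs)
  show ?case unfolding boxavg.simps
  proof (rule avg_cong[OF refl])
    fix q
    let ?t = "fst d * fst q + snd d * snd q"
    have "per M (\<lambda>y. T (y + ?t) * cnj (T y))" using Cons.prems by (intro per_mult per_shift per_cnj)
    from Cons.IH[OF this Cons.prems(2)]
    show "boxavg M N cs (\<lambda>y. T (y + ?t + c) * cnj (T (y + c))) = boxavg M N cs (\<lambda>y. T (y + ?t) * cnj (T y))"
      by (simp only: add_ac)
  qed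
qed

lemma card_gaps: "0 < N \<Longrightarrow> card (gaps N) = 2 * N - 1"
  by simp

text \<open>The factors in \<open>os\<close> are removed one at a time. Differencing keeps the
  slopes, so the target \<open>T\<close> acquires one direction per removed factor, the difference
  of the slopes. Once it stands alone, its average over \<open>y\<close> no longer depends on
  \<open>p\<close>.\<close>

lemma kill_bound:
  assumes M: "0 < M" and N: "0 < N" and L: "bdd_factor M (T, a, b)" "\<forall>l\<in>set os. bdd_factor M l"
    and P: "P \<subseteq> {1..int N} \<times> {1..int N}"
  shows "(lin_form M P ((T, a, b) # os) / N\<^sup>2) ^ (2 ^ length os) \<le>
    4 ^ (2 ^ length os) * boxavg M N (map (\<lambda>l. (a - fst (snd l), b - snd (snd l))) os) T"
  using L P
proof (induction "length os" arbitrary: os T P)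
  case 0
  then have os: "os = []" by simp
  have finP: "finite P" using "0.prems"(3) finite_subset by blast
  have "zavg M (\<lambda>y. T (y + c)) = zavg M T" for c using "0.prems"(1) M by (intro avg_shift) (auto simp: bdd_factor_def)
  then have "lin_form M P [(T, a, b)] = card P * norm (zavg M T)" by (simp add: lin_form_def eval_factor_def norm_mult)
  also have "card P \<le> card ({1..int N} \<times> {1..int N})" using "0.prems"(3) by (intro card_mono) auto
  then have "real (card P) \<le> N\<^sup>2" by (simp add: card_cartesian_product power2_eq_square del: of_nat_mult)
  then have "card P * norm (zavg M T) \<le> N\<^sup>2 * norm (zavg M T)" by (intro mult_right_mono) auto
  finally have "lin_form M P [(T, a, b)] / N\<^sup>2 \<le> norm (zavg M T)" using N by (simp add: field_simps)
  also have "\<dots> \<le> 4 * norm (zavg M T)" by simp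
  finally show ?case by (simp add: os)
next
  case (Suc n os0)
  then obtain l os where os0: "os0 = l # os" by (cases os0) auto
  note prems = Suc.prems[unfolded os0]
  have n: "n = length os" using Suc.hyps(2) by (simp add: os0)
  obtain F1 a1 b1 where l: "l = (F1, a1, b1)" by (cases l)
  define T' where "T' q y = T (y + ((a - a1) * fst q + (b - b1) * snd q)) * cnj (T y)" for q :: "int \<times> int" and y
  define P' where "P' q = {p \<in> P. (fst p + fst q, snd p + snd q) \<in> P}" for q
  define \<phi> where "\<phi> q = lin_form M (P' q) ((T' q, a, b) # map (diff_factor a1 b1 q) os) / N\<^sup>2" for q
  have \<phi>0: "0 \<le> \<phi> q" for q by (simp add: \<phi>_def lin_form_def)
  have swap: "lin_form M P ((T, a, b) # l # os) = lin_form M P (l # (T, a, b) # os)" by (simp add: lin_form_def mult_ac)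
  have "(lin_form M P (l # (T, a, b) # os))\<^sup>2 \<le> (\<Sum>q\<in>gaps N \<times> gaps N. lin_form M (P' q) (map (diff_factor a1 b1 q) ((T, a, b) # os)))"
    unfolding l P'_def
    by (rule kill_step[OF M]) (use prems l in \<open>auto simp: bdd_factor_def\<close>)
  also have "\<dots> = (\<Sum>q\<in>gaps N \<times> gaps N. N\<^sup>2 * \<phi> q)"
    using N by (simp add: \<phi>_def diff_factor_def T'_def[abs_def])
  also have "\<dots> = N\<^sup>2 * (card (gaps N \<times> gaps N) * avg (gaps N \<times> gaps N) \<phi>)"
    using N by (simp add: avg_def sum_distrib_left[symmetric] card_cartesian_product)
  \<comment> \<open>The differences fill fewer than (2N)^2 pairs, against the normalisation by N^2;
    this is the constant 4 lost at each removal.\<close>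
  also have "\<dots> \<le> N\<^sup>2 * ((4 * N\<^sup>2) * avg (gaps N \<times> gaps N) \<phi>)"
  proof -
    have "card (gaps N \<times> gaps N) \<le> (2 * N) * (2 * N)" unfolding card_cartesian_product card_gaps[OF N] by (intro mult_le_mono) auto
    then have "real (card (gaps N \<times> gaps N)) \<le> real ((2 * N) * (2 * N))" by (simp only: of_nat_le_iff)
    also have "\<dots> = 4 * N\<^sup>2" by (simp add: power2_eq_square)
    finally show ?thesis using \<phi>0 by (intro mult_left_mono mult_right_mono avg_nonneg) auto
  qed
  finally have "(lin_form M P ((T, a, b) # l # os) / N\<^sup>2)\<^sup>2 \<le> 4 * avg (gaps N \<times> gaps N) \<phi>"
    unfolding swap using N by (simp add: power_divide divide_le_eq power2_eq_square mult_ac)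
  then have "((lin_form M P ((T, a, b) # l # os) / N\<^sup>2)\<^sup>2) ^ (2 ^ n) \<le> (4 * avg (gaps N \<times> gaps N) \<phi>) ^ (2 ^ n)"
    by (intro power_mono) auto
  also have "\<dots> = 4 ^ (2 ^ n) * (avg (gaps N \<times> gaps N) \<phi>) ^ (2 ^ n)" by (simp add: power_mult_distrib)
  also have "\<dots> \<le> 4 ^ (2 ^ n) * avg (gaps N \<times> gaps N) (\<lambda>q. \<phi> q ^ (2 ^ n))"
    using \<phi>0 by (intro mult_left_mono avg_power_le) auto
  also have "\<dots> \<le> 4 ^ (2 ^ n) * avg (gaps N \<times> gaps N) (\<lambda>q. 4 ^ (2 ^ n) * boxavg M N (map (\<lambda>l. (a - fst (snd l), b - snd (snd l))) os) (T' q))"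
  proof (intro mult_left_mono avg_mono)
    fix q
    have e: "map (\<lambda>l. (a - fst (snd l), b - snd (snd l))) (map (diff_factor a1 b1 q) os) = map (\<lambda>l. (a - fst (snd l), b - snd (snd l))) os"
      by (auto simp: diff_factor_def split_def)
    have bT: "bdd_factor M (T' q, a, b)"
      using bdd_factor_diff[OF prems(1), of a1 b1 q] by (simp add: diff_factor_def T'_def[abs_def])
    have "\<phi> q ^ (2 ^ length (map (diff_factor a1 b1 q) os)) \<le> 4 ^ (2 ^ length (map (diff_factor a1 b1 q) os)) *
       boxavg M N (map (\<lambda>l. (a - fst (snd l), b - snd (snd l))) (map (diff_factor a1 b1 q) os)) (T' q)"
      unfolding \<phi>_def
    proof (rule Suc.hyps(1))
      show "n = length (map (diff_factor a1 b1 q) os)" using n by simp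
      show "bdd_factor M (T' q, a, b)" by (rule bT)
      show "\<forall>l\<in>set (map (diff_factor a1 b1 q) os). bdd_factor M l" using prems(2) bdd_factor_diff by auto
      show "P' q \<subseteq> {1..int N} \<times> {1..int N}" using prems(3) by (auto simp: P'_def)
    qed
    then show "\<phi> q ^ (2 ^ n) \<le> 4 ^ (2 ^ n) * boxavg M N (map (\<lambda>l. (a - fst (snd l), b - snd (snd l))) os) (T' q)"
      unfolding e by (simp add: n)
  qed simp
  also have "\<dots> = 4 ^ (2 ^ Suc n) * boxavg M N (map (\<lambda>l. (a - fst (snd l), b - snd (snd l))) (l # os)) T"
    unfolding avg_cmult by (simp add: l T'_def[abs_def] power_add[symmetric] mult_2)
  finally show ?case unfolding os0 by (simp add: n power_mult[symmetric])
qed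

lemma sum_pairs_by_difference:
  fixes G :: "int \<times> int \<Rightarrow> 'b::comm_monoid_add"
  shows "(\<Sum>p\<in>{1..int N} \<times> {1..int N}. G p) = (\<Sum>h\<in>gaps N. \<Sum>z\<in>{z \<in> {1..int N}. z + h \<in> {1..int N}}. G (z, z + h))"
proof -
  have fin: "finite {z \<in> {1..int N}. z + h \<in> {1..int N}}" for h by (rule finite_subset[of _ "{1..int N}"]) auto
  have "(\<Sum>p\<in>{1..int N} \<times> {1..int N}. G p) = (\<Sum>w\<in>Sigma (gaps N) (\<lambda>h. {z \<in> {1..int N}. z + h \<in> {1..int N}}). G (snd w, snd w + fst w))"
    by (rule sum.reindex_bij_witness[where i = "\<lambda>w. (snd w, snd w + fst w)" and j = "\<lambda>p. (snd p - fst p, fst p)"]) auto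
  also have "\<dots> = (\<Sum>h\<in>gaps N. \<Sum>z\<in>{z \<in> {1..int N}. z + h \<in> {1..int N}}. G (z, z + h))"
    using fin by (subst sum.Sigma) (auto simp: split_def)
  finally show ?thesis .
qed

text \<open>The square of the inner sum is expanded, the factor \<open>F y\<close> is removed by Cauchy--Schwarz, and
  the remaining five factors beside the target are removed by \<open>kill_bound\<close>. Removing
  \<open>F y\<close> duplicates the variables, and this is what makes three of the five resulting
  directions two-dimensional.\<close>
lemma pair_bound:
  assumes M: "0 < M" and N: "0 < N"
    and F: "per M F" "\<And>y. norm (F y) \<le> 1" and F': "per M F'" "\<And>y. norm (F' y) \<le> 1"
    and k: "k = x - x'"
  shows "(zavg M (\<lambda>y. (norm (avg {1..int N} (\<lambda>z. F (y + (z - x)^2) * cnj (F' (y + (z - x')^2)))))\<^sup>2)) ^ 64 \<le>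
    4 ^ 64 * avg (gaps N) (\<lambda>h. avg (gaps N) (\<lambda>h1.
      boxavg M N [(2 * k, 0), (2 * h, 0), (2 * (h + k), - 2 * h1), (2 * (h + k), - 2 * k), (2 * (h + k), - 2 * (h1 + k))] F'))"
    (is "?V ^ 64 \<le> _")
proof -
  let ?X = "{1..int N}"
  define a where "a z y = F (y + (z - x)^2) * cnj (F' (y + (z - x')^2))" for z y
  \<comment> \<open>Substituting for \<open>y\<close> so that the first factor becomes
    \<open>F y\<close>, free of \<open>z\<close> and \<open>w\<close>; that factor is the weight for
    the next Cauchy--Schwarz step.\<close>
  define A where "A z w y = cnj (F' (y + ((z - x')^2 - (z - x)^2))) * cnj (F (y + ((w - x)^2 - (z - x)^2))) * F' (y + ((w - x')^2 - (z - x)^2))" for z w y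
  have perA: "per M (A z w)" for z w unfolding A_def using F F' by (intro per_mult per_cnj per_shift)
  have V0: "0 \<le> ?V" by (intro avg_nonneg) auto
  have V1: "?V = norm (zavg M (\<lambda>y. F y * avg (?X \<times> ?X) (\<lambda>p. A (fst p) (snd p) y)))"
  proof -
    have "zavg M (\<lambda>y. a z y * cnj (a w y)) = zavg M (\<lambda>y. F y * A z w y)" for z w
    proof -
      have "per M (\<lambda>y. F y * A z w y)" by (intro per_mult F perA)
      from avg_shift[OF this M, of "(z - x)^2"] show ?thesis by (simp add: a_def A_def mult_ac)
    qed
    then have "?V = norm (avg ?X (\<lambda>z. avg ?X (\<lambda>w. zavg M (\<lambda>y. F y * A z w y))))"
      unfolding avg_norm_square' a_def[symmetric] by (simp only:)
    also have "avg ?X (\<lambda>z. avg ?X (\<lambda>w. zavg M (\<lambda>y. F y * A z w y))) = avg (?X \<times> ?X) (\<lambda>p. zavg M (\<lambda>y. F y * A (fst p) (snd p) y))"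
      by (simp only: avg_times fst_conv snd_conv)
    also have "\<dots> = zavg M (\<lambda>y. avg (?X \<times> ?X) (\<lambda>p. F y * A (fst p) (snd p) y))" by (rule avg_swap)
    finally show ?thesis by (simp only: avg_cmult)
  qed
  define c1 where "c1 h = h^2 - 2 * h * x" for h
  define c2 where "c2 = x'^2 - x^2"
  define c3 where "c3 h = h^2 - 2 * h * x' + x'^2 - x^2" for h
  define T where "T h y = F' (y + c3 h)" for h y
  \<comment> \<open>The pair \<open>z\<close>, \<open>z + h\<close> and its duplicate
    \<open>z1\<close>, \<open>z1 + h1\<close> supply three factors each; those of the first have
    slope only in \<open>z\<close>, those of the second only in \<open>z1\<close>. The target is the
    factor of the first pair with slope \<open>2 * (h + k)\<close>.\<close>
  define os where "os h h1 = [(\<lambda>y. cnj (F (y + c1 h)), 2 * h, 0), (\<lambda>y. cnj (F' (y + c2)), 2 * k, 0),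
     (\<lambda>y. F (y + c1 h1), 0, 2 * h1), (\<lambda>y. F' (y + c2), 0, 2 * k), (\<lambda>y. cnj (F' (y + c3 h1)), 0, 2 * (h1 + k))]" for h h1
  define Pz where "Pz h = {z \<in> ?X. z + h \<in> ?X}" for h
  define \<phi> where "\<phi> h h1 = lin_form M (Pz h \<times> Pz h1) ((T h, 2 * (h + k), 0) # os h h1) / N\<^sup>2" for h h1
  have \<phi>0: "0 \<le> \<phi> h h1" for h h1 by (simp add: \<phi>_def lin_form_def)
  have prod: "A z (z + h) y * cnj (A z1 (z1 + h1) y) = prod_list (map (eval_factor (z, z1) y) ((T h, 2 * (h + k), 0) # os h h1))" for z h z1 h1 y
  proof -
    \<comment> \<open>Writing the second variable as \<open>z + h\<close>, and \<open>x - x'\<close>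
      as \<open>k\<close>, cancels the squares of \<open>z\<close>, so the shifts become affine in
      \<open>z\<close>.\<close>
    have e: "(z + h - x)^2 - (z - x)^2 = c1 h + 2 * h * z" "(z - x')^2 - (z - x)^2 = c2 + 2 * k * z"
      "(z + h - x')^2 - (z - x)^2 = c3 h + 2 * (h + k) * z" for z h
      by (simp_all add: c1_def c2_def c3_def k power2_eq_square algebra_simps)
    have eA: "A z (z + h) y = cnj (F' (y + (c2 + 2 * k * z))) * cnj (F (y + (c1 h + 2 * h * z))) * F' (y + (c3 h + 2 * (h + k) * z))" for z h
      unfolding A_def e ..
    show ?thesis unfolding eA by (simp add: eval_factor_def os_def T_def algebra_simps)
  qed
  have "?V\<^sup>2 \<le> norm (avg (?X \<times> ?X) (\<lambda>p. avg (?X \<times> ?X) (\<lambda>p'. zavg M (\<lambda>y. A (fst p) (snd p) y * cnj (A (fst p') (snd p') y)))))"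
    unfolding V1 by (rule avg_vdc) (rule F)
  also have "\<dots> = norm (\<Sum>p\<in>?X \<times> ?X. \<Sum>p'\<in>?X \<times> ?X. zavg M (\<lambda>y. A (fst p) (snd p) y * cnj (A (fst p') (snd p') y))) / real N ^ 4"
    unfolding avg_def[of "?X \<times> ?X"] sum_divide_distrib[symmetric]
    by (simp add: norm_divide card_cartesian_product power4_eq_xxxx norm_mult)
  also have "(\<Sum>p\<in>?X \<times> ?X. \<Sum>p'\<in>?X \<times> ?X. zavg M (\<lambda>y. A (fst p) (snd p) y * cnj (A (fst p') (snd p') y))) =
     (\<Sum>h\<in>gaps N. \<Sum>z\<in>Pz h. \<Sum>h1\<in>gaps N. \<Sum>z1\<in>Pz h1. zavg M (\<lambda>y. A z (z + h) y * cnj (A z1 (z1 + h1) y)))"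
    unfolding sum_pairs_by_difference Pz_def by simp
  also have "\<dots> = (\<Sum>h\<in>gaps N. \<Sum>h1\<in>gaps N. \<Sum>z\<in>Pz h. \<Sum>z1\<in>Pz h1. zavg M (\<lambda>y. A z (z + h) y * cnj (A z1 (z1 + h1) y)))"
    by (rule sum.cong[OF refl], rule sum.swap)
  also have "\<dots> = (\<Sum>h\<in>gaps N. \<Sum>h1\<in>gaps N. \<Sum>p\<in>Pz h \<times> Pz h1. zavg M (\<lambda>y. prod_list (map (eval_factor p y) ((T h, 2 * (h + k), 0) # os h h1))))"
    unfolding prod by (simp only: sum.cartesian_product split_def prod.collapse)
  also have "norm \<dots> \<le> (\<Sum>h\<in>gaps N. \<Sum>h1\<in>gaps N. lin_form M (Pz h \<times> Pz h1) ((T h, 2 * (h + k), 0) # os h h1))"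
    unfolding lin_form_def by (rule order_trans[OF norm_sum sum_mono[OF norm_sum]])
  also have "\<dots> = (\<Sum>h\<in>gaps N. \<Sum>h1\<in>gaps N. N\<^sup>2 * \<phi> h h1)" using N by (simp add: \<phi>_def)
  also have "\<dots> / real N ^ 4 = (\<Sum>h\<in>gaps N. \<Sum>h1\<in>gaps N. \<phi> h h1) / N\<^sup>2"
    unfolding sum_distrib_left[symmetric] using N by (simp add: power2_eq_square power4_eq_xxxx)
  finally have V2: "?V\<^sup>2 \<le> (\<Sum>h\<in>gaps N. \<Sum>h1\<in>gaps N. \<phi> h h1) / N\<^sup>2" by (simp add: divide_right_mono)
  have V3: "?V\<^sup>2 \<le> 4 * avg (gaps N) (\<lambda>h. avg (gaps N) (\<phi> h))"
  proof -
    have c: "real (card (gaps N)) \<le> 2 * N" unfolding card_gaps[OF N] by simp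
    have c0: "0 < real (card (gaps N))" unfolding card_gaps[OF N] using N by simp
    have "(\<Sum>h\<in>gaps N. \<Sum>h1\<in>gaps N. \<phi> h h1) = card (gaps N) * (card (gaps N) * avg (gaps N) (\<lambda>h. avg (gaps N) (\<phi> h)))"
      unfolding avg_def sum_divide_distrib[symmetric] using c0 by simp
    also have "\<dots> \<le> (2 * N) * ((2 * N) * avg (gaps N) (\<lambda>h. avg (gaps N) (\<phi> h)))"
      using c c0 \<phi>0 by (intro mult_mono mult_nonneg_nonneg avg_nonneg) auto
    finally have "(\<Sum>h\<in>gaps N. \<Sum>h1\<in>gaps N. \<phi> h h1) / N\<^sup>2 \<le> (2 * N) * ((2 * N) * avg (gaps N) (\<lambda>h. avg (gaps N) (\<phi> h))) / N\<^sup>2"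
      by (intro divide_right_mono) auto
    also have "\<dots> = 4 * avg (gaps N) (\<lambda>h. avg (gaps N) (\<phi> h))" using N by (simp add: power2_eq_square)
    finally show ?thesis using V2 by linarith
  qed
  have boxavg: "\<phi> h h1 ^ 32 \<le> 4 ^ 32 * boxavg M N [(2 * k, 0), (2 * h, 0), (2 * (h + k), - 2 * h1), (2 * (h + k), - 2 * k), (2 * (h + k), - 2 * (h1 + k))] F'" for h h1
  proof -
    have "(lin_form M (Pz h \<times> Pz h1) ((T h, 2 * (h + k), 0) # os h h1) / N\<^sup>2) ^ (2 ^ length (os h h1)) \<le>
      4 ^ (2 ^ length (os h h1)) * boxavg M N (map (\<lambda>l. (2 * (h + k) - fst (snd l), 0 - snd (snd l))) (os h h1)) (T h)"
    proof (rule kill_bound[OF M N])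
      show "bdd_factor M (T h, 2 * (h + k), 0)" unfolding bdd_factor_def T_def using F' by (simp add: per_shift)
      show "\<forall>l\<in>set (os h h1). bdd_factor M l" unfolding bdd_factor_def os_def using F F' by (auto intro!: per_cnj per_shift)
    qed (auto simp: Pz_def)
    moreover have "map (\<lambda>l. (2 * (h + k) - fst (snd l), 0 - snd (snd l))) (os h h1) =
      [(2 * k, 0), (2 * h, 0), (2 * (h + k), - 2 * h1), (2 * (h + k), - 2 * k), (2 * (h + k), - 2 * (h1 + k))]"
      by (simp add: os_def)
    moreover have "2 ^ length (os h h1) = (32::nat)" by (simp add: os_def)
    ultimately show ?thesis unfolding \<phi>_def T_def boxavg_shift[OF F'(1) M] by (simp only:)
  qed
  \<comment> \<open>The exponent is one squaring for \<open>F y\<close> and five more for the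
    factors in \<open>os\<close>.\<close>
  have "?V ^ 64 = (?V\<^sup>2) ^ 32" by (simp add: power_mult[symmetric])
  also have "\<dots> \<le> (4 * avg (gaps N) (\<lambda>h. avg (gaps N) (\<phi> h))) ^ 32" using V3 by (intro power_mono) auto
  also have "\<dots> = 4 ^ 32 * (avg (gaps N) (\<lambda>h. avg (gaps N) (\<phi> h))) ^ (2 ^ 5)" by (simp add: power_mult_distrib)
  also have "\<dots> \<le> 4 ^ 32 * avg (gaps N) (\<lambda>h. (avg (gaps N) (\<phi> h)) ^ (2 ^ 5))"
    using \<phi>0 by (intro mult_left_mono avg_power_le avg_nonneg) auto
  also have "\<dots> \<le> 4 ^ 32 * avg (gaps N) (\<lambda>h. avg (gaps N) (\<lambda>h1. \<phi> h h1 ^ (2 ^ 5)))"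
    using \<phi>0 by (intro mult_left_mono avg_mono avg_power_le) auto
  also have "\<dots> \<le> 4 ^ 32 * avg (gaps N) (\<lambda>h. avg (gaps N) (\<lambda>h1. 4 ^ 32 * boxavg M N [(2 * k, 0), (2 * h, 0), (2 * (h + k), - 2 * h1), (2 * (h + k), - 2 * k), (2 * (h + k), - 2 * (h1 + k))] F'))"
    using boxavg by (intro mult_left_mono avg_mono) (simp_all del: boxavg.simps)
  finally show ?thesis by (simp add: avg_cmult del: boxavg.simps)
qed

subsection \<open>Equidistribution of differencing directions\<close>

text \<open>Conditions under which the values of the form with coefficients \<open>a\<close>,
  \<open>b\<close> on the box \<open>gaps N \<times> gaps N\<close> have bounded
  multiplicity.\<close>

definition spreading :: "real \<Rightarrow> nat \<Rightarrow> int \<Rightarrow> int \<Rightarrow> bool" where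
  "spreading \<rho> N a b \<longleftrightarrow> b \<noteq> 0 \<and> \<rho> * N \<le> \<bar>real_of_int b\<bar> \<and> real_of_int (gcd a b) \<le> 1 / \<rho>"

lemma card_residue_class:
  fixes S :: "int set"
  assumes S: "S \<subseteq> {lo..hi}" and d: "0 < d" and cong: "\<And>s s'. s \<in> S \<Longrightarrow> s' \<in> S \<Longrightarrow> d dvd s - s'"
  shows "int (card S) \<le> max 0 (hi div d - lo div d + 1)"
proof -
  have "inj_on (\<lambda>s. s div d) S"
  proof (rule inj_onI)
    fix s s' assume *: "s \<in> S" "s' \<in> S" "s div d = s' div d"
    then have "s mod d = s' mod d" using cong by (simp add: mod_eq_dvd_iff)
    with *(3) have "s div d * d + s mod d = s' div d * d + s' mod d" by (simp only:)
    then show "s = s'" by (simp only: div_mult_mod_eq)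
  qed
  then have "card S = card ((\<lambda>s. s div d) ` S)" by (simp add: card_image)
  also have "\<dots> \<le> card {lo div d..hi div d}"
    using S d by (intro card_mono) (auto intro!: zdiv_mono1)
  finally show ?thesis by simp
qed

text \<open>A solution is determined by its first coordinate, which is confined to one residue class
  modulo \<bar>b\<bar> / gcd(a, b). That modulus is at least \<rho>^2 N, so an interval of length
  about 2N contains few solutions.\<close>

lemma card_linear_solutions:
  assumes \<rho>: "0 < \<rho>" "\<rho> \<le> 1" and N: "0 < N" and g: "spreading \<rho> N a b"
  shows "real (card {q \<in> gaps N \<times> gaps N. a * fst q + b * snd q = t}) \<le> 4 / \<rho>^2"
proof -
  let ?R = "{q \<in> gaps N \<times> gaps N. a * fst q + b * snd q = t}"
  have b: "b \<noteq> 0" "\<rho> * N \<le> \<bar>real_of_int b\<bar>" "real_of_int (gcd a b) \<le> 1 / \<rho>" using g by (auto simp: spreading_def)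
  define d where "d = \<bar>b\<bar> div gcd a b"
  have gd: "gcd a b * d = \<bar>b\<bar>" "0 < gcd a b" using b(1) by (simp_all add: d_def)
  have d: "0 < d" using gd b(1) by (metis abs_of_nonneg abs_zero gcd_ge_0_int linorder_not_le mult_le_0_iff not_less_iff_gr_or_eq zero_less_abs_iff)
  have inj: "inj_on fst ?R"
    using b(1) by (auto simp: inj_on_def)
  have "card ?R = card (fst ` ?R)" by (simp add: card_image[OF inj])
  moreover have "int (card (fst ` ?R)) \<le> max 0 ((int N - 1) div d - (1 - int N) div d + 1)"
  proof (rule card_residue_class[OF _ d])
    show "fst ` ?R \<subseteq> {1 - int N..int N - 1}" by auto
    fix s s' assume "s \<in> fst ` ?R" "s' \<in> fst ` ?R"
    then obtain u u' where "a * s + b * u = t" "a * s' + b * u' = t" by auto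
    then have "a * (s - s') = b * (u' - u)" by (simp add: algebra_simps)
    then have "b dvd a * (s - s')" by simp
    then have "\<bar>b\<bar> div gcd a b dvd (s - s')"
    proof -
      obtain a' b' where ab: "a = a' * gcd a b" "b = b' * gcd a b" "coprime a' b'"
        using gcd_coprime_exists[of a b] gd(2) by auto
      have "b' dvd a' * (s - s')"
      proof -
        have "b' * gcd a b dvd (a' * (s - s')) * gcd a b" using \<open>b dvd a * (s - s')\<close> ab(1,2) by (metis mult.assoc mult.commute)
        then show ?thesis using gd(2) b(1) by auto
      qed
      then have "b' dvd (s - s')" using ab(3) by (simp add: coprime_dvd_mult_right_iff coprime_commute)
      moreover have "\<bar>b\<bar> div gcd a b = \<bar>b'\<bar>"
      proof -
        have "\<bar>b\<bar> = \<bar>b'\<bar> * gcd a b" using ab(2) gd(2) by (metis abs_mult abs_of_pos)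
        then show ?thesis using gd(2) by (metis less_irrefl nonzero_mult_div_cancel_right)
      qed
      ultimately show ?thesis by simp
    qed
    then show "d dvd s - s'" by (simp add: d_def)
  qed
  ultimately have "real (card ?R) \<le> of_int (max 0 ((int N - 1) div d - (1 - int N) div d + 1))" by linarith
  also have "\<dots> \<le> 2 * N / d + 2"
  proof -
    have "real_of_int ((int N - 1) div d) \<le> real_of_int (int N - 1) / of_int d" by (rule real_of_int_div4)
    moreover have "real_of_int (1 - int N) / of_int d - 1 \<le> real_of_int ((1 - int N) div d)"
      using real_of_int_div3[of "1 - int N" d] by linarith
    moreover have "real_of_int (int N - 1) / of_int d - real_of_int (1 - int N) / of_int d = (2 * real N - 2) / d"
      by (simp add: diff_divide_distrib[symmetric])
    moreover have "(2 * real N - 2) / d \<le> 2 * N / real_of_int d" using d by (intro divide_right_mono) auto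
    moreover have "0 \<le> 2 * N / real_of_int d" using d by simp
    ultimately show ?thesis by linarith
  qed
  also have "2 * N / d \<le> 2 / \<rho>^2"
  proof -
    have "\<rho> * N \<le> real_of_int (gcd a b) * d" using b(2) gd(1) by (metis of_int_abs of_int_mult)
    also have "\<dots> \<le> (1 / \<rho>) * d" using b(3) d by (intro mult_right_mono) auto
    finally have "\<rho>^2 * N \<le> d" using \<rho> by (simp add: field_simps power2_eq_square)
    then show ?thesis using \<rho> d by (simp add: field_simps)
  qed
  also have "2 / \<rho>^2 + 2 \<le> 4 / \<rho>^2"
  proof -
    have "\<rho>^2 \<le> 1" using \<rho> by (simp add: power_le_one)
    then have "2 * 1 \<le> 2 * (1 / \<rho>^2)" using \<rho> by (intro mult_left_mono) (simp_all add: le_divide_eq)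
    then show ?thesis by simp
  qed
  finally show ?thesis by simp
qed

text \<open>Only an upper bound for the multiplicity of each residue is needed, since
  \<open>A\<close> is nonnegative. It is 8 possible values of the form times 4 / \<rho>^2 solutions
  each; comparing the modulus with the size of the box costs a further factor 2.\<close>

lemma filling:
  fixes A :: "int \<Rightarrow> real"
  assumes \<rho>: "0 < \<rho>" "\<rho> \<le> 1" and N: "0 < N" and g: "spreading \<rho> N a b" and ab: "\<bar>a\<bar> \<le> 2 * int N" "\<bar>b\<bar> \<le> 2 * int N"
    and A: "per (modulus N) A" "\<And>v. 0 \<le> A v"
  shows "avg (gaps N \<times> gaps N) (\<lambda>q. A (2 * a * fst q + 2 * b * snd q)) \<le> 64 / \<rho>^2 * zavg (modulus N) A"
proof -
  define M where "M = modulus N"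
  have M: "0 < M" "M = 2 * (int N)^2" using N modulus_pos by (auto simp: M_def modulus_def)
  define f where "f q = (2 * a * fst q + 2 * b * snd q) mod M" for q :: "int \<times> int"
  let ?S = "gaps N \<times> gaps N"
  have fib: "real (card {q \<in> ?S. f q = v}) \<le> 32 / \<rho>^2" for v
  proof -
    define \<tau> where "\<tau> q = a * fst q + b * snd q" for q :: "int \<times> int"
    let ?F = "{q \<in> ?S. f q = v}"
    let ?T = "\<tau> ` ?F"
    have finF: "finite ?F" by (rule finite_subset[of _ ?S]) auto
    \<comment> \<open>Twice the form is known modulo 2N^2, hence the form modulo N^2. Its values lie
      below 4N^2 in absolute value, which leaves at most eight of them.\<close>
    have "int (card ?T) \<le> max 0 ((4 * (int N)^2 - 1) div (int N)^2 - (- 4 * (int N)^2) div (int N)^2 + 1)"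
    proof (rule card_residue_class)
      show "0 < (int N)^2" using N by simp
      show "?T \<subseteq> {- 4 * (int N)^2..4 * (int N)^2 - 1}"
      proof
        fix t assume "t \<in> ?T"
        then obtain q where q: "q \<in> ?S" "t = \<tau> q" by auto
        have b1: "\<bar>a * fst q\<bar> \<le> 2 * int N * (int N - 1)" "\<bar>b * snd q\<bar> \<le> 2 * int N * (int N - 1)"
          unfolding abs_mult using q(1) ab by (intro mult_mono; auto)+
        then have "\<bar>t\<bar> \<le> 4 * int N * (int N - 1)" unfolding q(2) \<tau>_def by linarith
        also have "\<dots> \<le> 4 * (int N)^2 - 1" using N by (simp add: power2_eq_square algebra_simps)
        finally show "t \<in> {- 4 * (int N)^2..4 * (int N)^2 - 1}" by auto
      qed
      fix s s' assume "s \<in> ?T" "s' \<in> ?T"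
      then obtain q q' where q: "f q = v" "s = \<tau> q" "f q' = v" "s' = \<tau> q'" by auto
      then have "M dvd (2 * a * fst q + 2 * b * snd q) - (2 * a * fst q' + 2 * b * snd q')"
        by (simp add: f_def mod_eq_dvd_iff[symmetric])
      also have "(2 * a * fst q + 2 * b * snd q) - (2 * a * fst q' + 2 * b * snd q') = 2 * (s - s')"
        unfolding q(2,4) \<tau>_def by (simp add: algebra_simps)
      finally show "(int N)^2 dvd s - s'" unfolding M(2) by (simp only: dvd_mult_cancel_left) simp
    qed
    also have "(4 * (int N)^2 - 1) div (int N)^2 - (- 4 * (int N)^2) div (int N)^2 + 1 \<le> 8"
    proof -
      have "(4 * d - 1) div d < 4" if "0 < d" for d :: int
      proof (rule ccontr)
        assume "\<not> ?thesis"
        then have "4 * d \<le> (4 * d - 1) div d * d" using that by (intro mult_right_mono) auto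
        then show False using div_mult_mod_eq[of "4 * d - 1" d] pos_mod_sign[OF that, of "4 * d - 1"] by linarith
      qed
      then have "(4 * (int N)^2 - 1) div (int N)^2 < 4" using N by simp
      moreover have "(- 4 * (int N)^2) div (int N)^2 = - 4" using N by (intro nonzero_mult_div_cancel_right) auto
      ultimately show ?thesis by linarith
    qed
    finally have cT: "card ?T \<le> 8" by simp
    have "?F \<subseteq> (\<Union>t\<in>?T. {q \<in> ?S. a * fst q + b * snd q = t})" by (auto simp: \<tau>_def)
    then have "card ?F \<le> card (\<Union>t\<in>?T. {q \<in> ?S. a * fst q + b * snd q = t})"
      using finF by (intro card_mono finite_UN_I) (auto intro: finite_subset[of _ ?S])
    also have "\<dots> \<le> (\<Sum>t\<in>?T. card {q \<in> ?S. a * fst q + b * snd q = t})" using finF by (intro card_UN_le) auto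
    finally have "real (card ?F) \<le> (\<Sum>t\<in>?T. real (card {q \<in> ?S. a * fst q + b * snd q = t}))"
      by (simp only: of_nat_sum[symmetric] of_nat_le_iff)
    also have "\<dots> \<le> card ?T * (4 / \<rho>^2)" by (rule sum_bounded_above) (rule card_linear_solutions[OF \<rho> N g])
    also have "\<dots> \<le> 8 * (4 / \<rho>^2)" using cT \<rho> by (intro mult_right_mono) auto
    finally show ?thesis by simp
  qed
  have "(\<Sum>q\<in>?S. A (2 * a * fst q + 2 * b * snd q)) = (\<Sum>q\<in>?S. A (f q))"
    unfolding f_def using per_mod[OF A(1)] by (simp add: M_def)
  also have "\<dots> = (\<Sum>v\<in>{0..<M}. \<Sum>q\<in>{q \<in> ?S. f q = v}. A (f q))"
    by (rule sum.group[symmetric]) (use M in \<open>auto simp: f_def\<close>)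
  also have "\<dots> = (\<Sum>v\<in>{0..<M}. card {q \<in> ?S. f q = v} * A v)" by simp
  also have "\<dots> \<le> (\<Sum>v\<in>{0..<M}. (32 / \<rho>^2) * A v)" by (intro sum_mono mult_right_mono fib A)
  also have "\<dots> = (32 / \<rho>^2) * (of_int M * zavg M A)"
  proof -
    have "of_int M * zavg M A = sum A {0..<M}" using M(1) by (simp add: avg_def)
    then show ?thesis by (simp only: sum_distrib_left)
  qed
  finally have 1: "(\<Sum>q\<in>?S. A (2 * a * fst q + 2 * b * snd q)) \<le> (32 / \<rho>^2) * (of_int M * zavg M A)" .
  have cS: "real (card ?S) = (2 * real N - 1)^2" unfolding card_cartesian_product card_gaps[OF N] using N by (simp add: power2_eq_square of_nat_diff)
  have "real N \<le> 2 * real N - 1" using N by simp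
  then have NN: "(real N)^2 \<le> real (card ?S)" unfolding cS by (intro power_mono) auto
  have c0: "0 < real (card ?S)" using NN N by (smt (verit) of_nat_0_less_iff zero_less_power)
  have z0: "0 \<le> zavg M A" using A(2) by (intro avg_nonneg)
  have "avg ?S (\<lambda>q. A (2 * a * fst q + 2 * b * snd q)) \<le> (32 / \<rho>^2) * (of_int M * zavg M A) / real (card ?S)"
    unfolding avg_def[of ?S] using 1 by (intro divide_right_mono) auto
  also have "\<dots> \<le> (32 / \<rho>^2) * ((2 * real (card ?S)) * zavg M A) / real (card ?S)"
    using NN z0 M(2) \<rho> by (intro divide_right_mono mult_left_mono mult_right_mono) auto
  also have "\<dots> = 64 / \<rho>^2 * zavg M A"
  proof -
    have "32 / r * ((2 * c) * z) / c = 64 / r * z" if "0 < c" for r c z :: real using that by simp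
    from this[OF c0] show ?thesis .
  qed
  finally show ?thesis by (simp add: M_def)
qed

lemma sum_inverse_squares_tail:
  assumes "0 < G"
  shows "(\<Sum>g\<in>{Suc G..n}. 1 / (real g)^2) \<le> 1 / real G"
proof (cases "G \<le> n")
  case True
  have "(\<Sum>g\<in>{Suc G..n}. 1 / (real g)^2) \<le> 1 / real G - 1 / real n"
    using True
  proof (induction n rule: dec_induct)
    case (step k)
    have k: "0 < real k" using step assms by simp
    have "1 / (real (Suc k))^2 \<le> 1 / (real k * real (Suc k))"
      using k by (intro divide_left_mono) (auto simp: power2_eq_square)
    also have "\<dots> = 1 / real k - 1 / real (Suc k)" using k by (simp add: field_simps)
    finally show ?case using step by (simp add: atLeastAtMostSuc_conv)
  qed simp
  also have "\<dots> \<le> 1 / real G" by simp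
  finally show ?thesis .
qed simp

text \<open>Either \<open>b\<close> is small, accounting for 12 \<rho> N^2 pairs, or a common
  divisor exceeds 1 / \<rho>, accounting for at most 128 \<rho> N^2 by the tail of the sum of
  inverse squares. The box has side \<open>2 * N\<close> in each direction because sums such as
  \<open>h + k\<close> occur as coefficients.\<close>

lemma card_bad_pairs:
  assumes \<rho>: "0 < \<rho>" "\<rho> \<le> 1" and N: "1 \<le> \<rho> * N"
  shows "real (card {p \<in> gaps (2 * N) \<times> gaps (2 * N). \<not> spreading \<rho> N (fst p) (snd p)}) \<le> 140 * \<rho> * real N^2"
proof -
  have N0: "0 < N" using N by (cases "N = 0") auto
  let ?B = "gaps (2 * N)"
  define S where "S = {b \<in> ?B. \<bar>real_of_int b\<bar> < \<rho> * N}"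
  define mult where "mult g = {a \<in> ?B. int g dvd a}" for g :: nat
  define G where "G = nat \<lfloor>1 / \<rho>\<rfloor>"
  have G: "0 < G" "1 / \<rho> < real G + 1" "1 / real G \<le> 2 * \<rho>"
  proof -
    have i1: "1 \<le> 1 / \<rho>" using \<rho> by simp
    then have f1: "1 \<le> \<lfloor>1 / \<rho>\<rfloor>" by simp
    then show G0: "0 < G" by (simp add: G_def)
    have rG: "real G = of_int \<lfloor>1 / \<rho>\<rfloor>" unfolding G_def by (rule of_nat_nat) (use f1 in linarith)
    show g1: "1 / \<rho> < real G + 1" unfolding rG by linarith
    have "1 / \<rho> \<le> 2 * real G" using g1 G0 by linarith
    then show "1 / real G \<le> 2 * \<rho>" using \<rho> G0 by (simp add: field_simps)
  qed
  have cB: "real (card ?B) \<le> 4 * N" using N0 by simp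
  have cS: "real (card S) \<le> 3 * \<rho> * N"
  proof -
    have "S \<subseteq> {- \<lfloor>\<rho> * N\<rfloor>..\<lfloor>\<rho> * N\<rfloor>}" by (auto simp: S_def abs_less_iff le_floor_iff) linarith
    then have "card S \<le> card {- \<lfloor>\<rho> * N\<rfloor>..\<lfloor>\<rho> * N\<rfloor>}" by (intro card_mono) auto
    then have "int (card S) \<le> 2 * \<lfloor>\<rho> * N\<rfloor> + 1" using N by (simp add: le_nat_iff)
    then have "real_of_int (int (card S)) \<le> of_int (2 * \<lfloor>\<rho> * N\<rfloor> + 1)" by (simp only: of_int_le_iff)
    then have "real (card S) \<le> 2 * of_int \<lfloor>\<rho> * N\<rfloor> + 1" by simp
    also have "\<dots> \<le> 3 * \<rho> * N" using N by linarith
    finally show ?thesis .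
  qed
  have cm: "real (card (mult g)) \<le> 8 * N / g" if g: "0 < g" "g \<le> 2 * N" for g
  proof -
    have "int (card (mult g)) \<le> max 0 ((2 * int N) div int g - (- 2 * int N) div int g + 1)"
      by (rule card_residue_class) (use g in \<open>auto simp: mult_def intro: dvd_diff\<close>)
    also have "\<dots> = (2 * int N) div int g - (- 2 * int N) div int g + 1"
    proof -
      have "(- 2 * int N) div int g \<le> (2 * int N) div int g" using g by (intro zdiv_mono1) auto
      then show ?thesis by simp
    qed
    finally have "int (card (mult g)) \<le> (2 * int N) div int g - (- 2 * int N) div int g + 1" .
    then have "real_of_int (int (card (mult g))) \<le> of_int ((2 * int N) div int g - (- 2 * int N) div int g + 1)"
      by (simp only: of_int_le_iff)
    then have c: "real (card (mult g)) \<le> real_of_int ((2 * int N) div int g) - real_of_int ((- 2 * int N) div int g) + 1" by simp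
    have "real_of_int ((2 * int N) div int g) \<le> 2 * N / g" using real_of_int_div4[of "2 * int N" "int g"] by simp
    moreover have "- 2 * N / g - 1 \<le> real_of_int ((- 2 * int N) div int g)" using real_of_int_div3[of "- 2 * int N" "int g"] by simp
    ultimately have "real (card (mult g)) \<le> 4 * N / g + 2" using c by simp
    also have "2 \<le> 2 * (2 * N / g)"
    proof -
      have "real g \<le> 2 * N" using g(2) by (metis of_nat_le_iff of_nat_mult of_nat_numeral)
      then have "1 \<le> 2 * N / g" using g(1) by simp
      then show ?thesis by simp
    qed
    finally show "real (card (mult g)) \<le> 8 * N / g" by simp
  qed
  let ?bad = "{p \<in> ?B \<times> ?B. \<not> spreading \<rho> N (fst p) (snd p)}"
  have finm: "finite (mult g)" for g by (rule finite_subset[of _ ?B]) (auto simp: mult_def)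
  have finS: "finite S" by (rule finite_subset[of _ ?B]) (auto simp: S_def)
  have "?bad \<subseteq> ?B \<times> S \<union> (\<Union>g\<in>{Suc G..2 * N}. mult g \<times> mult g)"
  proof
    fix p assume p: "p \<in> ?bad"
    obtain a b where ab: "p = (a, b)" by (cases p)
    show "p \<in> ?B \<times> S \<union> (\<Union>g\<in>{Suc G..2 * N}. mult g \<times> mult g)"
    proof (cases "b \<in> S")
      case False
      then have b: "\<rho> * N \<le> \<bar>real_of_int b\<bar>" using p ab by (auto simp: S_def)
      then have b0: "b \<noteq> 0" using N by auto
      then have g: "1 / \<rho> < real_of_int (gcd a b)" using p b ab by (auto simp: spreading_def)
      have "real_of_int (int G) \<le> 1 / \<rho>" using \<rho> by (simp add: G_def)
      then have "int G < gcd a b" using g by linarith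
      moreover have "gcd a b \<le> \<bar>b\<bar>" using b0 by (intro zdvd_imp_le) auto
      moreover have "\<bar>b\<bar> \<le> 2 * int N" using p ab by auto
      ultimately have "nat (gcd a b) \<in> {Suc G..2 * N}" by auto
      moreover have "p \<in> mult (nat (gcd a b)) \<times> mult (nat (gcd a b))" using p ab by (auto simp: mult_def)
      ultimately show ?thesis by blast
    qed (use p ab in auto)
  qed
  then have "card ?bad \<le> card (?B \<times> S \<union> (\<Union>g\<in>{Suc G..2 * N}. mult g \<times> mult g))"
    using finm finS by (intro card_mono) auto
  also have "\<dots> \<le> card (?B \<times> S) + card (\<Union>g\<in>{Suc G..2 * N}. mult g \<times> mult g)" by (rule card_Un_le)
  also have "\<dots> \<le> card (?B \<times> S) + (\<Sum>g\<in>{Suc G..2 * N}. card (mult g \<times> mult g))" by (intro add_left_mono card_UN_le) auto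
  finally have "real (card ?bad) \<le> real (card ?B * card S + (\<Sum>g\<in>{Suc G..2 * N}. card (mult g) * card (mult g)))"
    unfolding card_cartesian_product by (simp only: of_nat_le_iff)
  then have "real (card ?bad) \<le> real (card ?B) * real (card S) + (\<Sum>g\<in>{Suc G..2 * N}. real (card (mult g)) * real (card (mult g)))"
    by (simp only: of_nat_add of_nat_mult of_nat_sum)
  also have "\<dots> \<le> (4 * N) * (3 * \<rho> * N) + (\<Sum>g\<in>{Suc G..2 * N}. (8 * N / g) * (8 * N / g))"
    using cB cS cm \<rho> by (intro add_mono mult_mono sum_mono) auto
  also have "(\<Sum>g\<in>{Suc G..2 * N}. (8 * N / g) * (8 * N / g)) = 64 * real N^2 * (\<Sum>g\<in>{Suc G..2 * N}. 1 / (real g)^2)"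
    unfolding sum_distrib_left by (simp add: power2_eq_square)
  also have "\<dots> \<le> 64 * real N^2 * (2 * \<rho>)"
    using sum_inverse_squares_tail[OF G(1), of "2 * N"] G(3) by (intro mult_left_mono) auto
  finally show ?thesis by (simp add: power2_eq_square algebra_simps)
qed

subsection \<open>Derivatives of the third function\<close>

lemma avg_fst: "finite T \<Longrightarrow> T \<noteq> {} \<Longrightarrow> avg (S \<times> T) (\<lambda>q. f (fst q)) = avg S f"
  by (simp add: avg_times)

lemma gaps_facts: "0 < N \<Longrightarrow> finite (gaps N)" "0 < N \<Longrightarrow> gaps N \<noteq> {}" "0 < N \<Longrightarrow> real N \<le> card (gaps N)" "0 < N \<Longrightarrow> real (card (gaps N)) \<le> 2 * N"
proof -
  have "0 \<in> gaps N" if "0 < N" using that by simp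
  then show "0 < N \<Longrightarrow> gaps N \<noteq> {}" by blast
qed auto

definition autocor :: "int \<Rightarrow> (int \<Rightarrow> complex) \<Rightarrow> int \<Rightarrow> real" where
  "autocor M F u = norm (zavg M (\<lambda>y. F (y + u) * cnj (F y)))"

lemma autocor_bounds: "0 \<le> autocor M F u" "(\<And>y. norm (F y) \<le> 1) \<Longrightarrow> autocor M F u \<le> 1"
  unfolding autocor_def by (auto intro!: norm_avg_le simp: norm_mult mult_le_one)

lemma per_autocor: "per M F \<Longrightarrow> per M (autocor M F)"
  unfolding per_def autocor_def by (simp add: add.assoc[symmetric])

text \<open>The injection \<iota> rewrites the parameters as a coefficient pair together with a
  spare coordinate in \<open>T\<close>; bad parameters thus number at most the bad pairs times the
  size of \<open>T\<close>.\<close>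

lemma avg_bad_pairs:
  assumes \<rho>: "0 < \<rho>" "\<rho> \<le> 1" and N: "1 \<le> \<rho> * N"
    and fin: "finite S" and inj: "inj_on \<iota> S" and sub: "\<iota> ` S \<subseteq> (gaps (2 * N) \<times> gaps (2 * N)) \<times> T" and T: "finite T"
    and S: "real N^2 * card T \<le> card S" "0 < card T"
  shows "avg S (\<lambda>s. of_bool (\<not> spreading \<rho> N (fst (fst (\<iota> s))) (snd (fst (\<iota> s))))) \<le> 140 * \<rho>"
proof -
  have N0: "0 < N" using N by (cases "N = 0") auto
  let ?bad = "{p \<in> gaps (2 * N) \<times> gaps (2 * N). \<not> spreading \<rho> N (fst p) (snd p)}"
  let ?B = "{s \<in> S. \<not> spreading \<rho> N (fst (fst (\<iota> s))) (snd (fst (\<iota> s)))}"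
  have finb: "finite ?bad" by (rule finite_subset[of _ "gaps (2 * N) \<times> gaps (2 * N)"]) auto
  have "card ?B = card (\<iota> ` ?B)" by (rule card_image[symmetric], rule inj_on_subset[OF inj]) auto
  also have "\<dots> \<le> card (?bad \<times> T)" using sub finb T by (intro card_mono) auto
  finally have "real (card ?B) \<le> real (card ?bad * card T)" by (simp only: card_cartesian_product of_nat_le_iff)
  also have "\<dots> \<le> (140 * \<rho> * real N^2) * card T"
    unfolding of_nat_mult using card_bad_pairs[OF \<rho> N] by (intro mult_right_mono) auto
  also have "\<dots> = 140 * \<rho> * (real N^2 * card T)" by simp
  also have "\<dots> \<le> 140 * \<rho> * card S" using S \<rho> by (intro mult_left_mono) auto
  finally have "real (card ?B) \<le> 140 * \<rho> * card S" .
  moreover have "0 < real (card S)" using S N0 by (smt (verit) mult_pos_pos of_nat_0_less_iff zero_less_power)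
  ultimately show ?thesis using fin by (simp add: avg_of_bool divide_le_eq)
qed

text \<open>Products \<open>2 * k * s\<close> are badly distributed among the residues.
  Cauchy--Schwarz replaces the product by the difference \<open>2 * k * s - 2 * k' * s'\<close>, and
  for most \<open>k\<close>, \<open>k'\<close> this form in \<open>s\<close> and \<open>s'\<close>
  is spreading, so that \<open>filling\<close> applies. The term 140 \<rho> pays for the exceptional
  pairs.\<close>

lemma concatenation:
  assumes \<rho>: "0 < \<rho>" "\<rho> \<le> 1" and N: "1 \<le> \<rho> * N" and F: "per (modulus N) F" "\<And>y. norm (F y) \<le> 1"
  shows "(avg (gaps N) (\<lambda>k. avg (gaps N) (\<lambda>s. autocor (modulus N) F (2 * k * s))))\<^sup>2 \<le> 140 * \<rho> + 64 / \<rho>^2 * zavg (modulus N) (autocor (modulus N) F)"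
proof -
  define M where "M = modulus N"
  have N0: "0 < N" using N by (cases "N = 0") auto
  have M: "0 < M" using N0 modulus_pos by (simp add: M_def)
  let ?Q = "gaps N \<times> gaps N"
  define r where "r = autocor M F"
  have r: "0 \<le> r u" "r u \<le> 1" for u unfolding r_def using autocor_bounds F(2) by auto
  define R where "R u = zavg M (\<lambda>y. F (y + u) * cnj (F y))" for u
  have rR: "r u = norm (R u)" for u by (simp add: r_def R_def autocor_def)
  define u where "u q = 2 * fst q * snd q" for q :: "int \<times> int"
  define c where "c q = cnj (sgn (R (u q)))" for q
  have c1: "norm (c q) \<le> 1" for q by (simp add: c_def norm_sgn)
  have "complex_of_real (avg ?Q (\<lambda>q. r (u q))) = avg ?Q (\<lambda>q. c q * R (u q))"
    unfolding of_real_avg rR c_def cnj_sgn_mult ..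
  also have "\<dots> = zavg M (\<lambda>y. cnj (F y) * avg ?Q (\<lambda>q. c q * F (y + u q)))"
    unfolding R_def avg_cmult[symmetric] by (subst avg_swap) (simp only: mult_ac)
  finally have e: "complex_of_real (avg ?Q (\<lambda>q. r (u q))) = zavg M (\<lambda>y. cnj (F y) * avg ?Q (\<lambda>q. c q * F (y + u q)))" .
  have "(avg ?Q (\<lambda>q. r (u q)))\<^sup>2 = (norm (complex_of_real (avg ?Q (\<lambda>q. r (u q)))))\<^sup>2" by simp
  also have "\<dots> \<le> avg ?Q (\<lambda>q. avg ?Q (\<lambda>q'. norm (zavg M (\<lambda>y. (c q * F (y + u q)) * cnj (c q' * F (y + u q'))))))"
    unfolding e by (rule avg_vdc_norm) (simp add: F)
  also have "\<dots> \<le> avg ?Q (\<lambda>q. avg ?Q (\<lambda>q'. r (u q - u q')))"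
  proof (intro avg_mono)
    fix q q'
    have "zavg M (\<lambda>y. (c q * F (y + u q)) * cnj (c q' * F (y + u q'))) = (c q * cnj (c q')) * zavg M (\<lambda>y. F (y + u q) * cnj (F (y + u q')))"
      unfolding avg_cmult[symmetric] by (simp add: mult_ac)
    also have "zavg M (\<lambda>y. F (y + u q) * cnj (F (y + u q'))) = R (u q - u q')"
    proof -
      have "per M (\<lambda>y. F (y + (u q - u q')) * cnj (F y))" using F by (intro per_mult per_shift per_cnj) (auto simp: M_def)
      from avg_shift[OF this M, of "u q'"] show ?thesis by (simp add: R_def add.assoc)
    qed
    finally have "norm (zavg M (\<lambda>y. (c q * F (y + u q)) * cnj (c q' * F (y + u q')))) = norm (c q) * norm (c q') * r (u q - u q')"
      by (simp add: norm_mult rR)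
    also have "\<dots> \<le> 1 * 1 * r (u q - u q')" using c1 r by (intro mult_mono mult_nonneg_nonneg) auto
    finally show "norm (zavg M (\<lambda>y. (c q * F (y + u q)) * cnj (c q' * F (y + u q')))) \<le> r (u q - u q')" by simp
  qed
  also have "\<dots> = avg (gaps N) (\<lambda>k. avg (gaps N) (\<lambda>s. avg (gaps N) (\<lambda>k'. avg (gaps N) (\<lambda>s'. r (2 * k * s - 2 * k' * s')))))"
    by (simp only: avg_times u_def fst_conv snd_conv)
  also have "\<dots> = avg (gaps N) (\<lambda>k. avg (gaps N) (\<lambda>k'. avg (gaps N) (\<lambda>s. avg (gaps N) (\<lambda>s'. r (2 * k * s - 2 * k' * s')))))"
    by (rule avg_cong[OF refl], rule avg_swap)
  also have "\<dots> = avg ?Q (\<lambda>p. avg ?Q (\<lambda>q. r (2 * fst p * fst q + 2 * (- snd p) * snd q)))"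
    by (simp add: avg_times)
  also have "\<dots> \<le> avg ?Q (\<lambda>p. of_bool (\<not> spreading \<rho> N (fst p) (- snd p)) + 64 / \<rho>^2 * zavg M r)"
  proof (rule avg_mono)
    fix p assume p: "p \<in> ?Q"
    have z: "0 \<le> 64 / \<rho>^2 * zavg M r" using r by (intro mult_nonneg_nonneg avg_nonneg) auto
    show "avg ?Q (\<lambda>q. r (2 * fst p * fst q + 2 * (- snd p) * snd q)) \<le> of_bool (\<not> spreading \<rho> N (fst p) (- snd p)) + 64 / \<rho>^2 * zavg M r"
    proof (cases "spreading \<rho> N (fst p) (- snd p)")
      case True
      have "avg ?Q (\<lambda>q. r (2 * fst p * fst q + 2 * (- snd p) * snd q)) \<le> 64 / \<rho>^2 * zavg (modulus N) r"
        by (rule filling[OF \<rho> N0 True]) (use p r F in \<open>auto simp: r_def M_def per_autocor\<close>)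
      then show ?thesis using True by (simp add: M_def)
    next
      case False
      have "avg ?Q (\<lambda>q. r (2 * fst p * fst q + 2 * (- snd p) * snd q)) \<le> 1" using r by (intro avg_le) auto
      then show ?thesis using False z by simp
    qed
  qed
  also have "\<dots> = avg ?Q (\<lambda>p. of_bool (\<not> spreading \<rho> N (fst p) (- snd p))) + 64 / \<rho>^2 * zavg M r"
    using gaps_facts[OF N0] by (simp only: avg_add) simp
  also have "avg ?Q (\<lambda>p. of_bool (\<not> spreading \<rho> N (fst p) (- snd p))) \<le> 140 * \<rho>"
  proof -
    define \<iota> where "\<iota> p = ((fst p, - snd p), ())" for p :: "int \<times> int"
    have "avg ?Q (\<lambda>p. of_bool (\<not> spreading \<rho> N (fst (fst (\<iota> p))) (snd (fst (\<iota> p))))) \<le> 140 * \<rho>"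
    proof (rule avg_bad_pairs[OF \<rho> N, where T = UNIV])
      show "inj_on \<iota> ?Q" by (auto simp: inj_on_def \<iota>_def)
      show "\<iota> ` ?Q \<subseteq> (gaps (2 * N) \<times> gaps (2 * N)) \<times> UNIV" by (auto simp: \<iota>_def)
      have "real N * real N \<le> real (card (gaps N)) * real (card (gaps N))" using gaps_facts(3)[OF N0] by (intro mult_mono) auto
      then show "real N^2 * real (card (UNIV :: unit set)) \<le> real (card ?Q)" by (simp add: card_cartesian_product power2_eq_square)
    qed auto
    then show ?thesis by (simp add: \<iota>_def)
  qed
  finally have "(avg ?Q (\<lambda>q. r (u q)))\<^sup>2 \<le> 140 * \<rho> + 64 / \<rho>^2 * zavg M r" by simp
  then show ?thesis by (simp add: avg_times u_def r_def M_def)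
qed

lemma boxavg_le_1: "(\<And>y. norm (T y) \<le> 1) \<Longrightarrow> boxavg M N cs T \<le> 1"
proof (induction cs arbitrary: T)
  case Nil
  then show ?case by (auto intro!: norm_avg_le)
next
  case (Cons c cs)
  show ?case unfolding boxavg.simps
    by (intro avg_le Cons.IH) (auto simp: norm_mult Cons.prems mult_le_one)
qed

lemma boxavg_fill:
  assumes \<rho>: "0 < \<rho>" "\<rho> \<le> 1" and N: "0 < N" and g: "spreading \<rho> N a b" "\<bar>a\<bar> \<le> 2 * int N" "\<bar>b\<bar> \<le> 2 * int N"
    and T: "per (modulus N) T"
  shows "boxavg (modulus N) N ((2 * a, 2 * b) # cs) T \<le> 64 / \<rho>^2 * zavg (modulus N) (\<lambda>v. boxavg (modulus N) N cs (\<lambda>y. T (y + v) * cnj (T y)))"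
proof -
  have "per (modulus N) (\<lambda>v. boxavg (modulus N) N cs (\<lambda>y. T (y + v) * cnj (T y)))"
    unfolding per_def using T by (simp add: add.assoc[symmetric] perD)
  from filling[OF \<rho> N g this boxavg_nonneg] show ?thesis by simp
qed

lemma boxavg_fill3:
  assumes \<rho>: "0 < \<rho>" "\<rho> \<le> 1" and N: "0 < N"
    and g: "spreading \<rho> N a b1" "spreading \<rho> N a b2" "spreading \<rho> N a b3"
    and le: "\<bar>a\<bar> \<le> 2 * int N" "\<bar>b1\<bar> \<le> 2 * int N" "\<bar>b2\<bar> \<le> 2 * int N" "\<bar>b3\<bar> \<le> 2 * int N"
    and T: "per (modulus N) T"
  shows "boxavg (modulus N) N [(2 * a, 2 * b1), (2 * a, 2 * b2), (2 * a, 2 * b3)] T \<le>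
    (64 / \<rho>^2)^3 * vavg (modulus N) 3 (\<lambda>v. norm (zavg (modulus N) (mder v T)))"
proof -
  define M where "M = modulus N"
  define K where "K = 64 / \<rho>^2"
  have K: "0 \<le> K" using \<rho> by (simp add: K_def)
  define \<Delta> where "\<Delta> v T y = T (y + v) * cnj (T y)" for v and T :: "int \<Rightarrow> complex" and y
  have per\<Delta>: "per M (\<Delta> v T)" if "per M T" for v T unfolding \<Delta>_def using that by (intro per_mult per_cnj per_shift)
  have f: "boxavg M N ((2 * a, 2 * b) # cs) T \<le> K * zavg M (\<lambda>v. boxavg M N cs (\<Delta> v T))"
    if "spreading \<rho> N a b" "\<bar>b\<bar> \<le> 2 * int N" "per M T" for b cs T
    using boxavg_fill[OF \<rho> N that(1) le(1) that(2), of T cs] that(3) unfolding M_def K_def \<Delta>_def by simp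
  have "boxavg M N [(2 * a, 2 * b1), (2 * a, 2 * b2), (2 * a, 2 * b3)] T \<le> K * zavg M (\<lambda>v. boxavg M N [(2 * a, 2 * b2), (2 * a, 2 * b3)] (\<Delta> v T))"
    using g le T by (intro f) (auto simp: M_def)
  also have "\<dots> \<le> K * zavg M (\<lambda>v. K * zavg M (\<lambda>w. boxavg M N [(2 * a, 2 * b3)] (\<Delta> w (\<Delta> v T))))"
    using g le T K by (intro mult_left_mono avg_mono f per\<Delta>) (auto simp: M_def)
  also have "\<dots> \<le> K * zavg M (\<lambda>v. K * zavg M (\<lambda>w. K * zavg M (\<lambda>x. boxavg M N [] (\<Delta> x (\<Delta> w (\<Delta> v T))))))"
    using g le T K by (intro mult_left_mono avg_mono f per\<Delta>) (auto simp: M_def)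
  also have "\<dots> = K^3 * vavg M 3 (\<lambda>v. norm (zavg M (mder v T)))"
    unfolding avg_cmult by (simp add: numeral_3_eq_3 \<Delta>_def[abs_def])
  finally show ?thesis unfolding M_def K_def .
qed

definition mder_corr :: "int \<Rightarrow> (int \<Rightarrow> complex) \<Rightarrow> int list \<Rightarrow> real" where
  "mder_corr M F v = norm (zavg M (mder v F))"

lemma mder_corr_Cons: "mder_corr M F (u # v) = autocor M (mder v F) u"
  unfolding mder_corr_def autocor_def mder_Cons[abs_def] ..

lemma mder_corr_Cons2: "mder_corr M F (u # w # v) = autocor M (mder (u # v) F) w"
proof -
  have "mder (u # w # v) F = mder v (mder [w] (mder [u] F))" by simp
  also have "\<dots> = mder [w] (mder v (mder [u] F))" by (rule mder_commute)
  also have "mder v (mder [u] F) = mder (u # v) F" by simp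
  finally show ?thesis unfolding mder_corr_def autocor_def by simp
qed

text \<open>Derivatives commute, so either of the first two steps can play the part of the
  autocorrelation shift.\<close>

lemma autocor_swap: "autocor M (mder (w # v) F) u = autocor M (mder (u # v) F) w"
  by (rule trans[OF mder_corr_Cons[symmetric] mder_corr_Cons2])

text \<open>The exponent is 4 from removing \<open>f0\<close> and \<open>f1\<close>, times 64 from
  \<open>pair_bound\<close>. The factor 2 comes from extending \<open>x - x'\<close>, which takes
  \<open>N\<close> values, to all of \<open>gaps N\<close>.\<close>

lemma corner_box_bound:
  assumes N: "0 < N" and \<eta>: "0 \<le> \<eta>"
    and f: "bddper (modulus N) f0" "bddper (modulus N) f1" and g: "bddper (modulus N) g"
    and large: "\<eta> \<le> norm (zavg (modulus N) (\<lambda>y. avg {1..int N} (\<lambda>x. avg {1..int N} (\<lambda>z. f0 x y * f1 z y * g x (y + (z - x)^2)))))"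
  shows "\<eta> ^ 256 \<le> 2 * 4 ^ 64 * avg {1..int N} (\<lambda>x. avg (gaps N \<times> gaps N \<times> gaps N) (\<lambda>(k, h, h1).
     boxavg (modulus N) N [(2 * k, 0), (2 * h, 0), (2 * (h + k), - 2 * h1), (2 * (h + k), - 2 * k), (2 * (h + k), - 2 * (h1 + k))] (g x)))"
proof -
  define M where "M = modulus N"
  have M: "0 < M" using N modulus_pos by (simp add: M_def)
  let ?X = "{1..int N}"
  define W where "W k x = avg (gaps N) (\<lambda>h. avg (gaps N) (\<lambda>h1. boxavg M N [(2 * k, 0), (2 * h, 0), (2 * (h + k), - 2 * h1), (2 * (h + k), - 2 * k), (2 * (h + k), - 2 * (h1 + k))] (g x)))" for k x
  have W0: "0 \<le> W k x" for k x unfolding W_def by (intro avg_nonneg boxavg_nonneg)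
  define V where "V x x' = zavg M (\<lambda>y. (norm (avg ?X (\<lambda>z. g x (y + (z - x)^2) * cnj (g x' (y + (z - x')^2)))))\<^sup>2)" for x x'
  have V0: "0 \<le> V x x'" for x x' unfolding V_def by (intro avg_nonneg) auto
  have V: "V x x' ^ 64 \<le> 4 ^ 64 * W (x - x') x'" for x x'
    unfolding V_def W_def using g by (intro pair_bound[OF M N]) (auto simp: M_def dest: bddperD)
  have "\<eta> ^ 4 \<le> avg ?X (\<lambda>x. avg ?X (\<lambda>x'. V x x'))"
  proof -
    have "\<eta> ^ 4 \<le> (norm (zavg M (\<lambda>y. avg ?X (\<lambda>x. avg ?X (\<lambda>z. f0 x y * f1 z y * g x (y + (z - x)^2))))))^4"
      using large \<eta> unfolding M_def by (intro power_mono) auto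
    also have "\<dots> \<le> avg ?X (\<lambda>x. avg ?X (\<lambda>x'. V x x'))"
      unfolding V_def by (rule avg_corner_square) (use f in \<open>auto dest: bddperD\<close>)
    finally show ?thesis .
  qed
  then have "(\<eta> ^ 4) ^ (2 ^ 6) \<le> (avg ?X (\<lambda>x. avg ?X (\<lambda>x'. V x x'))) ^ (2 ^ 6)" using \<eta> by (intro power_mono) auto
  also have "\<dots> \<le> avg ?X (\<lambda>x. (avg ?X (\<lambda>x'. V x x')) ^ (2 ^ 6))" using V0 by (intro avg_power_le avg_nonneg) auto
  also have "\<dots> \<le> avg ?X (\<lambda>x. avg ?X (\<lambda>x'. V x x' ^ (2 ^ 6)))" using V0 by (intro avg_mono avg_power_le) auto
  also have "\<dots> \<le> avg ?X (\<lambda>x. avg ?X (\<lambda>x'. 4 ^ 64 * W (x - x') x'))" using V by (intro avg_mono) simp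
  also have "\<dots> = 4 ^ 64 * avg ?X (\<lambda>x'. avg ?X (\<lambda>x. W (x - x') x'))"
    unfolding avg_cmult by (subst avg_swap) simp
  also have "\<dots> \<le> 4 ^ 64 * avg ?X (\<lambda>x'. 2 * avg (gaps N) (\<lambda>k. W k x'))"
  proof (intro mult_left_mono avg_mono)
    fix x' assume x': "x' \<in> ?X"
    have "(\<Sum>x\<in>?X. W (x - x') x') = (\<Sum>k\<in>(\<lambda>x. x - x') ` ?X. W k x')" by (subst sum.reindex) (auto simp: inj_on_def)
    also have "\<dots> \<le> (\<Sum>k\<in>gaps N. W k x')" using x' W0 by (intro sum_mono2) auto
    finally have "avg ?X (\<lambda>x. W (x - x') x') \<le> (\<Sum>k\<in>gaps N. W k x') / N" by (simp add: avg_def divide_right_mono)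
    also have "\<dots> \<le> 2 * avg (gaps N) (\<lambda>k. W k x')"
    proof -
      have "0 \<le> (\<Sum>k\<in>gaps N. W k x')" using W0 by (intro sum_nonneg)
      then have "(\<Sum>k\<in>gaps N. W k x') * (1 / N) \<le> (\<Sum>k\<in>gaps N. W k x') * (2 / card (gaps N))"
        using gaps_facts(3,4)[OF N] N by (intro mult_left_mono) (simp_all add: divide_le_eq le_divide_eq)
      moreover have "S * (2 / c) = 2 * (S / c)" "S * (1 / c) = S / c" for S c :: real by simp_all
      ultimately show ?thesis unfolding avg_def by (simp only:)
    qed
    finally show "avg ?X (\<lambda>x. W (x - x') x') \<le> 2 * avg (gaps N) (\<lambda>k. W k x')" .
  qed simp
  also have "\<dots> = 2 * 4 ^ 64 * avg ?X (\<lambda>x. avg (gaps N) (\<lambda>k. W k x))" unfolding avg_cmult by simp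
  also have "(\<eta> ^ 4) ^ (2 ^ 6) = \<eta> ^ 256" by (simp add: power_mult[symmetric])
  finally show ?thesis unfolding W_def M_def by (simp only: avg_times prod.case)
qed

lemma boxavg_two:
  "boxavg M N ((c, 0) # (d, 0) # cs) G = avg (gaps N \<times> gaps N) (\<lambda>p. avg (gaps N \<times> gaps N) (\<lambda>q.
     boxavg M N cs (\<lambda>y. (G (y + d * fst q + c * fst p) * cnj (G (y + d * fst q))) * cnj (G (y + c * fst p) * cnj (G y)))))"
  by simp

text \<open>For generic \<open>k\<close>, \<open>h\<close>, \<open>h1\<close> the three
  two-dimensional directions are spreading and are replaced by free steps at a cost of 64 / \<rho>^2
  each. The other two ignore one coordinate of \<open>q\<close> and survive as products. Each of the
  three genericity conditions fails on a proportion at most 140 \<rho>.\<close>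

lemma box_fill_bound:
  assumes \<rho>: "0 < \<rho>" "\<rho> \<le> 1" and N: "1 \<le> \<rho> * N" and G: "per (modulus N) G" "\<And>y. norm (G y) \<le> 1"
  shows "avg (gaps N \<times> gaps N \<times> gaps N) (\<lambda>(k, h, h1).
     boxavg (modulus N) N [(2 * k, 0), (2 * h, 0), (2 * (h + k), - 2 * h1), (2 * (h + k), - 2 * k), (2 * (h + k), - 2 * (h1 + k))] G) \<le>
   420 * \<rho> + (64 / \<rho>^2)^3 * avg (gaps N) (\<lambda>k. avg (gaps N) (\<lambda>h. avg (gaps N) (\<lambda>s1. avg (gaps N) (\<lambda>s2.
     vavg (modulus N) 3 (\<lambda>v. mder_corr (modulus N) G (2 * k * s1 # 2 * h * s2 # v))))))"
proof -
  define M where "M = modulus N"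
  have N0: "0 < N" using N by (cases "N = 0") auto
  note Hf = gaps_facts[OF N0]
  define K where "K = (64 / \<rho>^2)^3"
  have K: "0 \<le> K" using \<rho> by (simp add: K_def)
  let ?S = "gaps N \<times> gaps N \<times> gaps N"
  define B where "B k h = avg (gaps N) (\<lambda>s1. avg (gaps N) (\<lambda>s2. vavg M 3 (\<lambda>v. mder_corr M G (2 * k * s1 # 2 * h * s2 # v))))" for k h
  have B0: "0 \<le> B k h" for k h unfolding B_def mder_corr_def by (intro avg_nonneg vavg_nonneg) auto
  define g1 where "g1 t = spreading \<rho> N (fst (snd t) + fst t) (- snd (snd t))" for t :: "int \<times> int \<times> int"
  define g2 where "g2 t = spreading \<rho> N (fst (snd t) + fst t) (- fst t)" for t :: "int \<times> int \<times> int"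
  define g3 where "g3 t = spreading \<rho> N (fst (snd t) + fst t) (- (snd (snd t) + fst t))" for t :: "int \<times> int \<times> int"
  define cs where "cs t = [(2 * fst t, 0), (2 * fst (snd t), 0), (2 * (fst (snd t) + fst t), - 2 * snd (snd t)),
     (2 * (fst (snd t) + fst t), - 2 * fst t), (2 * (fst (snd t) + fst t), - 2 * (snd (snd t) + fst t))]" for t :: "int \<times> int \<times> int"
  have "boxavg M N (cs t) G \<le> of_bool (\<not> g1 t) + of_bool (\<not> g2 t) + of_bool (\<not> g3 t) + K * B (fst t) (fst (snd t))" if t: "t \<in> ?S" for t
  proof (cases "g1 t \<and> g2 t \<and> g3 t")
    case True
    obtain k h h1 where t': "t = (k, h, h1)" by (cases t)
    have khh: "k \<in> gaps N" "h \<in> gaps N" "h1 \<in> gaps N" using t t' by auto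
    define E where "E q1 q2 y = (G (y + 2 * h * q2 + 2 * k * q1) * cnj (G (y + 2 * h * q2))) * cnj (G (y + 2 * k * q1) * cnj (G y))" for q1 q2 y :: int
    have perE: "per M (E q1 q2)" for q1 q2 unfolding E_def using G by (intro per_mult per_cnj per_shift) (simp_all add: M_def)
    have "boxavg M N (cs t) G = avg (gaps N \<times> gaps N) (\<lambda>p. avg (gaps N \<times> gaps N) (\<lambda>q. boxavg M N [(2 * (h + k), 2 * (- h1)), (2 * (h + k), 2 * (- k)), (2 * (h + k), 2 * (- (h1 + k)))] (E (fst p) (fst q))))"
    proof -
      have "cs t = (2 * k, 0) # (2 * h, 0) # [(2 * (h + k), 2 * (- h1)), (2 * (h + k), 2 * (- k)), (2 * (h + k), 2 * (- (h1 + k)))]"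
        by (simp add: cs_def t')
      then show ?thesis unfolding E_def by (simp only: boxavg_two)
    qed
    also have "\<dots> \<le> avg (gaps N \<times> gaps N) (\<lambda>p. avg (gaps N \<times> gaps N) (\<lambda>q. K * vavg M 3 (\<lambda>v. norm (zavg M (mder v (E (fst p) (fst q)))))))"
      unfolding M_def K_def
      by (intro avg_mono boxavg_fill3[OF \<rho> N0]) (use True khh perE in \<open>auto simp: g1_def g2_def g3_def t' M_def\<close>)
    also have "\<dots> = K * avg (gaps N) (\<lambda>s1. avg (gaps N) (\<lambda>s2. vavg M 3 (\<lambda>v. norm (zavg M (mder v (E s1 s2))))))"
      unfolding avg_cmult using Hf by (simp add: avg_fst[where f = "\<lambda>s1. avg (gaps N) (\<lambda>s2. vavg M 3 (\<lambda>v. norm (zavg M (mder v (E s1 s2)))))"]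
          avg_fst[where f = "\<lambda>s2. vavg M 3 (\<lambda>v. norm (zavg M (mder v (E s1 s2))))" for s1] del: vavg.simps)
    also have "\<dots> = K * B k h"
      unfolding B_def mder_corr_def by (simp add: E_def[abs_def] add_ac del: vavg.simps)
    finally show ?thesis using True by (simp add: t')
  next
    case False
    have "boxavg M N (cs t) G \<le> 1" by (rule boxavg_le_1) (rule G)
    moreover have "0 \<le> K * B (fst t) (fst (snd t))" using K B0 by simp
    ultimately show ?thesis using False by auto
  qed
  then have "avg ?S (\<lambda>t. boxavg M N (cs t) G) \<le> avg ?S (\<lambda>t. of_bool (\<not> g1 t) + of_bool (\<not> g2 t) + of_bool (\<not> g3 t) + K * B (fst t) (fst (snd t)))"
    by (rule avg_mono)
  also have "\<dots> = avg ?S (\<lambda>t. of_bool (\<not> g1 t)) + avg ?S (\<lambda>t. of_bool (\<not> g2 t)) + avg ?S (\<lambda>t. of_bool (\<not> g3 t)) + K * avg ?S (\<lambda>t. B (fst t) (fst (snd t)))"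
    by (simp only: avg_add avg_cmult)
  finally have 1: "avg ?S (\<lambda>t. boxavg M N (cs t) G) \<le> avg ?S (\<lambda>t. of_bool (\<not> g1 t)) + avg ?S (\<lambda>t. of_bool (\<not> g2 t)) + avg ?S (\<lambda>t. of_bool (\<not> g3 t)) + K * avg ?S (\<lambda>t. B (fst t) (fst (snd t)))" .
  have finS: "finite ?S" by auto
  have cS: "real N^2 * card (gaps N) \<le> card ?S" "0 < card (gaps N)"
  proof -
    have "real N * real N * card (gaps N) \<le> real (card (gaps N)) * real (card (gaps N)) * card (gaps N)" using Hf(3) by (intro mult_mono) auto
    then show "real N^2 * card (gaps N) \<le> card ?S" by (simp add: card_cartesian_product power2_eq_square mult.assoc)
    show "0 < card (gaps N)" using Hf(3) N0 by linarith
  qed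
  have b1: "avg ?S (\<lambda>t. of_bool (\<not> g1 t)) \<le> 140 * \<rho>"
  proof -
    define \<iota> where "\<iota> t = ((fst (snd t) + fst t, - snd (snd t)), fst t)" for t :: "int \<times> int \<times> int"
    have "avg ?S (\<lambda>t. of_bool (\<not> spreading \<rho> N (fst (fst (\<iota> t))) (snd (fst (\<iota> t))))) \<le> 140 * \<rho>"
      by (rule avg_bad_pairs[OF \<rho> N finS _ _ _ cS]) (auto simp: \<iota>_def inj_on_def)
    then show ?thesis by (simp add: \<iota>_def g1_def)
  qed
  have b2: "avg ?S (\<lambda>t. of_bool (\<not> g2 t)) \<le> 140 * \<rho>"
  proof -
    define \<iota> where "\<iota> t = ((fst (snd t) + fst t, - fst t), snd (snd t))" for t :: "int \<times> int \<times> int"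
    have "avg ?S (\<lambda>t. of_bool (\<not> spreading \<rho> N (fst (fst (\<iota> t))) (snd (fst (\<iota> t))))) \<le> 140 * \<rho>"
      by (rule avg_bad_pairs[OF \<rho> N finS _ _ _ cS]) (auto simp: \<iota>_def inj_on_def)
    then show ?thesis by (simp add: \<iota>_def g2_def)
  qed
  have b3: "avg ?S (\<lambda>t. of_bool (\<not> g3 t)) \<le> 140 * \<rho>"
  proof -
    define \<iota> where "\<iota> t = ((fst (snd t) + fst t, - (snd (snd t) + fst t)), fst t)" for t :: "int \<times> int \<times> int"
    have "avg ?S (\<lambda>t. of_bool (\<not> spreading \<rho> N (fst (fst (\<iota> t))) (snd (fst (\<iota> t))))) \<le> 140 * \<rho>"
      by (rule avg_bad_pairs[OF \<rho> N finS _ _ _ cS]) (auto simp: \<iota>_def inj_on_def)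
    then show ?thesis by (simp add: \<iota>_def g3_def)
  qed
  have "avg ?S (\<lambda>t. B (fst t) (fst (snd t))) = avg (gaps N) (\<lambda>k. avg (gaps N) (\<lambda>h. B k h))"
    using Hf by (simp add: avg_times)
  from 1[unfolded this] have "avg ?S (\<lambda>t. boxavg M N (cs t) G) \<le> 420 * \<rho> + K * avg (gaps N) (\<lambda>k. avg (gaps N) (\<lambda>h. B k h))"
    using b1 b2 b3 by linarith
  then show ?thesis unfolding B_def K_def M_def cs_def split_def by simp
qed

text \<open>The two one-dimensional directions \<open>2ks\<close> and \<open>2hs\<close> that remain after \<open>box_fill_bound\<close> are
  filled one after the other by \<open>concatenation\<close>.\<close>
lemma box_concatenation:
  assumes N: "0 < N" and g: "bddper (modulus N) g" and e1: "0 < e1" "e1 \<le> 1"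
    and e2: "e2 = e1^2 / 2 * (e1^2 / 280)^2 / 64" and e3: "e3 = e2^2 / 2 * (e2^2 / 280)^2 / 64" and Ne: "1 \<le> (e2^2 / 280) * N"
    and large: "e1 \<le> avg {1..int N} (\<lambda>x. avg (gaps N) (\<lambda>k. avg (gaps N) (\<lambda>h. avg (gaps N) (\<lambda>s1. avg (gaps N) (\<lambda>s2.
     vavg (modulus N) 3 (\<lambda>v. mder_corr (modulus N) (g x) (2 * k * s1 # 2 * h * s2 # v)))))))"
  shows "e3 \<le> avg {1..int N} (\<lambda>x. vavg (modulus N) 4 (\<lambda>v. zavg (modulus N) (autocor (modulus N) (mder v (g x)))))"
proof -
  define M where "M = modulus N"
  have M: "0 < M" using N modulus_pos by (simp add: M_def)
  note Hf = gaps_facts[OF N]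
  let ?X = "{1..int N}" and ?H = "gaps N"
  have X: "finite ?X" "?X \<noteq> {}" using N by auto
  have e1s: "e1^2 \<le> 1" "0 < e1^2" using e1 by (simp_all add: power_le_one)
  have e2b: "0 < e2" "e2 \<le> e1^2"
  proof -
    show "0 < e2" using e1 by (simp add: e2)
    have "(e1^2 / 280)^2 \<le> 1" using e1s by (intro power_le_one) auto
    then have "e1^2 * (e1^2 / 280)^2 \<le> e1^2 * 1" using e1s by (intro mult_left_mono) auto
    moreover have "e2 = e1^2 * (e1^2 / 280)^2 / 128" by (simp add: e2)
    ultimately show "e2 \<le> e1^2" using e1s by linarith
  qed
  have e2s: "e2^2 \<le> 1" "0 < e2^2" using e2b e1s by (simp_all add: power_le_one)
  have e2e1: "e2^2 \<le> e1^2"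
  proof -
    have "e2^2 \<le> e2" using e2b e1s by (simp add: power2_eq_square mult_left_le)
    then show ?thesis using e2b by linarith
  qed
  have \<rho>: "0 < e^2 / 280" "e^2 / 280 \<le> 1" "1 \<le> (e^2 / 280) * N" if "e2^2 \<le> e^2" "e^2 \<le> 1" for e
  proof -
    show "0 < e^2 / 280" using that e2s by linarith
    show "e^2 / 280 \<le> 1" using that by simp
    have "(e2^2 / 280) * N \<le> (e^2 / 280) * N" using that by (intro mult_right_mono) auto
    then show "1 \<le> (e^2 / 280) * N" using Ne by linarith
  qed
  have conc: "e^2 / 2 * (e^2 / 280)^2 / 64 \<le> avg I (\<lambda>i. zavg M (autocor M (F i)))"
    if e: "0 < e" "e2^2 \<le> e^2" "e^2 \<le> 1" and I: "finite I" "I \<noteq> {}"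
      and F: "\<And>i. per M (F i)" "\<And>i y. norm (F i y) \<le> 1"
      and lg: "e \<le> avg I (\<lambda>i. avg ?H (\<lambda>k. avg ?H (\<lambda>s. autocor M (F i) (2 * k * s))))" for e and I :: "'i set" and F
  proof -
    \<comment> \<open>Chosen so that the exceptional term 140 \<rho> of \<open>concatenation\<close>
      is half of \<open>e^2\<close>.\<close>
    let ?\<rho> = "e^2 / 280"
    have "e^2 \<le> (avg I (\<lambda>i. avg ?H (\<lambda>k. avg ?H (\<lambda>s. autocor M (F i) (2 * k * s)))))^2" using lg e by (intro power_mono) auto
    also have "\<dots> \<le> avg I (\<lambda>i. (avg ?H (\<lambda>k. avg ?H (\<lambda>s. autocor M (F i) (2 * k * s))))^2)" by (rule avg_square_le)
    also have "\<dots> \<le> avg I (\<lambda>i. 140 * ?\<rho> + 64 / ?\<rho>^2 * zavg M (autocor M (F i)))"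
      unfolding M_def using F \<rho>[OF e(2,3)] by (intro avg_mono concatenation) (auto simp: M_def)
    also have "\<dots> = e^2 / 2 + 64 / ?\<rho>^2 * avg I (\<lambda>i. zavg M (autocor M (F i)))"
      unfolding avg_add avg_cmult using I by simp
    finally have "e^2 / 2 \<le> 64 / ?\<rho>^2 * avg I (\<lambda>i. zavg M (autocor M (F i)))" by simp
    then show ?thesis using \<rho>[OF e(2,3)] by (simp add: pos_divide_le_eq field_simps)
  qed
  have gD: "per M (mder v (g x))" "norm (mder v (g x) y) \<le> 1" for v x y
    using bddperD[OF g] by (auto intro!: mder_per mder_norm simp: M_def)
  let ?V3 = "vecs M 3"
  have fin: "finite (vecs M m)" "vecs M m \<noteq> {}" for m using M by (induction m) auto
  have "avg ?X (\<lambda>x. avg ?H (\<lambda>k. avg ?H (\<lambda>h. avg ?H (\<lambda>s1. avg ?H (\<lambda>s2. vavg M 3 (\<lambda>v. mder_corr M (g x) (2 * k * s1 # 2 * h * s2 # v)))))))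
    = avg ?X (\<lambda>x. avg ?H (\<lambda>h. avg ?H (\<lambda>s2. avg ?V3 (\<lambda>v. avg ?H (\<lambda>k. avg ?H (\<lambda>s1. autocor M (mder (2 * h * s2 # v) (g x)) (2 * k * s1)))))))"
    (is "avg ?X ?l = avg ?X ?r")
  proof (rule avg_cong[OF refl])
    fix x
    define T where "T k h s1 s2 v = autocor M (mder (2 * h * s2 # v) (g x)) (2 * k * s1)" for k h s1 s2 v
    have "?l x = avg ?H (\<lambda>k. avg ?H (\<lambda>h. avg ?H (\<lambda>s1. avg ?H (\<lambda>s2. avg ?V3 (T k h s1 s2)))))"
      unfolding mder_corr_Cons vavg_avg T_def ..
    also have "\<dots> = avg ?H (\<lambda>k. avg ?H (\<lambda>h. avg ?H (\<lambda>s2. avg ?H (\<lambda>s1. avg ?V3 (T k h s1 s2)))))"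
      by (intro avg_cong refl avg_swap)
    also have "\<dots> = avg ?H (\<lambda>k. avg ?H (\<lambda>h. avg ?H (\<lambda>s2. avg ?V3 (\<lambda>v. avg ?H (\<lambda>s1. T k h s1 s2 v)))))"
      by (intro avg_cong refl avg_swap)
    also have "\<dots> = avg ?H (\<lambda>h. avg ?H (\<lambda>k. avg ?H (\<lambda>s2. avg ?V3 (\<lambda>v. avg ?H (\<lambda>s1. T k h s1 s2 v)))))"
      by (rule avg_swap)
    also have "\<dots> = avg ?H (\<lambda>h. avg ?H (\<lambda>s2. avg ?H (\<lambda>k. avg ?V3 (\<lambda>v. avg ?H (\<lambda>s1. T k h s1 s2 v)))))"
      by (rule avg_cong[OF refl], rule avg_swap)
    also have "\<dots> = avg ?H (\<lambda>h. avg ?H (\<lambda>s2. avg ?V3 (\<lambda>v. avg ?H (\<lambda>k. avg ?H (\<lambda>s1. T k h s1 s2 v)))))"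
      by (rule avg_cong[OF refl], rule avg_cong[OF refl], rule avg_swap)
    finally show "?l x = ?r x" unfolding T_def .
  qed
  also have "\<dots> = avg (?X \<times> ?H \<times> ?H \<times> ?V3) (\<lambda>i. avg ?H (\<lambda>k. avg ?H (\<lambda>s. autocor M (mder (2 * fst (snd i) * fst (snd (snd i)) # snd (snd (snd i))) (g (fst i))) (2 * k * s))))"
    by (simp only: avg_times fst_conv snd_conv)
  finally have l1: "e1 \<le> avg (?X \<times> ?H \<times> ?H \<times> ?V3) (\<lambda>i. avg ?H (\<lambda>k. avg ?H (\<lambda>s. autocor M (mder (2 * fst (snd i) * fst (snd (snd i)) # snd (snd (snd i))) (g (fst i))) (2 * k * s))))"
    using large unfolding M_def by (simp only:)
  have "e2 \<le> avg (?X \<times> ?H \<times> ?H \<times> ?V3) (\<lambda>i. zavg M (autocor M (mder (2 * fst (snd i) * fst (snd (snd i)) # snd (snd (snd i))) (g (fst i)))))"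
    unfolding e2 by (rule conc[OF e1(1) e2e1 e1s(1) _ _ gD l1]) (use X Hf fin in auto)
  \<comment> \<open>The step \<open>u\<close> gained from the first filling joins \<open>v\<close>,
    and \<open>2 * h * s2\<close> becomes the autocorrelation shift, so that the same argument fills
    it too.\<close>
  also have "\<dots> = avg ?X (\<lambda>x. avg ?H (\<lambda>h. avg ?H (\<lambda>s2. avg ?V3 (\<lambda>v. zavg M (\<lambda>u. autocor M (mder (u # v) (g x)) (2 * h * s2))))))"
    unfolding avg_times fst_conv snd_conv by (intro avg_cong refl) (rule autocor_swap)
  also have "\<dots> = avg ?X (\<lambda>x. vavg M 4 (\<lambda>v. avg ?H (\<lambda>h. avg ?H (\<lambda>s. autocor M (mder v (g x)) (2 * h * s)))))"
  proof (rule avg_cong[OF refl])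
    fix x
    define T where "T h s u v = autocor M (mder (u # v) (g x)) (2 * h * s)" for h s u v
    have "avg ?H (\<lambda>h. avg ?H (\<lambda>s2. avg ?V3 (\<lambda>v. zavg M (\<lambda>u. T h s2 u v)))) = avg ?H (\<lambda>h. avg ?H (\<lambda>s2. vavg M 4 (\<lambda>v. autocor M (mder v (g x)) (2 * h * s2))))"
    proof (intro avg_cong refl)
      fix h s
      have "vavg M 4 (\<lambda>v. autocor M (mder v (g x)) (2 * h * s)) = zavg M (\<lambda>u. vavg M 3 (\<lambda>v. T h s u v))"
        unfolding T_def using vavg.simps(2)[of M 3] by (simp del: mder.simps)
      also have "\<dots> = avg ?V3 (\<lambda>v. zavg M (\<lambda>u. T h s u v))" unfolding vavg_avg by (rule avg_swap)
      finally show "avg ?V3 (\<lambda>v. zavg M (\<lambda>u. T h s u v)) = vavg M 4 (\<lambda>v. autocor M (mder v (g x)) (2 * h * s))" by simp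
    qed
    also have "\<dots> = avg ?H (\<lambda>h. vavg M 4 (\<lambda>v. avg ?H (\<lambda>s2. autocor M (mder v (g x)) (2 * h * s2))))"
      by (rule avg_cong[OF refl], rule avg_vavg_swap)
    also have "\<dots> = vavg M 4 (\<lambda>v. avg ?H (\<lambda>h. avg ?H (\<lambda>s. autocor M (mder v (g x)) (2 * h * s))))" by (rule avg_vavg_swap)
    finally show "avg ?H (\<lambda>h. avg ?H (\<lambda>s2. avg ?V3 (\<lambda>v. zavg M (\<lambda>u. autocor M (mder (u # v) (g x)) (2 * h * s2))))) = vavg M 4 (\<lambda>v. avg ?H (\<lambda>h. avg ?H (\<lambda>s. autocor M (mder v (g x)) (2 * h * s))))"
      unfolding T_def .
  qed
  also have "\<dots> = avg (?X \<times> vecs M 4) (\<lambda>i. avg ?H (\<lambda>h. avg ?H (\<lambda>s. autocor M (mder (snd i) (g (fst i))) (2 * h * s))))"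
    by (simp only: avg_times fst_conv snd_conv vavg_avg)
  finally have l2: "e2 \<le> avg (?X \<times> vecs M 4) (\<lambda>i. avg ?H (\<lambda>h. avg ?H (\<lambda>s. autocor M (mder (snd i) (g (fst i))) (2 * h * s))))" .
  have "e3 \<le> avg (?X \<times> vecs M 4) (\<lambda>i. zavg M (autocor M (mder (snd i) (g (fst i)))))"
    unfolding e3 by (rule conc[OF e2b(1) order_refl e2s(1) _ _ gD l2]) (use X fin in auto)
  also have "\<dots> = avg ?X (\<lambda>x. vavg M 4 (\<lambda>v. zavg M (autocor M (mder v (g x)))))"
    by (simp only: avg_times fst_conv snd_conv vavg_avg)
  finally show ?thesis unfolding M_def .
qed

text \<open>The last derivative is given up here: for each \<open>x\<close> and \<open>v\<close> the
  averaged autocorrelation is bounded by one Fourier coefficient, whose frequency defines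
  \<open>J\<close>.\<close>

lemma autocor_correlation:
  assumes N: "0 < N" and g: "bddper (modulus N) g"
  obtains J where "avg {1..int N} (\<lambda>x. vavg (modulus N) m (\<lambda>v. zavg (modulus N) (autocor (modulus N) (mder v (g x))))) \<le> correlation N m g J"
proof -
  let ?M = "modulus N"
  have M: "0 < ?M" using N by (rule modulus_pos)
  have "\<forall>p. \<exists>j. zavg ?M (autocor ?M (mder (snd p) (g (fst p)))) \<le> norm (zavg ?M (\<lambda>y. mder (snd p) (g (fst p)) y * chi ?M j y))"
  proof
    fix p :: "int \<times> int list"
    obtain j where j: "zavg ?M (\<lambda>t. (norm (zavg ?M (\<lambda>y. mder (snd p) (g (fst p)) (y + t) * cnj (mder (snd p) (g (fst p)) y))))\<^sup>2)
      \<le> (norm (zavg ?M (\<lambda>y. mder (snd p) (g (fst p)) y * chi ?M j y)))\<^sup>2"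
      by (rule autocorrelation_le_fourier[OF mder_per mder_norm M]) (use g in \<open>auto dest: bddperD\<close>)
    have "(zavg ?M (autocor ?M (mder (snd p) (g (fst p)))))\<^sup>2 \<le> (norm (zavg ?M (\<lambda>y. mder (snd p) (g (fst p)) y * chi ?M j y)))\<^sup>2"
      by (rule order_trans[OF avg_square_le]) (use j in \<open>simp add: autocor_def\<close>)
    then show "\<exists>j. zavg ?M (autocor ?M (mder (snd p) (g (fst p)))) \<le> norm (zavg ?M (\<lambda>y. mder (snd p) (g (fst p)) y * chi ?M j y))"
      by (intro exI[of _ j]) (rule power2_le_imp_le, simp_all)
  qed
  from choice[OF this] obtain j where "\<forall>p. zavg ?M (autocor ?M (mder (snd p) (g (fst p)))) \<le> norm (zavg ?M (\<lambda>y. mder (snd p) (g (fst p)) y * chi ?M (j p) y))" ..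
  note j = this[rule_format]
  show thesis
  proof (rule that[of "\<lambda>x v. j (x, v)"])
    show "avg {1..int N} (\<lambda>x. vavg ?M m (\<lambda>v. zavg ?M (autocor ?M (mder v (g x))))) \<le> correlation N m g (\<lambda>x v. j (x, v))"
      unfolding correlation_def
    proof (intro avg_mono vavg_mono)
      fix x and v :: "int list"
      show "zavg ?M (autocor ?M (mder v (g x))) \<le> norm (zavg ?M (\<lambda>y. mder v (g x) y * chi ?M (j (x, v)) y))"
        using j[of "(x, v)"] by simp
    qed
  qed
qed

lemma corner_correlation:
  "\<exists>\<epsilon>. polylow \<epsilon> \<and> (\<forall>\<delta>. 0 < \<delta> \<longrightarrow> \<delta> \<le> 1 \<longrightarrow> \<epsilon> \<delta> \<le> \<delta>) \<and>
    (\<forall>\<eta> N f0 f1 g. 0 < \<eta> \<longrightarrow> \<eta> \<le> 1 \<longrightarrow> 1 \<le> real N * \<epsilon> \<eta> \<longrightarrow>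
      bddper (modulus N) f0 \<longrightarrow> bddper (modulus N) f1 \<longrightarrow> bddper (modulus N) g \<longrightarrow>
      \<eta> \<le> norm (zavg (modulus N) (\<lambda>y. avg {1..int N} (\<lambda>x. avg {1..int N} (\<lambda>z. f0 x y * f1 z y * g x (y + (z - x)^2))))) \<longrightarrow>
      (\<exists>J. \<epsilon> \<eta> \<le> correlation N 4 g J))"
proof -
  \<comment> \<open>The constants of \<open>corner_box_bound\<close> solved for its average.\<close>
  define a where "a \<eta> = (1 / (2 * 4 ^ 64)) * \<eta> ^ 256" for \<eta> :: real
  \<comment> \<open>With \<rho> = a / 840 the error 420 \<rho> of \<open>box_fill_bound\<close> is
    half of \<open>a\<close>; the other half, divided by the cube of 64 / \<rho>^2, is
    \<open>e1\<close>. The function \<open>nxt\<close> below is the loss in one application of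
    \<open>concatenation\<close>, applied twice.\<close>
  define e1 where "e1 \<eta> = (1 / (2 * 64 ^ 3)) * (a \<eta> * ((1 / 840) * a \<eta>) ^ 6)" for \<eta> :: real
  define nxt where "nxt e = (1 / (2 * 280^2 * 64)) * e ^ 6" for e :: real
  define e2 where "e2 \<eta> = nxt (e1 \<eta>)" for \<eta> :: real
  define e3 where "e3 \<eta> = nxt (e2 \<eta>)" for \<eta> :: real
  have nxt: "nxt e = e^2 / 2 * (e^2 / 280)^2 / 64" for e by (simp add: nxt_def power_divide power_add[symmetric] power_mult[symmetric])
  have nxt_le: "nxt e \<le> e^2 / 280" "nxt e \<le> e" "0 < nxt e" if "0 < e" "e \<le> 1" for e
  proof -
    show "0 < nxt e" using that by (simp add: nxt_def)
    have "e ^ 6 \<le> e ^ 2" "e ^ 6 \<le> e ^ 1" using that by (intro power_decreasing; simp)+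
    moreover have "0 \<le> e^6" using that by simp
    moreover have "nxt e = e^6 / 10035200" by (simp add: nxt_def)
    ultimately show "nxt e \<le> e^2 / 280" "nxt e \<le> e" by (simp_all only: power_one_right)
  qed
  have a: "0 < a \<eta>" "a \<eta> \<le> \<eta>" "a \<eta> \<le> 1" if "0 < \<eta>" "\<eta> \<le> 1" for \<eta>
  proof -
    show "0 < a \<eta>" using that by (simp add: a_def)
    have "\<eta> ^ 256 \<le> \<eta> ^ 1" using that by (intro power_decreasing) auto
    then have "1 / (2 * 4 ^ 64) * \<eta> ^ 256 \<le> 1 * \<eta>" using that by (intro mult_mono) auto
    then show "a \<eta> \<le> \<eta>" by (simp add: a_def)
    then show "a \<eta> \<le> 1" using that by simp
  qed
  have e1: "0 < e1 \<eta>" "e1 \<eta> \<le> a \<eta> / 840" "e1 \<eta> \<le> 1" if \<eta>: "0 < \<eta>" "\<eta> \<le> 1" for \<eta>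
  proof -
    note a = a[OF \<eta>]
    show "0 < e1 \<eta>" using a by (simp add: e1_def)
    have "((1 / 840) * a \<eta>) ^ 6 \<le> ((1 / 840) * a \<eta>) ^ 1" using a by (intro power_decreasing) auto
    then have "(1 / (2 * 64 ^ 3)) * (a \<eta> * ((1 / 840) * a \<eta>) ^ 6) \<le> 1 * (1 * ((1 / 840) * a \<eta>))"
      using a by (intro mult_mono) auto
    then show "e1 \<eta> \<le> a \<eta> / 840" by (simp add: e1_def)
    then show "e1 \<eta> \<le> 1" using a by simp
  qed
  have e2: "0 < e2 \<eta>" "e2 \<eta> \<le> 1" "e2 \<eta> \<le> e1 \<eta>" if "0 < \<eta>" "\<eta> \<le> 1" for \<eta>
    unfolding e2_def using nxt_le[OF e1(1,3)[OF that]] e1[OF that] by auto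
  have e3: "0 < e3 \<eta>" "e3 \<eta> \<le> (e2 \<eta>)^2 / 280" "e3 \<eta> \<le> e2 \<eta>" if "0 < \<eta>" "\<eta> \<le> 1" for \<eta>
    unfolding e3_def using nxt_le[OF e2(1,2)[OF that]] by auto
  have pa: "polylow a" unfolding a_def[abs_def] by (rule polylow_power) simp
  have pe1: "polylow e1" unfolding e1_def[abs_def] by (intro polylow_cmult polylow_mult polylow_pow pa) auto
  have pe2: "polylow e2" unfolding e2_def[abs_def] nxt_def by (intro polylow_cmult polylow_pow pe1) auto
  have pe3: "polylow e3" unfolding e3_def[abs_def] nxt_def by (intro polylow_cmult polylow_pow pe2) auto
  have main: "\<exists>J. e3 \<eta> \<le> correlation N 4 g J"
    if \<eta>: "0 < \<eta>" "\<eta> \<le> 1" and Ne: "1 \<le> real N * e3 \<eta>" and f: "bddper (modulus N) f0" "bddper (modulus N) f1" and g: "bddper (modulus N) g"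
      and large: "\<eta> \<le> norm (zavg (modulus N) (\<lambda>y. avg {1..int N} (\<lambda>x. avg {1..int N} (\<lambda>z. f0 x y * f1 z y * g x (y + (z - x)^2)))))"
    for \<eta> N f0 f1 g
  proof -
    define M where "M = modulus N"
    have N: "0 < N" using Ne by (cases "N = 0") auto
    have M: "0 < M" using N modulus_pos by (simp add: M_def)
    let ?X = "{1..int N}"
    have X: "finite ?X" "?X \<noteq> {}" using N by auto
    define \<rho> where "\<rho> = a \<eta> / 840"
    have \<rho>: "0 < \<rho>" "\<rho> \<le> 1" "1 \<le> \<rho> * N"
    proof -
      show "0 < \<rho>" "\<rho> \<le> 1" using a[OF \<eta>] by (simp_all add: \<rho>_def)
      have "e3 \<eta> \<le> \<rho>" using e1[OF \<eta>] e2[OF \<eta>] e3[OF \<eta>] by (simp add: \<rho>_def)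
      then have "real N * e3 \<eta> \<le> real N * \<rho>" by (intro mult_left_mono) auto
      then show "1 \<le> \<rho> * N" using Ne by (simp add: mult.commute)
    qed
    define E where "E = avg ?X (\<lambda>x. avg (gaps N) (\<lambda>k. avg (gaps N) (\<lambda>h. avg (gaps N) (\<lambda>s1. avg (gaps N) (\<lambda>s2.
     vavg M 3 (\<lambda>v. mder_corr M (g x) (2 * k * s1 # 2 * h * s2 # v)))))))"
    have "\<eta> ^ 256 \<le> 2 * 4 ^ 64 * avg ?X (\<lambda>x. avg (gaps N \<times> gaps N \<times> gaps N) (\<lambda>(k, h, h1).
     boxavg M N [(2 * k, 0), (2 * h, 0), (2 * (h + k), - 2 * h1), (2 * (h + k), - 2 * k), (2 * (h + k), - 2 * (h1 + k))] (g x)))"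
      unfolding M_def by (rule corner_box_bound[OF N _ f g large]) (use \<eta> in simp)
    also have "\<dots> \<le> 2 * 4 ^ 64 * avg ?X (\<lambda>x. 420 * \<rho> + (64 / \<rho>^2)^3 * avg (gaps N) (\<lambda>k. avg (gaps N) (\<lambda>h. avg (gaps N) (\<lambda>s1. avg (gaps N) (\<lambda>s2.
     vavg M 3 (\<lambda>v. mder_corr M (g x) (2 * k * s1 # 2 * h * s2 # v)))))))"
      unfolding M_def using bddperD[OF g] by (intro mult_left_mono avg_mono box_fill_bound[OF \<rho>]) auto
    also have "\<dots> = 2 * 4 ^ 64 * (420 * \<rho> + (64 / \<rho>^2)^3 * E)"
      unfolding E_def avg_add avg_cmult avg_const[OF X] ..
    finally have "\<eta> ^ 256 \<le> 2 * 4 ^ 64 * (420 * \<rho> + (64 / \<rho>^2)^3 * E)" .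
    then have "a \<eta> \<le> 420 * \<rho> + (64 / \<rho>^2)^3 * E" unfolding a_def by (simp add: field_simps)
    then have "a \<eta> / 2 \<le> (64 / \<rho>^2)^3 * E" unfolding \<rho>_def by simp
    also have "(64 / \<rho>^2)^3 * E = (64 ^ 3 * E) / \<rho> ^ 6" by (simp add: power_divide power_mult[symmetric])
    finally have "a \<eta> / 2 * \<rho> ^ 6 \<le> 64 ^ 3 * E" using \<rho>(1) by (simp add: pos_le_divide_eq)
    then have E: "e1 \<eta> \<le> E" unfolding e1_def \<rho>_def by simp
    have "e3 \<eta> \<le> avg ?X (\<lambda>x. vavg (modulus N) 4 (\<lambda>v. zavg (modulus N) (autocor (modulus N) (mder v (g x)))))"
    proof (rule box_concatenation[OF N g e1(1,3)[OF \<eta>]])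
      show "e2 \<eta> = (e1 \<eta>)^2 / 2 * ((e1 \<eta>)^2 / 280)^2 / 64" "e3 \<eta> = (e2 \<eta>)^2 / 2 * ((e2 \<eta>)^2 / 280)^2 / 64"
        unfolding e2_def e3_def nxt by simp_all
      have "real N * e3 \<eta> \<le> real N * ((e2 \<eta>)^2 / 280)" using e3[OF \<eta>] by (intro mult_left_mono) auto
      then show "1 \<le> (e2 \<eta>)^2 / 280 * N" using Ne by (simp add: mult.commute)
    qed (use E in \<open>simp only: E_def M_def\<close>)
    then show ?thesis using autocor_correlation[OF N g, of 4] by (meson order_trans)
  qed
  have le: "e3 \<delta> \<le> \<delta>" if "0 < \<delta>" "\<delta> \<le> 1" for \<delta>
    using a[OF that] e1[OF that] e2[OF that] e3[OF that] by linarith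
  show ?thesis using pe3 le main by blast
qed

subsection \<open>The first function\<close>

definition corner_avg :: "nat \<Rightarrow> (int \<Rightarrow> int \<Rightarrow> complex) \<Rightarrow> (int \<Rightarrow> int \<Rightarrow> complex) \<Rightarrow> (int \<Rightarrow> int \<Rightarrow> complex) \<Rightarrow> complex" where
  "corner_avg N f0 f1 g = zavg (modulus N) (\<lambda>y. avg {1..int N} (\<lambda>x. avg {1..int N} (\<lambda>z. f0 x y * f1 z y * g x (y + (z - x)^2))))"

lemma correlation_cnj: "correlation N m (\<lambda>x y. cnj (F x y)) J = correlation N m F (\<lambda>x v. - J x v)"
proof -
  have "norm (zavg M (\<lambda>y. mder v (\<lambda>y. cnj (F x y)) y * chi M (J x v) y)) = norm (zavg M (\<lambda>y. mder v (F x) y * chi M (- J x v) y))" for M v x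
  proof -
    have "zavg M (\<lambda>y. mder v (\<lambda>y. cnj (F x y)) y * chi M (J x v) y) = cnj (zavg M (\<lambda>y. mder v (F x) y * chi M (- J x v) y))"
      unfolding mder_cnj cnj_avg chi_minus by simp
    then show ?thesis by (simp only: complex_mod_cnj)
  qed
  then show ?thesis unfolding correlation_def by simp
qed

text \<open>The left side is the inner product of the dual function with \<open>g\<close>. By
  Cauchy--Schwarz and boundedness of \<open>g\<close> its square is at most the mean square of the
  dual function, which is its inner product with its own conjugate.\<close>

lemma dual_self_correlation:
  assumes N: "0 < N" and f: "bddper (modulus N) f0" "bddper (modulus N) f1" and g: "bddper (modulus N) g"
    and \<eta>: "0 \<le> \<eta>" "\<eta> \<le> norm (corner_avg N f0 f1 g)"
  shows "\<eta>^2 \<le> norm (corner_avg N f0 f1 (\<lambda>x y. cnj (dual N f0 f1 x y)))"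
proof -
  define M where "M = modulus N"
  have M: "0 < M" using N modulus_pos by (simp add: M_def)
  let ?P = "{1..int N} \<times> {0..<M}"
  let ?F = "dual N f0 f1"
  have F: "bddper M ?F" using dual_bddper f by (simp add: M_def)
  have c: "corner_avg N f0 f1 h = avg ?P (\<lambda>p. ?F (fst p) (snd p) * h (fst p) (snd p))" if "bddper M h" for h
    unfolding corner_avg_def M_def[symmetric] avg_times fst_conv snd_conv
    by (rule dual_correlation[symmetric]) (use M f that in \<open>auto simp: M_def dest: bddperD\<close>)
  have "\<eta>^2 \<le> (norm (avg ?P (\<lambda>p. ?F (fst p) (snd p) * g (fst p) (snd p))))^2"
    using \<eta> c[of g] g by (intro power_mono) (auto simp: M_def)
  also have "\<dots> \<le> avg ?P (\<lambda>p. (norm (?F (fst p) (snd p) * g (fst p) (snd p)))^2)" by (rule norm_avg_square_le)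
  also have "\<dots> \<le> avg ?P (\<lambda>p. (norm (?F (fst p) (snd p)))^2)"
    using g by (intro avg_mono power_mono) (auto simp: norm_mult M_def dest: bddperD(1) intro!: mult_right_le_one_le)
  also have "\<dots> = norm (complex_of_real (avg ?P (\<lambda>p. (norm (?F (fst p) (snd p)))^2)))"
    unfolding norm_of_real by (rule abs_of_nonneg[symmetric]) (intro avg_nonneg, simp)
  also have "complex_of_real (avg ?P (\<lambda>p. (norm (?F (fst p) (snd p)))^2)) = corner_avg N f0 f1 (\<lambda>x y. cnj (?F x y))"
    using F by (subst c) (auto simp: of_real_avg complex_norm_square bddper_def per_cnj simp del: of_real_power)
  finally show ?thesis .
qed

text \<open>Order 4 for the conjugated dual function, lowered to order 0, gives characters
  correlating with the dual function for many \<open>x\<close>. Their frequencies are not yet known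
  to be major; \<open>dual_correlates_character\<close>, with a weight supported where the
  correlation is large, finds one \<open>x\<close> with both properties.\<close>

lemma major_point:
  "\<exists>\<epsilon>. polylow \<epsilon> \<and> (\<forall>\<delta>. 0 < \<delta> \<longrightarrow> \<delta> \<le> 1 \<longrightarrow> \<epsilon> \<delta> \<le> \<delta>) \<and>
    (\<forall>\<eta> N f0 f1 g. 0 < \<eta> \<longrightarrow> \<eta> \<le> 1 \<longrightarrow> 1 \<le> real N * \<epsilon> \<eta> \<longrightarrow>
      bddper (modulus N) f0 \<longrightarrow> bddper (modulus N) f1 \<longrightarrow> bddper (modulus N) g \<longrightarrow> \<eta> \<le> norm (corner_avg N f0 f1 g) \<longrightarrow>
      (\<exists>x\<in>{1..int N}. \<exists>j. major N (\<epsilon> \<eta>) (of_int j / of_int (modulus N)) \<and>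
         \<epsilon> \<eta> \<le> norm (zavg (modulus N) (\<lambda>y. dual N f0 f1 x y * chi (modulus N) j y))))"
proof -
  obtain s where s: "polylow s" "\<And>\<delta>. 0 < \<delta> \<Longrightarrow> \<delta> \<le> 1 \<Longrightarrow> s \<delta> \<le> \<delta>"
    "\<And>\<eta> N f0 f1 g. 0 < \<eta> \<Longrightarrow> \<eta> \<le> 1 \<Longrightarrow> 1 \<le> real N * s \<eta> \<Longrightarrow>
      bddper (modulus N) f0 \<Longrightarrow> bddper (modulus N) f1 \<Longrightarrow> bddper (modulus N) g \<Longrightarrow> \<eta> \<le> norm (corner_avg N f0 f1 g) \<Longrightarrow>
      \<exists>J. s \<eta> \<le> correlation N 4 g J"
    using corner_correlation unfolding corner_avg_def by blast
  obtain l where l: "polylow l" "\<And>\<delta>. 0 < \<delta> \<Longrightarrow> \<delta> \<le> 1 \<Longrightarrow> l \<delta> \<le> \<delta>"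
    "\<And>\<eta> N f0 f1 J. 0 < \<eta> \<Longrightarrow> \<eta> \<le> 1 \<Longrightarrow> 1 \<le> real N * l \<eta> \<Longrightarrow> bddper (modulus N) f0 \<Longrightarrow> bddper (modulus N) f1 \<Longrightarrow>
      \<eta> \<le> correlation N 4 (dual N f0 f1) J \<Longrightarrow> \<exists>J'. l \<eta> \<le> correlation N 0 (dual N f0 f1) J'"
    using degree_lowering[of 4] by blast
  define t where "t \<eta> = l (s (\<eta>^2)) / 2" for \<eta>
  define \<epsilon> where "\<epsilon> \<eta> = (1 / (2^16 * 12000000000)) * t \<eta> ^ 32" for \<eta>
  have sq: "0 < \<eta>^2" "\<eta>^2 \<le> 1" "\<eta>^2 \<le> \<eta>" if "0 < \<eta>" "\<eta> \<le> 1" for \<eta> :: real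
  proof -
    show "0 < \<eta>^2" "\<eta>^2 \<le> 1" using that by (simp_all add: power_le_one)
    show "\<eta>^2 \<le> \<eta>" using that by (simp add: power2_eq_square mult_left_le)
  qed
  have s2: "0 < s (\<eta>^2)" "s (\<eta>^2) \<le> \<eta>" "s (\<eta>^2) \<le> 1" if "0 < \<eta>" "\<eta> \<le> 1" for \<eta>
    using sq[OF that] s(2)[of "\<eta>^2"] polylow_pos[OF s(1), of "\<eta>^2"] that by auto
  have ls: "0 < l (s (\<eta>^2))" "l (s (\<eta>^2)) \<le> s (\<eta>^2)" if "0 < \<eta>" "\<eta> \<le> 1" for \<eta>
    using s2[OF that] l(2)[of "s (\<eta>^2)"] polylow_pos[OF l(1), of "s (\<eta>^2)"] by auto
  have t: "0 < t \<eta>" "t \<eta> \<le> l (s (\<eta>^2))" "t \<eta> \<le> 1" "t \<eta> \<le> \<eta>" if "0 < \<eta>" "\<eta> \<le> 1" for \<eta>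
    using ls[OF that] s2[OF that] by (auto simp: t_def)
  have \<epsilon>: "0 < \<epsilon> \<eta>" "\<epsilon> \<eta> \<le> t \<eta>" if \<eta>: "0 < \<eta>" "\<eta> \<le> 1" for \<eta>
  proof -
    show "0 < \<epsilon> \<eta>" using t[OF \<eta>] by (simp add: \<epsilon>_def)
    have "t \<eta> ^ 32 \<le> t \<eta> ^ 1" using t[OF \<eta>] by (intro power_decreasing) auto
    then have "(1 / (2^16 * 12000000000)) * t \<eta> ^ 32 \<le> 1 * t \<eta>" using t[OF \<eta>] by (intro mult_mono) auto
    then show "\<epsilon> \<eta> \<le> t \<eta>" by (simp add: \<epsilon>_def)
  qed
  have "polylow (\<lambda>\<eta>. s (\<eta>^2))" using sq by (intro polylow_comp[OF s(1)] polylow_pow polylow_id) auto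
  then have "polylow (\<lambda>\<eta>. l (s (\<eta>^2)))" using s2 by (intro polylow_comp[OF l(1)]) auto
  then have "polylow (\<lambda>\<eta>. (1/2) * l (s (\<eta>^2)))" by (intro polylow_cmult) auto
  then have "polylow t" unfolding t_def[abs_def] by simp
  then have p\<epsilon>: "polylow \<epsilon>" unfolding \<epsilon>_def[abs_def] by (intro polylow_cmult polylow_pow) auto
  have main: "\<exists>x\<in>{1..int N}. \<exists>j. major N (\<epsilon> \<eta>) (of_int j / of_int (modulus N)) \<and>
         \<epsilon> \<eta> \<le> norm (zavg (modulus N) (\<lambda>y. dual N f0 f1 x y * chi (modulus N) j y))"
    if \<eta>: "0 < \<eta>" "\<eta> \<le> 1" and N\<epsilon>: "1 \<le> real N * \<epsilon> \<eta>" and f: "bddper (modulus N) f0" "bddper (modulus N) f1" and g: "bddper (modulus N) g"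
      and large: "\<eta> \<le> norm (corner_avg N f0 f1 g)" for \<eta> N f0 f1 g
  proof -
    define M where "M = modulus N"
    let ?F = "dual N f0 f1"
    let ?X = "{1..int N}"
    have N: "0 < N" using N\<epsilon> by (cases "N = 0") auto
    have X: "finite ?X" "?X \<noteq> {}" using N by auto
    have big: "1 \<le> real N * e" if "\<epsilon> \<eta> \<le> e" for e
      using N\<epsilon> mult_left_mono[OF that, of "real N"] by simp
    have "bddper (modulus N) (\<lambda>x y. cnj (?F x y))" using dual_bddper[OF f] by (auto simp: bddper_def per_cnj)
    moreover have "1 \<le> real N * s (\<eta>^2)" using big \<epsilon>[OF \<eta>] t[OF \<eta>] ls[OF \<eta>] by auto
    ultimately obtain J0 where "s (\<eta>^2) \<le> correlation N 4 (\<lambda>x y. cnj (?F x y)) J0"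
      using s(3)[OF sq(1,2)[OF \<eta>] _ f] dual_self_correlation[OF N f g _ large] \<eta> by force
    then have "s (\<eta>^2) \<le> correlation N 4 ?F (\<lambda>x v. - J0 x v)" by (simp only: correlation_cnj)
    moreover have "1 \<le> real N * l (s (\<eta>^2))" using big \<epsilon>[OF \<eta>] t[OF \<eta>] by auto
    ultimately obtain J1 where J1: "l (s (\<eta>^2)) \<le> correlation N 0 ?F J1"
      using l(3)[OF s2(1,3)[OF \<eta>] _ f] by blast
    define J where "J x = J1 x []" for x
    define Z where "Z x = zavg M (\<lambda>y. ?F x y * chi M (J x) y)" for x
    \<comment> \<open>The weight is supported where the correlation is at least
      \<open>t \<eta>\<close>, so nonvanishing of \<open>c x\<close> returns that lower
      bound.\<close>
    define c where "c x = of_bool (t \<eta> \<le> norm (Z x)) * cnj (sgn (Z x))" for x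
    have c1: "norm (c x) \<le> 1" for x unfolding c_def norm_mult by (simp add: norm_sgn)
    have "2 * t \<eta> \<le> avg ?X (\<lambda>x. norm (Z x))" using J1 by (simp add: t_def correlation_def Z_def J_def M_def)
    also have "\<dots> \<le> avg ?X (\<lambda>x. of_bool (t \<eta> \<le> norm (Z x)) * norm (Z x) + t \<eta>)"
      using t[OF \<eta>] by (intro avg_mono) auto
    also have "\<dots> = avg ?X (\<lambda>x. of_bool (t \<eta> \<le> norm (Z x)) * norm (Z x)) + t \<eta>" using X by (simp add: avg_add)
    also have "avg ?X (\<lambda>x. of_bool (t \<eta> \<le> norm (Z x)) * norm (Z x)) \<le> norm (avg ?X (\<lambda>x. c x * Z x))"
    proof -
      have "c x * Z x = of_real (of_bool (t \<eta> \<le> norm (Z x)) * norm (Z x))" for x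
        unfolding c_def mult.assoc cnj_sgn_mult by simp
      then have "avg ?X (\<lambda>x. c x * Z x) = of_real (avg ?X (\<lambda>x. of_bool (t \<eta> \<le> norm (Z x)) * norm (Z x)))"
        unfolding of_real_avg by (simp only:)
      then show ?thesis by (simp only: norm_of_real abs_ge_self)
    qed
    finally have cZ: "t \<eta> \<le> norm (avg ?X (\<lambda>x. c x * Z x))" by simp
    have e\<epsilon>: "((t \<eta>)^2 / 2)^16 / 12000000000 = \<epsilon> \<eta>" by (simp add: \<epsilon>_def power_divide power_mult[symmetric])
    have "0 < (t \<eta>)^4 / 2" using t[OF \<eta>] by simp
    also have "\<dots> \<le> avg ?X (\<lambda>x. of_bool (c x \<noteq> 0 \<and> major N (\<epsilon> \<eta>) (of_int (J x) / of_int M)))"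
      using dual_correlates_character[OF t(1,3)[OF \<eta>] _ f c1, where J = J] N\<epsilon> cZ unfolding e\<epsilon> Z_def M_def by simp
    finally have "\<exists>x\<in>?X. c x \<noteq> 0 \<and> major N (\<epsilon> \<eta>) (of_int (J x) / of_int M)"
    proof (rule contrapos_pp)
      assume "\<not> (\<exists>x\<in>?X. c x \<noteq> 0 \<and> major N (\<epsilon> \<eta>) (of_int (J x) / of_int M))"
      then have "avg ?X (\<lambda>x. of_bool (c x \<noteq> 0 \<and> major N (\<epsilon> \<eta>) (of_int (J x) / of_int M))) = avg ?X (\<lambda>x. 0 :: real)"
        by (intro avg_cong refl) auto
      then show "\<not> 0 < avg ?X (\<lambda>x. of_bool (c x \<noteq> 0 \<and> major N (\<epsilon> \<eta>) (of_int (J x) / of_int M)) :: real)"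
        using X by simp
    qed
    then obtain x where x: "x \<in> ?X" "c x \<noteq> 0" "major N (\<epsilon> \<eta>) (of_int (J x) / of_int M)" by blast
    then have "t \<eta> \<le> norm (Z x)" by (auto simp: c_def)
    then have "\<epsilon> \<eta> \<le> norm (Z x)" using \<epsilon>[OF \<eta>] by linarith
    then show ?thesis using x unfolding Z_def M_def by blast
  qed
  have le: "\<epsilon> \<delta> \<le> \<delta>" if "0 < \<delta>" "\<delta> \<le> 1" for \<delta> using \<epsilon>[OF that] t[OF that] by linarith
  show ?thesis using p\<epsilon> le main by blast
qed

section \<open>From a quadratic phase on a major arc to a linear phase\<close>

lemma parseval_window:
  fixes T :: "int \<Rightarrow> complex"
  assumes M: "0 < M" and T: "\<And>\<zeta>. T \<zeta> \<noteq> 0 \<Longrightarrow> - n \<le> \<zeta> \<and> \<zeta> < M - n" and S: "finite S" "\<And>\<zeta>. T \<zeta> \<noteq> 0 \<Longrightarrow> \<zeta> \<in> S"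
  shows "of_int M * (\<Sum>\<zeta>\<in>S. (norm (T \<zeta>))\<^sup>2) = (\<Sum>j\<in>{0..<M}. (norm (\<Sum>\<zeta>\<in>S. T \<zeta> * chi M j \<zeta>))\<^sup>2)"
proof -
  \<comment> \<open>The support of \<open>T\<close> fits into one period starting at
    \<open>- n\<close>. Hence sums over \<open>S\<close> are sums over all residues, and moving the
    window only multiplies Fourier coefficients by unimodular factors.\<close>
  have re: "(\<Sum>y\<in>{0..<M}. h (y - n)) = (\<Sum>\<zeta>\<in>S. h \<zeta>)" if h: "\<And>\<zeta>. T \<zeta> = 0 \<Longrightarrow> h \<zeta> = 0" for h :: "int \<Rightarrow> 'c::comm_monoid_add"
  proof -
    have "(\<Sum>y\<in>{0..<M}. h (y - n)) = (\<Sum>\<zeta>\<in>{- n..<M - n}. h \<zeta>)"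
      by (rule sum.reindex_bij_witness[where i = "\<lambda>\<zeta>. \<zeta> + n" and j = "\<lambda>y. y - n"]) auto
    also have "\<dots> = (\<Sum>\<zeta>\<in>{- n..<M - n} \<inter> S. h \<zeta>)" using h S(2) by (intro sum.mono_neutral_right) auto
    also have "\<dots> = (\<Sum>\<zeta>\<in>S. h \<zeta>)" using h T S(1) by (intro sum.mono_neutral_left) force+
    finally show ?thesis .
  qed
  have M0: "real_of_int M > 0" using M by simp
  have "(norm (zavg M (\<lambda>y. T (y - n) * chi M j y)))\<^sup>2 = (norm (\<Sum>\<zeta>\<in>S. T \<zeta> * chi M j \<zeta>))\<^sup>2 / (of_int M)^2" for j
  proof -
    have "(\<Sum>y\<in>{0..<M}. T (y - n) * chi M j y) = (\<Sum>y\<in>{0..<M}. (\<lambda>\<zeta>. T \<zeta> * chi M j \<zeta> * chi M j n) (y - n))"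
      by (intro sum.cong refl) (simp add: chi_add_right[symmetric] mult.assoc)
    also have "\<dots> = (\<Sum>\<zeta>\<in>S. T \<zeta> * chi M j \<zeta>) * chi M j n" unfolding sum_distrib_right by (rule re) simp
    finally show ?thesis using M by (simp add: norm_avg_complex norm_mult power_divide)
  qed
  then have "(\<Sum>j\<in>{0..<M}. (norm (\<Sum>\<zeta>\<in>S. T \<zeta> * chi M j \<zeta>))\<^sup>2 / (of_int M)^2) = zavg M (\<lambda>y. (norm (T (y - n)))\<^sup>2)"
    using parseval[OF M, of "\<lambda>y. T (y - n)"] by simp
  also have "\<dots> = (\<Sum>\<zeta>\<in>S. (norm (T \<zeta>))\<^sup>2) / of_int M"
    unfolding avg_def using re[of "\<lambda>\<zeta>. (norm (T \<zeta>))\<^sup>2"] M by simp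
  finally show ?thesis using M0 by (simp add: sum_divide_distrib[symmetric] field_simps power2_eq_square)
qed

text \<open>Along a progression of step \<open>q\<close> and length \<open>L\<close> the phase moves
  by at most 5NL / (\<epsilon> N^2), because \<open>q * \<theta>\<close> is nearly an integer. The
  bound for \<open>L\<close> makes this at most \<epsilon> / 80, and 2 pi < 20 / 3 turns it into
  \<epsilon> / 12. The slowly varying phase is then pulled out of each progression and discarded in
  the norm.\<close>

lemma short_progressions:
  fixes f :: "int \<Rightarrow> complex" and \<theta> \<epsilon> :: real and q L :: nat
  assumes f: "\<And>z. norm (f z) \<le> 1" "\<And>z. f z \<noteq> 0 \<Longrightarrow> z \<in> {1..int N}" and x: "x \<in> {1..int N}"
    and \<epsilon>: "0 < \<epsilon>" and q: "torus_norm (real q * \<theta>) \<le> 1 / (\<epsilon> * real N^2)"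
    and L: "real L \<le> \<epsilon>^2 * N / 400" "q * L \<le> N" and N: "0 < N"
  shows "L * norm (\<Sum>z\<in>{1..int N}. f z * unit_char (\<theta> * of_int ((z - x)^2))) \<le>
    (\<Sum>\<zeta>\<in>{- int N..int N}. norm (\<Sum>w\<in>{0..<int L}. f (\<zeta> + int q * w))) + L * (N * (\<epsilon> / 12))"
proof -
  let ?W = "{0..<int L}" and ?Z = "{- int N..int N}"
  define K where "K z = unit_char (\<theta> * of_int ((z - x)^2))" for z
  define \<rho> where "\<rho> = real q * \<theta> - of_int (round (real q * \<theta>))"
  have \<rho>: "\<bar>\<rho>\<bar> \<le> 1 / (\<epsilon> * real N^2)" using q by (simp add: \<rho>_def torus_norm_def)
  have qw: "0 \<le> int q * w" "int q * w \<le> int N" if "w \<in> ?W" for w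
  proof -
    show "0 \<le> int q * w" using that by simp
    have "int q * w \<le> int q * int L" using that by (intro mult_left_mono) auto
    also have "\<dots> \<le> int N" using L(2) by (simp only: of_nat_mult[symmetric] of_nat_le_iff)
    finally show "int q * w \<le> int N" .
  qed
  have shift: "(\<Sum>\<zeta>\<in>?Z. F (\<zeta> + int q * w)) = (\<Sum>z\<in>{1..int N}. F z)"
    if "w \<in> ?W" "\<And>z. F z \<noteq> 0 \<Longrightarrow> z \<in> {1..int N}" for w and F :: "int \<Rightarrow> 'c::comm_monoid_add"
    using qw[OF that(1)] that(2) by (intro sum_shift_support) auto
  have Kdiff: "norm (K (\<zeta> + int q * w) - K \<zeta>) \<le> \<epsilon> / 12" if "\<zeta> \<in> ?Z" "w \<in> ?W" for \<zeta> w
  proof -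
    define W U Q where "W = real_of_int w" and "U = real_of_int (\<zeta> - x)" and "Q = real q"
    let ?t = "(2 * W * U + Q * W^2) * \<rho>"
    have "K (\<zeta> + int q * w) = K \<zeta> * unit_char ?t"
      unfolding K_def unit_char_add[symmetric] W_def U_def Q_def
      by (rule unit_char_mod1[where m = "(2 * w * (\<zeta> - x) + int q * w^2) * round (real q * \<theta>)"])
         (simp add: \<rho>_def power2_eq_square algebra_simps)
    then have "norm (K (\<zeta> + int q * w) - K \<zeta>) = norm (K \<zeta> * (unit_char ?t - 1))" by (simp add: algebra_simps)
    also have "\<dots> = norm (unit_char ?t - 1)" by (simp add: norm_mult K_def)
    also have "\<dots> \<le> 2 * pi * torus_norm ?t" by (rule unit_char_near_1)
    also have "\<dots> \<le> 2 * pi * \<bar>?t\<bar>" by (intro mult_left_mono torus_norm_le_abs) auto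
    also have "\<bar>?t\<bar> \<le> (5 * N * L) * (1 / (\<epsilon> * real N^2))"
    proof -
      have w0: "0 \<le> W" "W \<le> L" using that by (auto simp: W_def)
      have "\<bar>\<zeta> - x\<bar> \<le> 2 * int N" using that x by auto
      then have u0: "\<bar>U\<bar> \<le> 2 * N" unfolding U_def by linarith
      have Q: "0 \<le> Q" "Q * W \<le> N" using qw(2)[OF that(2)] unfolding Q_def W_def by (simp, metis of_int_le_iff of_int_mult of_int_of_nat_eq)
      have "\<bar>2 * W * U\<bar> \<le> 2 * real L * (2 * N)" unfolding abs_mult using w0 u0 by (intro mult_mono) auto
      moreover have "\<bar>Q * W^2\<bar> \<le> N * real L"
      proof -
        have "(Q * W) * W \<le> real N * real L" using w0 Q by (intro mult_mono) auto
        then show ?thesis using w0 Q by (simp add: power2_eq_square mult.assoc)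
      qed
      moreover have "2 * real L * real (2 * N) + real N * real L = 5 * N * L" by simp
      ultimately have "\<bar>2 * W * U + Q * W^2\<bar> \<le> 5 * N * L" by linarith
      then show ?thesis unfolding abs_mult[of _ \<rho>] using \<rho> by (intro mult_mono) auto
    qed
    also have "\<dots> = 5 * (L / (\<epsilon> * N))" using N \<epsilon> by (simp add: field_simps power2_eq_square)
    also have "L / (\<epsilon> * N) \<le> \<epsilon> / 400" using L(1) N \<epsilon> by (simp add: field_simps power2_eq_square)
    finally have "norm (K (\<zeta> + int q * w) - K \<zeta>) \<le> 2 * pi * (5 * (\<epsilon> / 400))" by simp
    also have "\<dots> \<le> 2 * (10 / 3) * (5 * (\<epsilon> / 400))" using pi_less_4 pi_approx \<epsilon> by (intro mult_right_mono mult_left_mono) auto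
    finally show ?thesis by simp
  qed
  have "L * (\<Sum>z\<in>{1..int N}. f z * K z) = (\<Sum>w\<in>?W. \<Sum>\<zeta>\<in>?Z. f (\<zeta> + int q * w) * K (\<zeta> + int q * w))"
    using shift[of _ "\<lambda>z. f z * K z"] f(2) by simp
  also have "\<dots> = (\<Sum>\<zeta>\<in>?Z. \<Sum>w\<in>?W. f (\<zeta> + int q * w) * K (\<zeta> + int q * w))" by (rule sum.swap)
  also have "\<dots> = (\<Sum>\<zeta>\<in>?Z. (\<Sum>w\<in>?W. f (\<zeta> + int q * w)) * K \<zeta> + (\<Sum>w\<in>?W. f (\<zeta> + int q * w) * (K (\<zeta> + int q * w) - K \<zeta>)))"
    by (rule sum.cong[OF refl]) (simp add: sum_distrib_right right_diff_distrib sum_subtractf)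
  finally have e: "L * (\<Sum>z\<in>{1..int N}. f z * K z) = (\<Sum>\<zeta>\<in>?Z. (\<Sum>w\<in>?W. f (\<zeta> + int q * w)) * K \<zeta> + (\<Sum>w\<in>?W. f (\<zeta> + int q * w) * (K (\<zeta> + int q * w) - K \<zeta>)))" .
  have "L * norm (\<Sum>z\<in>{1..int N}. f z * K z) = norm (of_nat L * (\<Sum>z\<in>{1..int N}. f z * K z))" by (simp add: norm_mult)
  also have "\<dots> \<le> (\<Sum>\<zeta>\<in>?Z. norm ((\<Sum>w\<in>?W. f (\<zeta> + int q * w)) * K \<zeta> + (\<Sum>w\<in>?W. f (\<zeta> + int q * w) * (K (\<zeta> + int q * w) - K \<zeta>))))"
    unfolding e by (rule norm_sum)
  also have "\<dots> \<le> (\<Sum>\<zeta>\<in>?Z. norm (\<Sum>w\<in>?W. f (\<zeta> + int q * w)) + (\<Sum>w\<in>?W. norm (f (\<zeta> + int q * w)) * (\<epsilon> / 12)))"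
  proof (rule sum_mono)
    fix \<zeta> assume z: "\<zeta> \<in> ?Z"
    have "norm (\<Sum>w\<in>?W. f (\<zeta> + int q * w) * (K (\<zeta> + int q * w) - K \<zeta>)) \<le> (\<Sum>w\<in>?W. norm (f (\<zeta> + int q * w)) * (\<epsilon> / 12))"
    proof (rule order_trans[OF norm_sum], rule sum_mono)
      fix w assume "w \<in> ?W"
      then show "norm (f (\<zeta> + int q * w) * (K (\<zeta> + int q * w) - K \<zeta>)) \<le> norm (f (\<zeta> + int q * w)) * (\<epsilon> / 12)"
        unfolding norm_mult by (intro mult_left_mono Kdiff[OF z]) auto
    qed
    moreover have "norm ((\<Sum>w\<in>?W. f (\<zeta> + int q * w)) * K \<zeta>) = norm (\<Sum>w\<in>?W. f (\<zeta> + int q * w))" by (simp add: norm_mult K_def)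
    ultimately show "norm ((\<Sum>w\<in>?W. f (\<zeta> + int q * w)) * K \<zeta> + (\<Sum>w\<in>?W. f (\<zeta> + int q * w) * (K (\<zeta> + int q * w) - K \<zeta>)))
      \<le> norm (\<Sum>w\<in>?W. f (\<zeta> + int q * w)) + (\<Sum>w\<in>?W. norm (f (\<zeta> + int q * w)) * (\<epsilon> / 12))"
      using norm_triangle_ineq[of "(\<Sum>w\<in>?W. f (\<zeta> + int q * w)) * K \<zeta>"] by (smt (verit))
  qed
  also have "\<dots> = (\<Sum>\<zeta>\<in>?Z. norm (\<Sum>w\<in>?W. f (\<zeta> + int q * w))) + (\<Sum>w\<in>?W. (\<Sum>\<zeta>\<in>?Z. norm (f (\<zeta> + int q * w))) * (\<epsilon> / 12))"
    unfolding sum.distrib sum_distrib_right by (subst (2) sum.swap) simp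
  also have "(\<Sum>w\<in>?W. (\<Sum>\<zeta>\<in>?Z. norm (f (\<zeta> + int q * w))) * (\<epsilon> / 12)) \<le> (\<Sum>w\<in>?W. N * (\<epsilon> / 12))"
  proof (intro sum_mono mult_right_mono)
    fix w assume w: "w \<in> ?W"
    have "(\<Sum>\<zeta>\<in>?Z. norm (f (\<zeta> + int q * w))) = (\<Sum>z\<in>{1..int N}. norm (f z))"
      by (rule shift[OF w]) (use f(2) in auto)
    also have "\<dots> \<le> real (card {1..int N}) * 1" using f(1) by (intro sum_bounded_above) auto
    finally show "(\<Sum>\<zeta>\<in>?Z. norm (f (\<zeta> + int q * w))) \<le> N" by simp
  qed (use \<epsilon> in auto)
  also have "\<dots> = L * (N * (\<epsilon> / 12))" by simp
  finally show ?thesis unfolding K_def by simp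
qed

lemma ex_ge_sum_div_card:
  fixes A :: "'a \<Rightarrow> real"
  assumes B: "finite B" and S: "0 < S" "S \<le> (\<Sum>i\<in>B. A i)" and K: "real (card B) \<le> K"
  obtains i where "i \<in> B" "S / K \<le> A i"
proof -
  have "B \<noteq> {}" using S by auto
  then have cB: "0 < real (card B)" using B by (simp add: card_gt_0_iff)
  have "\<exists>i\<in>B. S / K \<le> A i"
  proof (rule ccontr)
    assume "\<not> (\<exists>i\<in>B. S / K \<le> A i)"
    then have "(\<Sum>i\<in>B. A i) < (\<Sum>i\<in>B. S / K)" using B \<open>B \<noteq> {}\<close> by (intro sum_strict_mono) auto
    also have "\<dots> = S * (real (card B) / K)" by simp
    also have "\<dots> \<le> S * 1" using S cB K by (intro mult_left_mono) auto
    finally show False using S by simp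
  qed
  then show thesis using that by blast
qed

text \<open>Sums along progressions are convolutions, so their Fourier coefficients are those of
  \<open>f y\<close> times the geometric sum \<open>E\<close>. Cauchy--Schwarz over at most 3N
  starting points and Parseval leave a sum in which frequencies with small \<open>E\<close> are
  negligible. The others have \<open>q\<close> times the frequency near an integer and are few;
  averaging over \<open>y\<close> before choosing makes one frequency serve all
  \<open>y\<close>.\<close>

lemma window_frequency:
  fixes f :: "'y \<Rightarrow> int \<Rightarrow> complex" and q L N :: nat and \<epsilon> \<tau> K :: real
  assumes f: "\<And>y z. norm (f y z) \<le> 1" "\<And>y z. f y z \<noteq> 0 \<Longrightarrow> z \<in> {1..int N}" and Y: "finite Y" "Y \<noteq> {}"
    and N0: "0 < N" and N: "2 * int N < M" and L: "0 < L" "q * L \<le> N" and \<epsilon>: "0 < \<epsilon>"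
    and large: "11 / 12 * \<epsilon> * N * L \<le> avg Y (\<lambda>y. \<Sum>\<zeta>\<in>{- int N..int N}. norm (\<Sum>w\<in>{0..<int L}. f y (\<zeta> + int q * w)))"
    and \<tau>: "2 / (\<epsilon> * L) \<le> \<tau>"
    and K: "real (card {i \<in> {0..<M}. torus_norm (real q * (of_int i / of_int M)) \<le> \<tau>}) \<le> K"
  obtains i where "torus_norm (real q * (of_int i / of_int M)) \<le> \<tau>"
    "\<epsilon>^2 * N * of_int M / (8 * K) \<le> avg Y (\<lambda>y. (norm (\<Sum>z\<in>{1..int N}. f y z * chi M i z))\<^sup>2)"
proof -
  let ?W = "{0..<int L}" and ?Z = "{- int N..int N}"
  define T where "T y \<zeta> = (\<Sum>w\<in>?W. f y (\<zeta> + int q * w))" for y \<zeta>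
  define F where "F y i = (\<Sum>z\<in>{1..int N}. f y z * chi M i z)" for y i
  define E where "E i = (\<Sum>w\<in>?W. cnj (chi M i (int q * w)))" for i
  \<comment> \<open>With threshold \<epsilon> L / 4 the frequencies outside \<open>B\<close>
    contribute at most \<epsilon>^2 N / 16, below the available 121 / 432 times \<epsilon>^2 N; at
    least an eighth remains for \<open>B\<close>.\<close>
  define B where "B = {i \<in> {0..<M}. \<epsilon> * L / 4 \<le> norm (E i)}"
  have M: "0 < M" using N by linarith
  have qw: "0 \<le> int q * w" "int q * w \<le> int N" if "w \<in> ?W" for w
  proof -
    show "0 \<le> int q * w" using that by simp
    have "int q * w \<le> int q * int L" using that by (intro mult_left_mono) auto
    also have "\<dots> \<le> int N" using L(2) by (simp only: of_nat_mult[symmetric] of_nat_le_iff)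
    finally show "int q * w \<le> int N" .
  qed
  have T0: "- int N \<le> \<zeta> \<and> \<zeta> < M - int N" "\<zeta> \<in> ?Z" if "T y \<zeta> \<noteq> 0" for y \<zeta>
  proof -
    obtain w where w: "w \<in> ?W" "f y (\<zeta> + int q * w) \<noteq> 0" using \<open>T y \<zeta> \<noteq> 0\<close> unfolding T_def by (meson sum.neutral)
    have "1 \<le> \<zeta> + int q * w" "\<zeta> + int q * w \<le> int N" using f(2)[OF w(2)] by auto
    then have "- int N \<le> \<zeta>" "\<zeta> \<le> int N" using qw[OF w(1)] by linarith+
    then show "- int N \<le> \<zeta> \<and> \<zeta> < M - int N" "\<zeta> \<in> ?Z" using N by auto
  qed
  have FE: "(\<Sum>\<zeta>\<in>?Z. T y \<zeta> * chi M i \<zeta>) = F y i * E i" for y i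
  proof -
    have "(\<Sum>\<zeta>\<in>?Z. T y \<zeta> * chi M i \<zeta>) = (\<Sum>\<zeta>\<in>?Z. \<Sum>w\<in>?W. f y (\<zeta> + int q * w) * chi M i (\<zeta> + int q * w) * cnj (chi M i (int q * w)))"
      unfolding T_def sum_distrib_right
      by (intro sum.cong refl) (simp add: mult.assoc chi_diff_right)
    also have "\<dots> = (\<Sum>w\<in>?W. \<Sum>\<zeta>\<in>?Z. f y (\<zeta> + int q * w) * chi M i (\<zeta> + int q * w) * cnj (chi M i (int q * w)))" by (rule sum.swap)
    also have "\<dots> = (\<Sum>w\<in>?W. F y i * cnj (chi M i (int q * w)))"
    proof (rule sum.cong[OF refl])
      fix w assume w: "w \<in> ?W"
      have "(\<Sum>\<zeta>\<in>?Z. f y (\<zeta> + int q * w) * chi M i (\<zeta> + int q * w)) = F y i"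
        unfolding F_def using f(2) qw[OF w] by (intro sum_shift_support[where F = "\<lambda>z. f y z * chi M i z"]) auto
      then show "(\<Sum>\<zeta>\<in>?Z. f y (\<zeta> + int q * w) * chi M i (\<zeta> + int q * w) * cnj (chi M i (int q * w))) = F y i * cnj (chi M i (int q * w))"
        by (simp only: sum_distrib_right[symmetric])
    qed
    finally show ?thesis by (simp only: E_def sum_distrib_left)
  qed
  have PT: "of_int M * (\<Sum>\<zeta>\<in>?Z. (norm (T y \<zeta>))\<^sup>2) = (\<Sum>i\<in>{0..<M}. (norm (F y i))\<^sup>2 * (norm (E i))\<^sup>2)" for y
    using parseval_window[where T = "T y", OF M T0(1) finite_atLeastAtMost_int T0(2)] unfolding FE norm_mult power_mult_distrib .
  have PF: "(\<Sum>i\<in>{0..<M}. (norm (F y i))\<^sup>2) \<le> of_int M * N" for y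
  proof -
    have "(\<Sum>i\<in>{0..<M}. (norm (F y i))\<^sup>2) = of_int M * (\<Sum>z\<in>{1..int N}. (norm (f y z))\<^sup>2)"
      unfolding F_def by (rule parseval_window[symmetric, where n = 0]) (use M N f(2) in force)+
    also have "(\<Sum>z\<in>{1..int N}. (norm (f y z))\<^sup>2) \<le> real (card {1..int N}) * 1"
      using f(1) by (intro sum_bounded_above power_le_one) auto
    finally show ?thesis using M by (simp add: mult_left_mono)
  qed
  have cs: "(\<Sum>\<zeta>\<in>?Z. norm (T y \<zeta>))^2 \<le> 3 * N * (\<Sum>\<zeta>\<in>?Z. (norm (T y \<zeta>))\<^sup>2)" for y
  proof -
    have "(\<Sum>\<zeta>\<in>?Z. 1 * norm (T y \<zeta>))^2 \<le> (\<Sum>\<zeta>\<in>?Z. 1^2) * (\<Sum>\<zeta>\<in>?Z. (norm (T y \<zeta>))\<^sup>2)"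
      by (rule Cauchy_Schwarz_ineq_sum)
    also have "\<dots> \<le> 3 * N * (\<Sum>\<zeta>\<in>?Z. (norm (T y \<zeta>))\<^sup>2)"
      using N0 by (intro mult_right_mono sum_nonneg) auto
    finally show ?thesis by simp
  qed
  define A where "A i = avg Y (\<lambda>y. (norm (F y i))\<^sup>2)" for i
  have A0: "0 \<le> A i" for i unfolding A_def by (intro avg_nonneg) simp
  have avg_sum: "avg Y (\<lambda>y. \<Sum>i\<in>{0..<M}. h y i) = (\<Sum>i\<in>{0..<M}. avg Y (\<lambda>y. h y i))" for h :: "'y \<Rightarrow> int \<Rightarrow> real"
    unfolding avg_def by (subst sum.swap) (simp only: sum_divide_distrib)
  have sumA: "(\<Sum>i\<in>{0..<M}. A i) \<le> of_int M * N"
    unfolding A_def avg_sum[symmetric] using PF M by (intro avg_le) auto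
  have "(11 / 12 * \<epsilon> * N * L)^2 \<le> (avg Y (\<lambda>y. \<Sum>\<zeta>\<in>?Z. norm (T y \<zeta>)))^2"
    using large \<epsilon> unfolding T_def by (intro power_mono) auto
  also have "\<dots> \<le> avg Y (\<lambda>y. (\<Sum>\<zeta>\<in>?Z. norm (T y \<zeta>))^2)" by (rule avg_square_le)
  also have "\<dots> \<le> avg Y (\<lambda>y. (3 * N / of_int M) * (\<Sum>i\<in>{0..<M}. (norm (F y i))\<^sup>2 * (norm (E i))\<^sup>2))"
    using cs M unfolding PT[symmetric] by (intro avg_mono) (simp add: mult.assoc)
  also have "\<dots> = (3 * N / of_int M) * (\<Sum>i\<in>{0..<M}. A i * (norm (E i))\<^sup>2)"
    unfolding avg_cmult avg_sum avg_multc A_def by simp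
  finally have 1: "(11 / 12 * \<epsilon> * N * L)^2 \<le> (3 * N / of_int M) * (\<Sum>i\<in>{0..<M}. A i * (norm (E i))\<^sup>2)" .
  have "(\<Sum>i\<in>{0..<M}. A i * (norm (E i))\<^sup>2) \<le> (\<Sum>i\<in>{0..<M}. (if i \<in> B then A i * (real L)^2 else 0) + A i * (\<epsilon> * L / 4)^2)"
  proof (rule sum_mono)
    fix i assume i: "i \<in> {0..<M}"
    show "A i * (norm (E i))\<^sup>2 \<le> (if i \<in> B then A i * (real L)^2 else 0) + A i * (\<epsilon> * L / 4)^2"
    proof (cases "i \<in> B")
      case True
      have "norm (E i) \<le> (\<Sum>w\<in>?W. 1)" unfolding E_def by (intro order_trans[OF norm_sum] sum_mono) simp
      then have "A i * (norm (E i))\<^sup>2 \<le> A i * (real L)^2" using A0 by (intro mult_left_mono power_mono) auto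
      moreover have "0 \<le> A i * (\<epsilon> * L / 4)^2" using A0 by (intro mult_nonneg_nonneg) auto
      ultimately show ?thesis using True by simp
    next
      case False
      then have "norm (E i) \<le> \<epsilon> * L / 4" using i by (auto simp: B_def)
      then have "A i * (norm (E i))\<^sup>2 \<le> A i * (\<epsilon> * L / 4)^2" using A0 by (intro mult_left_mono power_mono) auto
      then show ?thesis using False by simp
    qed
  qed
  also have "\<dots> = (\<Sum>i\<in>B. A i) * (real L)^2 + (\<Sum>i\<in>{0..<M}. A i) * (\<epsilon> * L / 4)^2"
    unfolding sum.distrib sum_distrib_right by (simp add: sum.If_cases B_def Int_def)
  also have "\<dots> \<le> (\<Sum>i\<in>B. A i) * (real L)^2 + (of_int M * N) * (\<epsilon> * L / 4)^2"
    using sumA by (intro add_left_mono mult_right_mono) auto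
  finally have "(3 * N / of_int M) * (\<Sum>i\<in>{0..<M}. A i * (norm (E i))\<^sup>2) \<le>
      (3 * N / of_int M) * ((\<Sum>i\<in>B. A i) * (real L)^2 + (of_int M * N) * (\<epsilon> * L / 4)^2)"
    using M by (intro mult_left_mono) auto
  also have "\<dots> = (3 * N * (real L)^2) * ((\<Sum>i\<in>B. A i) / of_int M + \<epsilon>^2 * N / 16)"
    using M by (simp add: field_simps power2_eq_square)
  finally have "(11 / 12 * \<epsilon> * N * L)^2 \<le> (3 * N * (real L)^2) * ((\<Sum>i\<in>B. A i) / of_int M + \<epsilon>^2 * N / 16)"
    using 1 by linarith
  moreover have "(11 / 12 * \<epsilon> * N * L)^2 = (3 * N * (real L)^2) * (121 / 432 * (\<epsilon>^2 * N))" by (simp add: power2_eq_square)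
  ultimately have "(3 * N * (real L)^2) * (121 / 432 * (\<epsilon>^2 * N)) \<le> (3 * N * (real L)^2) * ((\<Sum>i\<in>B. A i) / of_int M + \<epsilon>^2 * N / 16)"
    by (simp only:)
  then have "121 / 432 * (\<epsilon>^2 * N) \<le> (\<Sum>i\<in>B. A i) / of_int M + \<epsilon>^2 * N / 16"
    by (rule mult_left_le_imp_le) (use N0 L in simp)
  moreover have "0 \<le> \<epsilon>^2 * N" by simp
  ultimately have "\<epsilon>^2 * N / 8 \<le> (\<Sum>i\<in>B. A i) / of_int M" by linarith
  then have SA: "\<epsilon>^2 * N * of_int M / 8 \<le> (\<Sum>i\<in>B. A i)" using M by (simp add: field_simps)
  have BK: "B \<subseteq> {i \<in> {0..<M}. torus_norm (real q * (of_int i / of_int M)) \<le> \<tau>}"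
  proof
    fix i assume i: "i \<in> B"
    let ?\<theta> = "- (real q * (of_int i / of_int M))"
    have "?W = {0..int L - 1}" by auto
    moreover have "cnj (chi M i (int q * w)) = unit_char (?\<theta> * of_int w)" for w
      unfolding chi_def unit_char_minus[symmetric] by (simp add: mult_ac)
    ultimately have "norm (E i) * torus_norm ?\<theta> \<le> 1 / 2" unfolding E_def using geometric_sum_bound[of ?\<theta> 0 "int L - 1"] by simp
    moreover have "\<epsilon> * L / 4 * torus_norm ?\<theta> \<le> norm (E i) * torus_norm ?\<theta>" using i by (intro mult_right_mono) (auto simp: B_def)
    ultimately have "\<epsilon> * L / 4 * torus_norm (real q * (of_int i / of_int M)) \<le> 1 / 2" unfolding torus_norm_minus by linarith
    then have "torus_norm (real q * (of_int i / of_int M)) \<le> 2 / (\<epsilon> * L)" using \<epsilon> L by (simp add: field_simps)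
    then show "i \<in> {i \<in> {0..<M}. torus_norm (real q * (of_int i / of_int M)) \<le> \<tau>}" using \<tau> i by (auto simp: B_def)
  qed
  have finB: "finite B" unfolding B_def by (rule finite_subset[of _ "{0..<M}"]) auto
  have P: "0 < \<epsilon>^2 * N * of_int M / 8" using \<epsilon> N0 M by simp
  have cBK: "real (card B) \<le> K" proof -
    have "finite {i \<in> {0..<M}. torus_norm (real q * (of_int i / of_int M)) \<le> \<tau>}" by (rule finite_subset[of _ "{0..<M}"]) auto
    from card_mono[OF this BK] show ?thesis using K by linarith
  qed
  obtain i where i: "i \<in> B" "\<epsilon>^2 * N * of_int M / 8 / K \<le> A i"
    by (rule ex_ge_sum_div_card[OF finB P SA cBK])
  then show thesis using that[of i] BK unfolding A_def F_def by (auto simp: mult.commute)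
qed

text \<open>Since \<open>x\<close> is fixed, \<open>f0\<close> and the character depend on
  \<open>y\<close> alone and drop out in absolute value. This leaves \<open>f1\<close> along rows
  against one quadratic phase on a major arc, and the two preceding reductions turn it into a linear
  phase.\<close>

lemma first_function_correlates:
  fixes \<epsilon> :: real
  assumes \<epsilon>: "0 < \<epsilon>" "\<epsilon> \<le> 1" and N: "1 \<le> real N * (\<epsilon>^3 / 2400)" and f: "bddper (modulus N) f0" "bddper (modulus N) f1"
    and x: "x \<in> {1..int N}" and j: "major N \<epsilon> (of_int j / of_int (modulus N))"
    and large: "\<epsilon> \<le> norm (zavg (modulus N) (\<lambda>y. dual N f0 f1 x y * chi (modulus N) j y))"
  obtains \<alpha> :: real and q :: nat where "0 < q" "q \<le> 1 / \<epsilon>" "torus_norm (q * \<alpha>) \<le> 1600 / (\<epsilon>^3 * N)"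
    "\<epsilon>^5 / 64000 \<le> zavg (modulus N) (\<lambda>y. norm (avg {1..int N} (\<lambda>z. f1 z y * unit_char (\<alpha> * of_int z))))"
proof -
  define M where "M = modulus N"
  define \<phi> where "\<phi> = real_of_int j / of_int M"
  define f where "f y z = (if z \<in> {1..int N} then f1 z y else 0)" for y z
  \<comment> \<open>The largest length that \<open>short_progressions\<close> admits; the hypothesis
    on \<open>N\<close> keeps it positive and at least half of its target.\<close>
  define L where "L = nat \<lfloor>\<epsilon>^2 * N / 400\<rfloor>"
  have N0: "0 < N" using N by (cases "N = 0") auto
  have M: "0 < M" using modulus_pos N0 by (simp add: M_def)
  have "\<epsilon>^3 \<le> \<epsilon>^2" "\<epsilon>^2 \<le> 1" using \<epsilon> by (auto intro: power_decreasing power_le_one)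
  then have "real N * \<epsilon>^3 \<le> real N * \<epsilon>^2" "real N * \<epsilon>^2 \<le> real N * 1" by (intro mult_left_mono; simp)+
  then have \<epsilon>N: "2400 \<le> \<epsilon>^2 * N" "2400 \<le> N" using N by (auto simp: mult.commute)
  have L: "real L \<le> \<epsilon>^2 * N / 400" "\<epsilon>^2 * N / 800 \<le> L" "0 < L"
  proof -
    show "real L \<le> \<epsilon>^2 * N / 400" using \<epsilon>N unfolding L_def by (intro of_nat_floor) auto
    show *: "\<epsilon>^2 * N / 800 \<le> L" using \<epsilon>N unfolding L_def by linarith
    show "0 < L" using * \<epsilon>N by (cases "L = 0") auto
  qed
  obtain q :: nat where q: "0 < q" "real q \<le> 1 / \<epsilon>" "torus_norm (real q * \<phi>) \<le> 1 / (\<epsilon> * real N^2)"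
    using j unfolding major_def \<phi>_def M_def by blast
  have qL: "q * L \<le> N"
  proof -
    have "real q * real L \<le> (1 / \<epsilon>) * (\<epsilon>^2 * N / 400)" using q L \<epsilon> by (intro mult_mono) auto
    also have "\<dots> = (\<epsilon> * N) / 400" using \<epsilon> by (simp add: power2_eq_square)
    also have "\<dots> \<le> real N" using \<epsilon> mult_right_mono[of \<epsilon> 1 "real N"] by simp
    finally show ?thesis by (simp only: of_nat_mult[symmetric] of_nat_le_iff)
  qed
  have fb: "norm (f y z) \<le> 1" "f y z \<noteq> 0 \<Longrightarrow> z \<in> {1..int N}" for y z
    using assms(5) by (auto simp: f_def bddperD split: if_splits)
  have "\<epsilon> \<le> norm (zavg M (\<lambda>y. f0 x y * chi M j y * avg {1..int N} (\<lambda>z. f1 z y * chi M j ((z - x)^2))))"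
    using large unfolding M_def[symmetric]
    by (subst (asm) dual_correlation_point) (use f M in \<open>auto simp: M_def[symmetric] avg_cmult[symmetric] chi_add_right mult_ac intro: per_chi\<close>)
  also have "\<dots> \<le> zavg M (\<lambda>y. norm (\<Sum>z\<in>{1..int N}. f y z * unit_char (\<phi> * of_int ((z - x)^2))) / N)"
  proof (rule order_trans[OF norm_avg], rule avg_mono)
    fix y
    have "avg {1..int N} (\<lambda>z. f1 z y * chi M j ((z - x)^2)) = avg {1..int N} (\<lambda>z. f y z * unit_char (\<phi> * of_int ((z - x)^2)))"
      by (rule avg_cong[OF refl]) (simp add: f_def chi_def \<phi>_def)
    then have e: "norm (avg {1..int N} (\<lambda>z. f1 z y * chi M j ((z - x)^2))) = norm (\<Sum>z\<in>{1..int N}. f y z * unit_char (\<phi> * of_int ((z - x)^2))) / N"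
      by (simp only: norm_avg_complex) simp
    have "norm (f0 x y * chi M j y * b) \<le> 1 * norm b" for b
      unfolding norm_mult[of _ b] using f by (intro mult_right_mono) (auto simp: norm_mult bddperD)
    from this[of "avg {1..int N} (\<lambda>z. f1 z y * chi M j ((z - x)^2))"] show "norm (f0 x y * chi M j y * avg {1..int N} (\<lambda>z. f1 z y * chi M j ((z - x)^2))) \<le> norm (\<Sum>z\<in>{1..int N}. f y z * unit_char (\<phi> * of_int ((z - x)^2))) / N"
      unfolding e mult_1_left .
  qed
  finally have 1: "\<epsilon> \<le> zavg M (\<lambda>y. norm (\<Sum>z\<in>{1..int N}. f y z * unit_char (\<phi> * of_int ((z - x)^2))) * (1 / N))" by simp
  have "\<epsilon> * N * L \<le> zavg M (\<lambda>y. L * norm (\<Sum>z\<in>{1..int N}. f y z * unit_char (\<phi> * of_int ((z - x)^2))))"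
    using 1 N0 L(3) unfolding avg_multc avg_cmult by (simp add: field_simps)
  also have "\<dots> \<le> zavg M (\<lambda>y. (\<Sum>\<zeta>\<in>{- int N..int N}. norm (\<Sum>w\<in>{0..<int L}. f y (\<zeta> + int q * w))) + L * (N * (\<epsilon> / 12)))"
    by (intro avg_mono short_progressions fb x \<epsilon>(1) q(3) L(1) qL N0)
  also have "\<dots> = zavg M (\<lambda>y. \<Sum>\<zeta>\<in>{- int N..int N}. norm (\<Sum>w\<in>{0..<int L}. f y (\<zeta> + int q * w))) + L * (N * (\<epsilon> / 12))"
    using M by (simp add: avg_add)
  finally have 2: "11 / 12 * \<epsilon> * N * L \<le> zavg M (\<lambda>y. \<Sum>\<zeta>\<in>{- int N..int N}. norm (\<Sum>w\<in>{0..<int L}. f y (\<zeta> + int q * w)))" by (simp add: algebra_simps)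
  define \<tau> where "\<tau> = 1600 / (\<epsilon>^3 * N)"
  have \<tau>: "2 / (\<epsilon> * L) \<le> \<tau>"
  proof -
    have "2 / (\<epsilon> * L) \<le> 2 / (\<epsilon> * (\<epsilon>^2 * N / 800))" using L \<epsilon> N0 by (intro divide_left_mono mult_left_mono mult_pos_pos) auto
    then show ?thesis by (simp add: \<tau>_def power3_eq_cube power2_eq_square mult_ac)
  qed
  have MN: "of_int M = 2 * real N * N" by (simp add: M_def modulus_def power2_eq_square)
  have K: "real (card {i \<in> {0..<M}. torus_norm (real q * (of_int i / of_int M)) \<le> \<tau>}) \<le> 8000 * of_int M / (\<epsilon>^3 * N)"
  proof -
    have \<tau>0: "0 \<le> \<tau>" using \<epsilon> by (simp add: \<tau>_def)
    have "real (card {i \<in> {0..<M}. torus_norm (real q * (of_int i / of_int M)) \<le> \<tau>}) \<le> (real q + 1) * (2 * \<tau> * of_int M / q + 1)"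
      by (rule card_small_multiples[OF M q(1) \<tau>0])
    also have "\<dots> = (1 + 1 / q) * (2 * \<tau> * of_int M) + (real q + 1)" using q(1) by (simp add: field_simps)
    also have "\<dots> \<le> 2 * (2 * \<tau> * of_int M) + \<tau> * of_int M"
    proof (rule add_mono)
      show "(1 + 1 / q) * (2 * \<tau> * of_int M) \<le> 2 * (2 * \<tau> * of_int M)" using q(1) \<tau>0 M by (intro mult_right_mono) auto
      have "real q + 1 \<le> 2 / \<epsilon>" using q \<epsilon> by (simp add: field_simps)
      also have "\<dots> \<le> 3200 * N / \<epsilon>^3"
      proof -
        have "2 * \<epsilon>^2 \<le> 3200 * N" using \<open>\<epsilon>^2 \<le> 1\<close> \<epsilon>N by linarith
        then have "2 * \<epsilon>^2 / \<epsilon>^3 \<le> 3200 * N / \<epsilon>^3" using \<epsilon> by (intro divide_right_mono) auto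
        then show ?thesis using \<epsilon> by (simp add: power3_eq_cube power2_eq_square)
      qed
      also have "\<dots> = \<tau> * of_int M" using N0 by (simp add: \<tau>_def MN)
      finally show "real q + 1 \<le> \<tau> * of_int M" by simp
    qed
    also have "\<dots> = 8000 * of_int M / (\<epsilon>^3 * N)" by (simp add: \<tau>_def)
    finally show ?thesis .
  qed
  have N2: "2 * int N < M"
  proof -
    have "2 * int N * 1 < 2 * int N * int N" using \<epsilon>N by (intro mult_strict_left_mono) auto
    then show ?thesis by (simp add: M_def modulus_def power2_eq_square)
  qed
  have Mne: "{0..<M} \<noteq> {}" using M by simp
  obtain i where i: "torus_norm (real q * (of_int i / of_int M)) \<le> \<tau>"
    "\<epsilon>^2 * N * of_int M / (8 * (8000 * of_int M / (\<epsilon>^3 * N))) \<le> zavg M (\<lambda>y. (norm (\<Sum>z\<in>{1..int N}. f y z * chi M i z))\<^sup>2)"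
    by (rule window_frequency[OF fb finite_atLeastLessThan_int Mne N0 N2 L(3) qL \<epsilon>(1) 2 \<tau> K])
  define \<alpha> where "\<alpha> = real_of_int i / of_int M"
  have nS: "norm (\<Sum>z\<in>{1..int N}. f y z * chi M i z) = N * norm (avg {1..int N} (\<lambda>z. f1 z y * unit_char (\<alpha> * of_int z)))" for y
  proof -
    have "(\<Sum>z\<in>{1..int N}. f y z * chi M i z) = (\<Sum>z\<in>{1..int N}. f1 z y * unit_char (\<alpha> * of_int z))"
      by (rule sum.cong[OF refl]) (simp add: f_def chi_def \<alpha>_def)
    then show ?thesis using N0 by (simp add: norm_avg_complex)
  qed
  have avg1: "norm (avg {1..int N} (\<lambda>z. f1 z y * unit_char (\<alpha> * of_int z))) \<le> 1" for y
    using assms(5) by (intro norm_avg_le) (auto simp: norm_mult bddperD)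
  have "\<epsilon>^5 / 64000 * real N^2 = \<epsilon>^2 * N * of_int M / (8 * (8000 * of_int M / (\<epsilon>^3 * N)))"
    using \<epsilon> N0 M by (simp add: field_simps power_numeral_reduce)
  also have "\<dots> \<le> zavg M (\<lambda>y. real N^2 * norm (avg {1..int N} (\<lambda>z. f1 z y * unit_char (\<alpha> * of_int z))))"
  proof (rule order_trans[OF i(2)], rule avg_mono)
    fix y
    have "(norm (avg {1..int N} (\<lambda>z. f1 z y * unit_char (\<alpha> * of_int z))))^2 \<le> (norm (avg {1..int N} (\<lambda>z. f1 z y * unit_char (\<alpha> * of_int z))))^1"
      using avg1 by (intro power_decreasing) auto
    then show "(norm (\<Sum>z\<in>{1..int N}. f y z * chi M i z))\<^sup>2 \<le> real N^2 * norm (avg {1..int N} (\<lambda>z. f1 z y * unit_char (\<alpha> * of_int z)))"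
      unfolding nS power_mult_distrib by (intro mult_left_mono) auto
  qed
  also have "\<dots> = zavg M (\<lambda>y. norm (avg {1..int N} (\<lambda>z. f1 z y * unit_char (\<alpha> * of_int z)))) * real N^2"
    by (simp only: avg_cmult mult.commute)
  finally have "\<epsilon>^5 / 64000 \<le> zavg M (\<lambda>y. norm (avg {1..int N} (\<lambda>z. f1 z y * unit_char (\<alpha> * of_int z))))"
    using N0 by simp
  then show thesis using that[of q \<alpha>] q(1,2) i(1) unfolding \<alpha>_def \<tau>_def M_def by simp
qed

lemma first_function:
  "\<exists>\<epsilon>. polylow \<epsilon> \<and> (\<forall>\<delta>. 0 < \<delta> \<longrightarrow> \<delta> \<le> 1 \<longrightarrow> \<epsilon> \<delta> \<le> \<delta>) \<and>
    (\<forall>\<eta> N f0 f1 g. 0 < \<eta> \<longrightarrow> \<eta> \<le> 1 \<longrightarrow> 1 \<le> real N * \<epsilon> \<eta> \<longrightarrow>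
      bddper (modulus N) f0 \<longrightarrow> bddper (modulus N) f1 \<longrightarrow> bddper (modulus N) g \<longrightarrow> \<eta> \<le> norm (corner_avg N f0 f1 g) \<longrightarrow>
      (\<exists>(\<alpha>::real) (q::nat). 0 < q \<and> real q \<le> 1 / \<epsilon> \<eta> \<and> torus_norm (real q * \<alpha>) \<le> 1 / (\<epsilon> \<eta> * real N) \<and>
        \<epsilon> \<eta> \<le> zavg (modulus N) (\<lambda>y. norm (avg {1..int N} (\<lambda>z. f1 z y * unit_char (\<alpha> * of_int z))))))"
proof -
  obtain e where e: "polylow e" "\<And>\<delta>. 0 < \<delta> \<Longrightarrow> \<delta> \<le> 1 \<Longrightarrow> e \<delta> \<le> \<delta>"
    "\<And>\<eta> N f0 f1 g. 0 < \<eta> \<Longrightarrow> \<eta> \<le> 1 \<Longrightarrow> 1 \<le> real N * e \<eta> \<Longrightarrow>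
      bddper (modulus N) f0 \<Longrightarrow> bddper (modulus N) f1 \<Longrightarrow> bddper (modulus N) g \<Longrightarrow> \<eta> \<le> norm (corner_avg N f0 f1 g) \<Longrightarrow>
      \<exists>x\<in>{1..int N}. \<exists>j. major N (e \<eta>) (of_int j / of_int (modulus N)) \<and>
         e \<eta> \<le> norm (zavg (modulus N) (\<lambda>y. dual N f0 f1 x y * chi (modulus N) j y))"
    using major_point by blast
  define \<epsilon> where "\<epsilon> \<eta> = (1 / 64000) * e \<eta> ^ 5" for \<eta>
  have e0: "0 < e \<eta>" "e \<eta> \<le> 1" if "0 < \<eta>" "\<eta> \<le> 1" for \<eta>
    using polylow_pos[OF e(1) that] e(2)[OF that] that by auto
  have pw: "e \<eta> ^ 5 \<le> e \<eta> ^ k" if "0 < \<eta>" "\<eta> \<le> 1" "k \<le> 5" for \<eta> k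
    using e0[OF that(1,2)] that(3) by (intro power_decreasing) auto
  have p: "polylow \<epsilon>" unfolding \<epsilon>_def[abs_def] by (intro polylow_cmult polylow_pow e) auto
  have le: "\<epsilon> \<eta> \<le> e \<eta>" if "0 < \<eta>" "\<eta> \<le> 1" for \<eta>
    using pw[OF that, of 1] e0[OF that] by (simp add: \<epsilon>_def)
  have main: "\<exists>(\<alpha>::real) (q::nat). 0 < q \<and> real q \<le> 1 / \<epsilon> \<eta> \<and> torus_norm (real q * \<alpha>) \<le> 1 / (\<epsilon> \<eta> * real N) \<and>
        \<epsilon> \<eta> \<le> zavg (modulus N) (\<lambda>y. norm (avg {1..int N} (\<lambda>z. f1 z y * unit_char (\<alpha> * of_int z))))"
    if \<eta>: "0 < \<eta>" "\<eta> \<le> 1" and N: "1 \<le> real N * \<epsilon> \<eta>" and f: "bddper (modulus N) f0" "bddper (modulus N) f1" "bddper (modulus N) g"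
      and large: "\<eta> \<le> norm (corner_avg N f0 f1 g)" for \<eta> N f0 f1 g
  proof -
    have big: "1 \<le> real N * b" if "\<epsilon> \<eta> \<le> b" for b
      using N mult_left_mono[OF that, of "real N"] by simp
    have N0: "0 < N" using N by (cases "N = 0") auto
    obtain x j where xj: "x \<in> {1..int N}" "major N (e \<eta>) (of_int j / of_int (modulus N))"
      "e \<eta> \<le> norm (zavg (modulus N) (\<lambda>y. dual N f0 f1 x y * chi (modulus N) j y))"
      using e(3)[OF \<eta> big[OF le[OF \<eta>]] f large] by blast
    have cube: "\<epsilon> \<eta> \<le> e \<eta> ^ 3 / 2400"
      using pw[OF \<eta>, of 3] zero_less_power[OF e0(1)[OF \<eta>], of 3] unfolding \<epsilon>_def by linarith
    then have "1 \<le> real N * (e \<eta> ^ 3 / 2400)" by (rule big)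
    from first_function_correlates[OF e0[OF \<eta>] this f(1,2) xj]
    obtain \<alpha> :: real and q :: nat where q: "0 < q" "real q \<le> 1 / e \<eta>" "torus_norm (real q * \<alpha>) \<le> 1600 / (e \<eta> ^ 3 * N)"
      "e \<eta> ^ 5 / 64000 \<le> zavg (modulus N) (\<lambda>y. norm (avg {1..int N} (\<lambda>z. f1 z y * unit_char (\<alpha> * of_int z))))" by blast
    have \<epsilon>0: "0 < \<epsilon> \<eta>" using e0[OF \<eta>] by (simp add: \<epsilon>_def)
    have "1 / e \<eta> \<le> 1 / \<epsilon> \<eta>" using le[OF \<eta>] \<epsilon>0 e0[OF \<eta>] by (intro divide_left_mono) auto
    moreover have "1600 / (e \<eta> ^ 3 * N) \<le> 1 / (\<epsilon> \<eta> * N)"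
    proof -
      have "1 / (e \<eta> ^ 3 / 1600 * N) \<le> 1 / (\<epsilon> \<eta> * N)"
      proof (intro divide_left_mono mult_right_mono)
        show "\<epsilon> \<eta> \<le> e \<eta> ^ 3 / 1600" using cube zero_less_power[OF e0(1)[OF \<eta>], of 3] by linarith
      qed (use \<epsilon>0 N0 e0[OF \<eta>] in auto)
      then show ?thesis by simp
    qed
    ultimately have "real q \<le> 1 / \<epsilon> \<eta>" "torus_norm (real q * \<alpha>) \<le> 1 / (\<epsilon> \<eta> * real N)" using q(2,3) by linarith+
    moreover have "\<epsilon> \<eta> \<le> zavg (modulus N) (\<lambda>y. norm (avg {1..int N} (\<lambda>z. f1 z y * unit_char (\<alpha> * of_int z))))"
      using q(4) by (simp only: \<epsilon>_def)
    ultimately show ?thesis using q(1) by blast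
  qed
  have "\<epsilon> \<delta> \<le> \<delta>" if "0 < \<delta>" "\<delta> \<le> 1" for \<delta> using le[OF that] e(2)[OF that] by linarith
  then show ?thesis using p main by blast
qed

subsection \<open>The second function\<close>

text \<open>The correlation involves \<open>f0\<close> only as a bounded weight in \<open>x\<close>
  and \<open>y\<close>, so it bounds the mean of the norm of \<open>G x y\<close>, an average of
  translates of \<open>g x\<close>. In Fourier space this averaging multiplies by
  \<open>w x i\<close>, a quadratic Weyl sum in \<open>z\<close>, which can be large only if
  \<open>i\<close> is major. The set of such \<open>i\<close> is small and does not depend on
  \<open>x\<close>, so one frequency can be chosen for all \<open>x\<close>.\<close>

lemma second_function_correlates:
  fixes \<epsilon> \<alpha> :: real
  assumes \<epsilon>: "0 < \<epsilon>" "\<epsilon> \<le> 1" and N: "100000 \<le> real N * (\<epsilon> / 2)^7" and f0: "\<And>x y. norm (f0 x y) \<le> 1" and g: "bddper (modulus N) g"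
    and large: "\<epsilon> \<le> zavg (modulus N) (\<lambda>y. norm (avg {1..int N} (\<lambda>z. cnj (avg {1..int N} (\<lambda>x. f0 x y * g x (y + (z - x)^2))) * unit_char (\<alpha> * of_int z))))"
  obtains i where "major N (\<epsilon>^6 / 24576) (of_int i / of_int (modulus N))"
    "\<epsilon>^2 * (\<epsilon>^6 / 24576)^2 / 20 \<le> avg {1..int N} (\<lambda>x. norm (zavg (modulus N) (\<lambda>y. g x y * chi (modulus N) i y)))"
proof -
  define M where "M = modulus N"
  let ?X = "{1..int N}"
  define G where "G x y = avg ?X (\<lambda>z. g x (y + (z - x)^2) * unit_char (- \<alpha> * of_int z))" for x y
  define c where "c x i = zavg M (\<lambda>y. g x y * chi M i y)" for x i
  define w where "w x i = avg ?X (\<lambda>z. unit_char (- \<alpha> * of_int z) * cnj (chi M i ((z - x)^2)))" for x i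
  define B where "B = {i \<in> {0..<M}. major N (\<epsilon>^6 / 24576) (of_int i / of_int M)}"
  have N0: "0 < N" using N by (cases "N = 0") auto
  have M: "0 < M" using modulus_pos N0 by (simp add: M_def)
  have X: "finite ?X" "?X \<noteq> {}" using N0 by auto
  have gM: "\<And>x y. norm (g x y) \<le> 1" "\<And>x. per M (g x)" using g by (auto simp: M_def dest: bddperD)
  have "\<epsilon> \<le> zavg M (\<lambda>y. avg ?X (\<lambda>x. norm (G x y)))"
  proof (rule order_trans[OF large[folded M_def]], rule avg_mono)
    fix y
    let ?A = "avg ?X (\<lambda>z. cnj (avg ?X (\<lambda>x. f0 x y * g x (y + (z - x)^2))) * unit_char (\<alpha> * of_int z))"
    have "cnj ?A = avg ?X (\<lambda>z. avg ?X (\<lambda>x. f0 x y * g x (y + (z - x)^2)) * unit_char (- \<alpha> * of_int z))"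
      by (simp add: cnj_avg unit_char_minus[symmetric])
    also have "\<dots> = avg ?X (\<lambda>z. avg ?X (\<lambda>x. f0 x y * (g x (y + (z - x)^2) * unit_char (- \<alpha> * of_int z))))"
      unfolding avg_multc[symmetric] mult.assoc ..
    also have "\<dots> = avg ?X (\<lambda>x. avg ?X (\<lambda>z. f0 x y * (g x (y + (z - x)^2) * unit_char (- \<alpha> * of_int z))))"
      by (rule avg_swap)
    also have "\<dots> = avg ?X (\<lambda>x. f0 x y * G x y)" by (simp only: avg_cmult G_def)
    finally have A: "cnj ?A = avg ?X (\<lambda>x. f0 x y * G x y)" .
    have "norm ?A = norm (cnj ?A)" by (rule complex_mod_cnj[symmetric])
    also have "\<dots> = norm (avg ?X (\<lambda>x. f0 x y * G x y))" by (simp only: A)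
    also have "\<dots> \<le> avg ?X (\<lambda>x. norm (f0 x y * G x y))" by (rule norm_avg)
    also have "\<dots> \<le> avg ?X (\<lambda>x. norm (G x y))"
      using f0 by (intro avg_mono) (auto simp: norm_mult intro: mult_left_le_one_le)
    finally show "norm ?A \<le> avg ?X (\<lambda>x. norm (G x y))" .
  qed
  also have "\<dots> = avg ?X (\<lambda>x. zavg M (\<lambda>y. norm (G x y)))" by (rule avg_swap)
  finally have "\<epsilon>^2 \<le> (avg ?X (\<lambda>x. zavg M (\<lambda>y. norm (G x y))))^2" using \<epsilon> by (intro power_mono) auto
  also have "\<dots> \<le> avg ?X (\<lambda>x. (zavg M (\<lambda>y. norm (G x y)))^2)" by (rule avg_square_le)
  also have "\<dots> \<le> avg ?X (\<lambda>x. zavg M (\<lambda>y. (norm (G x y))^2))" by (intro avg_mono avg_square_le)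
  also have "\<dots> \<le> avg ?X (\<lambda>x. (\<Sum>i\<in>B. (norm (c x i))^2) + (\<epsilon> / 2)^2)"
  proof (rule avg_mono)
    fix x assume x: "x \<in> ?X"
    have cw: "zavg M (\<lambda>y. G x y * chi M i y) = c x i * w x i" for i
    proof -
      have "zavg M (\<lambda>y. G x y * chi M i y) = zavg M (\<lambda>y. avg ?X (\<lambda>z. g x (y + (z - x)^2) * unit_char (- \<alpha> * of_int z) * chi M i y))"
        unfolding G_def avg_multc ..
      also have "\<dots> = avg ?X (\<lambda>z. zavg M (\<lambda>y. g x (y + (z - x)^2) * unit_char (- \<alpha> * of_int z) * chi M i y))" by (rule avg_swap)
      also have "\<dots> = avg ?X (\<lambda>z. c x i * (unit_char (- \<alpha> * of_int z) * cnj (chi M i ((z - x)^2))))"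
      proof (rule avg_cong[OF refl])
        fix z
        have "g x (y + (z - x)^2) * unit_char (- \<alpha> * of_int z) * chi M i y =
          (g x (y + (z - x)^2) * chi M i (y + (z - x)^2)) * (unit_char (- \<alpha> * of_int z) * cnj (chi M i ((z - x)^2)))" for y
          using chi_diff_right[of M i "y + (z - x)^2" "(z - x)^2"] by (simp add: mult_ac)
        then have "zavg M (\<lambda>y. g x (y + (z - x)^2) * unit_char (- \<alpha> * of_int z) * chi M i y) =
          zavg M (\<lambda>y. (\<lambda>y. g x y * chi M i y) (y + (z - x)^2) * (unit_char (- \<alpha> * of_int z) * cnj (chi M i ((z - x)^2))))"
          by (intro avg_cong refl)
        also have "\<dots> = c x i * (unit_char (- \<alpha> * of_int z) * cnj (chi M i ((z - x)^2)))"
          unfolding avg_multc c_def by (subst avg_shift) (auto intro!: per_mult gM per_chi M)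
        finally show "zavg M (\<lambda>y. g x (y + (z - x)^2) * unit_char (- \<alpha> * of_int z) * chi M i y) = \<dots>" .
      qed
      finally show ?thesis by (simp only: avg_cmult w_def)
    qed
    have w1: "norm (w x i) \<le> 1" for i unfolding w_def by (intro norm_avg_le) (auto simp: norm_mult)
    have w2: "i \<in> B" if i: "i \<in> {0..<M}" and wi: "\<epsilon> / 2 \<le> norm (w x i)" for i
    proof -
      define \<phi> where "\<phi> = real_of_int i / of_int M"
      have "unit_char (- \<alpha> * of_int z) * cnj (chi M i ((z - x)^2)) =
        unit_char (- \<phi> * of_int (x^2)) * unit_char ((- \<phi>) * of_int (z^2) + (2 * of_int x * \<phi> - \<alpha>) * of_int z)" for z
        unfolding chi_def unit_char_minus[symmetric] unit_char_add[symmetric] \<phi>_def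
        by (rule arg_cong[of _ _ unit_char]) (simp add: divide_inverse power2_eq_square algebra_simps)
      then have "w x i = unit_char (- \<phi> * of_int (x^2)) * avg ?X (\<lambda>z. unit_char ((- \<phi>) * of_int (z^2) + (2 * of_int x * \<phi> - \<alpha>) * of_int z))"
        unfolding w_def avg_cmult[symmetric] by (simp only:)
      then have "norm (w x i) = norm (\<Sum>z\<in>?X. unit_char ((- \<phi>) * of_int (z^2) + (2 * of_int x * \<phi> - \<alpha>) * of_int z)) / N"
        by (simp only: norm_mult norm_unit_char norm_avg_complex) simp
      then have "\<epsilon> / 2 * N \<le> norm (\<Sum>z\<in>?X. unit_char ((- \<phi>) * of_int (z^2) + (2 * of_int x * \<phi> - \<alpha>) * of_int z))"
        using wi N0 by (simp only: pos_le_divide_eq of_nat_0_less_iff)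
      then obtain q :: nat where q: "0 < q" "real q \<le> 24 / (\<epsilon> / 2)^2" "torus_norm (real q * (- \<phi>)) \<le> 384 / ((\<epsilon> / 2)^6 * N^2)"
        \<comment> \<open>Applied with \<epsilon> / 2 in place of \<eta>; the constant 24576 is 384
          times 2^6.\<close>
        by (rule weyl_leading[rotated 3]) (use \<epsilon> N in auto)
      have "24 / (\<epsilon> / 2)^2 \<le> 384 / (\<epsilon> / 2)^6"
        using \<epsilon> by (intro frac_le power_decreasing) auto
      then have "real q \<le> 1 / (\<epsilon>^6 / 24576)" using q(2) by (simp add: power_divide)
      moreover have "torus_norm (real q * \<phi>) \<le> 1 / (\<epsilon>^6 / 24576 * real N^2)"
        using q(3) torus_norm_minus[of "real q * \<phi>"] by (simp add: power_divide)
      ultimately have "major N (\<epsilon>^6 / 24576) \<phi>" using q(1) unfolding major_def by blast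
      then show ?thesis using i by (simp add: B_def \<phi>_def)
    qed
    have "zavg M (\<lambda>y. (norm (G x y))^2) = (\<Sum>i\<in>{0..<M}. (norm (c x i))^2 * (norm (w x i))^2)"
      unfolding parseval[OF M, symmetric] cw norm_mult power_mult_distrib ..
    also have "\<dots> \<le> (\<Sum>i\<in>{0..<M}. (if i \<in> B then (norm (c x i))^2 else 0) + (norm (c x i))^2 * (\<epsilon> / 2)^2)"
    proof (rule sum_mono)
      fix i assume i: "i \<in> {0..<M}"
      show "(norm (c x i))^2 * (norm (w x i))^2 \<le> (if i \<in> B then (norm (c x i))^2 else 0) + (norm (c x i))^2 * (\<epsilon> / 2)^2"
      proof (cases "i \<in> B")
        case True
        have "(norm (c x i))^2 * (norm (w x i))^2 \<le> (norm (c x i))^2 * 1" using w1 by (intro mult_left_mono power_le_one) auto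
        then show ?thesis using True by (simp add: add_increasing2)
      next
        case False
        then have "norm (w x i) \<le> \<epsilon> / 2" using w2[OF i] by linarith
        then have "(norm (c x i))^2 * (norm (w x i))^2 \<le> (norm (c x i))^2 * (\<epsilon> / 2)^2" by (intro mult_left_mono power_mono) auto
        then show ?thesis using False by simp
      qed
    qed
    also have "\<dots> = (\<Sum>i\<in>B. (norm (c x i))^2) + (\<Sum>i\<in>{0..<M}. (norm (c x i))^2) * (\<epsilon> / 2)^2"
      unfolding sum.distrib sum_distrib_right by (simp add: sum.If_cases B_def Int_def)
    also have "(\<Sum>i\<in>{0..<M}. (norm (c x i))^2) \<le> 1"
      unfolding c_def parseval[OF M] using gM by (intro avg_le power_le_one) auto
    finally show "zavg M (\<lambda>y. (norm (G x y))^2) \<le> (\<Sum>i\<in>B. (norm (c x i))^2) + (\<epsilon> / 2)^2"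
      by (simp add: mult_right_mono)
  qed
  also have "\<dots> = avg ?X (\<lambda>x. \<Sum>i\<in>B. (norm (c x i))^2) + (\<epsilon> / 2)^2" using X by (simp add: avg_add)
  also have "avg ?X (\<lambda>x. \<Sum>i\<in>B. (norm (c x i))^2) = (\<Sum>i\<in>B. avg ?X (\<lambda>x. (norm (c x i))^2))"
    unfolding avg_def by (subst sum.swap) (simp only: sum_divide_distrib)
  finally have "\<epsilon>^2 \<le> (\<Sum>i\<in>B. avg ?X (\<lambda>x. (norm (c x i))^2)) + \<epsilon>^2 / 4" by (simp add: power_divide)
  then have S: "\<epsilon>^2 / 2 \<le> (\<Sum>i\<in>B. avg ?X (\<lambda>x. (norm (c x i))^2))"
    using zero_le_power2[of \<epsilon>] by linarith
  have \<epsilon>6: "0 < \<epsilon>^6 / 24576" "\<epsilon>^6 / 24576 \<le> 1" using \<epsilon> power_le_one[of \<epsilon> 6] by auto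
  have finB: "finite B" unfolding B_def by (rule finite_subset[of _ "{0..<M}"]) auto
  have cB: "real (card B) \<le> 10 / (\<epsilon>^6 / 24576)^2" unfolding B_def M_def by (rule card_major[OF N0 \<epsilon>6])
  have "0 < \<epsilon>^2 / 2" using \<epsilon> by simp
  then obtain i where i: "i \<in> B" "\<epsilon>^2 / 2 / (10 / (\<epsilon>^6 / 24576)^2) \<le> avg ?X (\<lambda>x. (norm (c x i))^2)"
    by (rule ex_ge_sum_div_card[OF finB _ S cB])
  have "\<epsilon>^2 / 2 / (10 / (\<epsilon>^6 / 24576)^2) = \<epsilon>^2 * (\<epsilon>^6 / 24576)^2 / 20" by simp
  moreover have "avg ?X (\<lambda>x. (norm (c x i))^2) \<le> avg ?X (\<lambda>x. norm (c x i))"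
  proof (rule avg_mono)
    fix x
    have "norm (c x i) \<le> 1" unfolding c_def using gM by (intro norm_avg_le) (auto simp: norm_mult)
    then show "(norm (c x i))^2 \<le> norm (c x i)" by (simp add: power2_eq_square mult_left_le)
  qed
  ultimately show thesis using that[of i] i unfolding B_def c_def M_def by simp
qed

text \<open>The new \<open>f\<^sub>1\<close> is made of \<open>f\<^sub>0\<close> and \<open>g\<close> only, so a correlation of it says something about \<open>g\<close>.\<close>
lemma corner_square:
  assumes f: "\<And>x y. norm (f1 x y) \<le> 1"
  shows "(norm (corner_avg N f0 f1 g))^2 \<le> norm (corner_avg N f0 (\<lambda>z y. cnj (avg {1..int N} (\<lambda>x. f0 x y * g x (y + (z - x)^2)))) g)"
proof -
  define M where "M = modulus N"
  let ?X = "{1..int N}"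
  define H where "H z y = avg ?X (\<lambda>x. f0 x y * g x (y + (z - x)^2))" for z y
  have c: "corner_avg N f0 h g = avg ({0..<M} \<times> ?X) (\<lambda>p. h (snd p) (fst p) * H (snd p) (fst p))" for h
  proof -
    have "avg ?X (\<lambda>x. avg ?X (\<lambda>z. f0 x y * h z y * g x (y + (z - x)^2))) = avg ?X (\<lambda>z. h z y * H z y)" for y
      unfolding H_def avg_cmult[symmetric] by (subst avg_swap) (simp add: mult_ac)
    then show ?thesis unfolding corner_avg_def M_def[symmetric] avg_times by simp
  qed
  have "(norm (corner_avg N f0 f1 g))^2 \<le> avg ({0..<M} \<times> ?X) (\<lambda>p. (norm (f1 (snd p) (fst p) * H (snd p) (fst p)))^2)"
    unfolding c by (rule norm_avg_square_le)
  also have "\<dots> \<le> avg ({0..<M} \<times> ?X) (\<lambda>p. (norm (H (snd p) (fst p)))^2)"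
    using f by (intro avg_mono power_mono) (auto simp: norm_mult intro!: mult_left_le_one_le)
  also have "\<dots> = norm (complex_of_real (avg ({0..<M} \<times> ?X) (\<lambda>p. (norm (H (snd p) (fst p)))^2)))"
    unfolding norm_of_real by (rule abs_of_nonneg[symmetric]) (intro avg_nonneg, simp)
  also have "complex_of_real (avg ({0..<M} \<times> ?X) (\<lambda>p. (norm (H (snd p) (fst p)))^2)) = corner_avg N f0 (\<lambda>z y. cnj (H z y)) g"
    unfolding c of_real_avg complex_norm_square by (simp only: mult.commute)
  finally show ?thesis unfolding H_def .
qed

lemma both_functions:
  "\<exists>\<epsilon>. polylow \<epsilon> \<and>
    (\<forall>\<eta> N f0 f1 g. 0 < \<eta> \<longrightarrow> \<eta> \<le> 1 \<longrightarrow> 1 \<le> real N * \<epsilon> \<eta> \<longrightarrow>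
      bddper (modulus N) f0 \<longrightarrow> bddper (modulus N) f1 \<longrightarrow> bddper (modulus N) g \<longrightarrow> \<eta> \<le> norm (corner_avg N f0 f1 g) \<longrightarrow>
      (\<exists>(\<alpha>::real) (\<beta>::real) (q::nat). 0 < q \<and> real q \<le> 1 / \<epsilon> \<eta> \<and>
        torus_norm (real q * \<alpha>) \<le> 1 / \<epsilon> \<eta> / real N \<and> torus_norm (real q * \<beta>) \<le> 1 / \<epsilon> \<eta> / real N^2 \<and>
        \<epsilon> \<eta> \<le> zavg (modulus N) (\<lambda>y. norm (avg {1..int N} (\<lambda>z. f1 z y * unit_char (\<alpha> * of_int z)))) \<and>
        \<epsilon> \<eta> \<le> avg {1..int N} (\<lambda>x. norm (zavg (modulus N) (\<lambda>y. g x y * unit_char (\<beta> * of_int y))))))"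
proof -
  obtain e where e: "polylow e" "\<And>\<delta>. 0 < \<delta> \<Longrightarrow> \<delta> \<le> 1 \<Longrightarrow> e \<delta> \<le> \<delta>"
    "\<And>\<eta> N f0 f1 g. 0 < \<eta> \<Longrightarrow> \<eta> \<le> 1 \<Longrightarrow> 1 \<le> real N * e \<eta> \<Longrightarrow>
      bddper (modulus N) f0 \<Longrightarrow> bddper (modulus N) f1 \<Longrightarrow> bddper (modulus N) g \<Longrightarrow> \<eta> \<le> norm (corner_avg N f0 f1 g) \<Longrightarrow>
      \<exists>(\<alpha>::real) (q::nat). 0 < q \<and> real q \<le> 1 / e \<eta> \<and> torus_norm (real q * \<alpha>) \<le> 1 / (e \<eta> * real N) \<and>
        e \<eta> \<le> zavg (modulus N) (\<lambda>y. norm (avg {1..int N} (\<lambda>z. f1 z y * unit_char (\<alpha> * of_int z))))"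
    using first_function by blast
  define d where "d \<eta> = e (\<eta>^2)" for \<eta>
  \<comment> \<open>The second factor is \<open>d^2 * (d^6 / 24576)^2 / 20\<close>, the correlation
    obtained for the second function; the product with \<open>e \<eta>\<close> also bounds the
    product of the two denominators.\<close>
  define \<epsilon> where "\<epsilon> \<eta> = e \<eta> * ((1 / 12079595520) * d \<eta> ^ 14)" for \<eta>
  have sq: "0 < \<eta>^2" "\<eta>^2 \<le> 1" if "0 < \<eta>" "\<eta> \<le> 1" for \<eta> :: real using that by (simp_all add: power_le_one)
  have e0: "0 < e \<eta>" "e \<eta> \<le> 1" if "0 < \<eta>" "\<eta> \<le> 1" for \<eta>
    using polylow_pos[OF e(1) that] e(2)[OF that] that by auto
  have d0: "0 < d \<eta>" "d \<eta> \<le> 1" if "0 < \<eta>" "\<eta> \<le> 1" for \<eta>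
    unfolding d_def using e0[OF sq[OF that]] by auto
  have "polylow d" unfolding d_def[abs_def] using sq by (intro polylow_comp[OF e(1)] polylow_pow polylow_id) auto
  then have p: "polylow \<epsilon>" unfolding \<epsilon>_def[abs_def] by (intro polylow_mult e(1) polylow_cmult polylow_pow) auto
  have main: "\<exists>(\<alpha>::real) (\<beta>::real) (q::nat). 0 < q \<and> real q \<le> 1 / \<epsilon> \<eta> \<and>
        torus_norm (real q * \<alpha>) \<le> 1 / \<epsilon> \<eta> / real N \<and> torus_norm (real q * \<beta>) \<le> 1 / \<epsilon> \<eta> / real N^2 \<and>
        \<epsilon> \<eta> \<le> zavg (modulus N) (\<lambda>y. norm (avg {1..int N} (\<lambda>z. f1 z y * unit_char (\<alpha> * of_int z)))) \<and>
        \<epsilon> \<eta> \<le> avg {1..int N} (\<lambda>x. norm (zavg (modulus N) (\<lambda>y. g x y * unit_char (\<beta> * of_int y))))"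
    if \<eta>: "0 < \<eta>" "\<eta> \<le> 1" and N: "1 \<le> real N * \<epsilon> \<eta>" and f0: "bddper (modulus N) f0" and f1: "bddper (modulus N) f1" and g: "bddper (modulus N) g"
      and large: "\<eta> \<le> norm (corner_avg N f0 f1 g)" for \<eta> N f0 f1 g
  proof -
    define a b t where "a = e \<eta>" and "b = d \<eta>" and "t = d \<eta> ^ 6 / 24576"
    define M where "M = modulus N"
    have N0: "0 < N" using N by (cases "N = 0") auto
    have M: "0 < M" using modulus_pos N0 by (simp add: M_def)
    have a: "0 < a" "a \<le> 1" using e0[OF \<eta>] by (auto simp: a_def)
    have b: "0 < b" "b \<le> 1" using d0[OF \<eta>] by (auto simp: b_def)
    have bp: "0 < b ^ k" "b ^ k \<le> 1" for k using b by (auto intro: power_le_one)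
    have b14: "b ^ 14 \<le> b ^ k" if "k \<le> 14" for k using b that by (intro power_decreasing) auto
    define s where "s = (1 / 12079595520) * b ^ 14"
    have s: "0 < s" "s \<le> 1" "s \<le> t" "s \<le> b" "100000 * s \<le> (b / 2)^7" "s = b^2 * t^2 / 20"
    proof -
      show "0 < s" "s \<le> 1" using bp[of 14] by (auto simp: s_def)
      show "s \<le> t" "s \<le> b" using b14[of 6, simplified] b14[of 1, simplified] bp(1)[of 6] b unfolding s_def t_def b_def[symmetric] by linarith+
      have "(b / 2)^7 = b^7 / 128" by (simp add: power_divide)
      then show "100000 * s \<le> (b / 2)^7" using b14[of 7, simplified] bp(1)[of 7] unfolding s_def by linarith
      show "s = b^2 * t^2 / 20" unfolding s_def t_def b_def[symmetric] by (simp add: power_divide power_mult[symmetric] power_add[symmetric])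
    qed
    have \<epsilon>: "\<epsilon> \<eta> = a * s" by (simp add: \<epsilon>_def a_def s_def b_def)
    have \<epsilon>0: "0 < a * s" using a s by simp
    have as: "a * s \<le> a" "a * s \<le> s" using a s by (auto intro: mult_left_le mult_left_le_one_le)
    have big: "c \<le> real N * h" if "c * (a * s) \<le> h" "0 \<le> c" for c h
    proof -
      have "c * 1 \<le> c * (real N * (a * s))" using N that unfolding \<epsilon> by (intro mult_left_mono) auto
      also have "\<dots> \<le> real N * h" using mult_left_mono[OF that(1), of "real N"] by (simp add: mult_ac)
      finally show ?thesis by simp
    qed
    have "1 \<le> real N * e \<eta>" using as by (intro big) (auto simp: a_def)
    from e(3)[OF \<eta> this f0 f1 g large] obtain \<alpha> :: real and q1 :: nat where q1: "0 < q1" "real q1 \<le> 1 / a" "torus_norm (real q1 * \<alpha>) \<le> 1 / (a * real N)"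
      "a \<le> zavg M (\<lambda>y. norm (avg {1..int N} (\<lambda>z. f1 z y * unit_char (\<alpha> * of_int z))))"
      unfolding a_def M_def by blast
    \<comment> \<open>This replaces \<open>f1\<close> by its dual, built from \<open>f0\<close> and
      \<open>g\<close>. The cost is the square of \<eta>, hence the argument \<open>\<eta>^2\<close>
      in \<open>d\<close>.\<close>
    define h where "h z y = cnj (avg {1..int N} (\<lambda>x. f0 x y * g x (y + (z - x)^2)))" for z y
    have h: "bddper M h"
      unfolding bddper_def h_def complex_mod_cnj using f0 g
      by (auto simp: M_def norm_mult mult_le_one bddperD intro!: norm_avg_le per_cnj per_avg per_mult per_shift)
    have "\<eta>^2 \<le> (norm (corner_avg N f0 f1 g))^2" using large \<eta> by (intro power_mono) auto
    also have "\<dots> \<le> norm (corner_avg N f0 h g)" unfolding h_def using f1 by (intro corner_square) (auto dest: bddperD)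
    finally have large2: "\<eta>^2 \<le> norm (corner_avg N f0 h g)" .
    have "1 * (a * s) \<le> e (\<eta>^2)" using as(2) s(4) unfolding b_def d_def mult_1_left by (rule order_trans)
    then have "1 \<le> real N * e (\<eta>^2)" by (rule big) simp
    from e(3)[OF sq[OF \<eta>] this f0 h[unfolded M_def] g large2] obtain \<alpha>' :: real where
      l1: "b \<le> zavg M (\<lambda>y. norm (avg {1..int N} (\<lambda>z. h z y * unit_char (\<alpha>' * of_int z))))"
      unfolding b_def d_def M_def by blast
    have l2: "100000 \<le> real N * (b / 2)^7"
      using as(2) s(5) by (intro big) linarith+
    have f0': "norm (f0 x y) \<le> 1" for x y using f0 by (rule bddperD)
    obtain i where i: "major N t (of_int i / of_int M)"
      "s \<le> avg {1..int N} (\<lambda>x. norm (zavg M (\<lambda>y. g x y * chi M i y)))"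
      unfolding M_def s(6) t_def b_def[symmetric]
      by (rule second_function_correlates[OF b l2 f0' g l1[unfolded h_def M_def]])
    define \<beta> where "\<beta> = real_of_int i / of_int M"
    have chi: "chi M i y = unit_char (\<beta> * of_int y)" for y by (simp add: chi_def \<beta>_def)
    obtain q2 :: nat where q2: "0 < q2" "real q2 \<le> 1 / t" "torus_norm (real q2 * \<beta>) \<le> 1 / (t * real N^2)"
      using i(1) unfolding major_def \<beta>_def by blast
    have t0: "0 < t" using s by linarith
    have "1 / (a * t) \<le> 1 / (a * s)" using a s t0 by (intro divide_left_mono mult_left_mono) auto
    then have E: "r \<le> 1 / (a * s) / w" if "r \<le> 1 / (a * t) / w" "0 < w" for r w :: real
      using that divide_right_mono[of "1 / (a * t)" "1 / (a * s)" w] by simp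
    have "real (q1 * q2) \<le> 1 / (a * s) / 1"
    proof (rule E)
      have "real q1 * real q2 \<le> (1 / a) * (1 / t)" using q1 q2 a by (intro mult_mono) auto
      then show "real (q1 * q2) \<le> 1 / (a * t) / 1" by simp
    qed simp
    moreover have "torus_norm (real (q1 * q2) * \<alpha>) \<le> 1 / (a * s) / real N"
    proof (rule E)
      have "torus_norm (real q2 * (real q1 * \<alpha>)) \<le> real q2 * torus_norm (real q1 * \<alpha>)" by (rule torus_norm_nat_mult)
      also have "\<dots> \<le> (1 / t) * (1 / (a * real N))" using q1 q2 t0 by (intro mult_mono) auto
      finally show "torus_norm (real (q1 * q2) * \<alpha>) \<le> 1 / (a * t) / real N" by (simp add: mult_ac)
    qed (use N0 in simp)
    moreover have "torus_norm (real (q1 * q2) * \<beta>) \<le> 1 / (a * s) / real N^2"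
    proof (rule E)
      have "torus_norm (real q1 * (real q2 * \<beta>)) \<le> real q1 * torus_norm (real q2 * \<beta>)" by (rule torus_norm_nat_mult)
      also have "\<dots> \<le> (1 / a) * (1 / (t * real N^2))" using q1 q2 a by (intro mult_mono) auto
      finally show "torus_norm (real (q1 * q2) * \<beta>) \<le> 1 / (a * t) / real N^2" by (simp add: mult_ac)
    qed (use N0 in simp)
    moreover have "a * s \<le> zavg M (\<lambda>y. norm (avg {1..int N} (\<lambda>z. f1 z y * unit_char (\<alpha> * of_int z))))"
      using as(1) q1(4) by (rule order_trans)
    moreover have "a * s \<le> avg {1..int N} (\<lambda>x. norm (zavg M (\<lambda>y. g x y * unit_char (\<beta> * of_int y))))"
      using as(2) i(2)[unfolded chi] by (rule order_trans)
    moreover have "0 < q1 * q2" using q1 q2 by simp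
    \<comment> \<open>The two frequencies come with separate denominators; their product serves
      both, since multiplying by an integer enlarges a torus norm at most by that factor.\<close>
    ultimately show ?thesis unfolding \<epsilon> M_def[symmetric] by (intro exI[of _ \<alpha>] exI[of _ \<beta>] exI[of _ "q1 * q2"] conjI) (simp_all only: div_by_1)
  qed
  show ?thesis using p main by blast
qed

subsection \<open>From sums over the integers to averages\<close>

lemma infsum_finite_support:
  fixes h :: "'a \<Rightarrow> 'b::{comm_monoid_add,t2_space}"
  assumes "finite S" "\<And>x. x \<notin> S \<Longrightarrow> h x = 0"
  shows "infsum h UNIV = sum h S"
proof -
  have "infsum h UNIV = infsum h S" by (rule infsum_cong_neutral) (use assms(2) in auto)
  then show ?thesis using assms(1) by simp
qed

definition supported :: "nat \<Rightarrow> (int \<times> int \<Rightarrow> complex) \<Rightarrow> bool" where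
  "supported N f \<longleftrightarrow> (\<forall>p. norm (f p) \<le> 1) \<and> {p. f p \<noteq> 0} \<subseteq> {1..int N} \<times> {1..(int N)^2}"

lemma supportedD:
  assumes "supported N f"
  shows "norm (f p) \<le> 1" "f (x, y) \<noteq> 0 \<Longrightarrow> x \<in> {1..int N} \<and> y \<in> {1..(int N)^2}"
  using assms unfolding supported_def by blast+

definition periodize :: "int \<Rightarrow> (int \<times> int \<Rightarrow> complex) \<Rightarrow> int \<Rightarrow> int \<Rightarrow> complex" where
  "periodize M f x y = f (x, y mod M)"

lemma bddper_periodize: "supported N f \<Longrightarrow> bddper M (periodize M f)"
  by (simp add: bddper_def per_def periodize_def supportedD)

lemma periodize_eq: "y \<in> {0..<M} \<Longrightarrow> periodize M f x y = f (x, y)"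
  by (simp add: periodize_def)

text \<open>The supports of \<open>f0\<close> and \<open>f1\<close> confine \<open>x\<close>,
  \<open>y\<close> and \<open>x + d\<close>, and the last becomes the variable
  \<open>z\<close>.\<close>

lemma corner_sum_finite:
  assumes f: "supported N f0" "supported N f1" "supported N f2"
  shows "(\<Sum>\<^sub>\<infinity>(x::int, y::int, d::int)\<in>UNIV. f0 (x, y) * f1 (x + d, y) * f2 (x, y + d^2)) =
    (\<Sum>y\<in>{1..(int N)^2}. \<Sum>x\<in>{1..int N}. \<Sum>z\<in>{1..int N}. f0 (x, y) * f1 (z, y) * f2 (x, y + (z - x)^2))"
proof -
  let ?X = "{1..int N}" and ?Y = "{1..(int N)^2}"
  let ?h = "\<lambda>(x::int, y::int, d::int). f0 (x, y) * f1 (x + d, y) * f2 (x, y + d^2)"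
  let ?j = "\<lambda>(y, x, z). (x, y, z - x)"
  have inj: "inj_on ?j (?Y \<times> ?X \<times> ?X)" by (auto simp: inj_on_def)
  have out: "?h p = 0" if "p \<notin> ?j ` (?Y \<times> ?X \<times> ?X)" for p
  proof (rule ccontr)
    obtain x y d where p: "p = (x, y, d)" by (cases p)
    assume "?h p \<noteq> 0"
    then have "f0 (x, y) \<noteq> 0" "f1 (x + d, y) \<noteq> 0" by (auto simp: p)
    then have "(y, x, x + d) \<in> ?Y \<times> ?X \<times> ?X" using supportedD(2)[OF f(1)] supportedD(2)[OF f(2)] by auto
    moreover have "p = ?j (y, x, x + d)" by (simp add: p)
    ultimately show False using that by blast
  qed
  have "infsum ?h UNIV = sum ?h (?j ` (?Y \<times> ?X \<times> ?X))" by (rule infsum_finite_support[OF _ out]) auto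
  also have "\<dots> = (\<Sum>(y, x, z)\<in>?Y \<times> ?X \<times> ?X. f0 (x, y) * f1 (z, y) * f2 (x, y + (z - x)^2))"
    unfolding sum.reindex[OF inj] by (intro sum.cong refl) auto
  finally show ?thesis by (simp add: sum.cartesian_product)
qed

text \<open>The factor 2 is the modulus divided by \<open>N^2\<close>: half of the residues lie
  outside the support.\<close>

lemma corner_sum_avg:
  assumes N: "0 < N" and f: "supported N f0" "supported N f1" "supported N f2"
  defines "M \<equiv> modulus N"
  shows "(\<Sum>y\<in>{1..(int N)^2}. \<Sum>x\<in>{1..int N}. \<Sum>z\<in>{1..int N}. f0 (x, y) * f1 (z, y) * f2 (x, y + (z - x)^2)) =
    2 * of_nat N ^ 4 * corner_avg N (periodize M f0) (periodize M f1) (periodize M f2)"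
proof -
  let ?X = "{1..int N}" and ?Y = "{1..(int N)^2}"
  have M: "0 < M" using modulus_pos N by (simp add: M_def)
  have YM: "?Y \<subseteq> {0..<M}"
  proof -
    have "0 < (int N)^2" using N by simp
    then show ?thesis unfolding M_def modulus_def by auto
  qed
  have cM: "of_nat (card {0..<M}) = (2 * of_nat N ^ 2 :: complex)"
    using M by (simp add: M_def modulus_def nat_mult_distrib nat_power_eq)
  have "(\<Sum>y\<in>?Y. \<Sum>x\<in>?X. \<Sum>z\<in>?X. f0 (x, y) * f1 (z, y) * f2 (x, y + (z - x)^2)) =
    (\<Sum>y\<in>{0..<M}. \<Sum>x\<in>?X. \<Sum>z\<in>?X. f0 (x, y) * f1 (z, y) * f2 (x, y + (z - x)^2))"
    using YM supportedD(2)[OF f(1)] by (intro sum.mono_neutral_left ballI sum.neutral) auto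
  also have "\<dots> = (\<Sum>y\<in>{0..<M}. \<Sum>x\<in>?X. \<Sum>z\<in>?X. periodize M f0 x y * periodize M f1 z y * periodize M f2 x (y + (z - x)^2))"
  proof (intro sum.cong refl)
    fix y x z assume y: "y \<in> {0..<M}" and xz: "x \<in> ?X" "z \<in> ?X"
    show "f0 (x, y) * f1 (z, y) * f2 (x, y + (z - x)^2) = periodize M f0 x y * periodize M f1 z y * periodize M f2 x (y + (z - x)^2)"
    \<comment> \<open>Wrap-around could occur for large \<open>y\<close>, but there
      \<open>f0\<close> vanishes; on its support \<open>y\<close> is at most N^2 and the square is
      smaller than N^2, so the argument of \<open>f2\<close> stays below the modulus.\<close>
    proof (cases "f0 (x, y) = 0")
      case False
      then have "y \<in> ?Y" using supportedD(2)[OF f(1)] by auto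
      moreover have "(z - x)^2 < (int N)^2"
      proof -
        have "\<bar>z - x\<bar> < int N" using xz by auto
        then have "\<bar>z - x\<bar>^2 < (int N)^2" by (intro power_strict_mono) auto
        then show ?thesis by simp
      qed
      ultimately have "y + (z - x)^2 \<in> {0..<M}" unfolding M_def modulus_def by auto
      then show ?thesis using y by (simp only: periodize_eq)
    qed (use y in \<open>simp add: periodize_eq\<close>)
  qed
  also have "\<dots> = 2 * of_nat N ^ 4 * corner_avg N (periodize M f0) (periodize M f1) (periodize M f2)"
    unfolding corner_avg_def M_def[symmetric] avg_def cM using N
    by (simp add: sum_divide_distrib[symmetric] power2_eq_square eval_nat_numeral)
  finally show ?thesis .
qed

lemma fibre_sums:
  fixes \<alpha> :: real
  assumes N: "0 < N" and f: "supported N f"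
  defines "M \<equiv> modulus N"
  shows "(\<Sum>\<^sub>\<infinity>y::int. norm (\<Sum>\<^sub>\<infinity>x::int. f (x, y) * unit_char (\<alpha> * of_int x))) =
      2 * real N ^ 3 * zavg M (\<lambda>y. norm (avg {1..int N} (\<lambda>z. periodize M f z y * unit_char (\<alpha> * of_int z))))"
    and "(\<Sum>\<^sub>\<infinity>x::int. norm (\<Sum>\<^sub>\<infinity>y::int. f (x, y) * unit_char (\<alpha> * of_int y))) =
      2 * real N ^ 3 * avg {1..int N} (\<lambda>x. norm (zavg M (\<lambda>y. periodize M f x y * unit_char (\<alpha> * of_int y))))"
proof -
  let ?X = "{1..int N}"
  have M: "0 < M" using modulus_pos N by (simp add: M_def)
  have cM: "real (card {0..<M}) = 2 * real N ^ 2"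
    using M by (simp add: M_def modulus_def nat_mult_distrib nat_power_eq)
  have f0: "x \<in> ?X" "y \<in> {0..<M}" if "f (x, y) \<noteq> 0" for x y
  proof -
    have "0 < (int N)^2" using N by simp
    then show "x \<in> ?X" "y \<in> {0..<M}" using supportedD(2)[OF f that] unfolding M_def modulus_def by auto
  qed
  have fz: "f (x, y) = 0" if "x \<notin> ?X \<or> y \<notin> {0..<M}" for x y using f0 that by blast
  have ix: "(\<Sum>\<^sub>\<infinity>x::int. f (x, y) * unit_char (\<alpha> * of_int x)) = (\<Sum>x\<in>?X. f (x, y) * unit_char (\<alpha> * of_int x))" for y
    by (rule infsum_finite_support) (use f0(1) in auto)
  have iy: "(\<Sum>\<^sub>\<infinity>y::int. f (x, y) * unit_char (\<alpha> * of_int y)) = (\<Sum>y\<in>{0..<M}. f (x, y) * unit_char (\<alpha> * of_int y))" for x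
    by (rule infsum_finite_support) (use f0(2) in auto)
  have "(\<Sum>\<^sub>\<infinity>y::int. norm (\<Sum>x\<in>?X. f (x, y) * unit_char (\<alpha> * of_int x))) = (\<Sum>y\<in>{0..<M}. norm (\<Sum>x\<in>?X. f (x, y) * unit_char (\<alpha> * of_int x)))"
    by (rule infsum_finite_support) (auto simp: fz)
  also have "\<dots> = (\<Sum>y\<in>{0..<M}. norm (\<Sum>x\<in>?X. periodize M f x y * unit_char (\<alpha> * of_int x)))"
    by (intro sum.cong arg_cong[of _ _ norm] refl) (simp add: periodize_eq)
  also have "\<dots> = 2 * real N ^ 3 * zavg M (\<lambda>y. norm (avg ?X (\<lambda>z. periodize M f z y * unit_char (\<alpha> * of_int z))))"
    unfolding norm_avg_complex unfolding avg_def cM using N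
    by (simp add: sum_divide_distrib[symmetric] power2_eq_square power3_eq_cube)
  finally show "(\<Sum>\<^sub>\<infinity>y::int. norm (\<Sum>\<^sub>\<infinity>x::int. f (x, y) * unit_char (\<alpha> * of_int x))) =
      2 * real N ^ 3 * zavg M (\<lambda>y. norm (avg ?X (\<lambda>z. periodize M f z y * unit_char (\<alpha> * of_int z))))" unfolding ix .
  have "(\<Sum>\<^sub>\<infinity>x::int. norm (\<Sum>y\<in>{0..<M}. f (x, y) * unit_char (\<alpha> * of_int y))) = (\<Sum>x\<in>?X. norm (\<Sum>y\<in>{0..<M}. f (x, y) * unit_char (\<alpha> * of_int y)))"
    by (rule infsum_finite_support) (auto simp: fz)
  also have "\<dots> = (\<Sum>x\<in>?X. norm (\<Sum>y\<in>{0..<M}. periodize M f x y * unit_char (\<alpha> * of_int y)))"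
    by (intro sum.cong arg_cong[of _ _ norm] refl) (simp add: periodize_eq)
  also have "\<dots> = 2 * real N ^ 3 * avg ?X (\<lambda>x. norm (zavg M (\<lambda>y. periodize M f x y * unit_char (\<alpha> * of_int y))))"
    unfolding norm_avg_complex unfolding avg_def cM using N
    by (simp add: sum_divide_distrib[symmetric] power2_eq_square power3_eq_cube)
  finally show "(\<Sum>\<^sub>\<infinity>x::int. norm (\<Sum>\<^sub>\<infinity>y::int. f (x, y) * unit_char (\<alpha> * of_int y))) =
      2 * real N ^ 3 * avg ?X (\<lambda>x. norm (zavg M (\<lambda>y. periodize M f x y * unit_char (\<alpha> * of_int y))))" unfolding iy .
qed

theorem theorem1p4:
  shows "\<exists>(C::real) (c::real). C \<ge> 1 \<and> c > 0 \<and>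
    (\<forall>(N::nat) (\<delta>::real) (f\<^sub>0 :: int \<times> int \<Rightarrow> complex) (f\<^sub>1 :: int \<times> int \<Rightarrow> complex) (f\<^sub>2 :: int \<times> int \<Rightarrow> complex).
      N > 0 \<longrightarrow> \<delta> > 0 \<longrightarrow>
      (\<forall>f\<in>{f\<^sub>0, f\<^sub>1, f\<^sub>2}. (\<forall>p. norm (f p) \<le> 1) \<and>
          {p. f p \<noteq> 0} \<subseteq> {1..int N} \<times> {1..(int N)^2}) \<longrightarrow>
      norm (\<Sum>\<^sub>\<infinity>(x::int, y::int, d::int)\<in>UNIV. f\<^sub>0 (x, y) * f\<^sub>1 (x + d, y) * f\<^sub>2 (x, y + d^2))
        \<ge> \<delta> * real N ^ 4 \<longrightarrow>
      real N \<le> C * \<delta> powr (- C) \<or>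
      (\<exists>(\<alpha>::real) (\<beta>::real) (q::nat).
        q > 0 \<and> real q \<le> C * \<delta> powr (- C) \<and>
        \<parallel>real q * \<alpha>\<parallel>\<^sub>T \<le> C * \<delta> powr (- C) / real N \<and>
        \<parallel>real q * \<beta>\<parallel>\<^sub>T \<le> C * \<delta> powr (- C) / real N ^ 2 \<and>
        (\<Sum>\<^sub>\<infinity>y::int. norm (\<Sum>\<^sub>\<infinity>x::int. f\<^sub>1 (x, y) * unit_char (\<alpha> * of_int x)))
          \<ge> c * \<delta> powr C * real N ^ 3 \<and>
        (\<Sum>\<^sub>\<infinity>x::int. norm (\<Sum>\<^sub>\<infinity>y::int. f\<^sub>2 (x, y) * unit_char (\<beta> * of_int y)))
          \<ge> c * \<delta> powr C * real N ^ 3))"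
proof -
  obtain \<epsilon> where p: "polylow \<epsilon>" and main: "\<And>\<eta> N f0 f1 g. 0 < \<eta> \<Longrightarrow> \<eta> \<le> 1 \<Longrightarrow> 1 \<le> real N * \<epsilon> \<eta> \<Longrightarrow>
      bddper (modulus N) f0 \<Longrightarrow> bddper (modulus N) f1 \<Longrightarrow> bddper (modulus N) g \<Longrightarrow> \<eta> \<le> norm (corner_avg N f0 f1 g) \<Longrightarrow>
      \<exists>(\<alpha>::real) (\<beta>::real) (q::nat). 0 < q \<and> real q \<le> 1 / \<epsilon> \<eta> \<and>
        torus_norm (real q * \<alpha>) \<le> 1 / \<epsilon> \<eta> / real N \<and> torus_norm (real q * \<beta>) \<le> 1 / \<epsilon> \<eta> / real N^2 \<and>
        \<epsilon> \<eta> \<le> zavg (modulus N) (\<lambda>y. norm (avg {1..int N} (\<lambda>z. f1 z y * unit_char (\<alpha> * of_int z)))) \<and>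
        \<epsilon> \<eta> \<le> avg {1..int N} (\<lambda>x. norm (zavg (modulus N) (\<lambda>y. g x y * unit_char (\<beta> * of_int y))))"
    using both_functions by blast
  obtain K :: nat where K: "1 \<le> K" "\<And>\<delta>. 0 < \<delta> \<Longrightarrow> \<delta> \<le> 1 \<Longrightarrow> \<delta> ^ K / K \<le> \<epsilon> \<delta>" using polylowE[OF p] by blast
  \<comment> \<open>The factor \<open>2 ^ K\<close> absorbs the halving of \<delta> that comes with
    normalising by the modulus; enlarging the exponent from \<open>K\<close> to \<open>C\<close> is
    harmless for \<delta> \<le> 1.\<close>
  define C where "C = real (2 ^ K * K)"
  have CK: "real K \<le> C" unfolding C_def of_nat_le_iff by simp
  have C1: "1 \<le> C" using CK K(1) by linarith
  have low: "\<delta> powr C / C \<le> \<epsilon> (\<delta> / 2)" if \<delta>: "0 < \<delta>" "\<delta> \<le> 1" for \<delta>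
  proof -
    have "\<delta> powr C \<le> \<delta> powr real K" using \<delta> CK by (intro powr_mono') auto
    also have "\<dots> = \<delta> ^ K" using \<delta> by (simp add: powr_realpow)
    finally have "\<delta> powr C / C \<le> \<delta> ^ K / C" using C1 by (intro divide_right_mono) auto
    also have "\<dots> = (\<delta> / 2) ^ K / K" by (simp add: C_def power_divide)
    also have "\<dots> \<le> \<epsilon> (\<delta> / 2)" using \<delta> by (intro K(2)) auto
    finally show ?thesis .
  qed
  have concl: "real N \<le> C * \<delta> powr (- C) \<or>
      (\<exists>(\<alpha>::real) (\<beta>::real) (q::nat).
        q > 0 \<and> real q \<le> C * \<delta> powr (- C) \<and>
        torus_norm (real q * \<alpha>) \<le> C * \<delta> powr (- C) / real N \<and>
        torus_norm (real q * \<beta>) \<le> C * \<delta> powr (- C) / real N ^ 2 \<and>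
        (\<Sum>\<^sub>\<infinity>y::int. norm (\<Sum>\<^sub>\<infinity>x::int. f1 (x, y) * unit_char (\<alpha> * of_int x))) \<ge> 1 / C * \<delta> powr C * real N ^ 3 \<and>
        (\<Sum>\<^sub>\<infinity>x::int. norm (\<Sum>\<^sub>\<infinity>y::int. f2 (x, y) * unit_char (\<beta> * of_int y))) \<ge> 1 / C * \<delta> powr C * real N ^ 3)"
    if N: "N > 0" and \<delta>: "\<delta> > 0" and f: "supported N f0" "supported N f1" "supported N f2"
      and large: "\<delta> * real N ^ 4 \<le> norm (\<Sum>\<^sub>\<infinity>(x::int, y::int, d::int)\<in>UNIV. f0 (x, y) * f1 (x + d, y) * f2 (x, y + d^2))"
    for N \<delta> f0 f1 f2
  proof (cases "real N \<le> C * \<delta> powr (- C)")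
    case False
    let ?X = "{1..int N}" and ?Y = "{1..(int N)^2}" and ?M = "modulus N"
    let ?S = "\<Sum>y\<in>?Y. \<Sum>x\<in>?X. \<Sum>z\<in>?X. f0 (x, y) * f1 (z, y) * f2 (x, y + (z - x)^2)"
    have N4: "0 < real N ^ 4" using N by simp
    have S: "\<delta> * real N ^ 4 \<le> norm ?S" using large by (simp only: corner_sum_finite[OF f])
    also have "norm ?S \<le> (\<Sum>y\<in>?Y. \<Sum>x\<in>?X. \<Sum>z\<in>?X. 1)"
      by (intro order_trans[OF norm_sum] sum_mono) (simp add: norm_mult supportedD(1)[OF f(1)] supportedD(1)[OF f(2)] supportedD(1)[OF f(3)] mult_le_one)
    also have "\<dots> = 1 * real N ^ 4" by (simp add: nat_power_eq power2_eq_square eval_nat_numeral)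
    \<comment> \<open>The trivial bound: at most N^4 terms of modulus at most 1.\<close>
    finally have \<delta>1: "\<delta> \<le> 1" using N4 by (simp only: mult_le_cancel_right_pos)
    have "norm ?S = (2 * real N ^ 4) * norm (corner_avg N (periodize ?M f0) (periodize ?M f1) (periodize ?M f2))"
      unfolding corner_sum_avg[OF N f] by (simp add: norm_mult norm_power)
    then have "\<delta> / 2 * (2 * real N ^ 4) \<le> norm (corner_avg N (periodize ?M f0) (periodize ?M f1) (periodize ?M f2)) * (2 * real N ^ 4)"
      using S by (simp add: mult.commute)
    then have corner: "\<delta> / 2 \<le> norm (corner_avg N (periodize ?M f0) (periodize ?M f1) (periodize ?M f2))"
      by (rule mult_right_le_imp_le) (use N4 in simp)
    define e where "e = \<epsilon> (\<delta> / 2)"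
    have pos: "0 < \<delta> powr C / C" using \<delta> C1 by simp
    have le: "\<delta> powr C / C \<le> e" unfolding e_def by (rule low[OF \<delta> \<delta>1])
    have inv: "1 / e \<le> C * \<delta> powr (- C)"
    proof -
      have "1 / e \<le> 1 / (\<delta> powr C / C)" using pos le by (intro frac_le) auto
      then show ?thesis by (simp add: powr_minus divide_inverse mult.commute)
    qed
    \<comment> \<open>Failure of the first alternative is exactly what supplies the threshold on
      \<open>N\<close>.\<close>
    have "1 / e \<le> real N" using False inv by linarith
    then have "1 \<le> real N * e" using pos le by (simp add: pos_divide_le_eq)
    then obtain \<alpha> \<beta> :: real and q :: nat where q: "0 < q" "real q \<le> 1 / e" "torus_norm (real q * \<alpha>) \<le> 1 / e / real N" "torus_norm (real q * \<beta>) \<le> 1 / e / real N^2"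
      "e \<le> zavg ?M (\<lambda>y. norm (avg ?X (\<lambda>z. periodize ?M f1 z y * unit_char (\<alpha> * of_int z))))"
      "e \<le> avg ?X (\<lambda>x. norm (zavg ?M (\<lambda>y. periodize ?M f2 x y * unit_char (\<beta> * of_int y))))"
      using main[of "\<delta> / 2" N, OF _ _ _ bddper_periodize[OF f(1)] bddper_periodize[OF f(2)] bddper_periodize[OF f(3)] corner] \<delta> \<delta>1
      unfolding e_def by auto
    have out: "1 / C * \<delta> powr C * real N ^ 3 \<le> 2 * real N ^ 3 * v" if "e \<le> v" for v
    proof -
      have "\<delta> powr C / C \<le> 2 * v" using that le pos by linarith
      then have "real N ^ 3 * (\<delta> powr C / C) \<le> real N ^ 3 * (2 * v)" by (intro mult_left_mono) auto
      then show ?thesis by (simp add: mult_ac)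
    qed
    have "1 / e / w \<le> C * \<delta> powr (- C) / w" if "0 \<le> w" for w :: real by (rule divide_right_mono[OF inv that])
    from this[of "real N"] this[of "real N^2"]
    have "torus_norm (real q * \<alpha>) \<le> C * \<delta> powr (- C) / real N" "torus_norm (real q * \<beta>) \<le> C * \<delta> powr (- C) / real N^2"
      using q(3,4) by (meson of_nat_0_le_iff order_trans zero_le_power)+
    moreover have "real q \<le> C * \<delta> powr (- C)" using q(2) inv by (rule order_trans)
    ultimately show ?thesis using q(1) out[OF q(5)] out[OF q(6)] unfolding fibre_sums(1)[OF N f(2)] fibre_sums(2)[OF N f(3)] by blast
  qed simp
  have "1 / C > 0" using C1 by simp
  show ?thesis
  proof (intro exI conjI allI impI)
    show "1 \<le> C" by (rule C1)
    show "0 < 1 / C" by fact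
    fix N :: nat and \<delta> :: real and f0 f1 f2 :: "int \<times> int \<Rightarrow> complex"
    assume N: "N > 0" "\<delta> > 0" and f: "\<forall>f\<in>{f0, f1, f2}. (\<forall>p. norm (f p) \<le> 1) \<and> {p. f p \<noteq> 0} \<subseteq> {1..int N} \<times> {1..(int N)^2}"
      and large: "\<delta> * real N ^ 4 \<le> norm (\<Sum>\<^sub>\<infinity>(x::int, y::int, d::int)\<in>UNIV. f0 (x, y) * f1 (x + d, y) * f2 (x, y + d^2))"
    have "supported N f0" "supported N f1" "supported N f2" using f unfolding supported_def by blast+
    from concl[OF N this large] show "real N \<le> C * \<delta> powr (- C) \<or>
      (\<exists>(\<alpha>::real) (\<beta>::real) (q::nat).
        q > 0 \<and> real q \<le> C * \<delta> powr (- C) \<and>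
        torus_norm (real q * \<alpha>) \<le> C * \<delta> powr (- C) / real N \<and>
        torus_norm (real q * \<beta>) \<le> C * \<delta> powr (- C) / real N ^ 2 \<and>
        (\<Sum>\<^sub>\<infinity>y::int. norm (\<Sum>\<^sub>\<infinity>x::int. f1 (x, y) * unit_char (\<alpha> * of_int x))) \<ge> 1 / C * \<delta> powr C * real N ^ 3 \<and>
        (\<Sum>\<^sub>\<infinity>x::int. norm (\<Sum>\<^sub>\<infinity>y::int. f2 (x, y) * unit_char (\<beta> * of_int y))) \<ge> 1 / C * \<delta> powr C * real N ^ 3)" .
  qed
qed

end
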